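(* Let $h\in L^0(M,N)$. Suppose that $N$ is complete. Then the isometry $\bar i_1: L^1(I,L^1_h(M,N))\to L^1_{\underline h}(M,L^1(I,N))$ induces the (well-defined) isometric mapping $$\tilde i_1:=(q_1^{-1})_*\circ\bar i_1\circ Q_1:\ (\mathcal{BV}(I,L^1_h(M,N)),d_{1,1})\to(L^1_{\underline h}(M,\mathcal{BV}(I,N)),D_{1,1}),$$ whose inverse mapping on its range is $\tilde i_1^{-1}=Q_1^{-1}\circ\bar i_1^{-1}\circ(q_1)_*$ and satisfies $$\tilde i_1^{-1}(f)(t)=(e_{t,1})_*(f)\quad\text{for all } t\in I\text{ and } f\in\tilde i_1(\mathcal{BV}(I,L^1_h(M,N))).$$ In addition, $\tilde i_1$ satisfies for all $c\in\mathcal{BV}(I,L^1_h(M,N))$ the equality of measures on $I$ $$|Dc|_1=\int_M|D\tilde i_1(c)(x)|_N\,d\mu_M(x),$$ and its range is the set of all $f\in L^1_{\underline h}(M,\mathcal{BV}(I,N))$ such that $$\int_M|Df(x)|_N(I)\,d\mu_M(x)<\infty.$$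
   Context: Setting: $(M,\Sigma_M,\mu_M)$ is a measure space with $M$ nonempty (no $\sigma$-finiteness assumed), $(N,d_N)$ is a nonempty metric space with finite metric, and $I=[a,b]\subset\mathbb{R}$ with $a<b$, equipped with Lebesgue measure $\mathscr{L}^1$. "Isometry" means surjective distance-preserving map; "isometric mapping" means distance-preserving. For a measure space $(Y,\Sigma_Y,\mu_Y)$ and a nonempty metric space $(Z,d_Z)$: $\mathcal{L}^0_{\mathrm s}(Y,Z)$ is the set of measurable maps $Y\to Z$ (Borel $\sigma$-algebra on $Z$) with separable range; $[f]_Y$ is the class of $f$ modulo $\mu_Y$-a.e. equality; $L^0(Y,Z)$ is the set of classes admitting a representative in $\mathcal{L}^0_{\mathrm s}(Y,Z)$. For $g\in L^0(Y,Z)$, $L^1_g(Y,Z)$ is the set of $f\in L^0(Y,Z)$ with $\int_Y d_Z(f,g)\,d\mu_Y<\infty$, with the metric $(f,f')\mapsto\int_Y d_Z(f,f')\,d\mu_Y$. $L^1(I,Z)$ denotes $L^1_g(I,Z)$ with $g$ constant (all constants give the same space when $d_Z$ is finite). Classes and representatives are not distinguished when clear from context. $I\times M$ carries the product measure $\mathscr{L}^1\otimes\mu_M$ obtained by Carathéodory's process from measurable rectangles. Given $h\in L^0(M,N)$: $\hat h(t,x)=h(x)$ on $I\times M$; $\underline h(x)$ is the constant curve $t\mapsto h(x)$ in $N$. Metrics: $D_1$ on $L^1_h(M,N)$; $d_1$ on $L^1(I,N)$; $d_{1,1}(c,c')=\int_I D_1(c(t),c'(t))\,dt$ on $L^1(I,L^1_h(M,N))$;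 $D_{1,1}(f,f')=\int_M d_1(f(x),f'(x))\,d\mu_M(x)$ on $L^1_{\underline h}(M,L^1(I,N))$. When $N$ is complete, $\bar i_1:=\overline{\operatorname{sec}}_{M,1}\circ\overline{\operatorname{sec}}_{I,1}^{-1}$ is an isometry, where $\overline{\operatorname{sec}}_{I,1}:L^1_{\hat h}(I\times M,N)\to L^1(I,L^1_h(M,N))$, $[\hat c]_{I\times M}\mapsto[t\mapsto[\hat c(t,\cdot)]_M]_I$, and $\overline{\operatorname{sec}}_{M,1}:L^1_{\hat h}(I\times M,N)\to L^1_{\underline h}(M,L^1(I,N))$, $[\hat c]_{I\times M}\mapsto[x\mapsto[\hat c(\cdot,x)]_I]_M$, are isometries. For a metric space $(X,d_X)$, a curve $c:I\to X$ and $J\subset I$: $\operatorname{Var}_X(c;J)$ is the supremum of $\sum_{i=0}^n d_X(c(t_i),c(t_{i+1}))$ over finite $t_0<\dots<t_{n+1}$ in $J$, and $\operatorname{ess\,Var}_X(c;J)=\inf\{\operatorname{Var}_X(\tilde c;J):\tilde c=c\ \mathscr{L}^1\text{-a.e.}\}$. $\mathcal{BV}(I,X)$ is the set of curves $c:I\to X$ that are càdlàg (right-continuous on $[a,b)$, with left limits in $X$ at every point of $(a,b]$), left-continuous at $b$, and with $\operatorname{Var}_X(c;I)<\infty$. On $\mathcal{BV}(I,X)$, $d_1(c,c')=\int_I d_X(c(t),c'(t))\,dt$ is a metric; on $\mathcal{BV}(I,L^1_h(M,N))$ it is denoted $d_{1,1}$. For $c$ with $\operatorname{ess\,Var}_X(c;I)<\infty$,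 the variation measure $|Dc|_X$ is the Lebesgue–Stieltjes measure on $I$ induced by the nondecreasing function $V(t)=\operatorname{ess\,Var}_X(c;(a,t))$; in particular $|Dc|_X((s,t))=\lim_{u\to t^-}V(u)-\lim_{u\to s^+}V(u)$ for $s<t$ in $I$. Write $|Dc|_1:=|Dc|_{L^1_h(M,N)}$. $L^1_{\underline h}(M,\mathcal{BV}(I,N))$ is the set of a.e.-equality classes of measurable, separably valued maps $f:M\to(\mathcal{BV}(I,N),d_1)$ with $D_{1,1}(f,\underline h)<\infty$. The maps $q_1:\mathcal{BV}(I,N)\to L^1(I,N)$ and $Q_1:\mathcal{BV}(I,L^1_h(M,N))\to L^1(I,L^1_h(M,N))$, both $c\mapsto[c]_I$, are injective and distance-preserving ($q_1^{-1}$, $Q_1^{-1}$ are inverses on their ranges). $e_{t,1}:\mathcal{BV}(I,N)\to N$ is evaluation $c\mapsto c(t)$. For a map $\varphi$, $\varphi_*$ denotes post-composition $f\mapsto\varphi\circ f$ on classes (the class of the composition of $\varphi$ with a compatible representative). *)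

theory Defs
  imports "HOL-Analysis.Analysis"
begin

text \<open>
  Metric spaces are carrier sets \<open>Z\<close> with a distance function \<open>d\<close>, as in the locale
  \<^locale>\<open>Metric_space\<close>, since the function spaces below are not types.
  Maps \<open>Y \<rightarrow> Z\<close> are extensional functions in \<open>space Y \<rightarrow>\<^sub>E Z\<close>, and elements of \<open>L\<^sup>0\<close> are genuine
  a.e.-equality classes, i.e. sets of such maps.
\<close>

section \<open>Classes of measurable, separably valued maps\<close>

definition borel_sigma :: "'z set \<Rightarrow> ('z \<Rightarrow> 'z \<Rightarrow> real) \<Rightarrow> 'z measure" where
  "borel_sigma Z d = sigma Z {U. openin (Metric_space.mtopology Z d) U}"

definition L0s :: "'y measure \<Rightarrow> 'z set \<Rightarrow> ('z \<Rightarrow> 'z \<Rightarrow> real) \<Rightarrow> ('y \<Rightarrow> 'z) set" where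
  "L0s Y Z d = {f \<in> space Y \<rightarrow>\<^sub>E Z. f \<in> measurable Y (borel_sigma Z d) \<and>
     separable_space (subtopology (Metric_space.mtopology Z d) (f ` space Y))}"

text \<open>
  The class of \<open>f\<close> consists of all maps \<open>Y \<rightarrow> Z\<close> (measurable or not) that are a.e. equal to \<open>f\<close>.
  The function \<open>f\<close> itself only needs to be \<open>Z\<close>-valued almost everywhere.
\<close>

definition ae_class :: "'y measure \<Rightarrow> 'z set \<Rightarrow> ('y \<Rightarrow> 'z) \<Rightarrow> ('y \<Rightarrow> 'z) set" where
  "ae_class Y Z f = {g \<in> space Y \<rightarrow>\<^sub>E Z. AE y in Y. g y = f y}"

definition rep :: "('y \<Rightarrow> 'z) set \<Rightarrow> 'y \<Rightarrow> 'z" where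
  "rep F = (SOME f. f \<in> F)"

definition L0 :: "'y measure \<Rightarrow> 'z set \<Rightarrow> ('z \<Rightarrow> 'z \<Rightarrow> real) \<Rightarrow> ('y \<Rightarrow> 'z) set set" where
  "L0 Y Z d = ae_class Y Z ` L0s Y Z d"

text \<open>
  The nonnegative integral is invariant under a.e. modification even for functions that are not
  measurable, so the integrals below do not depend on the representatives. (The Bochner integral
  would be \<open>0\<close> for representatives that are not measurable, which occur if \<open>Y\<close> is not complete.)
\<close>

definition L1 :: "'y measure \<Rightarrow> 'z set \<Rightarrow> ('z \<Rightarrow> 'z \<Rightarrow> real) \<Rightarrow> ('y \<Rightarrow> 'z) set \<Rightarrow> ('y \<Rightarrow> 'z) set set" where
  "L1 Y Z d G = {F \<in> L0 Y Z d. (\<integral>\<^sup>+ y. ennreal (d (rep F y) (rep G y)) \<partial>Y) < \<infinity>}"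

definition L1_dist :: "'y measure \<Rightarrow> ('z \<Rightarrow> 'z \<Rightarrow> real) \<Rightarrow> ('y \<Rightarrow> 'z) set \<Rightarrow> ('y \<Rightarrow> 'z) set \<Rightarrow> real" where
  "L1_dist Y d F F' = enn2real (\<integral>\<^sup>+ y. ennreal (d (rep F y) (rep F' y)) \<partial>Y)"

abbreviation leb_I :: "real \<Rightarrow> real \<Rightarrow> real measure" where
  "leb_I a b \<equiv> lebesgue_on {a..b}"

text \<open>\<open>L\<^sup>1(I, Z)\<close>: the constant reference map is immaterial.\<close>

definition L1_I :: "real \<Rightarrow> real \<Rightarrow> 'z set \<Rightarrow> ('z \<Rightarrow> 'z \<Rightarrow> real) \<Rightarrow> (real \<Rightarrow> 'z) set set" where
  "L1_I a b Z d = (\<Union>z\<in>Z. L1 (leb_I a b) Z d (ae_class (leb_I a b) Z (\<lambda>_. z)))"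

text \<open>
  Post-composition \<open>\<phi>\<^sub>*\<close> for a map \<open>\<phi>\<close> with domain \<open>D\<close> and values in \<open>Z\<close>: a representative is
  compatible if all its values lie in \<open>D\<close>.
\<close>

definition compatible :: "'y measure \<Rightarrow> 'w set \<Rightarrow> ('y \<Rightarrow> 'w) set \<Rightarrow> ('y \<Rightarrow> 'w) \<Rightarrow> bool" where
  "compatible Y D F f \<longleftrightarrow> f \<in> F \<and> f ` space Y \<subseteq> D"

definition post_comp :: "'y measure \<Rightarrow> 'w set \<Rightarrow> 'z set \<Rightarrow> ('w \<Rightarrow> 'z) \<Rightarrow> ('y \<Rightarrow> 'w) set \<Rightarrow> ('y \<Rightarrow> 'z) set" where
  "post_comp Y D Z \<phi> F = ae_class Y Z (\<lambda>y. \<phi> ((SOME f. compatible Y D F f) y))"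

definition isometric_mapping ::
    "'x set \<Rightarrow> ('x \<Rightarrow> 'x \<Rightarrow> real) \<Rightarrow> 'y set \<Rightarrow> ('y \<Rightarrow> 'y \<Rightarrow> real) \<Rightarrow> ('x \<Rightarrow> 'y) \<Rightarrow> bool" where
  "isometric_mapping X dX Y dY \<phi> \<longleftrightarrow>
     \<phi> ` X \<subseteq> Y \<and> (\<forall>x\<in>X. \<forall>x'\<in>X. dY (\<phi> x) (\<phi> x') = dX x x')"

section \<open>The Caratheodory product measure\<close>

text \<open>
  The library's \<open>\<Otimes>\<^sub>M\<close> is the iterated-integral measure on the product \<open>\<sigma>\<close>-algebra; without
  \<open>\<sigma>\<close>-finiteness it differs from the measure needed here.
\<close>

definition rect_outer :: "'x measure \<Rightarrow> 'y measure \<Rightarrow> ('x \<times> 'y) set \<Rightarrow> ennreal" where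
  "rect_outer X Y E =
     (INF (A, B) \<in> {(A :: nat \<Rightarrow> 'x set, B :: nat \<Rightarrow> 'y set).
         range A \<subseteq> sets X \<and> range B \<subseteq> sets Y \<and> E \<subseteq> (\<Union>i. A i \<times> B i)}.
       \<Sum>i. emeasure X (A i) * emeasure Y (B i))"

definition caratheodory_prod :: "'x measure \<Rightarrow> 'y measure \<Rightarrow> ('x \<times> 'y) measure" where
  "caratheodory_prod X Y =
     (let \<Omega> = space X \<times> space Y
      in measure_of \<Omega> (lambda_system \<Omega> (Pow \<Omega>) (rect_outer X Y)) (rect_outer X Y))"

section \<open>Variation and \<open>BV\<close> curves\<close>

definition Var :: "('z \<Rightarrow> 'z \<Rightarrow> real) \<Rightarrow> (real \<Rightarrow> 'z) \<Rightarrow> real set \<Rightarrow> ennreal" where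
  "Var d c J =
     (SUP (n, t) \<in> {(n :: nat, t :: nat \<Rightarrow> real). strict_mono_on {..Suc n} t \<and> t ` {..Suc n} \<subseteq> J}.
       \<Sum>i\<le>n. ennreal (d (c (t i)) (c (t (Suc i)))))"

definition ess_Var :: "real \<Rightarrow> real \<Rightarrow> 'z set \<Rightarrow> ('z \<Rightarrow> 'z \<Rightarrow> real) \<Rightarrow> (real \<Rightarrow> 'z) \<Rightarrow> real set \<Rightarrow> ennreal" where
  "ess_Var a b Z d c J = (INF c' \<in> ae_class (leb_I a b) Z c. Var d c' J)"

definition BV :: "real \<Rightarrow> real \<Rightarrow> 'z set \<Rightarrow> ('z \<Rightarrow> 'z \<Rightarrow> real) \<Rightarrow> (real \<Rightarrow> 'z) set" where
  "BV a b Z d = {c \<in> {a..b} \<rightarrow>\<^sub>E Z.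
     (\<forall>t\<in>{a..<b}. limitin (Metric_space.mtopology Z d) c (c t) (at_right t)) \<and>
     (\<forall>t\<in>{a<..b}. \<exists>l. limitin (Metric_space.mtopology Z d) c l (at_left t)) \<and>
     limitin (Metric_space.mtopology Z d) c (c b) (at_left b) \<and>
     Var d c {a..b} < \<infinity>}"

definition BV_dist :: "real \<Rightarrow> real \<Rightarrow> ('z \<Rightarrow> 'z \<Rightarrow> real) \<Rightarrow> (real \<Rightarrow> 'z) \<Rightarrow> (real \<Rightarrow> 'z) \<Rightarrow> real" where
  "BV_dist a b d c c' = enn2real (\<integral>\<^sup>+ t. ennreal (d (c t) (c' t)) \<partial>leb_I a b)"

text \<open>
  The Lebesgue--Stieltjes measure on \<open>[a, b]\<close> of a nondecreasing \<open>V\<close>. It assigns \<open>V(t+) - V(s+)\<close> to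
  \<open>(s, t]\<close>, where \<open>V\<close> is extended to the line by \<open>V(a)\<close> and \<open>V(b)\<close>. As \<^const>\<open>interval_measure\<close>
  expects a right-continuous function, it is applied to \<open>t \<mapsto> V(t+) = inf {V(u). u > t}\<close>.
\<close>

definition stieltjes_measure :: "real \<Rightarrow> real \<Rightarrow> (real \<Rightarrow> real) \<Rightarrow> real measure" where
  "stieltjes_measure a b V =
     restrict_space (interval_measure (\<lambda>t. INF u\<in>{t<..}. V (max a (min b u)))) {a..b}"

definition var_measure :: "real \<Rightarrow> real \<Rightarrow> 'z set \<Rightarrow> ('z \<Rightarrow> 'z \<Rightarrow> real) \<Rightarrow> (real \<Rightarrow> 'z) \<Rightarrow> real measure" where
  "var_measure a b Z d c = stieltjes_measure a b (\<lambda>t. enn2real (ess_Var a b Z d c {a<..<t}))"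

text \<open>The maps \<open>q\<^sub>1\<close> (for \<open>Z = N\<close>) and \<open>Q\<^sub>1\<close> (for \<open>Z = L\<^sup>1\<^sub>h(M, N)\<close>).\<close>

definition BV_class :: "real \<Rightarrow> real \<Rightarrow> 'z set \<Rightarrow> (real \<Rightarrow> 'z) \<Rightarrow> (real \<Rightarrow> 'z) set" where
  "BV_class a b Z c = ae_class (leb_I a b) Z c"

section \<open>The spaces and maps built from \<open>I\<close>, \<open>M\<close>, \<open>N\<close> and \<open>h\<close>\<close>

definition h_hat :: "real \<Rightarrow> real \<Rightarrow> 'm measure \<Rightarrow> 'n set \<Rightarrow> ('m \<Rightarrow> 'n) set \<Rightarrow> (real \<times> 'm \<Rightarrow> 'n) set" where
  "h_hat a b M N h = ae_class (caratheodory_prod (leb_I a b) M) N (\<lambda>(t, x). rep h x)"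

text \<open>\<open>L\<^sup>1\<close> of \<open>I \<times> M\<close>, relative to the lift of \<open>h\<close>\<close>

definition L1_IM ::
    "real \<Rightarrow> real \<Rightarrow> 'm measure \<Rightarrow> 'n set \<Rightarrow> ('n \<Rightarrow> 'n \<Rightarrow> real) \<Rightarrow> ('m \<Rightarrow> 'n) set \<Rightarrow> (real \<times> 'm \<Rightarrow> 'n) set set" where
  "L1_IM a b M N d h = L1 (caratheodory_prod (leb_I a b) M) N d (h_hat a b M N h)"

text \<open>\<open>L\<^sup>1(I, L\<^sup>1\<^sub>h(M, N))\<close>\<close>

definition L1_I_L1_M ::
    "real \<Rightarrow> real \<Rightarrow> 'm measure \<Rightarrow> 'n set \<Rightarrow> ('n \<Rightarrow> 'n \<Rightarrow> real) \<Rightarrow> ('m \<Rightarrow> 'n) set \<Rightarrow> (real \<Rightarrow> ('m \<Rightarrow> 'n) set) set set" where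
  "L1_I_L1_M a b M N d h = L1_I a b (L1 M N d h) (L1_dist M d)"

text \<open>\<open>L\<^sup>1(M, L\<^sup>1(I, N))\<close>, relative to the map \<open>M \<rightarrow> L\<^sup>1(I, N)\<close> into constant curves given by \<open>h\<close>\<close>

definition L1_M_L1_I ::
    "real \<Rightarrow> real \<Rightarrow> 'm measure \<Rightarrow> 'n set \<Rightarrow> ('n \<Rightarrow> 'n \<Rightarrow> real) \<Rightarrow> ('m \<Rightarrow> 'n) set \<Rightarrow> ('m \<Rightarrow> (real \<Rightarrow> 'n) set) set set" where
  "L1_M_L1_I a b M N d h =
     L1 M (L1_I a b N d) (L1_dist (leb_I a b) d)
       (ae_class M (L1_I a b N d) (\<lambda>x. ae_class (leb_I a b) N (\<lambda>t. rep h x)))"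

text \<open>\<open>BV(I, L\<^sup>1\<^sub>h(M, N))\<close> and its metric\<close>

definition BV_L1_M ::
    "real \<Rightarrow> real \<Rightarrow> 'm measure \<Rightarrow> 'n set \<Rightarrow> ('n \<Rightarrow> 'n \<Rightarrow> real) \<Rightarrow> ('m \<Rightarrow> 'n) set \<Rightarrow> (real \<Rightarrow> ('m \<Rightarrow> 'n) set) set" where
  "BV_L1_M a b M N d h = BV a b (L1 M N d h) (L1_dist M d)"

definition BV_L1_M_dist ::
    "real \<Rightarrow> real \<Rightarrow> 'm measure \<Rightarrow> ('n \<Rightarrow> 'n \<Rightarrow> real) \<Rightarrow> (real \<Rightarrow> ('m \<Rightarrow> 'n) set) \<Rightarrow> (real \<Rightarrow> ('m \<Rightarrow> 'n) set) \<Rightarrow> real" where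
  "BV_L1_M_dist a b M d = BV_dist a b (L1_dist M d)"

text \<open>\<open>L\<^sup>1(M, BV(I, N))\<close>, relative to the constant curves given by \<open>h\<close>, and its metric\<close>

definition L1_M_BV ::
    "real \<Rightarrow> real \<Rightarrow> 'm measure \<Rightarrow> 'n set \<Rightarrow> ('n \<Rightarrow> 'n \<Rightarrow> real) \<Rightarrow> ('m \<Rightarrow> 'n) set \<Rightarrow> ('m \<Rightarrow> real \<Rightarrow> 'n) set set" where
  "L1_M_BV a b M N d h =
     L1 M (BV a b N d) (BV_dist a b d) (ae_class M (BV a b N d) (\<lambda>x. \<lambda>t\<in>{a..b}. rep h x))"

definition L1_M_BV_dist ::
    "real \<Rightarrow> real \<Rightarrow> 'm measure \<Rightarrow> ('n \<Rightarrow> 'n \<Rightarrow> real) \<Rightarrow> ('m \<Rightarrow> real \<Rightarrow> 'n) set \<Rightarrow> ('m \<Rightarrow> real \<Rightarrow> 'n) set \<Rightarrow> real" where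
  "L1_M_BV_dist a b M d = L1_dist M (BV_dist a b d)"

text \<open>
  In \<open>sec_I\<close> and \<open>sec_M\<close>, almost every section of a representative belongs to the target space;
  the outer \<^const>\<open>ae_class\<close> takes care of the exceptional null set.
\<close>

definition sec_I ::
    "real \<Rightarrow> real \<Rightarrow> 'm measure \<Rightarrow> 'n set \<Rightarrow> ('n \<Rightarrow> 'n \<Rightarrow> real) \<Rightarrow> ('m \<Rightarrow> 'n) set
      \<Rightarrow> (real \<times> 'm \<Rightarrow> 'n) set \<Rightarrow> (real \<Rightarrow> ('m \<Rightarrow> 'n) set) set" where
  "sec_I a b M N d h C =
     ae_class (leb_I a b) (L1 M N d h) (\<lambda>t. ae_class M N (\<lambda>x. rep C (t, x)))"

definition sec_M ::
    "real \<Rightarrow> real \<Rightarrow> 'm measure \<Rightarrow> 'n set \<Rightarrow> ('n \<Rightarrow> 'n \<Rightarrow> real)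
      \<Rightarrow> (real \<times> 'm \<Rightarrow> 'n) set \<Rightarrow> ('m \<Rightarrow> (real \<Rightarrow> 'n) set) set" where
  "sec_M a b M N d C =
     ae_class M (L1_I a b N d) (\<lambda>x. ae_class (leb_I a b) N (\<lambda>t. rep C (t, x)))"

definition i_bar ::
    "real \<Rightarrow> real \<Rightarrow> 'm measure \<Rightarrow> 'n set \<Rightarrow> ('n \<Rightarrow> 'n \<Rightarrow> real) \<Rightarrow> ('m \<Rightarrow> 'n) set
      \<Rightarrow> (real \<Rightarrow> ('m \<Rightarrow> 'n) set) set \<Rightarrow> ('m \<Rightarrow> (real \<Rightarrow> 'n) set) set" where
  "i_bar a b M N d h F = sec_M a b M N d (inv_into (L1_IM a b M N d h) (sec_I a b M N d h) F)"

definition i_tilde ::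
    "real \<Rightarrow> real \<Rightarrow> 'm measure \<Rightarrow> 'n set \<Rightarrow> ('n \<Rightarrow> 'n \<Rightarrow> real) \<Rightarrow> ('m \<Rightarrow> 'n) set
      \<Rightarrow> (real \<Rightarrow> ('m \<Rightarrow> 'n) set) \<Rightarrow> ('m \<Rightarrow> real \<Rightarrow> 'n) set" where
  "i_tilde a b M N d h c =
     post_comp M (BV_class a b N ` BV a b N d) (BV a b N d)
       (inv_into (BV a b N d) (BV_class a b N))
       (i_bar a b M N d h (BV_class a b (L1 M N d h) c))"

end

theory Submission
  imports Defs
begin

text \<open>
  Let \<open>c\<close> be a curve in \<open>BV(I, L\<^sup>1\<^sub>h(M, N))\<close> and let \<open>k t\<close> represent \<open>c t\<close> for rational \<open>t\<close>. By monotone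
  convergence, the integral over \<open>M\<close> of the variation of \<open>t \<mapsto> k t x\<close> over the rationals is the variation
  of \<open>c\<close>. Hence for almost every \<open>x\<close> the map \<open>t \<mapsto> k t x\<close> has finite variation and, as \<open>N\<close> is complete,
  extends by one-sided limits to some \<open>\<gamma> x\<close> in \<open>BV(I, N)\<close>. Fatou's lemma shows that \<open>c t\<close> is the class of
  \<open>x \<mapsto> \<gamma> x t\<close> for every \<open>t\<close>, and since \<open>(t, x) \<mapsto> \<gamma> x t\<close> is jointly measurable, the image of \<open>c\<close> is the
  class of \<open>\<gamma>\<close>. Integrating the variations of \<open>\<gamma> x\<close> over the intervals \<open>(a, u)\<close> gives the equality of
  measures. Conversely, if \<open>f\<close> has integrable total variation, then \<open>t \<mapsto> [x \<mapsto> f x t]\<close> has one-sided limits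
  by dominated convergence.

  Since \<open>M\<close> need not be \<open>\<sigma>\<close>-finite, Tonelli's theorem is not directly available. However, an integrable
  function on \<open>I \<times> M\<close> agrees with \<open>h\<close> outside \<open>I \<times> S\<close> for a \<open>\<sigma>\<close>-finite set \<open>S\<close>, up to a null set, and over
  \<open>S\<close> the Caratheodory product is the usual product measure.
\<close>

section \<open>Separably valued measurable maps\<close>

text \<open>A curve \<open>c\<close> fixes only a class on \<open>M\<close> for each
  \<open>t\<close>; representatives chosen independently for uncountably many \<open>t\<close> have
  no joint measurability, and the curves \<open>t \<mapsto> k t x\<close> are uncontrolled. This is
  why only rational times are used and all other values are recreated as limits. Right continuity of
  \<open>c\<close>, and left continuity at \<open>b\<close>, then make the recreated value agree
  with \<open>c t\<close> for every \<open>t\<close>, which gives the evaluation formula.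
  Completeness of \<open>N\<close> enters twice: for these limits, and for lifting a Bochner
  integrable curve to \<open>I \<times> M\<close>. The lifting gives surjectivity of
  \<open>sec_I\<close> and hence injectivity of \<open>i_bar\<close> on its whole domain, on which
  the formula for the inverse depends; the value of \<open>i_tilde\<close> itself is computed from
  an explicit preimage under \<open>sec_I\<close>. In the converse direction the obstacle is that
  evaluation is discontinuous on \<open>BV(I, N)\<close>: before a class of
  \<open>x \<mapsto> f x t\<close> can be formed, measurability and separability of this map must be
  recovered from \<open>L\<^sup>1\<close> distances alone.\<close>

text \<open>
  Separability of the range is expressed by index maps. In this form the notion depends only on the
  distances between values, so that it transfers along distance-preserving maps.
\<close>

definition sep_meas :: "'y measure \<Rightarrow> 'z set \<Rightarrow> ('z \<Rightarrow> 'z \<Rightarrow> real) \<Rightarrow> ('y \<Rightarrow> 'z) \<Rightarrow> bool" where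
  "sep_meas Y Z d f \<longleftrightarrow> f \<in> space Y \<rightarrow> Z \<and>
     (\<forall>e>0. \<exists>i :: 'y \<Rightarrow> nat. \<forall>y\<in>space Y. \<forall>y'\<in>space Y. i y = i y' \<longrightarrow> d (f y) (f y') < e) \<and>
     (\<forall>z\<in>Z. (\<lambda>y. d (f y) z) \<in> borel_measurable Y)"

text \<open>The last two hypotheses say that \<open>f\<close> is the pointwise infimum of the
  \<open>g w\<close>, so strict sublevel sets are countable unions. With \<open>D\<close> a
  countable dense set this turns identities such as d(p, q) = inf over w of d(p, w) + d(w, q) into
  measurability.\<close>

lemma borel_measurable_countable_inf:
  fixes f :: "'y \<Rightarrow> real"
  assumes "countable D" and g: "\<And>w. w \<in> D \<Longrightarrow> g w \<in> borel_measurable Y"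
    and ge: "\<And>w y. w \<in> D \<Longrightarrow> y \<in> space Y \<Longrightarrow> f y \<le> g w y"
    and lt: "\<And>y e. y \<in> space Y \<Longrightarrow> e > 0 \<Longrightarrow> \<exists>w\<in>D. g w y < f y + e"
  shows "f \<in> borel_measurable Y"
  unfolding borel_measurable_iff_less
proof
  fix r :: real
  have "{y \<in> space Y. f y < r} = (\<Union>w\<in>D. {y \<in> space Y. g w y < r})"
  proof (intro set_eqI iffI)
    fix y assume "y \<in> {y \<in> space Y. f y < r}"
    then show "y \<in> (\<Union>w\<in>D. {y \<in> space Y. g w y < r})" using lt[of y "r - f y"] by auto
  next
    fix y assume "y \<in> (\<Union>w\<in>D. {y \<in> space Y. g w y < r})"
    then show "y \<in> {y \<in> space Y. f y < r}" using ge le_less_trans by blast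
  qed
  also have "\<dots> \<in> sets Y"
    using g by (intro sets.countable_UN''[OF assms(1)]) (simp add: borel_measurable_iff_less)
  finally show "{y \<in> space Y. f y < r} \<in> sets Y" .
qed

lemma sep_meas_cong:
  assumes "\<And>y. y \<in> space Y \<Longrightarrow> f y = g y"
  shows "sep_meas Y Z d f \<longleftrightarrow> sep_meas Y Z d g"
proof -
  have "f \<in> space Y \<rightarrow> Z \<longleftrightarrow> g \<in> space Y \<rightarrow> Z" using assms by (auto simp: Pi_iff)
  moreover have "(\<lambda>y. d (f y) z) \<in> borel_measurable Y \<longleftrightarrow> (\<lambda>y. d (g y) z) \<in> borel_measurable Y" for z
    by (rule measurable_cong) (simp add: assms)
  ultimately show ?thesis unfolding sep_meas_def using assms by simp
qed

lemma sep_measD: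
  assumes "sep_meas Y Z d f"
  shows "y \<in> space Y \<Longrightarrow> f y \<in> Z" "z \<in> Z \<Longrightarrow> (\<lambda>y. d (f y) z) \<in> borel_measurable Y"
  using assms by (auto simp: sep_meas_def)

lemma sep_meas_compose:
  assumes f: "sep_meas Y Z d f" and g: "g \<in> measurable X Y"
  shows "sep_meas X Z d (\<lambda>x. f (g x))"
  unfolding sep_meas_def
proof (intro conjI allI impI ballI)
  show "(\<lambda>x. f (g x)) \<in> space X \<rightarrow> Z"
    using f measurable_space[OF g] by (auto simp: sep_meas_def)
next
  fix e :: real assume "0 < e"
  then obtain i :: "_ \<Rightarrow> nat" where "\<forall>y\<in>space Y. \<forall>y'\<in>space Y. i y = i y' \<longrightarrow> d (f y) (f y') < e"
    using f by (auto simp: sep_meas_def)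
  then show "\<exists>i::_ \<Rightarrow> nat. \<forall>x\<in>space X. \<forall>x'\<in>space X. i x = i x' \<longrightarrow> d (f (g x)) (f (g x')) < e"
    using measurable_space[OF g] by (intro exI[of _ "\<lambda>x. i (g x)"]) auto
next
  fix z assume "z \<in> Z"
  then show "(\<lambda>x. d (f (g x)) z) \<in> borel_measurable X"
    using measurable_compose[OF g sep_measD(2)[OF f]] by simp
qed

locale metric_target = Metric_space Z d for Z :: "'z set" and d :: "'z \<Rightarrow> 'z \<Rightarrow> real"
begin

text \<open>One value of \<open>f\<close> is picked for every index that occurs at each scale
  1/(n+1); the value picked for the index of \<open>y\<close> is within the scale of
  \<open>f y\<close>.\<close>

lemma dense_of_index:
  assumes f: "f \<in> A \<rightarrow> Z"
    and ix: "\<And>e. e > 0 \<Longrightarrow> \<exists>i :: 'y \<Rightarrow> nat. \<forall>y\<in>A. \<forall>y'\<in>A. i y = i y' \<longrightarrow> d (f y) (f y') < e"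
  shows "\<exists>D. countable D \<and> D \<subseteq> f ` A \<and> (\<forall>y\<in>A. \<forall>e>0. \<exists>z\<in>D. d (f y) z < e)"
proof -
  have "\<exists>i :: 'y \<Rightarrow> nat. \<forall>y\<in>A. \<forall>y'\<in>A. i y = i y' \<longrightarrow> d (f y) (f y') < 1 / real (Suc n)" for n
    by (rule ix) simp
  then obtain i :: "nat \<Rightarrow> 'y \<Rightarrow> nat"
    where i: "\<And>n y y'. y \<in> A \<Longrightarrow> y' \<in> A \<Longrightarrow> i n y = i n y' \<Longrightarrow> d (f y) (f y') < 1 / real (Suc n)"
    by metis
  define s where "s n k = (SOME y. y \<in> A \<and> i n y = k)" for n k
  define D where "D = (\<Union>n. (\<lambda>k. f (s n k)) ` (i n ` A))"
  have s: "s n (i n y) \<in> A \<and> i n (s n (i n y)) = i n y" if "y \<in> A" for n y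
    unfolding s_def by (rule someI[of _ y]) (use that in auto)
  show ?thesis
  proof (intro exI[of _ D] conjI ballI allI impI)
    show "countable D" unfolding D_def by (intro countable_UN countable_image[where A = "i _ ` A"] countableI_type)
    show "D \<subseteq> f ` A" unfolding D_def using s by auto
    fix y e assume y: "y \<in> A" and e: "(e::real) > 0"
    then obtain n where n: "1 / real (Suc n) < e" using nat_approx_posE by blast
    have "d (f y) (f (s n (i n y))) < 1 / real (Suc n)"
      by (rule i) (use s[OF y, of n] y in auto)
    moreover have "f (s n (i n y)) \<in> D" unfolding D_def using y by auto
    ultimately show "\<exists>z\<in>D. d (f y) z < e" using n by force
  qed
qed

lemma sep_meas_dense:
  assumes "sep_meas Y Z d f"
  shows "\<exists>D. countable D \<and> D \<subseteq> f ` space Y \<and> D \<subseteq> Z \<and> (\<forall>y\<in>space Y. \<forall>e>0. \<exists>z\<in>D. d (f y) z < e)"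
proof -
  have 1: "f \<in> space Y \<rightarrow> Z" using assms by (simp add: sep_meas_def)
  have 2: "\<exists>i :: 'a \<Rightarrow> nat. \<forall>y\<in>space Y. \<forall>y'\<in>space Y. i y = i y' \<longrightarrow> d (f y) (f y') < e" if "e > 0" for e
    using assms that by (simp add: sep_meas_def)
  obtain D where "countable D" "D \<subseteq> f ` space Y" "\<forall>y\<in>space Y. \<forall>e>0. \<exists>z\<in>D. d (f y) z < e"
    using dense_of_index[OF 1 2] by auto
  moreover have "D \<subseteq> Z" using 1 calculation(2) by auto
  ultimately show ?thesis by blast
qed

text \<open>Measurability of the distances to the points of \<open>D\<close> suffices because d(f y,
  z) is the infimum over \<open>w\<close> in \<open>D\<close> of d(f y, w) + d(w, z). The index of
  \<open>y\<close> is the number of a point of \<open>D\<close> within e/2 of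
  \<open>f y\<close>.\<close>

lemma sep_meas_from_dense:
  assumes f: "f \<in> space Y \<rightarrow> Z" and D: "countable D" "D \<subseteq> Z"
    and dense: "\<And>y e. y \<in> space Y \<Longrightarrow> e > 0 \<Longrightarrow> \<exists>z\<in>D. d (f y) z < e"
    and meas: "\<And>z. z \<in> D \<Longrightarrow> (\<lambda>y. d (f y) z) \<in> borel_measurable Y"
  shows "sep_meas Y Z d f"
  unfolding sep_meas_def
proof (intro conjI allI impI ballI)
  show "f \<in> space Y \<rightarrow> Z" by fact
next
  fix e :: real assume e: "0 < e"
  define g where "g y = (SOME z. z \<in> D \<and> d (f y) z < e/2)" for y
  have g: "g y \<in> D \<and> d (f y) (g y) < e/2" if "y \<in> space Y" for y
    unfolding g_def by (rule someI_ex) (use dense[OF that, of "e/2"] e in auto)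
  have "d (f y) (f y') < e" if yy: "y \<in> space Y" "y' \<in> space Y"
    and eq: "to_nat_on D (g y) = to_nat_on D (g y')" for y y'
  proof -
    have "g y = g y'" using eq g yy D(1) by (metis from_nat_into_to_nat_on)
    moreover have "d (f y) (f y') \<le> d (f y) (g y) + d (g y) (f y')"
      by (rule triangle) (use f yy g D in auto)
    ultimately show ?thesis using g[OF yy(1)] g[OF yy(2)] by (simp add: commute)
  qed
  then show "\<exists>i::_ \<Rightarrow> nat. \<forall>y\<in>space Y. \<forall>y'\<in>space Y. i y = i y' \<longrightarrow> d (f y) (f y') < e"
    by (intro exI[of _ "\<lambda>y. to_nat_on D (g y)"]) auto
next
  fix z assume z: "z \<in> Z"
  show "(\<lambda>y. d (f y) z) \<in> borel_measurable Y"
  proof (rule borel_measurable_countable_inf[OF D(1), of "\<lambda>w y. d (f y) w + d w z"])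
    show "(\<lambda>y. d (f y) w + d w z) \<in> borel_measurable Y" if "w \<in> D" for w using meas[OF that] by simp
    fix y assume y: "y \<in> space Y"
    show "d (f y) z \<le> d (f y) w + d w z" if "w \<in> D" for w
      by (rule triangle) (use that D(2) f y z in auto)
    fix e :: real assume "e > 0"
    then obtain w where w: "w \<in> D" "d (f y) w < e / 2" using dense[OF y, of "e / 2"] by auto
    then have "d w z \<le> d (f y) w + d (f y) z"
      using triangle[of w "f y" z] y z f D(2) by (auto simp: commute)
    then show "\<exists>w\<in>D. d (f y) w + d w z < d (f y) z + e" using w by (intro bexI[of _ w]) auto
  qed
qed

text \<open>Separability of the range of \<open>g\<close> replaces second countability of
  \<open>Z\<close>: the distance is the infimum of d(f y, w) + d(g y, w) over a countable set of
  \<open>w\<close> dense near the range of \<open>g\<close>.\<close>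

lemma sep_meas_dist:
  assumes f: "sep_meas Y Z d f" and g: "sep_meas Y Z d g"
  shows "(\<lambda>y. d (f y) (g y)) \<in> borel_measurable Y"
proof -
  obtain D where D: "countable D" "D \<subseteq> Z" "\<And>y e. y \<in> space Y \<Longrightarrow> e > 0 \<Longrightarrow> \<exists>z\<in>D. d (g y) z < e"
    using sep_meas_dense[OF g] by metis
  show ?thesis
  proof (rule borel_measurable_countable_inf[OF D(1), of "\<lambda>w y. d (f y) w + d (g y) w"])
    show "(\<lambda>y. d (f y) w + d (g y) w) \<in> borel_measurable Y" if "w \<in> D" for w
      using sep_measD(2)[OF f, of w] sep_measD(2)[OF g, of w] D(2) that by auto
    fix y assume y: "y \<in> space Y"
    note fg = sep_measD(1)[OF f y] sep_measD(1)[OF g y]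
    show "d (f y) (g y) \<le> d (f y) w + d (g y) w" if "w \<in> D" for w
      by (rule triangle') (use that D(2) fg in auto)
    fix e :: real assume "e > 0"
    then obtain w where w: "w \<in> D" "d (g y) w < e / 2" using D(3)[OF y, of "e / 2"] by auto
    then have "d (f y) w \<le> d (f y) (g y) + d (g y) w"
      using triangle[OF fg, of w] D(2) by auto
    then show "\<exists>w\<in>D. d (f y) w + d (g y) w < d (f y) (g y) + e" using w by (intro bexI[of _ w]) auto
  qed
qed

lemma sep_meas_const: "z \<in> Z \<Longrightarrow> sep_meas Y Z d (\<lambda>_. z)"
  by (auto simp: sep_meas_def)

lemma dist_tendsto:
  assumes "(\<lambda>n. d (u n) w) \<longlonglongrightarrow> 0" "\<And>n. u n \<in> Z" "w \<in> Z" "z \<in> Z"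
  shows "(\<lambda>n. d (u n) z) \<longlonglongrightarrow> d w z"
proof -
  have "(\<lambda>n. d (u n) z - d w z) \<longlonglongrightarrow> 0"
  proof (rule Lim_null_comparison[OF _ assms(1)], intro always_eventually allI)
    fix n show "norm (d (u n) z - d w z) \<le> d (u n) w"
      using mdist_reverse_triangle[of "u n" z w] assms(2)[of n] assms(3,4) by (simp add: commute)
  qed
  then show ?thesis by (simp add: LIM_zero_iff)
qed

text \<open>Countable sets dense near the ranges of the \<open>f n\<close> have a union that is
  dense near the range of the limit, and distances to fixed points converge.\<close>

lemma sep_meas_lim:
  assumes f: "\<And>n::nat. sep_meas Y Z d (f n)" and g: "g \<in> space Y \<rightarrow> Z"
    and lim: "\<And>y. y \<in> space Y \<Longrightarrow> (\<lambda>n. d (f n y) (g y)) \<longlonglongrightarrow> 0"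
  shows "sep_meas Y Z d g"
proof -
  have "\<exists>D. countable D \<and> D \<subseteq> Z \<and> (\<forall>y\<in>space Y. \<forall>e>0. \<exists>z\<in>D. d (f n y) z < e)" for n
    using sep_meas_dense[OF f[of n]] by metis
  then obtain D where D: "\<And>n. countable (D n)" "\<And>n. D n \<subseteq> Z"
    "\<And>n y e. y \<in> space Y \<Longrightarrow> e > 0 \<Longrightarrow> \<exists>z\<in>D n. d (f n y) z < e" by metis
  show ?thesis
  proof (rule sep_meas_from_dense[OF g, of "\<Union>n. D n"])
    show "countable (\<Union>n. D n)" "(\<Union>n. D n) \<subseteq> Z" using D by auto
  next
    fix y and e :: real assume y: "y \<in> space Y" and e: "e > 0"
    have "eventually (\<lambda>n. d (f n y) (g y) < e/2) sequentially"
      using order_tendstoD(2)[OF lim[OF y], of "e/2"] e by simp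
    then obtain n where n: "d (f n y) (g y) < e/2" by (meson eventually_sequentially order_refl)
    obtain z where z: "z \<in> D n" "d (f n y) z < e/2" using D(3)[OF y, of "e/2" n] e by auto
    have "d (g y) z \<le> d (g y) (f n y) + d (f n y) z"
      by (rule triangle) (use g y z D(2)[of n] sep_measD(1)[OF f[of n] y] in auto)
    then show "\<exists>z\<in>\<Union>n. D n. d (g y) z < e" using n z by (auto simp: commute intro!: bexI[of _ z] exI[of _ n])
  next
    fix z assume "z \<in> (\<Union>n. D n)"
    then have z: "z \<in> Z" using D by auto
    show "(\<lambda>y. d (g y) z) \<in> borel_measurable Y"
    proof (rule borel_measurable_LIMSEQ_real)
      show "(\<lambda>y. d (f n y) z) \<in> borel_measurable Y" for n using f[of n] z by (auto simp: sep_meas_def)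
      show "(\<lambda>n. d (f n y) z) \<longlonglongrightarrow> d (g y) z" if "y \<in> space Y" for y
        by (rule dist_tendsto[OF lim[OF that]]) (use g that z sep_measD(1)[OF f that] in auto)
    qed
  qed
qed

text \<open>Glues countably many maps along a measurable index. Case distinctions, rounding of times
  to a grid and countably valued approximations all take this form.\<close>

lemma sep_meas_countable:
  fixes i :: "'y \<Rightarrow> nat"
  assumes f: "\<And>n. sep_meas Y Z d (f n)" and i: "i \<in> measurable Y (count_space UNIV)"
  shows "sep_meas Y Z d (\<lambda>y. f (i y) y)"
  unfolding sep_meas_def
proof (intro conjI allI impI ballI)
  show "(\<lambda>y. f (i y) y) \<in> space Y \<rightarrow> Z" using f by (auto simp: sep_meas_def)
next
  fix e :: real assume e: "0 < e"
  have "\<exists>j :: 'y \<Rightarrow> nat. \<forall>y\<in>space Y. \<forall>y'\<in>space Y. j y = j y' \<longrightarrow> d (f n y) (f n y') < e" for n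
    using f[of n] e by (auto simp: sep_meas_def)
  then obtain j :: "nat \<Rightarrow> 'y \<Rightarrow> nat"
    where j: "\<And>n y y'. y \<in> space Y \<Longrightarrow> y' \<in> space Y \<Longrightarrow> j n y = j n y' \<Longrightarrow> d (f n y) (f n y') < e"
    by metis
  show "\<exists>j::'y \<Rightarrow> nat. \<forall>y\<in>space Y. \<forall>y'\<in>space Y. j y = j y' \<longrightarrow> d (f (i y) y) (f (i y') y') < e"
    by (rule exI[of _ "\<lambda>y. prod_encode (i y, j (i y) y)"]) (use j in auto)
next
  fix z assume z: "z \<in> Z"
  show "(\<lambda>y. d (f (i y) y) z) \<in> borel_measurable Y"
    by (rule measurable_compose_countable[OF _ i, of "\<lambda>n y. d (f n y) z"]) (use f z in \<open>auto simp: sep_meas_def\<close>)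
qed

lemma sep_meas_if:
  assumes f: "sep_meas Y Z d f" and g: "sep_meas Y Z d g" and P: "{y \<in> space Y. P y} \<in> sets Y"
  shows "sep_meas Y Z d (\<lambda>y. if P y then f y else g y)"
proof -
  have [measurable]: "Measurable.pred Y P" using P by (simp add: pred_def)
  have "(\<lambda>y. if P y then 0 else 1 :: nat) \<in> measurable Y (count_space UNIV)" by measurable
  note this [THEN sep_meas_countable[of Y "\<lambda>n. if n = 0 then f else g", rotated]]
  then have "sep_meas Y Z d (\<lambda>y. (if (if P y then 0 else 1 :: nat) = 0 then f else g) y)"
    using f g by simp
  then show ?thesis by (rule sep_meas_cong[THEN iffD1, rotated]) auto
qed

text \<open>Distances control only preimages of balls. Separability of the range makes the preimage
  of an open set a countable union of these: centres run through a dense set and radii through the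
  rationals.\<close>

lemma L0s_iff: "f \<in> L0s Y Z d \<longleftrightarrow> f \<in> extensional (space Y) \<and> sep_meas Y Z d f"
proof
  assume "f \<in> L0s Y Z d"
  then have ex: "f \<in> extensional (space Y)" and fZ: "f \<in> space Y \<rightarrow> Z"
    and m: "f \<in> measurable Y (borel_sigma Z d)"
    and sep: "separable_space (subtopology mtopology (f ` space Y))"
    by (auto simp: L0s_def PiE_def)
  have ball: "{y \<in> space Y. d (f y) z < r} \<in> sets Y" if "z \<in> Z" for z r
  proof -
    have "mball z r \<in> sets (borel_sigma Z d)"
      unfolding borel_sigma_def by (subst sets_measure_of) (auto simp: openin_mtopology)
    from measurable_sets[OF m this] have "f -` mball z r \<inter> space Y \<in> sets Y" .
    also have "f -` mball z r \<inter> space Y = {y \<in> space Y. d (f y) z < r}"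
      using fZ that by (auto simp: commute)
    finally show ?thesis .
  qed
  have sub: "topspace (subtopology mtopology (f ` space Y)) = f ` space Y"
    using fZ by auto
  from sep have "\<exists>D. countable D \<and> D \<subseteq> f ` space Y \<and>
      (\<forall>T. openin (subtopology mtopology (f ` space Y)) T \<and> T \<noteq> {} \<longrightarrow> D \<inter> T \<noteq> {})"
    unfolding separable_space_def dense_intersects_open unfolding sub .
  then obtain D where D: "countable D" "D \<subseteq> f ` space Y"
    "\<And>T. openin (subtopology mtopology (f ` space Y)) T \<Longrightarrow> T \<noteq> {} \<Longrightarrow> D \<inter> T \<noteq> {}"
    by blast
  have "sep_meas Y Z d f"
  proof (rule sep_meas_from_dense[OF fZ D(1)])
    show "D \<subseteq> Z" using D fZ by auto
    show "\<exists>z\<in>D. d (f y) z < e" if "y \<in> space Y" "e > 0" for y e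
    proof -
      have "openin (subtopology mtopology (f ` space Y)) (mball (f y) e \<inter> f ` space Y)"
        by (auto simp: openin_subtopology)
      moreover have "f y \<in> mball (f y) e \<inter> f ` space Y" using that fZ centre_in_mball_iff[of "f y" e] by (auto simp del: in_mball)
      ultimately show ?thesis using D(3) by fastforce
    qed
    show "(\<lambda>y. d (f y) z) \<in> borel_measurable Y" if "z \<in> D" for z
    proof -
      have "z \<in> Z" using that D fZ by auto
      then show ?thesis unfolding borel_measurable_iff_less using ball by auto
    qed
  qed
  with ex show "f \<in> extensional (space Y) \<and> sep_meas Y Z d f" by blast
next
  assume "f \<in> extensional (space Y) \<and> sep_meas Y Z d f"
  then have ex: "f \<in> extensional (space Y)" and s: "sep_meas Y Z d f" by auto
  have fZ: "f \<in> space Y \<rightarrow> Z" using s by (simp add: sep_meas_def)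
  obtain D where D: "countable D" "D \<subseteq> f ` space Y" "D \<subseteq> Z"
    "\<And>y e. y \<in> space Y \<Longrightarrow> e > 0 \<Longrightarrow> \<exists>z\<in>D. d (f y) z < e"
    using sep_meas_dense[OF s] by metis
  have sub: "topspace (subtopology mtopology (f ` space Y)) = f ` space Y"
    using fZ by auto
  have "separable_space (subtopology mtopology (f ` space Y))"
    unfolding separable_space_def dense_intersects_open unfolding sub
  proof (intro exI[of _ D] conjI allI impI)
    show "countable D" "D \<subseteq> f ` space Y" by fact+
    fix T assume T: "openin (subtopology mtopology (f ` space Y)) T \<and> T \<noteq> {}"
    then obtain U where U: "openin mtopology U" "T = U \<inter> f ` space Y" by (auto simp: openin_subtopology)
    then obtain y where y: "y \<in> space Y" "f y \<in> U" using T by auto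
    then obtain r where r: "r > 0" "mball (f y) r \<subseteq> U" using U openin_mtopology by auto
    obtain z where z: "z \<in> D" "d (f y) z < r" using D(4)[OF y(1) r(1)] by auto
    then have "z \<in> mball (f y) r" using fZ y D by auto
    then have "z \<in> U" using r by auto
    then show "D \<inter> T \<noteq> {}" using z U D(2) by auto
  qed
  moreover have "f \<in> measurable Y (borel_sigma Z d)"
    unfolding borel_sigma_def
  proof (rule measurable_sigma_sets)
    show "sets (sigma Z {U. openin mtopology U}) = sigma_sets Z {U. openin mtopology U}"
      by (rule sets_measure_of) (auto simp: openin_mtopology)
    show "{U. openin mtopology U} \<subseteq> Pow Z" by (auto simp: openin_mtopology)
    show "f \<in> space Y \<rightarrow> Z" by fact
    fix U assume "U \<in> {U. openin mtopology U}"
    then have U: "openin mtopology U" by simp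
    have "f -` U \<inter> space Y = (\<Union>(z, q)\<in>{(z, q). z \<in> D \<and> q \<in> \<rat> \<and> mball z q \<subseteq> U}. {y \<in> space Y. d (f y) z < q})"
      (is "_ = ?R")
    proof (intro set_eqI iffI)
      fix y assume "y \<in> f -` U \<inter> space Y"
      then have y: "f y \<in> U" "y \<in> space Y" by auto
      then obtain r where r: "r > 0" "mball (f y) r \<subseteq> U" using U openin_mtopology by auto
      obtain q where q: "q \<in> \<rat>" "0 < q" "q < r/2" using Rats_dense_in_real[of 0 "r/2"] r by auto
      obtain z where z: "z \<in> D" "d (f y) z < q" using D(4)[OF y(2) q(2)] by auto
      have "mball z q \<subseteq> mball (f y) r"
      proof
        fix w assume w: "w \<in> mball z q"
        then have "d (f y) w \<le> d (f y) z + d z w" using triangle[of "f y" z w] fZ y by auto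
        then show "w \<in> mball (f y) r" using w z q fZ y by auto
      qed
      then show "y \<in> ?R" using q z y r by (auto intro!: bexI[of _ "(z,q)"])
    next
      fix y assume "y \<in> ?R"
      then obtain z q where "z \<in> D" "mball z q \<subseteq> U" "y \<in> space Y" "d (f y) z < q" by auto
      then show "y \<in> f -` U \<inter> space Y" using D(3) fZ by (auto simp: subset_iff commute)
    qed
    also have "?R \<in> sets Y"
    proof (rule sets.countable_UN'')
      have "countable (D \<times> \<rat> :: ('z \<times> real) set)" using D countable_rat by auto
      then show "countable {(z, q). z \<in> D \<and> q \<in> \<rat> \<and> mball z q \<subseteq> U}"
        by (rule countable_subset[rotated]) auto
      fix p assume "p \<in> {(z, q). z \<in> D \<and> q \<in> \<rat> \<and> mball z q \<subseteq> U}"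
      then obtain z q where p: "p = (z, q)" "z \<in> D" by auto
      then have [measurable]: "(\<lambda>y. d (f y) z) \<in> borel_measurable Y" using s D by (auto simp: sep_meas_def)
      show "(case p of (z, q) \<Rightarrow> {y \<in> space Y. d (f y) z < q}) \<in> sets Y" unfolding p by simp
    qed
    finally show "f -` U \<inter> space Y \<in> sets Y" .
  qed
  ultimately show "f \<in> L0s Y Z d" using ex fZ by (auto simp: L0s_def PiE_def)
qed

end

section \<open>Spaces of integrable classes\<close>

lemma ae_class_eq: "AE y in Y. f y = g y \<Longrightarrow> ae_class Y Z f = ae_class Y Z g"
  unfolding ae_class_def by (auto elim!: AE_mp)

lemma ae_class_self: "f \<in> space Y \<rightarrow>\<^sub>E Z \<Longrightarrow> f \<in> ae_class Y Z f"
  by (simp add: ae_class_def)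

lemma ae_class_restrict: "ae_class Y Z (restrict f (space Y)) = ae_class Y Z f"
  by (rule ae_class_eq) (rule AE_I2, simp)

lemma ae_class_memD: "g \<in> ae_class Y Z f \<Longrightarrow> g \<in> space Y \<rightarrow>\<^sub>E Z" "g \<in> ae_class Y Z f \<Longrightarrow> AE y in Y. g y = f y"
  by (auto simp: ae_class_def)

lemma ae_class_of_mem: "g \<in> ae_class Y Z f \<Longrightarrow> ae_class Y Z f = ae_class Y Z g"
  by (rule ae_class_eq) (auto simp: ae_class_def elim: AE_mp)

lemma ae_class_nonempty:
  assumes "AE y in Y. f y \<in> Z" "Z \<noteq> {}"
  shows "ae_class Y Z f \<noteq> {}"
proof -
  obtain z where z: "z \<in> Z" using assms by auto
  have "restrict (\<lambda>y. if f y \<in> Z then f y else z) (space Y) \<in> ae_class Y Z f"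
    unfolding ae_class_def using z assms(1) by (auto elim!: AE_mp)
  then show ?thesis by auto
qed

lemma rep_mem:
  assumes "AE y in Y. f y \<in> Z" "Z \<noteq> {}"
  shows "rep (ae_class Y Z f) \<in> ae_class Y Z f"
  using ae_class_nonempty[OF assms] unfolding rep_def by (simp add: some_in_eq)

lemma rep_AE:
  assumes "AE y in Y. f y \<in> Z" "Z \<noteq> {}"
  shows "AE y in Y. rep (ae_class Y Z f) y = f y"
  using rep_mem[OF assms] by (rule ae_class_memD)

text \<open>A map that does not lie in \<open>Z\<close> almost everywhere has an empty class. The
  assumption on \<open>f\<close> excludes this, and a common member of the two classes then links
  \<open>f\<close> with \<open>g\<close>.\<close>

lemma ae_class_eqD:
  assumes "ae_class Y Z f = ae_class Y Z g" "AE y in Y. f y \<in> Z" "Z \<noteq> {}"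
  shows "AE y in Y. f y = g y"
proof -
  obtain k where "k \<in> ae_class Y Z f" using ae_class_nonempty[OF assms(2,3)] by auto
  then have "AE y in Y. k y = f y" "AE y in Y. k y = g y"
    using assms(1) ae_class_memD(2) by metis+
  then show ?thesis by eventually_elim simp
qed

context metric_target
begin

lemma sep_meas_AE: "sep_meas Y Z d f \<Longrightarrow> AE y in Y. f y \<in> Z"
  by (rule AE_I2) (rule sep_measD)

lemma L0_iff: "F \<in> L0 Y Z d \<longleftrightarrow> (\<exists>f. sep_meas Y Z d f \<and> F = ae_class Y Z f)"
proof
  assume "F \<in> L0 Y Z d"
  then show "\<exists>f. sep_meas Y Z d f \<and> F = ae_class Y Z f" by (auto simp: L0_def L0s_iff)
next
  assume "\<exists>f. sep_meas Y Z d f \<and> F = ae_class Y Z f"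
  then obtain f where f: "sep_meas Y Z d f" "F = ae_class Y Z f" by auto
  have "restrict f (space Y) \<in> L0s Y Z d"
    using f(1) sep_meas_cong[of Y f "restrict f (space Y)"] by (auto simp: L0s_iff)
  then show "F \<in> L0 Y Z d" unfolding L0_def f(2) ae_class_restrict[of Y Z f, symmetric] by (rule imageI)
qed

text \<open>\<open>rep\<close> may be non-measurable, so membership is restated with a
  \<open>sep_meas\<close> representative; the integral is the same because the representatives agree
  almost everywhere.\<close>

lemma L1_iff:
  assumes g: "AE y in Y. g y \<in> Z" and ne: "Z \<noteq> {}"
  shows "F \<in> L1 Y Z d (ae_class Y Z g) \<longleftrightarrow>
    (\<exists>f. sep_meas Y Z d f \<and> (\<integral>\<^sup>+ y. ennreal (d (f y) (g y)) \<partial>Y) < \<infinity> \<and> F = ae_class Y Z f)"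
proof -
  have "(\<integral>\<^sup>+ y. ennreal (d (rep F y) (rep (ae_class Y Z g) y)) \<partial>Y) = (\<integral>\<^sup>+ y. ennreal (d (f y) (g y)) \<partial>Y)"
    if "sep_meas Y Z d f" "F = ae_class Y Z f" for f
    using rep_AE[OF g ne] rep_AE[OF sep_meas_AE[OF that(1)] ne] that(2)
    by (intro nn_integral_cong_AE) (auto elim: AE_mp)
  then show ?thesis unfolding L1_def L0_iff by auto
qed

lemma L1_dist_class:
  assumes "AE y in Y. f y \<in> Z" "AE y in Y. f' y \<in> Z" "Z \<noteq> {}"
  shows "L1_dist Y d (ae_class Y Z f) (ae_class Y Z f') = enn2real (\<integral>\<^sup>+ y. ennreal (d (f y) (f' y)) \<partial>Y)"
  unfolding L1_dist_def
  using rep_AE[OF assms(1,3)] rep_AE[OF assms(2,3)]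
  by (intro arg_cong[where f = enn2real] nn_integral_cong_AE) (auto elim: AE_mp)

lemma nn_integral_triangle:
  assumes "sep_meas Y Z d f" "sep_meas Y Z d g" "sep_meas Y Z d k"
  shows "(\<integral>\<^sup>+ y. ennreal (d (f y) (k y)) \<partial>Y) \<le>
    (\<integral>\<^sup>+ y. ennreal (d (f y) (g y)) \<partial>Y) + (\<integral>\<^sup>+ y. ennreal (d (g y) (k y)) \<partial>Y)"
proof -
  have "(\<integral>\<^sup>+ y. ennreal (d (f y) (k y)) \<partial>Y) \<le> (\<integral>\<^sup>+ y. ennreal (d (f y) (g y)) + ennreal (d (g y) (k y)) \<partial>Y)"
  proof (rule nn_integral_mono)
    fix y assume "y \<in> space Y"
    then show "ennreal (d (f y) (k y)) \<le> ennreal (d (f y) (g y)) + ennreal (d (g y) (k y))"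
      using assms sep_measD(1) by (metis ennreal_leI ennreal_plus nonneg triangle)
  qed
  also have "\<dots> = (\<integral>\<^sup>+ y. ennreal (d (f y) (g y)) \<partial>Y) + (\<integral>\<^sup>+ y. ennreal (d (g y) (k y)) \<partial>Y)"
    by (rule nn_integral_add) (auto intro!: measurable_compose[OF _ measurable_ennreal] sep_meas_dist assms)
  finally show ?thesis .
qed

end

section \<open>The metric space of integrable classes relative to a reference map\<close>

locale L1_target = metric_target Z d for Z :: "'z set" and d +
  fixes Y :: "'y measure" and g :: "'y \<Rightarrow> 'z"
  assumes ref: "sep_meas Y Z d g" and ne: "Z \<noteq> {}"
begin

abbreviation cls :: "('y \<Rightarrow> 'z) \<Rightarrow> ('y \<Rightarrow> 'z) set" where "cls \<equiv> ae_class Y Z"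

abbreviation L :: "('y \<Rightarrow> 'z) set set" where "L \<equiv> L1 Y Z d (cls g)"

definition int1 :: "('y \<Rightarrow> 'z) \<Rightarrow> bool" where
  "int1 f \<longleftrightarrow> sep_meas Y Z d f \<and> (\<integral>\<^sup>+ y. ennreal (d (f y) (g y)) \<partial>Y) < \<infinity>"

lemma int1_sep: "int1 f \<Longrightarrow> sep_meas Y Z d f" by (simp add: int1_def)

lemma int1_AE: "int1 f \<Longrightarrow> AE y in Y. f y \<in> Z" by (simp add: int1_def sep_meas_AE)

lemma int1_ref: "int1 g"
proof -
  have "(\<integral>\<^sup>+ y. ennreal (d (g y) (g y)) \<partial>Y) = (\<integral>\<^sup>+ y. 0 \<partial>Y)"
    by (rule nn_integral_cong) (use sep_measD(1)[OF ref] in simp)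
  then show ?thesis by (simp add: int1_def ref)
qed

lemma L_iff: "F \<in> L \<longleftrightarrow> (\<exists>f. int1 f \<and> F = cls f)"
  unfolding L1_iff[OF sep_meas_AE[OF ref] ne] int1_def by auto

lemma cls_mem: "int1 f \<Longrightarrow> cls f \<in> L" by (auto simp: L_iff)

lemma nn_finite:
  assumes "int1 f" "int1 f'"
  shows "(\<integral>\<^sup>+ y. ennreal (d (f y) (f' y)) \<partial>Y) < \<infinity>"
proof -
  have "(\<integral>\<^sup>+ y. ennreal (d (f y) (f' y)) \<partial>Y) \<le>
      (\<integral>\<^sup>+ y. ennreal (d (f y) (g y)) \<partial>Y) + (\<integral>\<^sup>+ y. ennreal (d (g y) (f' y)) \<partial>Y)"
    by (rule nn_integral_triangle) (use assms ref in \<open>auto simp: int1_def\<close>)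
  also have "\<dots> < \<infinity>" using assms by (simp add: int1_def commute)
  finally show ?thesis .
qed

lemma dist_cls: "int1 f \<Longrightarrow> int1 f' \<Longrightarrow> L1_dist Y d (cls f) (cls f') = enn2real (\<integral>\<^sup>+ y. ennreal (d (f y) (f' y)) \<partial>Y)"
  by (rule L1_dist_class) (auto simp: int1_AE ne)

lemma ennreal_dist_cls:
  assumes "int1 f" "int1 f'"
  shows "ennreal (L1_dist Y d (cls f) (cls f')) = (\<integral>\<^sup>+ y. ennreal (d (f y) (f' y)) \<partial>Y)"
  unfolding dist_cls[OF assms] using nn_finite[OF assms] by simp

lemma cls_eq_iff:
  assumes "int1 f" "int1 f'"
  shows "cls f = cls f' \<longleftrightarrow> (\<integral>\<^sup>+ y. ennreal (d (f y) (f' y)) \<partial>Y) = 0"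
proof -
  have "(\<integral>\<^sup>+ y. ennreal (d (f y) (f' y)) \<partial>Y) = 0 \<longleftrightarrow> (AE y in Y. ennreal (d (f y) (f' y)) = 0)"
    by (rule nn_integral_0_iff_AE)
      (auto intro!: measurable_compose[OF _ measurable_ennreal] sep_meas_dist int1_sep assms)
  also have "\<dots> \<longleftrightarrow> (AE y in Y. f y = f' y)"
  proof (rule AE_cong)
    fix y assume "y \<in> space Y"
    then have "f y \<in> Z" "f' y \<in> Z" using sep_measD(1)[OF int1_sep] assms by auto
    then have "d (f y) (f' y) = 0 \<longleftrightarrow> f y = f' y" by simp
    then show "ennreal (d (f y) (f' y)) = 0 \<longleftrightarrow> f y = f' y"
      unfolding ennreal_eq_0_iff using nonneg[of "f y" "f' y"] by linarith
  qed
  also have "\<dots> \<longleftrightarrow> cls f = cls f'"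
    using ae_class_eq[of f f' Y Z] ae_class_eqD[of Y Z f f', OF _ int1_AE[OF assms(1)] ne] by blast
  finally show ?thesis by simp
qed

text \<open>Integrability depends on the class only, so a newly constructed measurable map inherits
  it once its class is identified.\<close>

lemma int1_of_cls:
  assumes f: "sep_meas Y Z d f" and mem: "cls f \<in> L"
  shows "int1 f"
proof -
  obtain w where w: "int1 w" "cls f = cls w" using mem by (auto simp: L_iff)
  have "AE y in Y. f y = w y" by (rule ae_class_eqD[OF w(2) sep_meas_AE[OF f] ne])
  then have "(\<integral>\<^sup>+ y. ennreal (d (f y) (g y)) \<partial>Y) = (\<integral>\<^sup>+ y. ennreal (d (w y) (g y)) \<partial>Y)"
    by (intro nn_integral_cong_AE) (auto elim: AE_mp)
  then show ?thesis using w(1) f by (simp add: int1_def)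
qed

text \<open>Being a metric target again, the space of classes can carry curves of bounded variation
  and serve as target of measurable maps; \<open>L\<^sup>1(I, L\<^sup>1\<^sub>h(M, N))\<close>
  arises by iteration. The axioms are read off from the nonnegative integrals, which are finite
  here.\<close>

sublocale Lp: metric_target L "L1_dist Y d"
proof
  show "0 \<le> L1_dist Y d x y" for x y by (simp add: L1_dist_def)
  show "L1_dist Y d x y = L1_dist Y d y x" for x y by (simp add: L1_dist_def commute)
next
  fix F F' assume "F \<in> L" "F' \<in> L"
  then obtain f f' where f: "int1 f" "F = cls f" "int1 f'" "F' = cls f'" by (auto simp: L_iff)
  have "L1_dist Y d F F' = 0 \<longleftrightarrow> ennreal (L1_dist Y d F F') = 0" by (simp add: L1_dist_def)
  then show "L1_dist Y d F F' = 0 \<longleftrightarrow> F = F'"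
    using cls_eq_iff[OF f(1,3)] ennreal_dist_cls[OF f(1,3)] f by simp
next
  fix F F' F'' assume "F \<in> L" "F' \<in> L" "F'' \<in> L"
  then obtain f f' f'' where f: "int1 f" "F = cls f" "int1 f'" "F' = cls f'" "int1 f''" "F'' = cls f''"
    by (auto simp: L_iff)
  have "ennreal (L1_dist Y d F F'') \<le> ennreal (L1_dist Y d F F') + ennreal (L1_dist Y d F' F'')"
    unfolding f(2,4,6) using f by (simp only: ennreal_dist_cls) (rule nn_integral_triangle; simp add: int1_sep)
  then show "L1_dist Y d F F'' \<le> L1_dist Y d F F' + L1_dist Y d F' F''"
    by (simp add: L1_dist_def flip: ennreal_plus)
qed

end

section \<open>Variation\<close>

text \<open>Partitions are lists: refinement becomes inclusion of the sets of entries, proofs go by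
  induction, and a countable set has only countably many partitions.\<close>

fun vsum :: "('z \<Rightarrow> 'z \<Rightarrow> real) \<Rightarrow> (real \<Rightarrow> 'z) \<Rightarrow> real list \<Rightarrow> real" where
  "vsum d g (x # y # zs) = d (g x) (g y) + vsum d g (y # zs)"
| "vsum d g _ = 0"

lemma vsum_snoc: "vsum d g (xs @ [y, z]) = vsum d g (xs @ [y]) + d (g y) (g z)"
  by (induction d g xs rule: vsum.induct) auto

lemma vsum_map_upt:
  "vsum d g (map t [0..<Suc (Suc n)]) = (\<Sum>i\<le>n. d (g (t i)) (g (t (Suc i))))"
proof (induction n)
  case (Suc n)
  have "map t [0..<Suc (Suc (Suc n))] = map t [0..<Suc n] @ [t (Suc n), t (Suc (Suc n))]" by simp
  then have "vsum d g (map t [0..<Suc (Suc (Suc n))]) =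
      vsum d g (map t [0..<Suc n] @ [t (Suc n)]) + d (g (t (Suc n))) (g (t (Suc (Suc n))))"
    by (simp only: vsum_snoc)
  also have "map t [0..<Suc n] @ [t (Suc n)] = map t [0..<Suc (Suc n)]" by simp
  finally show ?case using Suc by (simp only: sum.atMost_Suc)
qed simp

lemma vsum_cong: "(\<And>x. x \<in> set xs \<Longrightarrow> g x = g' x) \<Longrightarrow> vsum d g xs = vsum d g' xs"
  by (induction d g xs rule: vsum.induct) auto

definition partitions :: "real set \<Rightarrow> real list set" where
  "partitions J = {xs. sorted_wrt (<) xs \<and> set xs \<subseteq> J}"

lemma partitions_mono: "J \<subseteq> J' \<Longrightarrow> partitions J \<subseteq> partitions J'"
  by (auto simp: partitions_def)

lemma Nil_partitions: "[] \<in> partitions J" by (simp add: partitions_def)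

context metric_target
begin

lemma vsum_nonneg: "0 \<le> vsum d g xs"
proof -
  have "0 \<le> vsum e g xs" if "e = d" for e
    using that by (induction e g xs rule: vsum.induct) auto
  then show ?thesis by simp
qed

lemma vsum_Cons: "vsum d g xs \<le> vsum d g (x # xs)"
  by (cases xs) (auto simp: vsum_nonneg)

lemma Var_eq: "Var d g J = (SUP xs\<in>partitions J. ennreal (vsum d g xs))"
proof (rule antisym)
  show "Var d g J \<le> (SUP xs\<in>partitions J. ennreal (vsum d g xs))"
    unfolding Var_def
  proof (rule SUP_least, clarify)
    fix n :: nat and t :: "nat \<Rightarrow> real"
    assume t: "strict_mono_on {..Suc n} t" "t ` {..Suc n} \<subseteq> J"
    have "sorted_wrt (<) (map t [0..<Suc (Suc n)])"
      unfolding sorted_wrt_map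
      by (rule sorted_wrt_mono_rel[OF _ sorted_wrt_upt])
        (use t(1) in \<open>auto simp: strict_mono_on_def simp del: upt_Suc\<close>)
    then have "map t [0..<Suc (Suc n)] \<in> partitions J"
      unfolding partitions_def using t(2) by (auto simp: image_subset_iff simp del: upt_Suc)
    then have "ennreal (vsum d g (map t [0..<Suc (Suc n)])) \<le> (SUP xs\<in>partitions J. ennreal (vsum d g xs))"
      by (rule SUP_upper)
    then show "(\<Sum>i\<le>n. ennreal (d (g (t i)) (g (t (Suc i))))) \<le> (SUP xs\<in>partitions J. ennreal (vsum d g xs))"
      unfolding vsum_map_upt by (subst sum_ennreal) auto
  qed
  show "(SUP xs\<in>partitions J. ennreal (vsum d g xs)) \<le> Var d g J"
  proof (rule SUP_least)
    fix xs assume xs: "xs \<in> partitions J"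
    show "ennreal (vsum d g xs) \<le> Var d g J"
    \<comment> \<open>A list with fewer than two entries has no counterpart in \<open>Var\<close>,
      but contributes 0.\<close>
    proof (cases "length xs < 2")
      case True
      then have "vsum d g xs = 0" by (cases xs; cases "tl xs") auto
      then show ?thesis by simp
    next
      case False
      define n where "n = length xs - 2"
      have n: "length xs = Suc (Suc n)" using False by (simp add: n_def)
      have "strict_mono_on {..Suc n} (nth xs)"
        using xs n by (auto simp: strict_mono_on_def partitions_def sorted_wrt_iff_nth_less)
      moreover have "nth xs ` {..Suc n} \<subseteq> J"
        using xs n by (auto simp: partitions_def subset_iff)
      ultimately have "(\<Sum>i\<le>n. ennreal (d (g (xs ! i)) (g (xs ! Suc i)))) \<le> Var d g J"
        unfolding Var_def by (intro SUP_upper2[of "(n, nth xs)"]) auto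
      moreover have "map (nth xs) [0..<Suc (Suc n)] = xs"
        using map_nth[of xs] n by simp
      ultimately show ?thesis
        using vsum_map_upt[of d g "nth xs" n] by (subst (asm) sum_ennreal) auto
    qed
  qed
qed

lemma Var_upper: "xs \<in> partitions J \<Longrightarrow> ennreal (vsum d g xs) \<le> Var d g J"
  unfolding Var_eq by (rule SUP_upper)

lemma Var_mono: "J \<subseteq> J' \<Longrightarrow> Var d g J \<le> Var d g J'"
  unfolding Var_eq by (rule SUP_subset_mono[OF partitions_mono]) auto

lemma Var_cong: "(\<And>x. x \<in> J \<Longrightarrow> g x = g' x) \<Longrightarrow> Var d g J = Var d g' J"
  unfolding Var_eq
  by (intro SUP_cong refl arg_cong[where f = ennreal] vsum_cong) (auto simp: partitions_def)

lemma Var_dist: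
  assumes "s \<in> J" "t \<in> J" "g s \<in> Z"
  shows "ennreal (d (g s) (g t)) \<le> Var d g J"
proof (cases s t rule: linorder_cases)
  case less
  then show ?thesis using Var_upper[of "[s,t]" J g] assms by (simp add: partitions_def)
next
  case greater
  then show ?thesis using Var_upper[of "[t,s]" J g] assms by (simp add: partitions_def commute)
qed (use assms in simp)

lemma vsum_mono:
  assumes "sorted_wrt (<) xs" "sorted_wrt (<) ys" "set xs \<subseteq> set ys" "g ` set ys \<subseteq> Z"
  shows "vsum d g xs \<le> vsum d g ys"
  using assms
proof (induction ys arbitrary: xs)
  case Nil
  then show ?case by simp
next
  case (Cons y ys)
  show ?case
  proof (cases xs)
    case Nil
    then show ?thesis using vsum_nonneg by simp
  next
    case xs: (Cons x xs')
    show ?thesis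
    proof (cases "x = y")
      case False
      have "y \<notin> set xs" using Cons.prems xs False by fastforce
      then have "vsum d g xs \<le> vsum d g ys" using Cons by auto
      also have "\<dots> \<le> vsum d g (y # ys)" by (rule vsum_Cons)
      finally show ?thesis .
    next
      case True
      have sub: "set xs' \<subseteq> set ys" using Cons.prems xs True by fastforce
      show ?thesis
      proof (cases xs')
        case Nil
        then show ?thesis using xs vsum_nonneg by simp
      next
        case xs': (Cons z zs)
        then obtain w ws where ys: "ys = w # ws" using sub by (cases ys) auto
        show ?thesis
        proof (cases "z = w")
          case z: True
          have "vsum d g xs' \<le> vsum d g ys" using Cons.prems xs sub by (intro Cons.IH) auto
          then show ?thesis using xs xs' ys z True by simp
        next
          case False
          have "w < z" using False sub xs' ys Cons.prems(2) by auto
          have "sorted_wrt (<) xs'" using Cons.prems(1) xs by simp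
          then have "sorted_wrt (<) (w # xs')"
            using xs' by (auto intro: less_trans[OF \<open>w < z\<close>] \<open>w < z\<close>)
          \<comment> \<open>The coarse list skips \<open>w\<close>. The induction hypothesis is
            applied to \<open>xs'\<close> with \<open>w\<close> put in front, and the triangle
            inequality through \<open>g w\<close> pays for the detour.\<close>
          then have "vsum d g (w # xs') \<le> vsum d g ys"
            using Cons.prems(2,4) sub ys by (intro Cons.IH) auto
          moreover have "d (g y) (g z) \<le> d (g y) (g w) + d (g w) (g z)"
            by (rule triangle) (use Cons.prems(4) ys sub xs' in auto)
          ultimately show ?thesis using xs xs' ys True by simp
        qed
      qed
    qed
  qed
qed

lemma Var_finite:
  assumes "finite A" "g ` A \<subseteq> Z"
  shows "Var d g A = ennreal (vsum d g (sorted_list_of_set A))"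
proof (rule antisym)
  show "Var d g A \<le> ennreal (vsum d g (sorted_list_of_set A))"
    unfolding Var_eq
    by (intro SUP_least ennreal_leI vsum_mono) (use assms in \<open>auto simp: partitions_def\<close>)
  show "ennreal (vsum d g (sorted_list_of_set A)) \<le> Var d g A"
    by (rule Var_upper) (use assms in \<open>auto simp: partitions_def\<close>)
qed

text \<open>A partition is finite and so lies in one of the sets. With \<open>Var_finite\<close>
  this makes the variation over a countable set an increasing limit of single sums, ready for
  monotone convergence.\<close>

lemma Var_UN_incseq:
  assumes "incseq A"
  shows "Var d g (\<Union>n. A n) = (SUP n. Var d g (A n))"
proof (rule antisym)
  show "(SUP n. Var d g (A n)) \<le> Var d g (\<Union>n. A n)"
    by (intro SUP_least Var_mono) auto
  show "Var d g (\<Union>n. A n) \<le> (SUP n. Var d g (A n))"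
    unfolding Var_eq[of g "\<Union>n. A n"]
  proof (rule SUP_least)
    fix xs assume xs: "xs \<in> partitions (\<Union>n. A n)"
    have "\<forall>x\<in>set xs. \<exists>n. x \<in> A n" using xs by (auto simp: partitions_def)
    then obtain m where m: "\<And>x. x \<in> set xs \<Longrightarrow> x \<in> A (m x)" by metis
    have "x \<in> A (Max (m ` set xs))" if "x \<in> set xs" for x
    proof -
      have "m x \<le> Max (m ` set xs)" using that by simp
      from incseqD[OF assms this] m[OF that] show ?thesis by blast
    qed
    then have "\<exists>n. set xs \<subseteq> A n" by blast
    then obtain n where "set xs \<subseteq> A n" by auto
    then have "ennreal (vsum d g xs) \<le> Var d g (A n)"
      using xs by (intro Var_upper) (auto simp: partitions_def)
    then show "ennreal (vsum d g xs) \<le> (SUP n. Var d g (A n))"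
      by (rule SUP_upper2[rotated]) simp
  qed
qed

text \<open>Every partition of \<open>A\<close> can be refined to end at the maximum
  \<open>s\<close>, after which the step to \<open>s'\<close> is appended. This bounds distances by
  increments of the variation.\<close>

lemma Var_superadditive:
  assumes s: "s \<in> A" "\<And>t. t \<in> A \<Longrightarrow> t \<le> s" "s < s'" and g: "g ` insert s' A \<subseteq> Z"
  shows "Var d g A + ennreal (d (g s) (g s')) \<le> Var d g (insert s' A)"
proof -
  have "ennreal (vsum d g xs) + ennreal (d (g s) (g s')) \<le> Var d g (insert s' A)" if xs: "xs \<in> partitions A" for xs
  proof -
    define ys where "ys = filter (\<lambda>t. t < s) xs"
    have ys: "sorted_wrt (<) (ys @ [s])" "set ys \<subseteq> A" "set xs \<subseteq> set (ys @ [s])"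
      using xs s by (auto simp: ys_def partitions_def sorted_wrt_append sorted_wrt_filter) (meson order_less_le subsetD)
    have "set (ys @ [s]) \<subseteq> A" using ys(2) s(1) by simp
    then have "g ` set (ys @ [s]) \<subseteq> Z" using g by blast
    then have "vsum d g xs \<le> vsum d g (ys @ [s])"
      using xs ys(1,3) by (intro vsum_mono) (auto simp: partitions_def)
    then have "ennreal (vsum d g xs) + ennreal (d (g s) (g s')) \<le> ennreal (vsum d g (ys @ [s, s']))"
      unfolding vsum_snoc by (subst ennreal_plus[symmetric]) (auto simp: vsum_nonneg intro!: ennreal_leI)
    also have "\<dots> \<le> Var d g (insert s' A)"
    proof (rule Var_upper)
      have "sorted_wrt (<) ((ys @ [s]) @ [s'])"
        unfolding sorted_wrt_append[of _ "ys @ [s]"] using ys(1,2) s by fastforce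
      then show "ys @ [s, s'] \<in> partitions (insert s' A)"
        unfolding partitions_def using ys s by auto
    qed
    finally show ?thesis .
  qed
  then have "(SUP xs\<in>partitions A. ennreal (vsum d g xs) + ennreal (d (g s) (g s'))) \<le> Var d g (insert s' A)"
    by (rule SUP_least)
  then show ?thesis
    unfolding Var_eq[of g A] using Nil_partitions[of A]
    by (subst ennreal_SUP_add_left[symmetric]) auto
qed

lemma dist_tendsto2:
  assumes "(\<lambda>n. d (u n) w) \<longlonglongrightarrow> 0" "(\<lambda>n. d (v n) z) \<longlonglongrightarrow> 0"
    "\<And>n. u n \<in> Z" "\<And>n. v n \<in> Z" "w \<in> Z" "z \<in> Z"
  shows "(\<lambda>n. d (u n) (v n)) \<longlonglongrightarrow> d w z"
proof -
  have "(\<lambda>n. d (u n) w + d (v n) z) \<longlonglongrightarrow> 0" using tendsto_add[OF assms(1,2)] by simp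
  then have "(\<lambda>n. d (u n) (v n) - d w z) \<longlonglongrightarrow> 0"
  proof (rule Lim_null_comparison[rotated], intro always_eventually allI)
    fix n
    have "d (u n) (v n) \<le> d (u n) w + d w z + d z (v n)"
      using triangle[of "u n" w "v n"] triangle[of w z "v n"] assms(3-6) by force
    moreover have "d w z \<le> d w (u n) + d (u n) (v n) + d (v n) z"
      using triangle[of w "u n" z] triangle[of "u n" "v n" z] assms(3-6) by force
    ultimately show "norm (d (u n) (v n) - d w z) \<le> d (u n) w + d (v n) z"
      by (simp add: commute abs_le_iff)
  qed
  then show ?thesis by (simp add: LIM_zero_iff)
qed

text \<open>Lower semicontinuity of the variation: the entries of a partition of \<open>J\<close>
  are replaced by nearby points of \<open>A\<close>, which eventually come in the same order, and
  the sums converge. Only values of \<open>g'\<close> on \<open>A\<close> enter, so \<open>g\<close>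
  and \<open>g'\<close> may be different functions.\<close>

lemma Var_le_approx:
  assumes s: "\<And>t. t \<in> J \<Longrightarrow> \<exists>s :: nat \<Rightarrow> real. (\<forall>j. s j \<in> A) \<and> s \<longlonglongrightarrow> t \<and> (\<lambda>j. d (g' (s j)) (g t)) \<longlonglongrightarrow> 0"
    and g: "g ` J \<subseteq> Z" and g': "g' ` A \<subseteq> Z"
  shows "Var d g J \<le> Var d g' A"
  unfolding Var_eq[of g J]
proof (rule SUP_least)
  fix xs assume xs: "xs \<in> partitions J"
  from s obtain s where s: "\<And>t j. t \<in> J \<Longrightarrow> s t j \<in> A" "\<And>t. t \<in> J \<Longrightarrow> s t \<longlonglongrightarrow> t"
    "\<And>t. t \<in> J \<Longrightarrow> (\<lambda>j. d (g' (s t j)) (g t)) \<longlonglongrightarrow> 0"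
    by metis
  have *: "set ys \<subseteq> J \<Longrightarrow> (\<lambda>j. vsum d g' (map (\<lambda>t. s t j) ys)) \<longlonglongrightarrow> vsum d g ys" for ys
  proof (induction ys rule: induct_list012)
    case (3 x y zs)
    have "(\<lambda>j. d (g' (s x j)) (g' (s y j))) \<longlonglongrightarrow> d (g x) (g y)"
      by (rule dist_tendsto2) (use 3(3) s g g' in \<open>auto simp: image_subset_iff\<close>)
    then show ?case using tendsto_add[OF _ 3(2)] 3(3) by simp
  qed auto
  have **: "sorted_wrt (<) ys \<Longrightarrow> set ys \<subseteq> J \<Longrightarrow> \<forall>\<^sub>F j in sequentially. sorted_wrt (<) (map (\<lambda>t. s t j) ys)" for ys
  proof (induction ys)
    case (Cons y ys)
    have "\<forall>\<^sub>F j in sequentially. \<forall>t\<in>set ys. s y j < s t j"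
    proof (rule eventually_ball_finite, simp, rule ballI)
      fix t assume t: "t \<in> set ys"
      then have yt: "y < t" "y \<in> J" "t \<in> J" using Cons.prems by auto
      obtain m where m: "y < m" "m < t" using dense[OF yt(1)] by blast
      from order_tendstoD(2)[OF s(2)[OF yt(2)] m(1)] order_tendstoD(1)[OF s(2)[OF yt(3)] m(2)]
      show "\<forall>\<^sub>F j in sequentially. s y j < s t j" by eventually_elim simp
    qed
    moreover have "\<forall>\<^sub>F j in sequentially. sorted_wrt (<) (map (\<lambda>t. s t j) ys)"
      using Cons by auto
    ultimately show ?case by eventually_elim auto
  qed simp
  have "\<forall>\<^sub>F j in sequentially. ennreal (vsum d g' (map (\<lambda>t. s t j) xs)) \<le> Var d g' A"
    by (rule eventually_mono[OF **[of xs]])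
      (use xs s(1) in \<open>auto simp: partitions_def subset_iff intro!: Var_upper\<close>)
  moreover have "(\<lambda>j. ennreal (vsum d g' (map (\<lambda>t. s t j) xs))) \<longlonglongrightarrow> ennreal (vsum d g xs)"
    using xs by (intro tendsto_ennrealI *) (auto simp: partitions_def)
  ultimately show "ennreal (vsum d g xs) \<le> Var d g' A"
    by (intro tendsto_upperbound[of _ _ sequentially]) auto
qed

end

section \<open>Curves of bounded variation\<close>

text \<open>Stated through open subintervals because one-sided limits are taken along
  \<open>A\<close>: points are wanted strictly to the right of some \<open>t < b\<close>, or
  strictly to the left of \<open>b\<close>, within a prescribed bound.\<close>

definition dense_in :: "real \<Rightarrow> real \<Rightarrow> real set \<Rightarrow> bool" where
  "dense_in a b A \<longleftrightarrow> (\<forall>u v. a \<le> u \<longrightarrow> u < v \<longrightarrow> v \<le> b \<longrightarrow> (\<exists>s\<in>A. u < s \<and> s < v))"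

lemma dense_in_interval: "dense_in a b {a<..<b}"
  unfolding dense_in_def
proof (intro allI impI)
  fix u v assume "a \<le> u" "u < v" "v \<le> b"
  moreover obtain s where "u < s" "s < v" using dense[OF \<open>u < v\<close>] by blast
  ultimately show "\<exists>s\<in>{a<..<b}. u < s \<and> s < v" by (intro bexI[of _ s]) auto
qed

lemma dense_in_rats: "dense_in a b (\<rat> \<inter> {a<..<b})"
  unfolding dense_in_def
proof (intro allI impI)
  fix u v assume "a \<le> u" "u < v" "v \<le> b"
  moreover obtain s where "s \<in> \<rat>" "u < s" "s < v" using Rats_dense_in_real[OF \<open>u < v\<close>] by blast
  ultimately show "\<exists>s\<in>\<rat> \<inter> {a<..<b}. u < s \<and> s < v" by (intro bexI[of _ s]) auto
qed

lemma dense_in_seq_right: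
  assumes "dense_in a b A" "a \<le> t" "t < u" "u \<le> b"
  shows "\<exists>s :: nat \<Rightarrow> real. (\<forall>j. s j \<in> A \<and> t < s j \<and> s j < u) \<and> filterlim s (at_right t) sequentially"
proof -
  have "\<exists>s\<in>A. t < s \<and> s < min u (t + 1 / Suc j)" for j
    using assms unfolding dense_in_def by (metis add.commute less_add_same_cancel2 min.coboundedI1 min_less_iff_conj of_nat_0_less_iff zero_less_Suc zero_less_divide_1_iff)
  then obtain s where s: "\<And>j. s j \<in> A" "\<And>j. t < s j" "\<And>j. s j < min u (t + 1 / Suc j)" by metis
  have "s \<longlonglongrightarrow> t"
  proof (rule tendsto_sandwich)
    show "\<forall>\<^sub>F j in sequentially. t \<le> s j" using s(2) by (auto intro!: always_eventually less_imp_le)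
    show "\<forall>\<^sub>F j in sequentially. s j \<le> t + 1 / Suc j" using s(3) by (auto intro!: always_eventually less_imp_le)
    show "(\<lambda>j. t + 1 / Suc j) \<longlonglongrightarrow> t"
      using tendsto_add[OF tendsto_const[of t] LIMSEQ_inverse_real_of_nat] by (simp add: inverse_eq_divide)
  qed simp
  then have "filterlim s (at_right t) sequentially"
    unfolding filterlim_at using s(2) by (auto intro!: always_eventually)
  then show ?thesis using s by (intro exI[of _ s]) auto
qed

lemma dense_in_seq_left:
  assumes "dense_in a b A" "a \<le> u" "u < t" "t \<le> b"
  shows "\<exists>s :: nat \<Rightarrow> real. (\<forall>j. s j \<in> A \<and> u < s j \<and> s j < t) \<and> filterlim s (at_left t) sequentially"
proof -
  have "dense_in (-b) (-a) (uminus ` A)"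
    unfolding dense_in_def
  proof (intro allI impI)
    fix p q :: real assume "- b \<le> p" "p < q" "q \<le> - a"
    then obtain s where "s \<in> A" "- q < s" "s < - p"
      using assms(1)[unfolded dense_in_def, rule_format, of "-q" "-p"] by auto
    then show "\<exists>s\<in>uminus ` A. p < s \<and> s < q" by (intro bexI[of _ "-s"]) auto
  qed
  from dense_in_seq_right[OF this, of "-t" "-u"] assms
  obtain s :: "nat \<Rightarrow> real" where s: "\<And>j. s j \<in> uminus ` A" "\<And>j. - t < s j" "\<And>j. s j < - u"
    and lim: "filterlim s (at_right (- t)) sequentially" by auto
  have "filterlim (\<lambda>j. - s j) (at_left t) sequentially"
    using lim unfolding filterlim_at_left_to_right filterlim_at by (auto dest: tendsto_minus elim: eventually_mono)
  then show ?thesis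
    using s by (intro exI[of _ "\<lambda>j. - s j"]) (auto simp: image_iff minus_less_iff less_minus_iff, metis minus_minus)
qed

text \<open>An open interval has positive length, so it cannot lie in the exceptional null set.
  Through density, almost everywhere equality controls one-sided limits.\<close>

lemma AE_dense_in:
  assumes "AE t in leb_I a b. P t"
  shows "dense_in a b {t \<in> {a..b}. P t}"
  unfolding dense_in_def
proof (intro allI impI, rule ccontr)
  fix u v assume uv: "a \<le> u" "u < v" "v \<le> b" and "\<not> (\<exists>s\<in>{t \<in> {a..b}. P t}. u < s \<and> s < v)"
  then have *: "{u<..<v} \<subseteq> {t \<in> space (leb_I a b). \<not> P t}" by (auto simp: space_restrict_space)
  obtain N where N: "N \<in> null_sets (leb_I a b)" "{t \<in> space (leb_I a b). \<not> P t} \<subseteq> N"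
    using assms by (auto elim!: AE_E simp: null_sets_def)
  have "N \<in> null_sets lebesgue" using N(1) by (subst (asm) null_sets_restrict_space) auto
  then have "{u<..<v} \<in> null_sets lebesgue"
    using * N(2) by (intro null_sets_completion_subset[of "{u<..<v}" N lborel]) auto
  then have "emeasure lborel {u<..<v} = 0" by (simp add: null_sets_def)
  then show False using uv by simp
qed

locale BV_target = metric_target Z d for Z :: "'z set" and d +
  fixes a b :: real
  assumes ab: "a < b" and Z_ne: "Z \<noteq> {}"
begin

lemma BV_iff: "c \<in> BV a b Z d \<longleftrightarrow> c \<in> {a..b} \<rightarrow>\<^sub>E Z \<and>
    (\<forall>t\<in>{a..<b}. ((\<lambda>s. d (c s) (c t)) \<longlongrightarrow> 0) (at_right t)) \<and>
    (\<forall>t\<in>{a<..b}. \<exists>l\<in>Z. ((\<lambda>s. d (c s) l) \<longlongrightarrow> 0) (at_left t)) \<and>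
    ((\<lambda>s. d (c s) (c b)) \<longlongrightarrow> 0) (at_left b) \<and> Var d c {a..b} < \<infinity>"
proof -
  have "limitin mtopology c l (at_right t) \<longleftrightarrow> l \<in> Z \<and> ((\<lambda>s. d (c s) l) \<longlongrightarrow> 0) (at_right t)"
    if "c \<in> {a..b} \<rightarrow>\<^sub>E Z" "t \<in> {a..<b}" for t l
  proof -
    have "\<forall>\<^sub>F s in at_right t. s \<in> {t<..<b}" using that by (intro eventually_at_right_real) auto
    then have "\<forall>\<^sub>F s in at_right t. c s \<in> Z" by (rule eventually_mono) (use that in auto)
    then show ?thesis by (simp add: limitin_metric_dist_null)
  qed
  moreover have "limitin mtopology c l (at_left t) \<longleftrightarrow> l \<in> Z \<and> ((\<lambda>s. d (c s) l) \<longlongrightarrow> 0) (at_left t)"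
    if "c \<in> {a..b} \<rightarrow>\<^sub>E Z" "t \<in> {a<..b}" for t l
  proof -
    have "\<forall>\<^sub>F s in at_left t. s \<in> {a<..<t}" using that by (intro eventually_at_left_real) auto
    then have "\<forall>\<^sub>F s in at_left t. c s \<in> Z" by (rule eventually_mono) (use that in auto)
    then show ?thesis by (simp add: limitin_metric_dist_null)
  qed
  moreover have "c t \<in> Z" if "c \<in> {a..b} \<rightarrow>\<^sub>E Z" "t \<in> {a..b}" for t using that by auto
  ultimately show ?thesis unfolding BV_def mem_Collect_eq using ab
    by (intro conj_cong ball_cong refl) auto
qed

lemma
  assumes "c \<in> BV a b Z d"
  shows BV_funcset: "c \<in> {a..b} \<rightarrow>\<^sub>E Z"
    and BV_mem: "\<And>t. t \<in> {a..b} \<Longrightarrow> c t \<in> Z"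
    and BV_right: "\<And>t. a \<le> t \<Longrightarrow> t < b \<Longrightarrow> ((\<lambda>s. d (c s) (c t)) \<longlongrightarrow> 0) (at_right t)"
    and BV_left: "((\<lambda>s. d (c s) (c b)) \<longlongrightarrow> 0) (at_left b)"
    and BV_Var: "Var d c {a..b} < \<infinity>"
  using assms unfolding BV_iff by auto

lemma approx_right:
  assumes c: "c \<in> BV a b Z d" and A: "dense_in a b A" "a \<le> t" "t < u" "u \<le> b" and eq: "\<And>s. s \<in> A \<Longrightarrow> c' s = c s"
  shows "\<exists>s :: nat \<Rightarrow> real. (\<forall>j. s j \<in> A \<and> t < s j \<and> s j < u) \<and> s \<longlonglongrightarrow> t \<and> (\<lambda>j. d (c' (s j)) (c t)) \<longlonglongrightarrow> 0"
proof -
  obtain s where s: "\<And>j. s j \<in> A" "\<And>j. t < s j" "\<And>j. s j < u" "filterlim s (at_right t) sequentially"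
    using dense_in_seq_right[OF A] by blast
  have "t < b" using A by simp
  have "(\<lambda>j. d (c (s j)) (c t)) \<longlonglongrightarrow> 0"
    by (rule filterlim_compose[OF BV_right[OF c \<open>a \<le> t\<close> \<open>t < b\<close>] s(4)])
  moreover have "s \<longlonglongrightarrow> t" using s(4) by (simp add: filterlim_at)
  ultimately show ?thesis using s eq by (intro exI[of _ s]) auto
qed

lemma approx_left:
  assumes c: "c \<in> BV a b Z d" and A: "dense_in a b A" and eq: "\<And>s. s \<in> A \<Longrightarrow> c' s = c s"
  shows "\<exists>s :: nat \<Rightarrow> real. (\<forall>j. s j \<in> A \<and> a < s j \<and> s j < b) \<and> s \<longlonglongrightarrow> b \<and> (\<lambda>j. d (c' (s j)) (c b)) \<longlonglongrightarrow> 0"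
proof -
  obtain s where s: "\<And>j. s j \<in> A" "\<And>j. a < s j" "\<And>j. s j < b" "filterlim s (at_left b) sequentially"
    using dense_in_seq_left[OF A order_refl ab order_refl] by blast
  have "(\<lambda>j. d (c (s j)) (c b)) \<longlonglongrightarrow> 0"
    by (rule filterlim_compose[OF BV_left[OF c] s(4)])
  moreover have "s \<longlonglongrightarrow> b" using s(4) by (simp add: filterlim_at)
  ultimately show ?thesis using s eq by (intro exI[of _ s]) auto
qed

text \<open>Every \<open>t < u\<close> is a limit from the right of points of \<open>A\<close> that
  stay below \<open>u\<close>, and right continuity makes the values converge. As \<open>c'\<close>
  agrees with \<open>c\<close> only on \<open>A\<close>, the lemma covers both dense subsets and
  other representatives.\<close>

lemma Var_open_le:
  assumes c: "c \<in> BV a b Z d" and A: "dense_in a b A" and eq: "\<And>s. s \<in> A \<Longrightarrow> c' s = c s" and u: "u \<le> b"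
  shows "Var d c {a<..<u} \<le> Var d c' (A \<inter> {a<..<u})"
proof (rule Var_le_approx)
  show "\<exists>s :: nat \<Rightarrow> real. (\<forall>j. s j \<in> A \<inter> {a<..<u}) \<and> s \<longlonglongrightarrow> t \<and> (\<lambda>j. d (c' (s j)) (c t)) \<longlonglongrightarrow> 0"
    if t: "t \<in> {a<..<u}" for t
  proof -
    obtain s :: "nat \<Rightarrow> real" where "\<And>j. s j \<in> A" "\<And>j. t < s j" "\<And>j. s j < u" "s \<longlonglongrightarrow> t" "(\<lambda>j. d (c' (s j)) (c t)) \<longlonglongrightarrow> 0"
      using approx_right[OF c A _ _ u eq, of t] t by auto
    then show ?thesis using t by (intro exI[of _ s]) (auto intro: less_trans)
  qed
  show "c ` {a<..<u} \<subseteq> Z" "c' ` (A \<inter> {a<..<u}) \<subseteq> Z" using BV_mem[OF c] u eq by auto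
qed

lemma Var_open_dense:
  assumes "c \<in> BV a b Z d" "dense_in a b A" "u \<le> b"
  shows "Var d c {a<..<u} = Var d c (A \<inter> {a<..<u})"
  by (rule antisym[OF Var_open_le Var_mono]) (use assms in auto)

text \<open>The endpoints are limits of interior points along which the values converge, by right
  continuity at \<open>a\<close> and left continuity at \<open>b\<close>.\<close>

lemma Var_closed:
  assumes c: "c \<in> BV a b Z d"
  shows "Var d c {a..b} = Var d c {a<..<b}"
proof (rule antisym)
  show "Var d c {a..b} \<le> Var d c {a<..<b}"
  proof (rule Var_le_approx)
    fix t assume t: "t \<in> {a..b}"
    show "\<exists>s :: nat \<Rightarrow> real. (\<forall>j. s j \<in> {a<..<b}) \<and> s \<longlonglongrightarrow> t \<and> (\<lambda>j. d (c (s j)) (c t)) \<longlonglongrightarrow> 0"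
    proof (cases "t = b")
      case True
      then show ?thesis using approx_left[OF c dense_in_interval, of c] by blast
    next
      case False
      then have "a \<le> t" "t < b" using t by auto
      then show ?thesis using approx_right[OF c dense_in_interval _ _ order_refl, of t c] by blast
    qed
  qed (use BV_mem[OF c] in auto)
qed (rule Var_mono, auto)

text \<open>A competitor agrees with \<open>c\<close> on a set of full measure, which is dense, so
  it varies at least as much on \<open>(a, u)\<close>: the BV curve is an optimal
  representative.\<close>

lemma ess_Var_BV:
  assumes c: "c \<in> BV a b Z d" and u: "u \<le> b"
  shows "ess_Var a b Z d c {a<..<u} = Var d c {a<..<u}"
proof (rule antisym)
  have "c \<in> ae_class (leb_I a b) Z c"
    using BV_funcset[OF c] by (intro ae_class_self) (simp add: space_restrict_space)
  then show "ess_Var a b Z d c {a<..<u} \<le> Var d c {a<..<u}" unfolding ess_Var_def by (rule INF_lower)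
  show "Var d c {a<..<u} \<le> ess_Var a b Z d c {a<..<u}"
    unfolding ess_Var_def
  proof (rule INF_greatest)
    fix c' assume "c' \<in> ae_class (leb_I a b) Z c"
    then have "dense_in a b {t \<in> {a..b}. c' t = c t}" by (intro AE_dense_in ae_class_memD)
    then have "Var d c {a<..<u} \<le> Var d c' ({t \<in> {a..b}. c' t = c t} \<inter> {a<..<u})"
      by (rule Var_open_le[OF c _ _ u]) simp
    also have "\<dots> \<le> Var d c' {a<..<u}" by (rule Var_mono) simp
    finally show "Var d c {a<..<u} \<le> Var d c' {a<..<u}" .
  qed
qed

text \<open>Every value is a one-sided limit along \<open>A\<close>, from the right before
  \<open>b\<close> and from the left at \<open>b\<close>.\<close>

lemma BV_eq_dense:
  assumes c: "c \<in> BV a b Z d" "c' \<in> BV a b Z d" and A: "dense_in a b A" "\<And>s. s \<in> A \<Longrightarrow> c s = c' s"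
  shows "c = c'"
proof (rule PiE_ext[OF BV_funcset[OF c(1)] BV_funcset[OF c(2)]])
  fix t assume t: "t \<in> {a..b}"
  have "\<exists>s :: nat \<Rightarrow> real. (\<forall>j. s j \<in> A \<inter> {a..b}) \<and> (\<lambda>j. d (c (s j)) (c t)) \<longlonglongrightarrow> 0 \<and> (\<lambda>j. d (c (s j)) (c' t)) \<longlonglongrightarrow> 0"
  proof (cases "t = b")
    case True
    obtain s :: "nat \<Rightarrow> real" where s: "\<And>j. s j \<in> A" "\<And>j. a < s j" "\<And>j. s j < b" "filterlim s (at_left b) sequentially"
      using dense_in_seq_left[OF A(1) order_refl ab order_refl] by blast
    then show ?thesis
      using filterlim_compose[OF BV_left[OF c(1)] s(4)] filterlim_compose[OF BV_left[OF c(2)] s(4)] True A(2)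
      by (intro exI[of _ s]) (auto intro: less_imp_le)
  next
    case False
    then have tb: "a \<le> t" "t < b" using t by auto
    obtain s :: "nat \<Rightarrow> real" where s: "\<And>j. s j \<in> A" "\<And>j. t < s j" "\<And>j. s j < b" "filterlim s (at_right t) sequentially"
      using dense_in_seq_right[OF A(1) tb order_refl] by blast
    then have "a \<le> s j" for j using tb(1) s(2)[of j] by linarith
    then show ?thesis
      using filterlim_compose[OF BV_right[OF c(1) tb] s(4)] filterlim_compose[OF BV_right[OF c(2) tb] s(4)] A(2) s
      by (intro exI[of _ s]) (auto intro: less_imp_le)
  qed
  then obtain s :: "nat \<Rightarrow> real" where s: "\<And>j. s j \<in> A \<inter> {a..b}" "(\<lambda>j. d (c (s j)) (c t)) \<longlonglongrightarrow> 0"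
    "(\<lambda>j. d (c (s j)) (c' t)) \<longlonglongrightarrow> 0" by blast
  have "(\<lambda>j. d (c (s j)) (c (s j))) \<longlonglongrightarrow> d (c t) (c' t)"
    by (rule dist_tendsto2[OF s(2,3)]) (use BV_mem[OF c(1)] BV_mem[OF c(2)] s(1) t in auto)
  then have "(\<lambda>j. 0) \<longlonglongrightarrow> d (c t) (c' t)" using BV_mem[OF c(1)] s(1) by simp
  then have "d (c t) (c' t) = 0" by (simp add: LIMSEQ_const_iff)
  then show "c t = c' t" using BV_mem[OF c(1) t] BV_mem[OF c(2) t] by simp
qed

lemma BV_eq_AE:
  assumes "c \<in> BV a b Z d" "c' \<in> BV a b Z d" "AE t in leb_I a b. c t = c' t"
  shows "c = c'"
  by (rule BV_eq_dense[OF assms(1,2) AE_dense_in[OF assms(3)]]) simp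

lemma BV_dist_le:
  assumes "c \<in> BV a b Z d" "s \<in> {a..b}" "t \<in> {a..b}"
  shows "ennreal (d (c s) (c t)) \<le> Var d c {a..b}" "d (c s) (c t) \<le> enn2real (Var d c {a..b})"
proof -
  show 1: "ennreal (d (c s) (c t)) \<le> Var d c {a..b}"
    using Var_dist[of s "{a..b}" t c] BV_mem[OF assms(1,2)] assms(2,3) by simp
  show "d (c s) (c t) \<le> enn2real (Var d c {a..b})"
    using enn2real_mono[OF 1 BV_Var[OF assms(1), unfolded infinity_ennreal_def]] by simp
qed

lemma BV_const: "z \<in> Z \<Longrightarrow> (\<lambda>t\<in>{a..b}. z) \<in> BV a b Z d"
proof -
  assume z: "z \<in> Z"
  have R: "((\<lambda>s. d ((\<lambda>t\<in>{a..b}. z) s) z) \<longlongrightarrow> 0) (at_right t)" if "t \<in> {a..<b}" for t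
  proof -
    have "\<forall>\<^sub>F s in at_right t. s \<in> {t<..<b}" using that by (intro eventually_at_right_real) auto
    then have "\<forall>\<^sub>F s in at_right t. d ((\<lambda>t\<in>{a..b}. z) s) z = 0" by (rule eventually_mono) (use that z in auto)
    then show ?thesis by (rule tendsto_eventually)
  qed
  have L: "((\<lambda>s. d ((\<lambda>t\<in>{a..b}. z) s) z) \<longlongrightarrow> 0) (at_left t)" if "t \<in> {a<..b}" for t
  proof -
    have "\<forall>\<^sub>F s in at_left t. s \<in> {a<..<t}" using that by (intro eventually_at_left_real) auto
    then have "\<forall>\<^sub>F s in at_left t. d ((\<lambda>t\<in>{a..b}. z) s) z = 0" by (rule eventually_mono) (use that z in auto)
    then show ?thesis by (rule tendsto_eventually)
  qed
  have "vsum d (\<lambda>t\<in>{a..b}. z) xs = 0" if "set xs \<subseteq> {a..b}" for xs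
    using that by (induction xs rule: induct_list012) (use z in auto)
  then have "Var d (\<lambda>t\<in>{a..b}. z) {a..b} \<le> 0"
    unfolding Var_eq by (intro SUP_least) (auto simp: partitions_def)
  then have V: "Var d (\<lambda>t\<in>{a..b}. z) {a..b} < \<infinity>" by simp
  show ?thesis unfolding BV_iff
  proof (intro conjI ballI)
    fix t assume t: "t \<in> {a..<b}"
    then show "((\<lambda>s. d ((\<lambda>t\<in>{a..b}. z) s) ((\<lambda>t\<in>{a..b}. z) t)) \<longlongrightarrow> 0) (at_right t)" using R[OF t] by auto
  next
    fix t assume t: "t \<in> {a<..b}"
    then show "\<exists>l\<in>Z. ((\<lambda>s. d ((\<lambda>t\<in>{a..b}. z) s) l) \<longlongrightarrow> 0) (at_left t)" using L[OF t] z by blast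
  next
    show "((\<lambda>s. d ((\<lambda>t\<in>{a..b}. z) s) ((\<lambda>t\<in>{a..b}. z) b)) \<longlongrightarrow> 0) (at_left b)" using L[of b] ab by simp
  qed (use z V in auto)
qed

end

section \<open>Limits along filters in complete spaces, and extension of curves from a dense
  set\<close>

lemma (in metric_target) dist_tendsto_0I:
  assumes "\<And>e. e > 0 \<Longrightarrow> \<forall>\<^sub>F s in F. d (f s) l < e"
  shows "((\<lambda>s. d (f s) l) \<longlongrightarrow> 0) F"
  unfolding tendsto_iff using assms by (simp add: dist_real_def)

text \<open>Completeness speaks of sequences, one-sided limits of filters. Choosing
  \<open>x n\<close> in the events \<open>P 0\<close>, ..., \<open>P n\<close> yields a Cauchy
  sequence whose limit attracts the whole filter.\<close>

lemma (in metric_target) mcomplete_limit: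
  assumes "mcomplete" and F: "F \<noteq> bot" and Z: "\<forall>\<^sub>F s in F. g s \<in> Z"
    and C: "\<And>e. e > 0 \<Longrightarrow> \<exists>P. eventually P F \<and> (\<forall>x y. P x \<and> P y \<longrightarrow> d (g x) (g y) < e)"
  shows "\<exists>l\<in>Z. ((\<lambda>s. d (g s) l) \<longlongrightarrow> 0) F"
proof -
  have "\<exists>P. eventually P F \<and> (\<forall>x y. P x \<and> P y \<longrightarrow> d (g x) (g y) < 1 / Suc n)" for n
    by (rule C) simp
  then obtain P where P: "\<And>n. eventually (P n) F" "\<And>n x y. P n x \<Longrightarrow> P n y \<Longrightarrow> d (g x) (g y) < 1 / Suc n"
    by metis
  have "\<exists>x. g x \<in> Z \<and> (\<forall>k\<le>n. P k x)" for n
  proof -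
    have "\<forall>\<^sub>F x in F. \<forall>k\<in>{..n}. P k x" by (rule eventually_ball_finite) (auto intro: P)
    with Z have "\<forall>\<^sub>F x in F. g x \<in> Z \<and> (\<forall>k\<le>n. P k x)" by eventually_elim auto
    then show ?thesis using F eventually_happens' by blast
  qed
  then obtain x where x: "\<And>n. g (x n) \<in> Z" "\<And>n k. k \<le> n \<Longrightarrow> P k (x n)" by metis
  have small: "\<exists>N. 1 / real (Suc N) < e" if "e > 0" for e using that nat_approx_posE by blast
  have "MCauchy (\<lambda>n. g (x n))"
    unfolding MCauchy_def
  proof (intro conjI allI impI)
    show "range (\<lambda>n. g (x n)) \<subseteq> Z" using x by auto
    fix e :: real assume "e > 0"
    then obtain N where N: "1 / real (Suc N) < e" using small by blast
    show "\<exists>N. \<forall>n n'. N \<le> n \<longrightarrow> N \<le> n' \<longrightarrow> d (g (x n)) (g (x n')) < e"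
      using P(2)[OF x(2) x(2)] N by (meson less_trans)
  qed
  then obtain l where l: "limitin mtopology (\<lambda>n. g (x n)) l sequentially"
    using \<open>mcomplete\<close> by (auto simp: mcomplete_def)
  then have lZ: "l \<in> Z" and lt: "(\<lambda>n. d (g (x n)) l) \<longlonglongrightarrow> 0" by (auto simp: limitin_metric_dist_null)
  have "((\<lambda>s. d (g s) l) \<longlongrightarrow> 0) F"
  proof (rule dist_tendsto_0I)
    fix e :: real assume e: "0 < e"
    then obtain N where N: "1 / real (Suc N) < e/2" using small[of "e/2"] by auto
    have "\<forall>\<^sub>F n in sequentially. d (g (x n)) l < e/2" using order_tendstoD(2)[OF lt, of "e/2"] e by simp
    then obtain k where "\<forall>n\<ge>k. d (g (x n)) l < e/2" unfolding eventually_sequentially by blast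
    then have n: "max N k \<ge> N" "d (g (x (max N k))) l < e/2" by auto
    from Z P(1)[of N] show "\<forall>\<^sub>F s in F. d (g s) l < e"
    proof eventually_elim
      case (elim s)
      have "d (g s) l \<le> d (g s) (g (x (max N k))) + d (g (x (max N k))) l" by (rule triangle[OF elim(1) x(1) lZ])
      moreover have "d (g s) (g (x (max N k))) < 1 / Suc N" using P(2)[OF elim(2) x(2)[OF n(1)]] .
      ultimately show ?case using N n by linarith
    qed
  qed
  with lZ show ?thesis by blast
qed

text \<open>Since \<phi> is 1-Lipschitz, \<phi>(f y) is the infimum of \<phi>(w) + d(f y, w) over a
  countable set of \<open>w\<close> dense near the range.\<close>

lemma (in metric_target) sep_meas_lipschitz:
  assumes f: "sep_meas Y Z d f"
    and L: "\<And>y y'. y \<in> Z \<Longrightarrow> y' \<in> Z \<Longrightarrow> \<phi> y \<le> \<phi> y' + d y y'"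
  shows "(\<lambda>y. \<phi> (f y) :: real) \<in> borel_measurable Y"
proof -
  obtain D where D: "countable D" "D \<subseteq> Z" "\<And>y e. y \<in> space Y \<Longrightarrow> e > 0 \<Longrightarrow> \<exists>z\<in>D. d (f y) z < e"
    using sep_meas_dense[OF f] by metis
  show ?thesis
  proof (rule borel_measurable_countable_inf[OF D(1), of "\<lambda>w y. \<phi> w + d (f y) w"])
    show "(\<lambda>y. \<phi> w + d (f y) w) \<in> borel_measurable Y" if "w \<in> D" for w
      using sep_measD(2)[OF f, of w] D(2) that by auto
    fix y assume y: "y \<in> space Y"
    show "\<phi> (f y) \<le> \<phi> w + d (f y) w" if "w \<in> D" for w
      using L[OF sep_measD(1)[OF f y], of w] D(2) that by auto
    fix e :: real assume "e > 0"
    then obtain w where w: "w \<in> D" "d (f y) w < e / 2" using D(3)[OF y, of "e / 2"] by auto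
    then have "\<phi> w \<le> \<phi> (f y) + d (f y) w"
      using L[OF _ sep_measD(1)[OF f y], of w] D(2) by (auto simp: commute)
    then show "\<exists>w\<in>D. \<phi> w + d (f y) w < \<phi> (f y) + e" using w by (intro bexI[of _ w]) auto
  qed
qed

context BV_target
begin

lemma within_right_witness:
  assumes T: "dense_in a b T" and P: "eventually P (at t within (T \<inter> {t<..}))" and t: "a \<le> t" "t < u" "u \<le> b"
  shows "\<exists>s\<in>T. t < s \<and> s < u \<and> P s"
proof -
  obtain s :: "nat \<Rightarrow> real" where s: "\<And>j. s j \<in> T" "\<And>j. t < s j" "\<And>j. s j < u" "filterlim s (at_right t) sequentially"
    using dense_in_seq_right[OF T t] by blast
  have "filterlim s (at t within (T \<inter> {t<..})) sequentially"
    using s by (auto simp: filterlim_at)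
  from eventually_compose_filterlim[OF P this] obtain j where "P (s j)"
    by (meson eventually_sequentially order_refl)
  then show ?thesis using s by auto
qed

lemma within_left_nonbot:
  assumes T: "dense_in a b T" and t: "a < t" "t \<le> b"
  shows "at t within (T \<inter> {..<t}) \<noteq> bot"
proof -
  obtain s :: "nat \<Rightarrow> real" where s: "\<And>j. s j \<in> T" "\<And>j. s j < t" "filterlim s (at_left t) sequentially"
    using dense_in_seq_left[OF T order_refl t] by blast
  have "filterlim s (at t within (T \<inter> {..<t})) sequentially"
    using s by (auto simp: filterlim_at)
  then show ?thesis by (auto simp: filterlim_def bot.extremum_unique filtermap_bot_iff)
qed

text \<open>One-sided limits exist because the variation up to \<^term>\<open>s\<close> is a monotone bounded function of \<^term>\<open>s\<close>
  that controls the distances.\<close>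

lemma BV_extend:
  assumes mcomplete and T: "dense_in a b T" "T \<subseteq> {a<..<b}" and g: "g ` T \<subseteq> Z" and V: "Var d g T < \<infinity>"
  shows "\<exists>\<gamma>\<in>BV a b Z d.
    (\<forall>t\<in>{a..<b}. ((\<lambda>s. d (g s) (\<gamma> t)) \<longlongrightarrow> 0) (at t within (T \<inter> {t<..}))) \<and>
    ((\<lambda>s. d (g s) (\<gamma> b)) \<longlongrightarrow> 0) (at b within (T \<inter> {..<b}))"
proof -
  define v where "v s = enn2real (Var d g (T \<inter> {..s}))" for s
  have vV: "Var d g (T \<inter> {..s}) < \<infinity>" for s
    by (rule le_less_trans[OF Var_mono V]) simp
  have ev: "ennreal (v s) = Var d g (T \<inter> {..s})" for s using vV[of s] by (simp add: v_def)
  have v_nonneg: "0 \<le> v s" for s by (simp add: v_def)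
  have dv: "d (g s) (g s') \<le> v s' - v s" if "s \<in> T" "s' \<in> T" "s < s'" for s s'
  proof -
    have "ennreal (v s + d (g s) (g s')) = Var d g (T \<inter> {..s}) + ennreal (d (g s) (g s'))"
      by (simp only: ev[symmetric] ennreal_plus v_nonneg nonneg)
    also have "\<dots> \<le> Var d g (insert s' (T \<inter> {..s}))"
      by (rule Var_superadditive) (use that g in auto)
    also have "\<dots> \<le> Var d g (T \<inter> {..s'})" by (rule Var_mono) (use that in auto)
    finally have "ennreal (v s + d (g s) (g s')) \<le> ennreal (v s')" by (simp only: ev)
    then have "v s + d (g s) (g s') \<le> v s'" using v_nonneg[of s'] by (simp only: ennreal_le_iff)
    then show ?thesis by linarith
  qed
  have v_mono: "v s \<le> v s'" if "s \<in> T" "s' \<in> T" "s \<le> s'" for s s'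
    using order_trans[OF nonneg dv[OF that(1,2)]] that(3) by (cases "s = s'") auto
  have v_le: "v s \<le> enn2real (Var d g T)" for s
    unfolding v_def using V by (intro enn2real_mono Var_mono) auto
  have close: "d (g x) (g y) < e" if xy: "x \<in> T" "y \<in> T" "\<bar>v x - v y\<bar> < e" for x y e
    using dv[of x y] dv[of y x] xy g by (cases x y rule: linorder_cases) (auto simp: commute image_subset_iff)
  have right: "\<exists>l\<in>Z. ((\<lambda>s. d (g s) l) \<longlongrightarrow> 0) (at t within (T \<inter> {t<..}))" if t: "t \<in> {a..<b}" for t
  proof (rule mcomplete_limit[OF \<open>mcomplete\<close>])
    show "at t within (T \<inter> {t<..}) \<noteq> bot"
      using within_right_witness[OF T(1), of "\<lambda>_. False" t b] t by (auto simp: trivial_limit_def)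
    show "\<forall>\<^sub>F s in at t within (T \<inter> {t<..}). g s \<in> Z"
      unfolding eventually_at by (rule exI[of _ 1]) (use g in auto)
    fix e :: real assume e: "e > 0"
    \<comment> \<open>\<open>L\<close> is the right limit of \<open>v\<close> at \<open>t\<close>:
      between \<open>t\<close> and \<open>s0\<close> all values of \<open>v\<close> on
      \<open>T\<close> lie in \<open>[L, L + e)\<close>.\<close>
    define L where "L = Inf (v ` (T \<inter> {t<..}))"
    have ne: "v ` (T \<inter> {t<..}) \<noteq> {}" using within_right_witness[OF T(1), of "\<lambda>_. True" t b] t by auto
    have bdd: "bdd_below (v ` (T \<inter> {t<..}))" using v_nonneg by (auto intro!: bdd_belowI)
    obtain s0 where s0: "s0 \<in> T" "t < s0" "v s0 < L + e"
      using cInf_lessD[OF ne, of "L + e"] e by (auto simp: L_def)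
    have Lv: "L \<le> v s" if "s \<in> T" "t < s" for s unfolding L_def using that by (intro cInf_lower bdd) auto
    define P where "P s \<longleftrightarrow> s \<in> T \<and> t < s \<and> s < s0" for s
    have "eventually P (at t within (T \<inter> {t<..}))"
      unfolding eventually_at P_def by (rule exI[of _ "s0 - t"]) (use s0 in \<open>auto simp: dist_real_def\<close>)
    moreover have "d (g x) (g y) < e" if "P x" "P y" for x y
    proof (rule close)
      have "L \<le> v x" "v x \<le> v s0" "L \<le> v y" "v y \<le> v s0"
        using that s0 Lv v_mono unfolding P_def by (meson less_imp_le)+
      then show "\<bar>v x - v y\<bar> < e" using s0(3) by linarith
    qed (use that P_def in auto)
    ultimately show "\<exists>P. eventually P (at t within (T \<inter> {t<..})) \<and> (\<forall>x y. P x \<and> P y \<longrightarrow> d (g x) (g y) < e)"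
      by blast
  qed
  have left: "\<exists>l\<in>Z. ((\<lambda>s. d (g s) l) \<longlongrightarrow> 0) (at t within (T \<inter> {..<t}))" if t: "t \<in> {a<..b}" for t
  proof (rule mcomplete_limit[OF \<open>mcomplete\<close>])
    show nb: "at t within (T \<inter> {..<t}) \<noteq> bot" using within_left_nonbot[OF T(1)] t by auto
    show "\<forall>\<^sub>F s in at t within (T \<inter> {..<t}). g s \<in> Z"
      unfolding eventually_at by (rule exI[of _ 1]) (use g in auto)
    fix e :: real assume e: "e > 0"
    define L where "L = Sup (v ` (T \<inter> {..<t}))"
    have ne: "v ` (T \<inter> {..<t}) \<noteq> {}" using nb by auto
    have bdd: "bdd_above (v ` (T \<inter> {..<t}))" using v_le by (auto intro!: bdd_aboveI)
    obtain s0 where s0: "s0 \<in> T" "s0 < t" "L - e < v s0"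
      using less_cSupD[OF ne, of "L - e"] e by (auto simp: L_def)
    have Lv: "v s \<le> L" if "s \<in> T" "s < t" for s unfolding L_def using that by (intro cSup_upper bdd) auto
    define P where "P s \<longleftrightarrow> s \<in> T \<and> s0 < s \<and> s < t" for s
    have "eventually P (at t within (T \<inter> {..<t}))"
      unfolding eventually_at P_def by (rule exI[of _ "t - s0"]) (use s0 in \<open>auto simp: dist_real_def\<close>)
    moreover have "d (g x) (g y) < e" if "P x" "P y" for x y
    proof (rule close)
      have "v x \<le> L" "v s0 \<le> v x" "v y \<le> L" "v s0 \<le> v y"
        using that s0 Lv v_mono unfolding P_def by (meson less_imp_le)+
      then show "\<bar>v x - v y\<bar> < e" using s0(3) by linarith
    qed (use that P_def in auto)
    ultimately show "\<exists>P. eventually P (at t within (T \<inter> {..<t})) \<and> (\<forall>x y. P x \<and> P y \<longrightarrow> d (g x) (g y) < e)"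
      by blast
  qed
  from right obtain R where R: "\<And>t. t \<in> {a..<b} \<Longrightarrow> R t \<in> Z"
    "\<And>t. t \<in> {a..<b} \<Longrightarrow> ((\<lambda>s. d (g s) (R t)) \<longlongrightarrow> 0) (at t within (T \<inter> {t<..}))" by metis
  obtain l where l: "l \<in> Z" "((\<lambda>s. d (g s) l) \<longlongrightarrow> 0) (at b within (T \<inter> {..<b}))" using left[of b] ab by auto
  \<comment> \<open>Right limits before \<open>b\<close> and the left limit at \<open>b\<close>, as
    the definition of BV prescribes; the values of \<open>g\<close> on \<open>T\<close> itself may
    change.\<close>
  define \<gamma> where "\<gamma> = (\<lambda>t\<in>{a..b}. if t < b then R t else l)"
  have \<gamma>Z: "\<gamma> t \<in> Z" if "t \<in> {a..b}" for t using that R(1) l(1) by (auto simp: \<gamma>_def)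
  have \<gamma>R: "((\<lambda>s. d (g s) (\<gamma> t)) \<longlongrightarrow> 0) (at t within (T \<inter> {t<..}))" if "t \<in> {a..<b}" for t
    using R(2)[OF that] that by (simp add: \<gamma>_def)
  have \<gamma>L: "((\<lambda>s. d (g s) (\<gamma> b)) \<longlongrightarrow> 0) (at b within (T \<inter> {..<b}))" using l ab by (simp add: \<gamma>_def)
  have near: "\<exists>s\<in>T. t < s \<and> s < u \<and> d (g s) (\<gamma> t) < e" if "a \<le> t" "t < u" "u \<le> b" "e > 0" for t u e
    using within_right_witness[OF T(1) order_tendstoD(2)[OF \<gamma>R], of t e u] that by auto
  have rc: "((\<lambda>s. d (\<gamma> s) (\<gamma> t)) \<longlongrightarrow> 0) (at_right t)" if t: "t \<in> {a..<b}" for t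
  proof (rule dist_tendsto_0I)
    fix e :: real assume e: "0 < e"
    have "\<forall>\<^sub>F s in at t within (T \<inter> {t<..}). d (g s) (\<gamma> t) < e/2"
      using order_tendstoD(2)[OF \<gamma>R[OF t], of "e/2"] e by simp
    then obtain \<delta> where "\<delta> > 0"
      and "\<forall>s\<in>T \<inter> {t<..}. s \<noteq> t \<and> dist s t < \<delta> \<longrightarrow> d (g s) (\<gamma> t) < e/2"
      unfolding eventually_at by blast
    then have \<delta>: "\<delta> > 0" "\<And>s. s \<in> T \<Longrightarrow> t < s \<Longrightarrow> s < t + \<delta> \<Longrightarrow> d (g s) (\<gamma> t) < e/2"
      by (auto simp: dist_real_def)
    have "\<forall>\<^sub>F s in at_right t. s \<in> {t<..<min b (t + \<delta>)}"
      using t \<delta> by (intro eventually_at_right_real) auto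
    then show "\<forall>\<^sub>F s in at_right t. d (\<gamma> s) (\<gamma> t) < e"
    proof eventually_elim
      case (elim s)
      \<comment> \<open>\<open>s\<close> need not lie in \<open>T\<close>, and \<gamma> may differ
        from \<open>g\<close> there, so \<open>s\<close> is replaced by a nearby point of
        \<open>T\<close> on its right that still lies before \<open>t + \<delta>\<close>.\<close>
      then obtain s' where s': "s' \<in> T" "s < s'" "s' < min b (t + \<delta>)" "d (g s') (\<gamma> s) < e/2"
        using near[of s "min b (t + \<delta>)" "e/2"] t e by auto
      have "d (\<gamma> s) (\<gamma> t) \<le> d (\<gamma> s) (g s') + d (g s') (\<gamma> t)"
        by (rule triangle) (use \<gamma>Z g s' elim t in auto)
      also have "d (g s') (\<gamma> t) < e/2" using \<delta>(2)[of s'] s' elim by auto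
      finally show ?case using s'(4) by (simp add: commute)
    qed
  qed
  \<comment> \<open>The limit \<open>m\<close> is kept separate from \<gamma>(t): at an interior
    jump the left limit exists but differs from \<gamma>(t).\<close>
  have lc: "((\<lambda>s. d (\<gamma> s) m) \<longlongrightarrow> 0) (at_left t)"
    if t: "t \<in> {a<..b}" and m: "m \<in> Z" "((\<lambda>s. d (g s) m) \<longlongrightarrow> 0) (at t within (T \<inter> {..<t}))" for t m
  proof (rule dist_tendsto_0I)
    fix e :: real assume e: "0 < e"
    have "\<forall>\<^sub>F s in at t within (T \<inter> {..<t}). d (g s) m < e/2"
      using order_tendstoD(2)[OF m(2), of "e/2"] e by simp
    then obtain \<delta> where "\<delta> > 0"
      and "\<forall>s\<in>T \<inter> {..<t}. s \<noteq> t \<and> dist s t < \<delta> \<longrightarrow> d (g s) m < e/2"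
      unfolding eventually_at by blast
    then have \<delta>: "\<delta> > 0" "\<And>s. s \<in> T \<Longrightarrow> s < t \<Longrightarrow> t - \<delta> < s \<Longrightarrow> d (g s) m < e/2"
      by (auto simp: dist_real_def)
    have "\<forall>\<^sub>F s in at_left t. s \<in> {max a (t - \<delta>)<..<t}"
      using t \<delta> by (intro eventually_at_left_real) auto
    then show "\<forall>\<^sub>F s in at_left t. d (\<gamma> s) m < e"
    proof eventually_elim
      case (elim s)
      then obtain s' where s': "s' \<in> T" "s < s'" "s' < t" "d (g s') (\<gamma> s) < e/2"
        using near[of s t "e/2"] t e by auto
      have "d (\<gamma> s) m \<le> d (\<gamma> s) (g s') + d (g s') m"
        by (rule triangle) (use \<gamma>Z g s' elim t m in auto)
      also have "d (g s') m < e/2" using \<delta>(2)[of s'] s' elim by auto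
      finally show ?case using s'(4) by (simp add: commute)
    qed
  qed
  have "Var d \<gamma> {a..b} \<le> Var d g T"
  proof (rule Var_le_approx)
    fix t assume t: "t \<in> {a..b}"
    show "\<exists>s :: nat \<Rightarrow> real. (\<forall>j. s j \<in> T) \<and> s \<longlonglongrightarrow> t \<and> (\<lambda>j. d (g (s j)) (\<gamma> t)) \<longlonglongrightarrow> 0"
    proof (cases "t = b")
      case True
      obtain s :: "nat \<Rightarrow> real" where s: "\<And>j. s j \<in> T" "\<And>j. s j < b" "filterlim s (at_left b) sequentially"
        using dense_in_seq_left[OF T(1) order_refl ab order_refl] by blast
      then have f: "filterlim s (at b within (T \<inter> {..<b})) sequentially" by (auto simp: filterlim_at)
      show ?thesis using filterlim_compose[OF \<gamma>L f] f s(1) True by (intro exI[of _ s]) (auto simp: filterlim_at)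
    next
      case False
      then have tb: "a \<le> t" "t < b" using t by auto
      obtain s :: "nat \<Rightarrow> real" where s: "\<And>j. s j \<in> T" "\<And>j. t < s j" "filterlim s (at_right t) sequentially"
        using dense_in_seq_right[OF T(1) tb order_refl] by blast
      then have f: "filterlim s (at t within (T \<inter> {t<..})) sequentially" by (auto simp: filterlim_at)
      show ?thesis using filterlim_compose[OF \<gamma>R f] f s(1) tb by (intro exI[of _ s]) (auto simp: filterlim_at)
    qed
  qed (use \<gamma>Z g in auto)
  then have V\<gamma>: "Var d \<gamma> {a..b} < \<infinity>" using V by (rule le_less_trans)
  have "\<gamma> \<in> BV a b Z d"
    unfolding BV_iff
  proof (intro conjI ballI)
    show "\<gamma> \<in> {a..b} \<rightarrow>\<^sub>E Z" using \<gamma>Z by (auto simp: \<gamma>_def)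
    show "\<exists>m\<in>Z. ((\<lambda>s. d (\<gamma> s) m) \<longlongrightarrow> 0) (at_left t)" if "t \<in> {a<..b}" for t
      using left[OF that] lc[OF that] by blast
    show "((\<lambda>s. d (\<gamma> s) (\<gamma> b)) \<longlongrightarrow> 0) (at_left b)"
      by (rule lc) (use \<gamma>L \<gamma>Z ab in auto)
  qed (use rc V\<gamma> in auto)
  with \<gamma>R \<gamma>L show ?thesis by blast
qed

end

section \<open>Lebesgue measure on the interval, grid approximation and joint measurability\<close>

lemma finite_measure_leb_I: "finite_measure (leb_I a b)"
  by (rule finite_measure_lebesgue_on) (metis cbox_interval lmeasurable_cbox)

lemma sigma_finite_leb_I: "sigma_finite_measure (leb_I a b)"
  using finite_measure_leb_I finite_measure.axioms(1) by blast

lemma space_leb_I [simp]: "space (leb_I a b) = {a..b}"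
  by (simp add: space_restrict_space)

lemma emeasure_leb_I: "a \<le> b \<Longrightarrow> emeasure (leb_I a b) {a..b} = ennreal (b - a)"
  by (subst emeasure_restrict_space) auto

text \<open>
  Rounding up goes strictly to the right, so that right continuity applies; the cap keeps \<open>b\<close> fixed.
\<close>

definition grid :: "real \<Rightarrow> real \<Rightarrow> nat \<Rightarrow> nat \<Rightarrow> real" where
  "grid a b n k = min b (a + (real k + 1) / real (Suc n))"

definition grid_index :: "real \<Rightarrow> nat \<Rightarrow> real \<Rightarrow> nat" where
  "grid_index a n t = nat \<lfloor>real (Suc n) * (t - a)\<rfloor>"

definition round_up :: "real \<Rightarrow> real \<Rightarrow> nat \<Rightarrow> real \<Rightarrow> real" where
  "round_up a b n t = grid a b n (grid_index a n t)"

lemma grid_in: "a \<le> b \<Longrightarrow> grid a b n k \<in> {a..b}"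
  by (auto simp: grid_def min_def)

lemma round_up_end: assumes "a \<le> b" shows "round_up a b n b = b"
proof -
  have "real (Suc n) * (b - a) < real (grid_index a n b) + 1"
    unfolding grid_index_def using assms by (simp add: le_nat_floor floor_less_iff)
  then have "b - a < (real (grid_index a n b) + 1) / real (Suc n)"
    by (simp add: field_simps)
  then show ?thesis by (simp add: round_up_def grid_def)
qed

lemma round_up_bounds:
  assumes "a \<le> t" "t < b"
  shows "t < round_up a b n t" "round_up a b n t \<le> t + 1 / real (Suc n)" "round_up a b n t \<le> b"
proof -
  let ?k = "real (grid_index a n t)"
  have "0 \<le> real (Suc n) * (t - a)" using assms by simp
  then have k: "?k \<le> real (Suc n) * (t - a)" "real (Suc n) * (t - a) < ?k + 1"
    unfolding grid_index_def by (simp_all only: of_nat_nat zero_le_floor of_int_floor_le) linarith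
  then have "t - a < (?k + 1) / real (Suc n)" "?k / real (Suc n) \<le> t - a"
    by (simp_all add: field_simps)
  then show "t < round_up a b n t" "round_up a b n t \<le> t + 1 / real (Suc n)" "round_up a b n t \<le> b"
    using assms by (auto simp: round_up_def grid_def add_divide_distrib)
qed

lemma round_up_tendsto:
  assumes "a \<le> t" "t < b"
  shows "filterlim (\<lambda>n. round_up a b n t) (at_right t) sequentially"
proof -
  have "(\<lambda>n. round_up a b n t) \<longlonglongrightarrow> t"
  proof (rule tendsto_sandwich)
    show "\<forall>\<^sub>F n in sequentially. t \<le> round_up a b n t"
      using round_up_bounds(1)[OF assms] by (intro always_eventually allI less_imp_le)
    show "\<forall>\<^sub>F n in sequentially. round_up a b n t \<le> t + 1 / Suc n"
      using round_up_bounds(2)[OF assms] by (intro always_eventually allI)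
    show "(\<lambda>j. t + 1 / Suc j) \<longlonglongrightarrow> t"
      using tendsto_add[OF tendsto_const[of t] LIMSEQ_inverse_real_of_nat] by (simp add: inverse_eq_divide)
  qed simp
  then show ?thesis
    unfolding filterlim_at using round_up_bounds(1)[OF assms]
    by (auto intro!: always_eventually simp: less_imp_neq[THEN not_sym])
qed

lemma measurable_grid_index: "grid_index a n \<in> measurable (leb_I a b) (count_space UNIV)"
proof -
  have "(\<lambda>t. nat \<lfloor>real (Suc n) * (t - a)\<rfloor>) \<in> measurable borel (count_space UNIV)" by measurable
  then have "(\<lambda>t. nat \<lfloor>real (Suc n) * (t - a)\<rfloor>) \<in> measurable (leb_I a b) (count_space UNIV)"
    by (intro measurable_restrict_space1 measurable_completion) simp
  then show ?thesis by (simp add: grid_index_def[abs_def])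
qed

context BV_target
begin

text \<open>For fixed \<open>n\<close> the rounded time is a function of a measurable index, so
  countably many measurable evaluations are glued.\<close>

lemma sep_meas_round_up:
  assumes m: "\<And>t. t \<in> {a..b} \<Longrightarrow> sep_meas M Z d (\<lambda>x. \<gamma> x t)"
  shows "sep_meas (leb_I a b \<Otimes>\<^sub>M M) Z d (\<lambda>p. \<gamma> (snd p) (round_up a b n (fst p)))"
  unfolding round_up_def
proof (rule sep_meas_countable[where f = "\<lambda>k p. \<gamma> (snd p) (grid a b n k)" and i = "\<lambda>p. grid_index a n (fst p)"])
  show "sep_meas (leb_I a b \<Otimes>\<^sub>M M) Z d (\<lambda>p. \<gamma> (snd p) (grid a b n k))" for k
    by (rule sep_meas_compose[OF m measurable_snd]) (use ab in \<open>simp add: grid_in less_imp_le del: atLeastAtMost_iff\<close>)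
  show "(\<lambda>p. grid_index a n (fst p)) \<in> measurable (leb_I a b \<Otimes>\<^sub>M M) (count_space UNIV)"
    by (rule measurable_compose[OF measurable_fst measurable_grid_index])
qed

lemma BV_round_up_tendsto:
  assumes c: "c \<in> BV a b Z d" and t: "t \<in> {a..b}"
  shows "(\<lambda>n. d (c (round_up a b n t)) (c t)) \<longlonglongrightarrow> 0"
proof (cases "t = b")
  case True
  then show ?thesis using BV_mem[OF c] ab by (simp add: round_up_end)
next
  case False
  then have "a \<le> t" "t < b" using t by auto
  then show ?thesis by (intro filterlim_compose[OF BV_right[OF c] round_up_tendsto])
qed

text \<open>Measurability in \<open>x\<close> for fixed \<open>t\<close> and one-sided continuity in
  \<open>t\<close> give joint measurability, as a limit over finer and finer grids.\<close>

lemma sep_meas_joint: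
  assumes \<gamma>: "\<And>x. x \<in> space M \<Longrightarrow> \<gamma> x \<in> BV a b Z d"
    and m: "\<And>t. t \<in> {a..b} \<Longrightarrow> sep_meas M Z d (\<lambda>x. \<gamma> x t)"
  shows "sep_meas (leb_I a b \<Otimes>\<^sub>M M) Z d (\<lambda>p. \<gamma> (snd p) (fst p))"
proof (rule sep_meas_lim[OF sep_meas_round_up[OF m]])
  show "(\<lambda>p. \<gamma> (snd p) (fst p)) \<in> space (leb_I a b \<Otimes>\<^sub>M M) \<rightarrow> Z"
    using BV_mem[OF \<gamma>] by (auto simp: space_pair_measure)
  show "(\<lambda>n. d (\<gamma> (snd p) (round_up a b n (fst p))) (\<gamma> (snd p) (fst p))) \<longlonglongrightarrow> 0"
    if "p \<in> space (leb_I a b \<Otimes>\<^sub>M M)" for p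
    by (rule BV_round_up_tendsto[OF \<gamma>]) (use that in \<open>auto simp: space_pair_measure\<close>)
qed

lemma sep_meas_BV:
  assumes c: "c \<in> BV a b Z d"
  shows "sep_meas (leb_I a b) Z d c" "sep_meas (leb_I a b) Z d (\<lambda>t. c (round_up a b n t))"
proof -
  \<comment> \<open>A single curve is treated as a family over the one-point space.\<close>
  have C: "sep_meas (count_space UNIV) Z d (\<lambda>x::unit. c t)" if "t \<in> {a..b}" for t
    by (rule sep_meas_const[OF BV_mem[OF c that]])
  have P: "(\<lambda>t. (t, ())) \<in> measurable (leb_I a b) (leb_I a b \<Otimes>\<^sub>M count_space UNIV)" by measurable
  show "sep_meas (leb_I a b) Z d c"
    using sep_meas_compose[OF sep_meas_joint[of "count_space (UNIV :: unit set)" "\<lambda>_. c", OF c C] P] by simp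
  show "sep_meas (leb_I a b) Z d (\<lambda>t. c (round_up a b n t))"
    using sep_meas_compose[OF sep_meas_round_up[of "count_space (UNIV :: unit set)" "\<lambda>_. c", OF C] P] by simp
qed

lemma round_up_in: "t \<in> {a..b} \<Longrightarrow> round_up a b n t \<in> {a..b}"
  unfolding round_up_def using ab by (intro grid_in) simp

lemma BV_round_up_L1:
  assumes c: "c \<in> BV a b Z d"
  shows "(\<lambda>n. \<integral>\<^sup>+ t. ennreal (d (c (round_up a b n t)) (c t)) \<partial>leb_I a b) \<longlonglongrightarrow> 0"
proof -
  have "(\<lambda>n. \<integral>\<^sup>+ t. ennreal (d (c (round_up a b n t)) (c t)) \<partial>leb_I a b) \<longlonglongrightarrow> (\<integral>\<^sup>+ t. 0 \<partial>leb_I a b)"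
  proof (rule nn_integral_dominated_convergence[where w = "\<lambda>_. Var d c {a..b}"])
    show "(\<lambda>t. ennreal (d (c (round_up a b n t)) (c t))) \<in> borel_measurable (leb_I a b)" for n
      using sep_meas_dist[OF sep_meas_BV(2)[OF c] sep_meas_BV(1)[OF c]] by measurable
    show "AE t in leb_I a b. ennreal (d (c (round_up a b n t)) (c t)) \<le> Var d c {a..b}" for n
      by (rule AE_I2) (rule BV_dist_le(1)[OF c round_up_in], auto)
    show "(\<integral>\<^sup>+ t. Var d c {a..b} \<partial>leb_I a b) < \<infinity>"
      using BV_Var[OF c] ab by (simp add: emeasure_leb_I ennreal_mult_less_top)
    show "AE t in leb_I a b. (\<lambda>n. ennreal (d (c (round_up a b n t)) (c t))) \<longlonglongrightarrow> 0"
      by (rule AE_I2) (use tendsto_ennrealI[OF BV_round_up_tendsto[OF c]] in auto)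
  qed auto
  then show ?thesis by simp
qed

section \<open>Curves of bounded variation as integrable curves\<close>

definition z0 :: 'z where "z0 = (SOME z. z \<in> Z)"

lemma z0: "z0 \<in> Z" unfolding z0_def using Z_ne by (simp add: some_in_eq)

sublocale I: L1_target Z d "leb_I a b" "\<lambda>_. z0"
  by unfold_locales (rule sep_meas_const[OF z0], rule Z_ne)

lemma nn_integral_leb_I_const: "(\<integral>\<^sup>+ t. ennreal r \<partial>leb_I a b) = ennreal r * ennreal (b - a)"
  using ab by (simp add: emeasure_leb_I)

lemma int1_change:
  assumes s: "sep_meas (leb_I a b) Z d f" and z: "z \<in> Z"
    and fin: "(\<integral>\<^sup>+ t. ennreal (d (f t) z) \<partial>leb_I a b) < \<infinity>"
  shows "I.int1 f"
proof -
  have "(\<integral>\<^sup>+ t. ennreal (d (f t) z0) \<partial>leb_I a b) \<le>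
      (\<integral>\<^sup>+ t. ennreal (d (f t) z) \<partial>leb_I a b) + (\<integral>\<^sup>+ t. ennreal (d z z0) \<partial>leb_I a b)"
    by (rule nn_integral_triangle) (auto intro: s sep_meas_const z z0)
  also have "\<dots> < \<infinity>" using fin unfolding nn_integral_leb_I_const by (simp add: ennreal_mult_less_top)
  finally show ?thesis by (simp add: I.int1_def s)
qed

text \<open>Constants are at finite distance from each other on an interval of finite length, so the
  union over all reference points collapses to a single space.\<close>

lemma L1_I_eq: "L1_I a b Z d = I.L"
proof (rule antisym)
  show "I.L \<subseteq> L1_I a b Z d" unfolding L1_I_def using z0 by auto
  show "L1_I a b Z d \<subseteq> I.L"
  proof
    fix F assume "F \<in> L1_I a b Z d"
    then obtain z where z: "z \<in> Z" "F \<in> L1 (leb_I a b) Z d (ae_class (leb_I a b) Z (\<lambda>_. z))"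
      by (auto simp: L1_I_def)
    then obtain f where "sep_meas (leb_I a b) Z d f" "(\<integral>\<^sup>+ t. ennreal (d (f t) z) \<partial>leb_I a b) < \<infinity>" "F = I.cls f"
      using L1_iff[where Y = "leb_I a b" and g = "\<lambda>_. z" and F = F] Z_ne by auto
    then show "F \<in> I.L" using int1_change[of f z] z(1) by (auto simp: I.L_iff)
  qed
qed

lemma BV_int1: assumes c: "c \<in> BV a b Z d" shows "I.int1 c"
proof (rule int1_change[OF sep_meas_BV(1)[OF c]])
  show "c a \<in> Z" using BV_mem[OF c] ab by simp
  have "(\<integral>\<^sup>+ t. ennreal (d (c t) (c a)) \<partial>leb_I a b) \<le> (\<integral>\<^sup>+ t. Var d c {a..b} \<partial>leb_I a b)"
    by (intro nn_integral_mono BV_dist_le(1)[OF c]) (use ab in auto)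
  also have "\<dots> < \<infinity>" using BV_Var[OF c] ab by (simp add: emeasure_leb_I ennreal_mult_less_top)
  finally show "(\<integral>\<^sup>+ t. ennreal (d (c t) (c a)) \<partial>leb_I a b) < \<infinity>" .
qed

lemma BV_dist_cls:
  assumes "c \<in> BV a b Z d" "c' \<in> BV a b Z d"
  shows "BV_dist a b d c c' = L1_dist (leb_I a b) d (I.cls c) (I.cls c')"
  unfolding BV_dist_def I.dist_cls[OF BV_int1 BV_int1, OF assms] ..

lemma BV_cls_inj: "inj_on I.cls (BV a b Z d)"
proof (rule inj_onI)
  fix c c' assume c: "c \<in> BV a b Z d" "c' \<in> BV a b Z d" and "I.cls c = I.cls c'"
  then have "AE t in leb_I a b. c t = c' t" using ae_class_eqD[OF _ I.int1_AE[OF BV_int1[OF c(1)]] Z_ne] by blast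
  then show "c = c'" by (rule BV_eq_AE[OF c])
qed

text \<open>The metric is the one of \<open>L\<^sup>1(I, Z)\<close>, pulled back along the injective
  map from curves to classes.\<close>

sublocale B: metric_target "BV a b Z d" "BV_dist a b d"
proof
  show "0 \<le> BV_dist a b d x y" for x y by (simp add: BV_dist_def)
  show "BV_dist a b d x y = BV_dist a b d y x" for x y by (simp add: BV_dist_def commute)
next
  fix x y assume "x \<in> BV a b Z d" "y \<in> BV a b Z d"
  then show "BV_dist a b d x y = 0 \<longleftrightarrow> x = y"
    using I.Lp.zero[OF I.cls_mem I.cls_mem, OF BV_int1 BV_int1] BV_cls_inj
    by (auto simp: BV_dist_cls inj_on_def)
next
  fix x y z assume "x \<in> BV a b Z d" "y \<in> BV a b Z d" "z \<in> BV a b Z d"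
  then show "BV_dist a b d x z \<le> BV_dist a b d x y + BV_dist a b d y z"
    using I.Lp.triangle[OF I.cls_mem I.cls_mem I.cls_mem, OF BV_int1 BV_int1 BV_int1]
    by (simp add: BV_dist_cls)
qed

text \<open>The delicate point is separability for the \<open>L\<^sup>1\<close> metric. A curve is
  known up to e/4 once its rounding at a suitable level is, and the rounding involves finitely many
  grid points; the level and the approximate values there are coded in one natural number.\<close>

lemma sep_meas_class:
  assumes \<gamma>: "\<And>x. x \<in> space M \<Longrightarrow> \<gamma> x \<in> BV a b Z d"
    and m: "\<And>t. t \<in> {a..b} \<Longrightarrow> sep_meas M Z d (\<lambda>x. \<gamma> x t)"
  shows "sep_meas M (L1_I a b Z d) (L1_dist (leb_I a b) d) (\<lambda>x. I.cls (\<gamma> x))"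
  unfolding sep_meas_def L1_I_eq
proof (intro conjI allI impI ballI)
  show "(\<lambda>x. I.cls (\<gamma> x)) \<in> space M \<rightarrow> I.L" using I.cls_mem[OF BV_int1[OF \<gamma>]] by auto
next
  fix W assume "W \<in> I.L"
  then obtain w where w: "I.int1 w" "W = I.cls w" by (auto simp: I.L_iff)
  interpret leb: sigma_finite_measure "leb_I a b" by (rule sigma_finite_leb_I)
  have 1: "sep_meas (M \<Otimes>\<^sub>M leb_I a b) Z d (\<lambda>p. \<gamma> (fst p) (snd p))"
    using sep_meas_compose[OF sep_meas_joint[OF \<gamma> m] measurable_pair_swap'] by (simp add: case_prod_beta)
  have 2: "sep_meas (M \<Otimes>\<^sub>M leb_I a b) Z d (\<lambda>p. w (snd p))"
    by (rule sep_meas_compose[OF I.int1_sep[OF w(1)] measurable_snd])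
  have "(\<lambda>p. d (\<gamma> (fst p) (snd p)) (w (snd p))) \<in> borel_measurable (M \<Otimes>\<^sub>M leb_I a b)"
    by (rule sep_meas_dist[OF 1 2])
  then have "(\<lambda>(x, t). ennreal (d (\<gamma> x t) (w t))) \<in> borel_measurable (M \<Otimes>\<^sub>M leb_I a b)"
    by (simp add: case_prod_beta)
  then have "(\<lambda>x. enn2real (\<integral>\<^sup>+ t. ennreal (d (\<gamma> x t) (w t)) \<partial>leb_I a b)) \<in> borel_measurable M"
    by (intro borel_measurable_enn2real leb.borel_measurable_nn_integral)
  then show "(\<lambda>x. L1_dist (leb_I a b) d (I.cls (\<gamma> x)) W) \<in> borel_measurable M"
    by (rule measurable_cong[THEN iffD2, rotated]) (simp add: w(2) I.dist_cls[OF BV_int1[OF \<gamma>] w(1)])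
next
  fix e :: real assume e: "0 < e"
  \<comment> \<open>Three errors are added below: two roundings of at most e/4 each, and values on
    the grid within \<delta>, which integrate to at most \<delta> (b - a) = e/4.\<close>
  define \<delta> where "\<delta> = (e / 4) / (b - a)"
  have \<delta>: "\<delta> > 0" "\<delta> * (b - a) = e / 4" using e ab nonzero_mult_div_cancel_right[of "b - a" "e / 4"] by (simp_all add: \<delta>_def)
  have "\<exists>n. (\<integral>\<^sup>+ t. ennreal (d (\<gamma> x (round_up a b n t)) (\<gamma> x t)) \<partial>leb_I a b) < ennreal (e/4)" if "x \<in> space M" for x
    using order_tendstoD(2)[OF BV_round_up_L1[OF \<gamma>[OF that]], of "ennreal (e/4)"] e
    by (auto simp: eventually_sequentially)
  then obtain n where n: "\<And>x. x \<in> space M \<Longrightarrow>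
      (\<integral>\<^sup>+ t. ennreal (d (\<gamma> x (round_up a b (n x) t)) (\<gamma> x t)) \<partial>leb_I a b) < ennreal (e/4)" by metis
  have "\<exists>i :: _ \<Rightarrow> nat. \<forall>x\<in>space M. \<forall>x'\<in>space M. i x = i x' \<longrightarrow> d (\<gamma> x (grid a b k l)) (\<gamma> x' (grid a b k l)) < \<delta>" for k l
    using m[OF grid_in] ab \<delta>(1) by (simp add: sep_meas_def)
  then obtain i :: "nat \<Rightarrow> nat \<Rightarrow> _ \<Rightarrow> nat" where i: "\<And>k l x x'. x \<in> space M \<Longrightarrow> x' \<in> space M \<Longrightarrow> i k l x = i k l x' \<Longrightarrow>
      d (\<gamma> x (grid a b k l)) (\<gamma> x' (grid a b k l)) < \<delta>" by metis
  \<comment> \<open>The largest index that occurs for times in \<open>[a, b]\<close>, so the finite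
    list in \<open>idx\<close> covers all grid points that matter.\<close>
  define K where "K k = grid_index a k b" for k
  define idx where "idx x = prod_encode (n x, list_encode (map (\<lambda>l. i (n x) l x) [0..<Suc (K (n x))]))" for x
  have "L1_dist (leb_I a b) d (I.cls (\<gamma> x)) (I.cls (\<gamma> x')) < e"
    if x: "x \<in> space M" "x' \<in> space M" and eq: "idx x = idx x'" for x x'
  proof -
    define k where "k = n x"
    have k: "n x' = k" using eq by (simp add: idx_def k_def del: upt_Suc)
    have "list_encode (map (\<lambda>l. i k l x) [0..<Suc (K k)]) = list_encode (map (\<lambda>l. i k l x') [0..<Suc (K k)])"
      using eq k unfolding idx_def k_def by (simp del: upt_Suc)
    then have "map (\<lambda>l. i k l x) [0..<Suc (K k)] = map (\<lambda>l. i k l x') [0..<Suc (K k)]"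
      unfolding list_encode_eq .
    then have il: "i k l x = i k l x'" if "l \<le> K k" for l
      using that unfolding map_eq_conv by (simp del: upt_Suc)
    have gd: "d (\<gamma> x (round_up a b k t)) (\<gamma> x' (round_up a b k t)) \<le> \<delta>" if "t \<in> {a..b}" for t
    proof -
      have "real (Suc k) * (t - a) \<le> real (Suc k) * (b - a)"
        using that by (intro mult_left_mono) auto
      then have "grid_index a k t \<le> K k"
        unfolding K_def grid_index_def by (intro nat_mono floor_mono)
      then show ?thesis unfolding round_up_def using i[OF x il] by (simp add: less_imp_le)
    qed
    note S = sep_meas_BV[OF \<gamma>[OF x(1)]] sep_meas_BV[OF \<gamma>[OF x(2)]]
    have "(\<integral>\<^sup>+ t. ennreal (d (\<gamma> x t) (\<gamma> x' t)) \<partial>leb_I a b)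
        \<le> (\<integral>\<^sup>+ t. ennreal (d (\<gamma> x t) (\<gamma> x (round_up a b k t))) \<partial>leb_I a b)
          + (\<integral>\<^sup>+ t. ennreal (d (\<gamma> x (round_up a b k t)) (\<gamma> x' t)) \<partial>leb_I a b)"
      by (rule nn_integral_triangle[OF S(1,2,3)])
    also have "(\<integral>\<^sup>+ t. ennreal (d (\<gamma> x (round_up a b k t)) (\<gamma> x' t)) \<partial>leb_I a b)
        \<le> (\<integral>\<^sup>+ t. ennreal (d (\<gamma> x (round_up a b k t)) (\<gamma> x' (round_up a b k t))) \<partial>leb_I a b)
          + (\<integral>\<^sup>+ t. ennreal (d (\<gamma> x' (round_up a b k t)) (\<gamma> x' t)) \<partial>leb_I a b)"
      by (rule nn_integral_triangle[OF S(2,4,3)])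
    also have "(\<integral>\<^sup>+ t. ennreal (d (\<gamma> x (round_up a b k t)) (\<gamma> x' (round_up a b k t))) \<partial>leb_I a b)
        \<le> (\<integral>\<^sup>+ t. ennreal \<delta> \<partial>leb_I a b)"
      by (intro nn_integral_mono ennreal_leI gd) simp
    also have "\<dots> = ennreal (e/4)" unfolding nn_integral_leb_I_const \<delta>(2)[symmetric] using \<delta>(1) ab by (simp add: ennreal_mult)
    also have "(\<integral>\<^sup>+ t. ennreal (d (\<gamma> x' (round_up a b k t)) (\<gamma> x' t)) \<partial>leb_I a b) \<le> ennreal (e/4)"
      using n[OF x(2)] k by simp
    also have "(\<integral>\<^sup>+ t. ennreal (d (\<gamma> x t) (\<gamma> x (round_up a b k t))) \<partial>leb_I a b) \<le> ennreal (e/4)"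
      using n[OF x(1)] k_def by (simp add: commute)
    also have "ennreal (e/4) + (ennreal (e/4) + ennreal (e/4)) = ennreal (3 * e / 4)"
      using e by (simp flip: ennreal_plus)
    finally have "ennreal (L1_dist (leb_I a b) d (I.cls (\<gamma> x)) (I.cls (\<gamma> x'))) \<le> ennreal (3 * e / 4)"
      by (simp add: I.ennreal_dist_cls[OF BV_int1 BV_int1, OF \<gamma>[OF x(1)] \<gamma>[OF x(2)]])
    then have "L1_dist (leb_I a b) d (I.cls (\<gamma> x)) (I.cls (\<gamma> x')) \<le> 3 * e / 4" using e by simp
    then show ?thesis using e by simp
  qed
  then show "\<exists>i::_ \<Rightarrow> nat. \<forall>x\<in>space M. \<forall>x'\<in>space M. i x = i x' \<longrightarrow>
      L1_dist (leb_I a b) d (I.cls (\<gamma> x)) (I.cls (\<gamma> x')) < e" by blast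
qed

lemma sep_meas_BV_valued:
  assumes \<gamma>: "\<And>x. x \<in> space M \<Longrightarrow> \<gamma> x \<in> BV a b Z d"
    and m: "\<And>t. t \<in> {a..b} \<Longrightarrow> sep_meas M Z d (\<lambda>x. \<gamma> x t)"
  shows "sep_meas M (BV a b Z d) (BV_dist a b d) \<gamma>"
  unfolding sep_meas_def
proof (intro conjI allI impI ballI)
  note S = sep_meas_class[OF \<gamma> m]
  show "\<gamma> \<in> space M \<rightarrow> BV a b Z d" using \<gamma> by auto
  fix c assume c: "c \<in> BV a b Z d"
  have "(\<lambda>x. L1_dist (leb_I a b) d (I.cls (\<gamma> x)) (I.cls c)) \<in> borel_measurable M"
    using sep_measD(2)[OF S] I.cls_mem[OF BV_int1[OF c]] by (simp add: L1_I_eq)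
  then show "(\<lambda>x. BV_dist a b d (\<gamma> x) c) \<in> borel_measurable M"
    by (rule measurable_cong[THEN iffD2, rotated]) (simp add: BV_dist_cls[OF \<gamma> c])
next
  fix e :: real assume "0 < e"
  then obtain i :: "_ \<Rightarrow> nat" where "\<forall>x\<in>space M. \<forall>x'\<in>space M. i x = i x' \<longrightarrow>
      L1_dist (leb_I a b) d (I.cls (\<gamma> x)) (I.cls (\<gamma> x')) < e"
    using sep_meas_class[OF \<gamma> m] by (auto simp: sep_meas_def)
  then show "\<exists>i :: _ \<Rightarrow> nat. \<forall>x\<in>space M. \<forall>x'\<in>space M. i x = i x' \<longrightarrow> BV_dist a b d (\<gamma> x) (\<gamma> x') < e"
    by (intro exI[of _ i]) (simp add: BV_dist_cls[OF \<gamma> \<gamma>])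
qed

text \<open>One sequence of windows serves all curves: it lies to the right of \<open>t\<close>, or
  to the left when t = b, where curves are left continuous. On a small enough window all values are
  near \<open>c t\<close>; conversely every dense set contains, within each window, a sequence along
  which the values tend to \<open>c t\<close>.\<close>

lemma eval_windows:
  assumes t: "t \<in> {a..b}"
  shows "\<exists>J :: nat \<Rightarrow> real set. (\<forall>n. \<exists>u v. a \<le> u \<and> u < v \<and> v \<le> b \<and> J n = {u<..<v}) \<and>
    (\<forall>c\<in>BV a b Z d. (\<forall>e>0. \<exists>n. \<forall>s\<in>J n. d (c s) (c t) < e) \<and>
      (\<forall>n A. dense_in a b A \<longrightarrow> (\<exists>s :: nat \<Rightarrow> real. (\<forall>j. s j \<in> A \<inter> J n) \<and> (\<lambda>j. d (c (s j)) (c t)) \<longlonglongrightarrow> 0)))"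
proof (cases "t = b")
  case False
  then have tb: "a \<le> t" "t < b" using t by auto
  define J where "J n = {t<..<t + (b - t) / Suc n}" for n :: nat
  have J_b: "t < t + (b - t) / Suc n" "t + (b - t) / Suc n \<le> b" for n
    using tb mult_left_mono[of 1 "real (Suc n)" "b - t"] by (auto simp: field_simps)
  have 1: "\<exists>n. \<forall>s\<in>J n. d (c s) (c t) < e" if c: "c \<in> BV a b Z d" and e: "e > 0" for c e
  proof -
    obtain v where v: "v > t" "\<And>s. t < s \<Longrightarrow> s < v \<Longrightarrow> d (c s) (c t) < e"
      using order_tendstoD(2)[OF BV_right[OF c tb] e] unfolding eventually_at_right_field by blast
    obtain n where "1 / real (Suc n) < (v - t) / (b - t)" using nat_approx_posE[of "(v - t) / (b - t)"] v tb by auto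
    then have "(b - t) / Suc n < v - t" using tb by (simp add: field_simps)
    then show ?thesis using v(2) by (intro exI[of _ n]) (auto simp: J_def)
  qed
  have 2: "\<exists>s :: nat \<Rightarrow> real. (\<forall>j. s j \<in> A \<inter> J n) \<and> (\<lambda>j. d (c (s j)) (c t)) \<longlonglongrightarrow> 0"
    if c: "c \<in> BV a b Z d" and A: "dense_in a b A" for c n A
    using approx_right[OF c A tb(1) J_b[of n], of c] by (auto simp: J_def)
  show ?thesis
    by (intro exI[of _ J] conjI allI ballI impI 1 2) (use tb(1) J_b J_def in blast)
next
  case True
  define J where "J n = {b - (b - a) / Suc n<..<b}" for n :: nat
  have J_b: "a \<le> b - (b - a) / Suc n" "b - (b - a) / Suc n < b" for n
    using ab mult_left_mono[of 1 "real (Suc n)" "b - a"] by (auto simp: field_simps)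
  have 1: "\<exists>n. \<forall>s\<in>J n. d (c s) (c t) < e" if c: "c \<in> BV a b Z d" and e: "e > 0" for c e
  proof -
    obtain v where v: "v < b" "\<And>s. v < s \<Longrightarrow> s < b \<Longrightarrow> d (c s) (c b) < e"
      using order_tendstoD(2)[OF BV_left[OF c] e] unfolding eventually_at_left_field by blast
    obtain n where "1 / real (Suc n) < (b - v) / (b - a)" using nat_approx_posE[of "(b - v) / (b - a)"] v ab by auto
    then have "(b - a) / Suc n < b - v" using ab by (simp add: field_simps)
    then show ?thesis using v(2) True by (intro exI[of _ n]) (auto simp: J_def)
  qed
  have 2: "\<exists>s :: nat \<Rightarrow> real. (\<forall>j. s j \<in> A \<inter> J n) \<and> (\<lambda>j. d (c (s j)) (c t)) \<longlonglongrightarrow> 0"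
    if c: "c \<in> BV a b Z d" and A: "dense_in a b A" for c n A
  proof -
    obtain s :: "nat \<Rightarrow> real" where "\<And>j. s j \<in> A \<inter> J n" "filterlim s (at_left b) sequentially"
      using dense_in_seq_left[OF A J_b(1,2)[of n] order_refl] by (auto simp: J_def)
    then show ?thesis using filterlim_compose[OF BV_left[OF c]] True by blast
  qed
  show ?thesis
    by (intro exI[of _ J] conjI allI ballI impI 1 2) (use ab J_b J_def in blast)
qed

text \<open>Evaluation is not continuous for \<^const>\<open>BV_dist\<close>, but
  \<^term>\<open>d (c t) z < r\<close> says that on a one-sided window at \<^term>\<open>t\<close> the part of \<^term>\<open>d (c s) z\<close> above
  some rational below \<^term>\<open>r\<close> has integral \<open>0\<close>, and this integral is a Lipschitz function of \<^term>\<open>c\<close>.\<close>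

lemma sep_meas_eval:
  assumes f: "sep_meas M (BV a b Z d) (BV_dist a b d) f" and t: "t \<in> {a..b}"
  shows "sep_meas M Z d (\<lambda>x. f x t)"
proof -
  obtain J :: "nat \<Rightarrow> real set" where J: "\<And>n. \<exists>u v. a \<le> u \<and> u < v \<and> v \<le> b \<and> J n = {u<..<v}"
    and J1: "\<And>c e. c \<in> BV a b Z d \<Longrightarrow> e > 0 \<Longrightarrow> \<exists>n. \<forall>s\<in>J n. d (c s) (c t) < e"
    and J2: "\<And>c n A. c \<in> BV a b Z d \<Longrightarrow> dense_in a b A \<Longrightarrow>
      \<exists>s :: nat \<Rightarrow> real. (\<forall>j. s j \<in> A \<inter> J n) \<and> (\<lambda>j. d (c (s j)) (c t)) \<longlonglongrightarrow> 0"
    using eval_windows[OF t] by metis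
  have J_sub: "J n \<subseteq> {a..b}" and J_meas: "J n \<in> sets (leb_I a b)" and J_pos: "emeasure (leb_I a b) (J n) > 0" for n
  proof -
    obtain u v where uv: "a \<le> u" "u < v" "v \<le> b" "J n = {u<..<v}" using J by blast
    then show "J n \<subseteq> {a..b}" by auto
    then show "J n \<in> sets (leb_I a b)" using uv(4) by (simp add: sets_restrict_space_iff)
    have "emeasure (leb_I a b) (J n) = emeasure lborel {u<..<v}"
      using \<open>J n \<subseteq> {a..b}\<close> uv(4) by (subst emeasure_restrict_space) auto
    then show "emeasure (leb_I a b) (J n) > 0" using uv by simp
  qed
  have fB: "f x \<in> BV a b Z d" if "x \<in> space M" for x using sep_measD(1)[OF f that] .
  have meas: "(\<lambda>x. d (f x t) z) \<in> borel_measurable M" if z: "z \<in> Z" for z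
  proof -
    define \<psi> where "\<psi> n q c s = ennreal (d (c s) z - q) * indicator (J n) s" for n :: nat and q :: real and c :: "real \<Rightarrow> 'z" and s
    define \<phi> where "\<phi> n q c = enn2real (\<integral>\<^sup>+ s. \<psi> n q c s \<partial>leb_I a b)" for n :: nat and q :: real and c :: "real \<Rightarrow> 'z"
    have \<psi>m: "\<psi> n q c \<in> borel_measurable (leb_I a b)" if c: "c \<in> BV a b Z d" for n q c
    proof -
      note [measurable] = sep_measD(2)[OF sep_meas_BV(1)[OF c] z] J_meas
      show ?thesis unfolding \<psi>_def[abs_def] by measurable
    qed
    have fin: "(\<integral>\<^sup>+ s. \<psi> n q c s \<partial>leb_I a b) < \<infinity>" if c: "c \<in> BV a b Z d" for n q c
    proof -
      define C where "C = enn2real (Var d c {a..b}) + d (c a) z + \<bar>q\<bar>"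
      have bd: "d (c s) z - q \<le> C" if s: "s \<in> {a..b}" for s
      proof -
        have "d (c s) z \<le> d (c s) (c a) + d (c a) z"
          by (rule triangle) (use BV_mem[OF c] s ab z in auto)
        moreover have "d (c s) (c a) \<le> enn2real (Var d c {a..b})"
          by (rule BV_dist_le(2)[OF c s]) (use ab in auto)
        ultimately show ?thesis unfolding C_def by linarith
      qed
      have "(\<integral>\<^sup>+ s. \<psi> n q c s \<partial>leb_I a b) \<le> (\<integral>\<^sup>+ s. ennreal C \<partial>leb_I a b)"
        by (rule nn_integral_mono) (use bd in \<open>auto simp: \<psi>_def indicator_def intro!: ennreal_leI\<close>)
      also have "\<dots> < \<infinity>" unfolding nn_integral_leb_I_const by (simp add: ennreal_mult_less_top)
      finally show ?thesis .
    qed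
    have lip: "\<phi> n q c \<le> \<phi> n q c' + BV_dist a b d c c'" if c: "c \<in> BV a b Z d" "c' \<in> BV a b Z d" for n q c c'
    proof -
      have fd: "(\<integral>\<^sup>+ s. ennreal (d (c s) (c' s)) \<partial>leb_I a b) < \<infinity>" by (rule I.nn_finite[OF BV_int1 BV_int1, OF c])
      have "(\<integral>\<^sup>+ s. \<psi> n q c s \<partial>leb_I a b) \<le> (\<integral>\<^sup>+ s. \<psi> n q c' s + ennreal (d (c s) (c' s)) \<partial>leb_I a b)"
      proof (rule nn_integral_mono)
        fix s assume "s \<in> space (leb_I a b)"
        then have "d (c s) z \<le> d (c s) (c' s) + d (c' s) z"
          by (intro triangle) (use BV_mem[OF c(1)] BV_mem[OF c(2)] z in auto)
        then have "ennreal (d (c s) z - q) \<le> ennreal (max 0 (d (c' s) z - q) + d (c s) (c' s))"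
          by (intro ennreal_leI) auto
        also have "\<dots> = ennreal (d (c' s) z - q) + ennreal (d (c s) (c' s))"
          by (simp add: ennreal_plus max_def ennreal_neg)
        finally show "\<psi> n q c s \<le> \<psi> n q c' s + ennreal (d (c s) (c' s))"
          by (auto simp: \<psi>_def indicator_def)
      qed
      also have "\<dots> = (\<integral>\<^sup>+ s. \<psi> n q c' s \<partial>leb_I a b) + (\<integral>\<^sup>+ s. ennreal (d (c s) (c' s)) \<partial>leb_I a b)"
        using sep_meas_dist[OF sep_meas_BV(1)[OF c(1)] sep_meas_BV(1)[OF c(2)]]
        by (intro nn_integral_add \<psi>m c) measurable
      finally have "\<phi> n q c \<le> enn2real ((\<integral>\<^sup>+ s. \<psi> n q c' s \<partial>leb_I a b) + (\<integral>\<^sup>+ s. ennreal (d (c s) (c' s)) \<partial>leb_I a b))"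
        unfolding \<phi>_def using fin[OF c(2)] fd by (intro enn2real_mono) (auto simp: ennreal_add_less_top)
      also have "\<dots> = \<phi> n q c' + BV_dist a b d c c'"
        unfolding \<phi>_def BV_dist_def using fin[OF c(2)] fd by (intro enn2real_plus) auto
      finally show ?thesis .
    qed
    have key: "d (c t) z < r \<longleftrightarrow> (\<exists>n. \<exists>q\<in>\<rat>. q < r \<and> \<phi> n q c = 0)" if c: "c \<in> BV a b Z d" for c r
    proof
      assume r: "d (c t) z < r"
      obtain q where q: "q \<in> \<rat>" "d (c t) z < q" "q < r" using Rats_dense_in_real[OF r] by auto
      obtain n where n: "\<And>s. s \<in> J n \<Longrightarrow> d (c s) (c t) < q - d (c t) z" using J1[OF c, of "q - d (c t) z"] q by auto
      have "\<psi> n q c s = 0" for s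
      proof (cases "s \<in> J n")
        case True
        then have "s \<in> {a..b}" using J_sub by blast
        then have "d (c s) z \<le> d (c s) (c t) + d (c t) z"
          by (intro triangle) (use BV_mem[OF c] t z in auto)
        then have "d (c s) z - q \<le> 0" using n[OF True] by linarith
        then show ?thesis by (simp add: \<psi>_def ennreal_neg)
      qed (simp add: \<psi>_def)
      then have "\<phi> n q c = 0" by (simp add: \<phi>_def)
      then show "\<exists>n. \<exists>q\<in>\<rat>. q < r \<and> \<phi> n q c = 0" using q by blast
    next
      assume "\<exists>n. \<exists>q\<in>\<rat>. q < r \<and> \<phi> n q c = 0"
      then obtain n q where q: "q < r" "\<phi> n q c = 0" by blast
      then have "(\<integral>\<^sup>+ s. \<psi> n q c s \<partial>leb_I a b) = 0" using fin[OF c, of n q] by (auto simp: \<phi>_def enn2real_eq_0_iff)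
      \<comment> \<open>The vanishing integral gives d(c s, z) \<le> q at almost every
        \<open>s\<close> in the window; a sequence of such \<open>s\<close> carries the bound over
        to \<open>c t\<close>.\<close>
      then have "AE s in leb_I a b. \<psi> n q c s = 0" by (subst (asm) nn_integral_0_iff_AE[OF \<psi>m[OF c]])
      then have "dense_in a b {s \<in> {a..b}. \<psi> n q c s = 0}" by (rule AE_dense_in)
      from J2[OF c this, of n] obtain s :: "nat \<Rightarrow> real"
        where s: "\<And>j. s j \<in> J n" "\<And>j. \<psi> n q c (s j) = 0" "\<And>j. s j \<in> {a..b}" "(\<lambda>j. d (c (s j)) (c t)) \<longlonglongrightarrow> 0"
        by auto
      have "d (c (s j)) z \<le> q" for j using s(1,2)[of j] by (simp add: \<psi>_def ennreal_eq_0_iff)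
      moreover have "(\<lambda>j. d (c (s j)) z) \<longlonglongrightarrow> d (c t) z"
        by (rule dist_tendsto[OF s(4)]) (use BV_mem[OF c] s(3) t z in auto)
      ultimately have "d (c t) z \<le> q" by (intro LIMSEQ_le_const2) auto
      then show "d (c t) z < r" using q by simp
    qed
    have \<phi>m: "(\<lambda>x. \<phi> n q (f x)) \<in> borel_measurable M" for n q
      by (rule B.sep_meas_lipschitz[OF f lip])
    show ?thesis
      unfolding borel_measurable_iff_less
    proof
      fix r
      have "{x \<in> space M. d (f x t) z < r} = (\<Union>n. \<Union>q\<in>{q \<in> \<rat>. q < r}. {x \<in> space M. \<phi> n q (f x) = 0})"
      proof -
        have "{x \<in> space M. d (f x t) z < r} = {x \<in> space M. \<exists>n. \<exists>q\<in>\<rat>. q < r \<and> \<phi> n q (f x) = 0}"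
          using key[OF fB] by (intro Collect_cong conj_cong refl)
        also have "\<dots> = (\<Union>n. \<Union>q\<in>{q \<in> \<rat>. q < r}. {x \<in> space M. \<phi> n q (f x) = 0})" by blast
        finally show ?thesis .
      qed
      also have "\<dots> \<in> sets M"
      proof (intro sets.countable_nat_UN subsetI, elim imageE, simp only:, intro sets.countable_UN'')
        show "countable {q \<in> \<rat>. q < r}" using countable_rat by (rule countable_subset[rotated]) auto
        show "{x \<in> space M. \<phi> n q (f x) = 0} \<in> sets M" for n q using \<phi>m[of n q] by measurable
      qed
      finally show "{x \<in> space M. d (f x t) z < r} \<in> sets M" .
    qed
  qed
  \<comment> \<open>For separability, a countable set of curves dense near the range of
    \<open>f\<close> is replaced by countable sets dense near the ranges of these curves; their
    union is dense near all values \<open>f x t\<close>.\<close>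
  obtain D where D: "countable D" "D \<subseteq> BV a b Z d"
    "\<And>x e. x \<in> space M \<Longrightarrow> e > 0 \<Longrightarrow> \<exists>c\<in>D. BV_dist a b d (f x) c < e"
    using B.sep_meas_dense[OF f] by metis
  have "\<exists>W. countable W \<and> W \<subseteq> Z \<and> (\<forall>s\<in>{a..b}. \<forall>e>0. \<exists>w\<in>W. d (c s) w < e)" if "c \<in> D" for c
  proof -
    have "c \<in> BV a b Z d" using D(2) that by blast
    from sep_meas_dense[OF sep_meas_BV(1)[OF this]] show ?thesis by auto
  qed
  then obtain W where W: "\<And>c. c \<in> D \<Longrightarrow> countable (W c)" "\<And>c. c \<in> D \<Longrightarrow> W c \<subseteq> Z"
    "\<And>c s e. c \<in> D \<Longrightarrow> s \<in> {a..b} \<Longrightarrow> e > 0 \<Longrightarrow> \<exists>w\<in>W c. d (c s) w < e" by metis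
  show ?thesis
  proof (rule sep_meas_from_dense[of _ _ "\<Union>c\<in>D. W c"])
    show "(\<lambda>x. f x t) \<in> space M \<rightarrow> Z" using BV_mem[OF fB] t by auto
    show "countable (\<Union>c\<in>D. W c)" using D(1) W(1) by blast
    show "(\<Union>c\<in>D. W c) \<subseteq> Z" using W(2) by blast
    show "(\<lambda>x. d (f x t) z) \<in> borel_measurable M" if "z \<in> (\<Union>c\<in>D. W c)" for z
      by (rule meas) (use W(2) that in blast)
    fix x and e :: real assume x: "x \<in> space M" and e: "e > 0"
    obtain n where n: "\<And>s. s \<in> J n \<Longrightarrow> d (f x s) (f x t) < e/3" using J1[OF fB[OF x], of "e/3"] e by auto
    define m where "m = enn2real (emeasure (leb_I a b) (J n))"
    have "emeasure (leb_I a b) (J n) \<le> emeasure (leb_I a b) {a..b}"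
      using J_sub by (intro emeasure_mono) (auto simp: sets_restrict_space_iff)
    then have fin: "emeasure (leb_I a b) (J n) < \<infinity>" using ab by (simp add: emeasure_leb_I le_less_trans)
    then have m: "ennreal m = emeasure (leb_I a b) (J n)" "m > 0"
      using J_pos[of n] by (auto simp: m_def enn2real_positive_iff)
    \<comment> \<open>By Chebyshev's inequality: if the distance to \<open>c\<close> were at least
      e/3 throughout the window, whose measure is \<open>m\<close>, the integral would be at least
      \<open>e / 3 * m\<close>.\<close>
    obtain c where c: "c \<in> D" "BV_dist a b d (f x) c < e / 3 * m" using D(3)[OF x, of "e / 3 * m"] e m by auto
    have cB: "c \<in> BV a b Z d" using c D by auto
    have "\<exists>s\<in>J n. d (f x s) (c s) < e/3"
    proof (rule ccontr)
      assume "\<not> (\<exists>s\<in>J n. d (f x s) (c s) < e/3)"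
      then have *: "e/3 \<le> d (f x s) (c s)" if "s \<in> J n" for s using that by auto
      have "ennreal (e / 3 * m) = ennreal (e/3) * ennreal m" by (rule ennreal_mult) (use e m in auto)
      also have "\<dots> = (\<integral>\<^sup>+ s. ennreal (e/3) * indicator (J n) s \<partial>leb_I a b)"
        unfolding m(1) by (rule nn_integral_cmult_indicator[OF J_meas, symmetric])
      also have "\<dots> \<le> (\<integral>\<^sup>+ s. ennreal (d (f x s) (c s)) \<partial>leb_I a b)"
        by (intro nn_integral_mono) (use * in \<open>auto simp: indicator_def intro!: ennreal_leI\<close>)
      also have "\<dots> = ennreal (BV_dist a b d (f x) c)"
        unfolding BV_dist_def using I.nn_finite[OF BV_int1 BV_int1, OF fB[OF x] cB] by simp
      finally show False using c(2) by (simp add: BV_dist_def)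
    qed
    then obtain s where s: "s \<in> J n" "d (f x s) (c s) < e/3" by blast
    then have sI: "s \<in> {a..b}" using J_sub by blast
    obtain w where w: "w \<in> W c" "d (c s) w < e/3" using W(3)[OF c(1) sI, of "e/3"] e by auto
    have mem: "f x t \<in> Z" "f x s \<in> Z" "c s \<in> Z" "w \<in> Z"
      using BV_mem[OF fB[OF x] t] BV_mem[OF fB[OF x] sI] BV_mem[OF cB sI] w(1) W(2)[OF c(1)] by auto
    have "d (f x t) w \<le> d (f x t) (f x s) + (d (f x s) (c s) + d (c s) w)"
      using triangle[OF mem(1,2,4)] triangle[OF mem(2,3,4)] by linarith
    also have "\<dots> < e" using n[OF s(1)] s w by (simp add: commute)
    finally show "\<exists>z\<in>\<Union>c\<in>D. W c. d (f x t) z < e" using w c by blast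
  qed
qed

end

section \<open>The Caratheodory product\<close>

definition rect_cover :: "'x measure \<Rightarrow> 'y measure \<Rightarrow> ('x \<times> 'y) set \<Rightarrow> (nat \<Rightarrow> 'x set) \<Rightarrow> (nat \<Rightarrow> 'y set) \<Rightarrow> bool" where
  "rect_cover X Y E A B \<longleftrightarrow> range A \<subseteq> sets X \<and> range B \<subseteq> sets Y \<and> E \<subseteq> (\<Union>i. A i \<times> B i)"

definition rect_cost :: "'x measure \<Rightarrow> 'y measure \<Rightarrow> (nat \<Rightarrow> 'x set) \<Rightarrow> (nat \<Rightarrow> 'y set) \<Rightarrow> ennreal" where
  "rect_cost X Y A B = (\<Sum>i. emeasure X (A i) * emeasure Y (B i))"

lemma rect_outer_alt: "rect_outer X Y E = (INF (A, B) \<in> {(A, B). rect_cover X Y E A B}. rect_cost X Y A B)"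
  by (simp add: rect_outer_def rect_cover_def rect_cost_def)

lemma rect_outer_lower: "rect_cover X Y E A B \<Longrightarrow> rect_outer X Y E \<le> rect_cost X Y A B"
  unfolding rect_outer_alt by (rule INF_lower2[of "(A, B)"]) auto

lemma rect_outer_greatest:
  "(\<And>A B. rect_cover X Y E A B \<Longrightarrow> c \<le> rect_cost X Y A B) \<Longrightarrow> c \<le> rect_outer X Y E"
  unfolding rect_outer_alt by (rule INF_greatest) auto

lemma rect_outer_less:
  assumes "rect_outer X Y E < c"
  shows "\<exists>A B. rect_cover X Y E A B \<and> rect_cost X Y A B < c"
  using assms unfolding rect_outer_alt by (auto simp: INF_less_iff)

lemma rect_coverD:
  assumes "rect_cover X Y E A B"
  shows "A i \<in> sets X" "B i \<in> sets Y" "E \<subseteq> (\<Union>i. A i \<times> B i)"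
  using assms by (auto simp: rect_cover_def)

lemma rect_outer_mono: "E \<subseteq> F \<Longrightarrow> rect_outer X Y E \<le> rect_outer X Y F"
  by (rule rect_outer_greatest, rule rect_outer_lower) (auto simp: rect_cover_def)

lemma rect_outer_rect_le:
  assumes "A \<in> sets X" "B \<in> sets Y"
  shows "rect_outer X Y (A \<times> B) \<le> emeasure X A * emeasure Y B"
proof -
  let ?A = "\<lambda>i::nat. if i = 0 then A else {}" and ?B = "\<lambda>i::nat. if i = 0 then B else {}"
  have "rect_cover X Y (A \<times> B) ?A ?B" using assms by (auto simp: rect_cover_def)
  from rect_outer_lower[OF this] have "rect_outer X Y (A \<times> B) \<le> rect_cost X Y ?A ?B" .
  also have "rect_cost X Y ?A ?B = (\<Sum>i\<in>{0}. emeasure X (?A i) * emeasure Y (?B i))"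
    unfolding rect_cost_def by (rule suminf_finite) auto
  finally show ?thesis by simp
qed

lemma rect_outer_empty: "rect_outer X Y {} = 0"
  using rect_outer_rect_le[of "{}" X "{}" Y] by simp

lemma rect_outer_countably_subadditive:
  "rect_outer X Y (\<Union>i. E i) \<le> (\<Sum>i. rect_outer X Y (E i :: ('x \<times> 'y) set))"
proof (rule ennreal_le_epsilon)
  fix e :: real assume fin: "(\<Sum>i. rect_outer X Y (E i)) < top" and e: "0 < e"
  have "rect_outer X Y (E i) < rect_outer X Y (E i) + ennreal (e * (1/2) ^ Suc i)" for i
  proof -
    have "rect_outer X Y (E i) < top"
      using fin by (rule ennreal_suminf_lessD)
    moreover have "0 < ennreal (e * (1/2) ^ Suc i)" using e by simp
    ultimately show ?thesis
      using ennreal_add_left_cancel_less[of "rect_outer X Y (E i)" 0 "ennreal (e * (1/2) ^ Suc i)"] by simp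
  qed
  then have "\<exists>A B. rect_cover X Y (E i) A B \<and> rect_cost X Y A B < rect_outer X Y (E i) + ennreal (e * (1/2) ^ Suc i)" for i
    by (rule rect_outer_less)
  then obtain A B where AB: "\<And>i. rect_cover X Y (E i) (A i) (B i)"
    "\<And>i. rect_cost X Y (A i) (B i) < rect_outer X Y (E i) + ennreal (e * (1/2) ^ Suc i)" by metis
  define A' where "A' k = case_prod A (prod_decode k)" for k
  define B' where "B' k = case_prod B (prod_decode k)" for k
  have "rect_cover X Y (\<Union>i. E i) A' B'"
    unfolding rect_cover_def
  proof (intro conjI)
    show "range A' \<subseteq> sets X" "range B' \<subseteq> sets Y"
      using rect_coverD(1,2)[OF AB(1)] by (auto simp: A'_def B'_def split: prod.split)
    show "(\<Union>i. E i) \<subseteq> (\<Union>k. A' k \<times> B' k)"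
    proof
      fix p assume "p \<in> (\<Union>i. E i)"
      then obtain i j where "p \<in> A i j \<times> B i j" using rect_coverD(3)[OF AB(1)] by blast
      then have "p \<in> A' (prod_encode (i, j)) \<times> B' (prod_encode (i, j))" by (simp add: A'_def B'_def)
      then show "p \<in> (\<Union>k. A' k \<times> B' k)" by blast
    qed
  qed
  then have "rect_outer X Y (\<Union>i. E i) \<le> rect_cost X Y A' B'" by (rule rect_outer_lower)
  also have "rect_cost X Y A' B' = (\<Sum>k. (\<lambda>(i, j). emeasure X (A i j) * emeasure Y (B i j)) (prod_decode k))"
    unfolding rect_cost_def A'_def B'_def by (simp add: case_prod_beta)
  also have "\<dots> = (\<Sum>i. rect_cost X Y (A i) (B i))"
    by (rule suminf_ennreal_2dimen) (simp add: rect_cost_def)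
  also have "\<dots> \<le> (\<Sum>i. rect_outer X Y (E i) + ennreal (e * (1/2) ^ Suc i))"
    using AB(2) by (intro suminf_le less_imp_le) auto
  also have "\<dots> = (\<Sum>i. rect_outer X Y (E i)) + (\<Sum>i. ennreal (e * (1/2) ^ Suc i))"
    by (rule suminf_add[symmetric]) auto
  also have "(\<Sum>i. ennreal (e * (1/2) ^ Suc i)) = ennreal e"
    using sums_mult[OF power_half_series, of e] e by (intro suminf_ennreal_eq) auto
  finally show "rect_outer X Y (\<Union>i. E i) \<le> (\<Sum>i. rect_outer X Y (E i)) + ennreal e" .
qed

lemma rect_outer_Un: "rect_outer X Y (E \<union> F) \<le> rect_outer X Y E + rect_outer X Y F"
proof -
  define C where "C i = (if i = 0 then E else if i = 1 then F else {})" for i :: nat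
  have "E = C 0" "F = C 1" by (simp_all add: C_def)
  then have "E \<union> F \<subseteq> (\<Union>i. C i)" by blast
  then have "rect_outer X Y (E \<union> F) \<le> (\<Sum>i. rect_outer X Y (C i))"
    by (rule order_trans[OF rect_outer_mono rect_outer_countably_subadditive])
  also have "\<dots> = (\<Sum>i\<in>{0,1}. rect_outer X Y (C i))"
    by (rule suminf_finite) (auto simp: C_def rect_outer_empty)
  finally show ?thesis by (simp add: C_def)
qed

lemma rect_outer_measure: "outer_measure_space (Pow \<Omega>) (rect_outer X Y)"
  unfolding outer_measure_space_def positive_def increasing_def countably_subadditive_def
  by (auto simp: rect_outer_empty rect_outer_mono rect_outer_countably_subadditive)

section \<open>The measure generated by the outer measure of rectangle covers\<close>

context
  fixes X :: "'x measure" and Y :: "'y measure"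
begin

private abbreviation (input) "\<Omega> \<equiv> space X \<times> space Y"
private abbreviation (input) "P \<equiv> caratheodory_prod X Y"

lemma caratheodory_measure_space: "measure_space \<Omega> (lambda_system \<Omega> (Pow \<Omega>) (rect_outer X Y)) (rect_outer X Y)"
  by (rule sigma_algebra.caratheodory_lemma[OF sigma_algebra_Pow rect_outer_measure])

lemma sets_caratheodory: "sets P = lambda_system \<Omega> (Pow \<Omega>) (rect_outer X Y)"
  and space_caratheodory: "space P = \<Omega>"
proof -
  have sub: "lambda_system \<Omega> (Pow \<Omega>) (rect_outer X Y) \<subseteq> Pow \<Omega>" by (auto simp: lambda_system_def)
  then show "space P = \<Omega>" unfolding caratheodory_prod_def Let_def by (rule space_measure_of)
  show "sets P = lambda_system \<Omega> (Pow \<Omega>) (rect_outer X Y)"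
    unfolding caratheodory_prod_def Let_def sets_measure_of[OF sub]
    using caratheodory_measure_space by (simp add: measure_space_def sigma_algebra.sigma_sets_eq)
qed

lemma emeasure_caratheodory: "E \<in> sets P \<Longrightarrow> emeasure P E = rect_outer X Y E"
proof -
  assume E: "E \<in> sets P"
  have P: "P = measure_of \<Omega> (sets P) (rect_outer X Y)"
    unfolding sets_caratheodory by (simp add: caratheodory_prod_def Let_def)
  show "emeasure P E = rect_outer X Y E"
  proof (subst P, rule emeasure_measure_of_sigma[OF _ _ _ E])
    have "measure_space \<Omega> (sets P) (rect_outer X Y)"
      using caratheodory_measure_space by (simp add: sets_caratheodory)
    then show "sigma_algebra \<Omega> (sets P)" "positive (sets P) (rect_outer X Y)"
      "countably_additive (sets P) (rect_outer X Y)"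
      by (simp_all add: measure_space_def)
  qed
qed

lemma caratheodory_setsI:
  assumes "E \<subseteq> \<Omega>" "\<And>F. F \<subseteq> \<Omega> \<Longrightarrow> rect_outer X Y (F \<inter> E) + rect_outer X Y (F - E) \<le> rect_outer X Y F"
  shows "E \<in> sets P"
  unfolding sets_caratheodory lambda_system_def
proof (intro CollectI conjI ballI)
  show "E \<in> Pow \<Omega>" using assms by auto
  fix F assume "F \<in> Pow \<Omega>"
  then have F: "F \<subseteq> \<Omega>" by auto
  have eq: "(\<Omega> - E) \<inter> F = F - E" using F by blast
  have "rect_outer X Y F \<le> rect_outer X Y (F \<inter> E) + rect_outer X Y (F - E)"
    using rect_outer_Un[of X Y "F \<inter> E" "F - E"] by (simp add: Int_Diff_Un)
  then show "rect_outer X Y (E \<inter> F) + rect_outer X Y ((\<Omega> - E) \<inter> F) = rect_outer X Y F"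
    unfolding eq by (subst Int_commute) (rule antisym[OF assms(2)[OF F]])
qed

lemma rect_in_caratheodory:
  assumes AB: "A0 \<in> sets X" "B0 \<in> sets Y"
  shows "A0 \<times> B0 \<in> sets P"
proof (rule caratheodory_setsI)
  show "A0 \<times> B0 \<subseteq> \<Omega>" using sets.sets_into_space[OF AB(1)] sets.sets_into_space[OF AB(2)] by blast
  fix F
  show "rect_outer X Y (F \<inter> A0 \<times> B0) + rect_outer X Y (F - A0 \<times> B0) \<le> rect_outer X Y F"
  proof (rule rect_outer_greatest)
    fix A B assume c: "rect_cover X Y F A B"
    note m = rect_coverD(1,2)[OF c]
    \<comment> \<open>Each covering rectangle is cut into three: its part in
      \<open>A0 \<times> B0\<close>, its part over \<open>A0\<close> off \<open>B0\<close>, and its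
      part over the complement of \<open>A0\<close>. The costs of the pieces add up to the original
      cost.\<close>
    have 1: "rect_outer X Y (F \<inter> A0 \<times> B0) \<le> rect_cost X Y (\<lambda>i. A i \<inter> A0) (\<lambda>i. B i \<inter> B0)"
      by (rule rect_outer_lower) (use c AB in \<open>auto simp: rect_cover_def\<close>)
    have 2: "rect_outer X Y (F \<inter> A0 \<times> (- B0)) \<le> rect_cost X Y (\<lambda>i. A i \<inter> A0) (\<lambda>i. B i - B0)"
      by (rule rect_outer_lower) (use c AB in \<open>auto simp: rect_cover_def\<close>)
    have 3: "rect_outer X Y (F \<inter> (- A0) \<times> UNIV) \<le> rect_cost X Y (\<lambda>i. A i - A0) (\<lambda>i. B i)"
      by (rule rect_outer_lower) (use c AB in \<open>auto simp: rect_cover_def\<close>)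
    have "F - A0 \<times> B0 \<subseteq> (F \<inter> A0 \<times> (- B0)) \<union> (F \<inter> (- A0) \<times> UNIV)" by auto
    then have 4: "rect_outer X Y (F - A0 \<times> B0) \<le> rect_outer X Y (F \<inter> A0 \<times> (- B0)) + rect_outer X Y (F \<inter> (- A0) \<times> UNIV)"
      by (rule order_trans[OF rect_outer_mono rect_outer_Un])
    have "emeasure X (A i) * emeasure Y (B i) = emeasure X (A i \<inter> A0) * emeasure Y (B i \<inter> B0)
        + (emeasure X (A i \<inter> A0) * emeasure Y (B i - B0) + emeasure X (A i - A0) * emeasure Y (B i))" for i
    proof -
      have "emeasure X (A i) = emeasure X (A i \<inter> A0) + emeasure X (A i - A0)"
        using plus_emeasure[of "A i \<inter> A0" X "A i - A0"] m AB by (simp add: Int_Diff_Un Int_Diff_disjoint)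
      moreover have "emeasure Y (B i) = emeasure Y (B i \<inter> B0) + emeasure Y (B i - B0)"
        using plus_emeasure[of "B i \<inter> B0" Y "B i - B0"] m AB by (simp add: Int_Diff_Un Int_Diff_disjoint)
      ultimately show ?thesis by (metis (no_types, lifting) add.assoc distrib_left distrib_right)
    qed
    then have "rect_cost X Y A B = rect_cost X Y (\<lambda>i. A i \<inter> A0) (\<lambda>i. B i \<inter> B0)
        + (rect_cost X Y (\<lambda>i. A i \<inter> A0) (\<lambda>i. B i - B0) + rect_cost X Y (\<lambda>i. A i - A0) (\<lambda>i. B i))"
      unfolding rect_cost_def by (simp add: suminf_add)
    then show "rect_outer X Y (F \<inter> A0 \<times> B0) + rect_outer X Y (F - A0 \<times> B0) \<le> rect_cost X Y A B"
      using add_mono[OF 1 order_trans[OF 4 add_mono[OF 2 3]]] by simp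
  qed
qed

lemma pair_sets_subset: "sets (X \<Otimes>\<^sub>M Y) \<subseteq> sets P"
proof -
  have "sigma_sets \<Omega> {A \<times> B |A B. A \<in> sets X \<and> B \<in> sets Y} \<subseteq> sets P"
    using sets.sigma_sets_subset[of "{A \<times> B |A B. A \<in> sets X \<and> B \<in> sets Y}" P] rect_in_caratheodory
    by (auto simp: space_caratheodory)
  then show ?thesis by (simp add: sets_pair_measure)
qed

lemma measurable_pair_caratheodory: "f \<in> measurable (X \<Otimes>\<^sub>M Y) K \<Longrightarrow> f \<in> measurable P K"
  using pair_sets_subset by (auto simp: measurable_def space_caratheodory space_pair_measure)

text \<open>For the lower bound a cover is fixed. Its section at any \<open>t\<close> in
  \<open>A0\<close> covers \<open>B0\<close>, so \<open>emeasure Y B0\<close> is at most the sum of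
  the \<open>emeasure Y (B i)\<close> with \<open>t\<close> in \<open>A i\<close>; integrating over
  \<open>t\<close> gives the cost.\<close>

lemma emeasure_caratheodory_rect:
  assumes AB: "A0 \<in> sets X" "B0 \<in> sets Y"
  shows "emeasure P (A0 \<times> B0) = emeasure X A0 * emeasure Y B0"
proof (rule antisym)
  have eq: "emeasure P (A0 \<times> B0) = rect_outer X Y (A0 \<times> B0)"
    by (rule emeasure_caratheodory[OF rect_in_caratheodory[OF AB]])
  show "emeasure P (A0 \<times> B0) \<le> emeasure X A0 * emeasure Y B0"
    unfolding eq by (rule rect_outer_rect_le[OF AB])
  show "emeasure X A0 * emeasure Y B0 \<le> emeasure P (A0 \<times> B0)"
    unfolding eq
  proof (rule rect_outer_greatest)
    fix A B assume c: "rect_cover X Y (A0 \<times> B0) A B"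
    note m = rect_coverD(1,2)[OF c]
    have "emeasure X A0 * emeasure Y B0 = (\<integral>\<^sup>+ t. emeasure Y B0 * indicator A0 t \<partial>X)"
      by (subst nn_integral_cmult_indicator[OF AB(1)]) (rule mult.commute)
    also have "\<dots> \<le> (\<integral>\<^sup>+ t. (\<Sum>i. emeasure Y (B i) * indicator (A i) t) \<partial>X)"
    proof (rule nn_integral_mono)
      fix t
      show "emeasure Y B0 * indicator A0 t \<le> (\<Sum>i. emeasure Y (B i) * indicator (A i) t)"
      proof (cases "t \<in> A0")
        case True
        define C where "C i = (if t \<in> A i then B i else {})" for i
        have C: "range C \<subseteq> sets Y" using m by (auto simp: C_def)
        have "B0 \<subseteq> (\<Union>i. C i)"
        proof
          fix x assume "x \<in> B0"
          then obtain i where "(t, x) \<in> A i \<times> B i" using rect_coverD(3)[OF c] True by blast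
          then have "x \<in> C i" by (simp add: C_def)
          then show "x \<in> (\<Union>i. C i)" by blast
        qed
        then have "emeasure Y B0 \<le> emeasure Y (\<Union>i. C i)" using C by (intro emeasure_mono) auto
        also have "\<dots> \<le> (\<Sum>i. emeasure Y (C i))" by (rule emeasure_subadditive_countably[OF C])
        also have "\<dots> = (\<Sum>i. emeasure Y (B i) * indicator (A i) t)"
          by (rule suminf_cong) (simp add: C_def indicator_def)
        finally show ?thesis using True by simp
      qed simp
    qed
    also have "\<dots> = (\<Sum>i. \<integral>\<^sup>+ t. emeasure Y (B i) * indicator (A i) t \<partial>X)"
      by (rule nn_integral_suminf) (use m in measurable)
    also have "\<dots> = rect_cost X Y A B"
      unfolding rect_cost_def
      by (intro suminf_cong, subst nn_integral_cmult_indicator[OF m(1)]) (rule mult.commute)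
    finally show "emeasure X A0 * emeasure Y B0 \<le> rect_cost X Y A B" .
  qed
qed

text \<open>The integral over \<^term>\<open>t\<close> of the total measure of the sections at \<^term>\<open>t\<close> of a cover is the
  cost of the cover, so no finiteness of \<^term>\<open>Y\<close> is needed here.\<close>

lemma rect_outer_null_sections:
  assumes "rect_outer X Y E = 0"
  shows "AE t in X. \<exists>N\<in>null_sets Y. {x. (t, x) \<in> E} \<subseteq> N"
proof -
  have "\<exists>A B. rect_cover X Y E A B \<and> rect_cost X Y A B < ennreal (1 / Suc n)" for n
    by (rule rect_outer_less) (simp add: assms)
  then obtain A B where AB: "\<And>n. rect_cover X Y E (A n) (B n)" "\<And>n. rect_cost X Y (A n) (B n) < ennreal (1 / Suc n)"
    by metis
  note m = rect_coverD(1,2)[OF AB(1)]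
  define G where "G n t = (\<Sum>i. emeasure Y (B n i) * indicator (A n i) t)" for n t
  have Gm: "G n \<in> borel_measurable X" for n unfolding G_def[abs_def] using m by measurable
  have Gint: "(\<integral>\<^sup>+ t. G n t \<partial>X) = rect_cost X Y (A n) (B n)" for n
  proof -
    have "(\<integral>\<^sup>+ t. G n t \<partial>X) = (\<Sum>i. \<integral>\<^sup>+ t. emeasure Y (B n i) * indicator (A n i) t \<partial>X)"
      unfolding G_def by (rule nn_integral_suminf) (use m in measurable)
    also have "\<dots> = rect_cost X Y (A n) (B n)"
      unfolding rect_cost_def
      by (intro suminf_cong, subst nn_integral_cmult_indicator[OF m(1)]) (rule mult.commute)
    finally show ?thesis .
  qed
  have "(\<integral>\<^sup>+ t. (INF n. G n t) \<partial>X) \<le> ennreal (1 / Suc n)" for n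
  proof -
    have "(\<integral>\<^sup>+ t. (INF n. G n t) \<partial>X) \<le> (\<integral>\<^sup>+ t. G n t \<partial>X)" by (intro nn_integral_mono INF_lower) simp
    then show ?thesis using AB(2)[of n] Gint[of n] by simp
  qed
  moreover have "(\<lambda>n. ennreal (1 / Suc n)) \<longlonglongrightarrow> ennreal 0"
    by (intro tendsto_ennrealI) (use LIMSEQ_inverse_real_of_nat in \<open>simp add: inverse_eq_divide\<close>)
  ultimately have "(\<integral>\<^sup>+ t. (INF n. G n t) \<partial>X) \<le> ennreal 0" by (intro LIMSEQ_le_const) auto
  then have "(\<integral>\<^sup>+ t. (INF n. G n t) \<partial>X) = 0" by simp
  then have "AE t in X. (INF n. G n t) = 0"
    using Gm by (subst (asm) nn_integral_0_iff_AE) auto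
  then show ?thesis
  proof (rule AE_mp, intro AE_I2 impI)
    fix t assume z: "(INF n. G n t) = 0"
    define C where "C n i = (if t \<in> A n i then B n i else {})" for n i
    have C: "C n i \<in> sets Y" for n i using m by (auto simp: C_def)
    define N where "N = (\<Inter>n. \<Union>i. C n i)"
    have Nm: "N \<in> sets Y" unfolding N_def using C by auto
    have "emeasure Y N \<le> G n t" for n
    proof -
      have "emeasure Y N \<le> emeasure Y (\<Union>i. C n i)" using C by (intro emeasure_mono) (auto simp: N_def)
      also have "\<dots> \<le> (\<Sum>i. emeasure Y (C n i))" using C by (intro emeasure_subadditive_countably) auto
      also have "\<dots> = G n t" unfolding G_def by (rule suminf_cong) (simp add: C_def indicator_def)
      finally show ?thesis .
    qed
    then have "emeasure Y N \<le> (INF n. G n t)" by (rule INF_greatest)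
    then have "N \<in> null_sets Y" using z Nm by (simp add: null_sets_def)
    moreover have "{x. (t, x) \<in> E} \<subseteq> N"
    proof
      fix x assume "x \<in> {x. (t, x) \<in> E}"
      then have "\<exists>i. (t, x) \<in> A n i \<times> B n i" for n using rect_coverD(3)[OF AB(1), of n] by blast
      then show "x \<in> N" by (auto simp: N_def C_def)
    qed
    ultimately show "\<exists>N\<in>null_sets Y. {x. (t, x) \<in> E} \<subseteq> N" by blast
  qed
qed

text \<open>The hull is the intersection of the unions of covers whose costs exceed the outer
  measure by less than 1/(n+1). It reduces questions on the completed measure to sets of the product
  sigma-algebra.\<close>

lemma caratheodory_hull:
  assumes "rect_outer X Y E < \<infinity>"
  shows "\<exists>G\<in>sets (X \<Otimes>\<^sub>M Y). E \<subseteq> G \<and> emeasure P G = rect_outer X Y E"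
proof -
  have "rect_outer X Y E < rect_outer X Y E + ennreal (1 / Suc n)" for n
    using assms ennreal_add_left_cancel_less[of "rect_outer X Y E" 0 "ennreal (1 / Suc n)"] by simp
  then have "\<exists>A B. rect_cover X Y E A B \<and> rect_cost X Y A B < rect_outer X Y E + ennreal (1 / Suc n)" for n
    by (rule rect_outer_less)
  then obtain A B where AB: "\<And>n. rect_cover X Y E (A n) (B n)"
    "\<And>n. rect_cost X Y (A n) (B n) < rect_outer X Y E + ennreal (1 / Suc n)" by metis
  note m = rect_coverD(1,2)[OF AB(1)]
  define G where "G = (\<Inter>n. \<Union>i. A n i \<times> B n i)"
  have G: "G \<in> sets (X \<Otimes>\<^sub>M Y)" unfolding G_def using m by auto
  then have GP: "emeasure P G = rect_outer X Y G" using pair_sets_subset by (intro emeasure_caratheodory) auto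
  have E: "E \<subseteq> G" unfolding G_def using rect_coverD(3)[OF AB(1)] by blast
  have "rect_outer X Y G \<le> rect_outer X Y E + ennreal (1 / Suc n)" for n
  proof -
    have "rect_cover X Y G (A n) (B n)" unfolding rect_cover_def using m by (auto simp: G_def)
    from order_trans[OF rect_outer_lower[OF this] less_imp_le[OF AB(2)]] show ?thesis .
  qed
  moreover have "(\<lambda>n. rect_outer X Y E + ennreal (1 / Suc n)) \<longlonglongrightarrow> rect_outer X Y E + ennreal 0"
    by (intro tendsto_add tendsto_const tendsto_ennrealI)
      (use LIMSEQ_inverse_real_of_nat in \<open>simp add: inverse_eq_divide\<close>)
  ultimately have "rect_outer X Y G \<le> rect_outer X Y E + ennreal 0" by (intro LIMSEQ_le_const) auto
  then have "rect_outer X Y G \<le> rect_outer X Y E" by simp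
  then have "rect_outer X Y G = rect_outer X Y E" by (rule antisym[OF _ rect_outer_mono[OF E]])
  with GP have "emeasure P G = rect_outer X Y E" by (rule trans)
  with G E show ?thesis by blast
qed

end

section \<open>Exchange of the factors and sections of null sets\<close>

lemma rect_cover_swap:
  assumes c: "rect_cover X Y E A B"
  shows "rect_cover Y X (prod.swap ` E) B A"
  unfolding rect_cover_def
proof (intro conjI subsetI)
  fix p assume "p \<in> prod.swap ` E"
  then have "prod.swap p \<in> E" by auto
  then have "prod.swap p \<in> (\<Union>i. A i \<times> B i)" by (rule subsetD[OF rect_coverD(3)[OF c]])
  then obtain i where "prod.swap p \<in> A i \<times> B i" by (rule UN_E)
  then have "p \<in> B i \<times> A i" by (cases p) simp
  then show "p \<in> (\<Union>i. B i \<times> A i)" by blast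
qed (use rect_coverD(1,2)[OF c] in auto)

lemma rect_outer_swap_le: "rect_outer Y X (prod.swap ` E) \<le> rect_outer X Y E"
proof (rule rect_outer_greatest)
  fix A B assume "rect_cover X Y E A B"
  from rect_outer_lower[OF rect_cover_swap[OF this]]
  show "rect_outer Y X (prod.swap ` E) \<le> rect_cost X Y A B"
    by (simp add: rect_cost_def mult.commute)
qed

text \<open>Null sets of the product have outer measure 0, so almost all their sections are null;
  exchanging the factors of covers gives the other order. Valid for every measure on either factor,
  this makes the sections of a class independent of the representative.\<close>

lemma caratheodory_AE_sections:
  assumes "AE p in caratheodory_prod X Y. Q p"
  shows "AE t in X. AE x in Y. Q (t, x)" "AE x in Y. AE t in X. Q (t, x)"
proof -
  obtain N where N: "N \<in> null_sets (caratheodory_prod X Y)" "{p \<in> space X \<times> space Y. \<not> Q p} \<subseteq> N"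
    using assms by (auto elim!: AE_E simp: null_sets_def space_caratheodory)
  then have o: "rect_outer X Y N = 0" using emeasure_caratheodory[of N X Y] by (auto simp: null_sets_def)
  show "AE t in X. AE x in Y. Q (t, x)"
  proof (rule AE_mp[OF rect_outer_null_sections[OF o]], rule AE_I2, rule impI)
    fix t assume t: "t \<in> space X" and "\<exists>K\<in>null_sets Y. {x. (t, x) \<in> N} \<subseteq> K"
    then obtain K where "K \<in> null_sets Y" "{x. (t, x) \<in> N} \<subseteq> K" by blast
    then show "AE x in Y. Q (t, x)" using N(2) t by (intro AE_I'[of K]) auto
  qed
  have o': "rect_outer Y X (prod.swap ` N) = 0" using o rect_outer_swap_le[of Y X N] by simp
  show "AE x in Y. AE t in X. Q (t, x)"
  proof (rule AE_mp[OF rect_outer_null_sections[OF o']], rule AE_I2, rule impI)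
    fix x assume x: "x \<in> space Y" and "\<exists>K\<in>null_sets X. {t. (x, t) \<in> prod.swap ` N} \<subseteq> K"
    then obtain K where K: "K \<in> null_sets X" "{t. (x, t) \<in> prod.swap ` N} \<subseteq> K" by blast
    have "{t \<in> space X. \<not> Q (t, x)} \<subseteq> {t. (x, t) \<in> prod.swap ` N}"
    proof
      fix t assume "t \<in> {t \<in> space X. \<not> Q (t, x)}"
      then have "(t, x) \<in> N" using N(2) x by auto
      then show "t \<in> {t. (x, t) \<in> prod.swap ` N}" by (intro CollectI image_eqI[of _ _ "(t, x)"]) auto
    qed
    then show "AE t in X. Q (t, x)" using K by (intro AE_I'[of K]) auto
  qed
qed

section \<open>Sets of sigma-finite measure\<close>

definition sfin :: "'y measure \<Rightarrow> 'y set \<Rightarrow> bool" where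
  "sfin Y S \<longleftrightarrow> S \<in> sets Y \<and> (\<exists>C :: nat \<Rightarrow> 'y set. (\<forall>i. C i \<in> sets Y \<and> emeasure Y (C i) < \<infinity>) \<and> S = (\<Union>i. C i))"

lemma sfin_cover:
  fixes Y :: "'y measure"
  assumes "sfin Y S"
  shows "\<exists>C :: nat \<Rightarrow> 'y set. (\<forall>i. C i \<in> sets Y) \<and> (\<forall>i. emeasure Y (C i) < \<infinity>) \<and> S = (\<Union>i. C i)"
  using assms[unfolded sfin_def, THEN conjunct2] by (simp only: all_conj_distrib conj_assoc)

lemma sfin_sets: "sfin Y S \<Longrightarrow> S \<in> sets Y" by (simp add: sfin_def)

lemma sfin_finite: "S \<in> sets Y \<Longrightarrow> emeasure Y S < \<infinity> \<Longrightarrow> sfin Y S"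
  unfolding sfin_def by (intro conjI exI[of _ "\<lambda>_. S"]) auto

lemma sfin_UN:
  assumes "\<And>i::nat. sfin Y (S i)"
  shows "sfin Y (\<Union>i. S i)"
proof -
  have "\<exists>C :: nat \<Rightarrow> 'a set. (\<forall>j. C j \<in> sets Y \<and> emeasure Y (C j) < \<infinity>) \<and> S i = (\<Union>j. C j)" for i
    using assms[of i] by (simp add: sfin_def)
  then obtain C where C: "\<And>i j::nat. C i j \<in> sets Y" "\<And>i j. emeasure Y (C i j) < \<infinity>" "\<And>i. S i = (\<Union>j. C i j)"
    by metis
  have "(\<Union>i. S i) = (\<Union>k. case_prod C (prod_decode k))"
  proof (intro set_eqI iffI)
    fix x assume "x \<in> (\<Union>i. S i)"
    then obtain i j where "x \<in> C i j" unfolding C(3) by auto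
    then have "x \<in> case_prod C (prod_decode (prod_encode (i, j)))" by simp
    then show "x \<in> (\<Union>k. case_prod C (prod_decode k))" by (rule UN_I[OF UNIV_I])
  next
    fix x assume "x \<in> (\<Union>k. case_prod C (prod_decode k))"
    then obtain k where "x \<in> case_prod C (prod_decode k)" by (rule UN_E)
    then have "x \<in> C (fst (prod_decode k)) (snd (prod_decode k))" by (simp add: case_prod_beta)
    then show "x \<in> (\<Union>i. S i)" unfolding C(3) by auto
  qed
  moreover have "case_prod C (prod_decode k) \<in> sets Y \<and> emeasure Y (case_prod C (prod_decode k)) < \<infinity>" for k
    using C(1,2) by (simp add: case_prod_beta)
  moreover have "(\<Union>i. S i) \<in> sets Y" using assms sfin_sets by (intro sets.countable_nat_UN) auto
  ultimately show ?thesis unfolding sfin_def by (intro conjI exI[of _ "\<lambda>k. case_prod C (prod_decode k)"]) auto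
qed

lemma sfin_countable_UN:
  assumes "countable I" "\<And>i. i \<in> I \<Longrightarrow> sfin Y (S i)"
  shows "sfin Y (\<Union>i\<in>I. S i)"
proof (cases "I = {}")
  case True
  then show ?thesis by (simp add: sfin_finite)
next
  case False
  have "(\<Union>i\<in>I. S i) = (\<Union>n. S (from_nat_into I n))"
    using range_from_nat_into[OF False assms(1)] by (metis image_image)
  then show ?thesis using assms(2) from_nat_into[OF False] by (auto intro: sfin_UN)
qed

lemma sfin_Un: "sfin Y S \<Longrightarrow> sfin Y T \<Longrightarrow> sfin Y (S \<union> T)"
  using sfin_countable_UN[of "{True, False}" Y "\<lambda>b. if b then S else T"] by (simp add: Un_commute)

text \<open>By Markov's inequality each set where \<open>g\<close> is at least 1/(n+1) has finite
  measure; the inequality is written as a product to avoid division in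
  \<open>ennreal\<close>.\<close>

lemma sfin_support:
  assumes g: "g \<in> borel_measurable Y" and fin: "(\<integral>\<^sup>+ y. g y \<partial>Y) < (\<infinity> :: ennreal)"
  shows "sfin Y {y \<in> space Y. g y \<noteq> 0}"
proof -
  have "{y \<in> space Y. g y \<noteq> 0} = (\<Union>n. {y \<in> space Y. 1 \<le> of_nat (Suc n) * g y})"
  proof (intro set_eqI iffI)
    fix y assume y: "y \<in> {y \<in> space Y. g y \<noteq> 0}"
    show "y \<in> (\<Union>n. {y \<in> space Y. 1 \<le> of_nat (Suc n) * g y})"
    proof (cases "g y")
      case (real r)
      then have "0 < r" using y by (auto simp: less_le)
      then obtain n where n: "1 / real (Suc n) < r" using nat_approx_posE by blast
      then have "1 \<le> real (Suc n) * r" by (simp add: field_simps)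
      then have "ennreal 1 \<le> ennreal (real (Suc n) * r)" by (rule ennreal_leI)
      also have "\<dots> = of_nat (Suc n) * g y" using real by (simp only: ennreal_mult of_nat_0_le_iff ennreal_of_nat_eq_real_of_nat)
      finally have "1 \<le> of_nat (Suc n) * g y" by simp
      then show ?thesis using y by blast
    next
      case top
      then have "1 \<le> of_nat (Suc 0) * g y" by simp
      then show ?thesis using y by blast
    qed
  next
    fix y assume "y \<in> (\<Union>n. {y \<in> space Y. 1 \<le> of_nat (Suc n) * g y})"
    then show "y \<in> {y \<in> space Y. g y \<noteq> 0}" by auto
  qed
  moreover have "sfin Y {y \<in> space Y. 1 \<le> of_nat (Suc n) * g y}" for n
  proof (rule sfin_finite)
    show "{y \<in> space Y. 1 \<le> of_nat (Suc n) * g y} \<in> sets Y" using g by measurable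
    have "emeasure Y {y \<in> space Y. 1 \<le> of_nat (Suc n) * g y} \<le> of_nat (Suc n) * (\<integral>\<^sup>+ y. g y * indicator (space Y) y \<partial>Y)"
      by (rule nn_integral_Markov_inequality) (use g in auto)
    also have "(\<integral>\<^sup>+ y. g y * indicator (space Y) y \<partial>Y) = (\<integral>\<^sup>+ y. g y \<partial>Y)"
      by (rule nn_integral_cong) simp
    also have "of_nat (Suc n) * (\<integral>\<^sup>+ y. g y \<partial>Y) < \<infinity>"
      unfolding infinity_ennreal_def ennreal_mult_less_top
      using fin of_nat_less_top[of "Suc n"] by (simp only: infinity_ennreal_def simp_thms)
    finally show "emeasure Y {y \<in> space Y. 1 \<le> of_nat (Suc n) * g y} < \<infinity>" .
  qed
  ultimately show ?thesis by (simp only: sfin_UN)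
qed

text \<open>Restriction to \<open>S\<close> is encoded as a density, which keeps the space and the
  measurable sets of \<open>Y\<close>; the complement of \<open>S\<close> then joins the countable
  cover as a null set.\<close>

lemma sigma_finite_density_sfin:
  assumes "sfin Y S"
  shows "sigma_finite_measure (density Y (indicator S))"
proof -
  obtain C :: "nat \<Rightarrow> 'a set" where C: "\<And>i. C i \<in> sets Y" "\<And>i. emeasure Y (C i) < \<infinity>" "S = (\<Union>i. C i)"
    using sfin_cover[OF assms] by metis
  note S = sfin_sets[OF assms]
  have "emeasure (density Y (indicator S)) (C i) \<noteq> \<infinity>" for i
  proof -
    have "emeasure (density Y (indicator S)) (C i) = emeasure Y (C i)"
      using C(1,3) S by (subst emeasure_restricted) (auto simp: Int_absorb1 UN_upper)
    then show ?thesis using C(2)[of i] by simp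
  qed
  moreover have "emeasure (density Y (indicator S)) (space Y - S) = 0"
    using S by (subst emeasure_restricted) auto
  ultimately show ?thesis
    using C S sets.sets_into_space[OF S]
    by unfold_locales (intro exI[of _ "insert (space Y - S) (range C)"], auto)
qed

section \<open>Integration on the product over a sigma-finite set\<close>

locale caratheodory_product =
  fixes X :: "'x measure" and Y :: "'y measure"
  assumes finite_X: "finite_measure X"
begin

sublocale X: finite_measure X by (rule finite_X)

abbreviation P :: "('x \<times> 'y) measure" where "P \<equiv> caratheodory_prod X Y"

text \<open>Both measures agree on rectangles and the factors are sigma-finite, so they are equal.
  The identity map serves to pass from the sets of \<open>P\<close> to the product
  sigma-algebra.\<close>

lemma density_prod:
  assumes S: "sfin Y S"
  shows "X \<Otimes>\<^sub>M density Y (indicator S) = distr (density P (indicator (space X \<times> S))) (X \<Otimes>\<^sub>M Y) (\<lambda>p. p)"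
proof (rule pair_measure_eqI)
  note Sm = sfin_sets[OF S]
  have SP: "space X \<times> S \<in> sets P" by (rule rect_in_caratheodory) (use Sm in auto)
  have idm: "(\<lambda>p. p) \<in> measurable (density P (indicator (space X \<times> S))) (X \<Otimes>\<^sub>M Y)"
    using measurable_pair_caratheodory[of "\<lambda>p. p" X Y "X \<Otimes>\<^sub>M Y"] by simp
  show "sigma_finite_measure X" by (rule X.sigma_finite_measure_axioms)
  show "sigma_finite_measure (density Y (indicator S))" by (rule sigma_finite_density_sfin[OF S])
  show "sets (X \<Otimes>\<^sub>M density Y (indicator S)) = sets (distr (density P (indicator (space X \<times> S))) (X \<Otimes>\<^sub>M Y) (\<lambda>p. p))"
    by (simp cong: sets_pair_measure_cong)
  fix A B assume A: "A \<in> sets X" and "B \<in> sets (density Y (indicator S))"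
  then have B: "B \<in> sets Y" by simp
  have "emeasure (distr (density P (indicator (space X \<times> S))) (X \<Otimes>\<^sub>M Y) (\<lambda>p. p)) (A \<times> B)
      = emeasure (density P (indicator (space X \<times> S))) (A \<times> B)"
    using A B idm sets.sets_into_space[OF A] sets.sets_into_space[OF B]
    by (subst emeasure_distr) (auto simp: space_caratheodory intro!: arg_cong2[where f = emeasure])
  also have "\<dots> = emeasure P ((space X \<times> S) \<inter> (A \<times> B))"
    by (rule emeasure_restricted[OF SP rect_in_caratheodory[OF A B]])
  also have "(space X \<times> S) \<inter> (A \<times> B) = A \<times> (S \<inter> B)" using sets.sets_into_space[OF A] by auto
  also have "emeasure P (A \<times> (S \<inter> B)) = emeasure X A * emeasure Y (S \<inter> B)"
    by (rule emeasure_caratheodory_rect) (use A B Sm in auto)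
  finally show "emeasure X A * emeasure (density Y (indicator S)) B =
      emeasure (distr (density P (indicator (space X \<times> S))) (X \<Otimes>\<^sub>M Y) (\<lambda>p. p)) (A \<times> B)"
    by (simp add: emeasure_restricted[OF Sm B])
qed

lemma emeasure_density_prod:
  assumes S: "sfin Y S" and W: "W \<in> sets (X \<Otimes>\<^sub>M Y)"
  shows "emeasure (X \<Otimes>\<^sub>M density Y (indicator S)) W = emeasure P ((space X \<times> S) \<inter> W)"
proof -
  have SP: "space X \<times> S \<in> sets P" by (rule rect_in_caratheodory) (use sfin_sets[OF S] in auto)
  have idm: "(\<lambda>p. p) \<in> measurable (density P (indicator (space X \<times> S))) (X \<Otimes>\<^sub>M Y)"
    using measurable_pair_caratheodory[of "\<lambda>p. p" X Y "X \<Otimes>\<^sub>M Y"] by simp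
  have WP: "W \<in> sets P" using W pair_sets_subset by auto
  have "emeasure (X \<Otimes>\<^sub>M density Y (indicator S)) W = emeasure (density P (indicator (space X \<times> S))) W"
    unfolding density_prod[OF S] using W idm sets.sets_into_space[OF WP]
    by (subst emeasure_distr) (auto intro!: arg_cong2[where f = emeasure])
  also have "\<dots> = emeasure P ((space X \<times> S) \<inter> W)" by (rule emeasure_restricted[OF SP WP])
  finally show ?thesis .
qed

lemma nn_integral_density_prod:
  assumes S: "sfin Y S" and g: "g \<in> borel_measurable (X \<Otimes>\<^sub>M Y)"
    and z: "\<And>t x. t \<in> space X \<Longrightarrow> x \<in> space Y \<Longrightarrow> x \<notin> S \<Longrightarrow> g (t, x) = (0::ennreal)"
  shows "(\<integral>\<^sup>+ p. g p \<partial>P) = (\<integral>\<^sup>+ p. g p \<partial>(X \<Otimes>\<^sub>M density Y (indicator S)))"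
    "t \<in> space X \<Longrightarrow> (\<integral>\<^sup>+ x. g (t, x) \<partial>density Y (indicator S)) = (\<integral>\<^sup>+ x. g (t, x) \<partial>Y)"
proof -
  note Sm = sfin_sets[OF S]
  have SP: "space X \<times> S \<in> sets P" by (rule rect_in_caratheodory) (use Sm in auto)
  have idm: "(\<lambda>p. p) \<in> measurable (density P (indicator (space X \<times> S))) (X \<Otimes>\<^sub>M Y)"
    using measurable_pair_caratheodory[of "\<lambda>p. p" X Y "X \<Otimes>\<^sub>M Y"] by simp
  have gP: "g \<in> borel_measurable P" by (rule measurable_pair_caratheodory[OF g])
  have "(\<integral>\<^sup>+ p. g p \<partial>(X \<Otimes>\<^sub>M density Y (indicator S))) = (\<integral>\<^sup>+ p. g p \<partial>density P (indicator (space X \<times> S)))"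
    unfolding density_prod[OF S] by (subst nn_integral_distr[OF idm]) (use g in auto)
  also have "\<dots> = (\<integral>\<^sup>+ p. indicator (space X \<times> S) p * g p \<partial>P)"
    by (rule nn_integral_density) (use SP gP in auto)
  also have "\<dots> = (\<integral>\<^sup>+ p. g p \<partial>P)"
  proof (rule nn_integral_cong)
    fix p assume "p \<in> space P"
    then obtain t x where p: "p = (t, x)" "t \<in> space X" "x \<in> space Y" by (auto simp: space_caratheodory)
    then show "indicator (space X \<times> S) p * g p = g p" by (cases "x \<in> S") (simp_all add: z)
  qed
  finally show "(\<integral>\<^sup>+ p. g p \<partial>P) = (\<integral>\<^sup>+ p. g p \<partial>(X \<Otimes>\<^sub>M density Y (indicator S)))" by simp
  assume t: "t \<in> space X"
  have "(\<integral>\<^sup>+ x. g (t, x) \<partial>density Y (indicator S)) = (\<integral>\<^sup>+ x. indicator S x * g (t, x) \<partial>Y)"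
    by (rule nn_integral_density) (use Sm measurable_Pair2[OF g t] in auto)
  also have "\<dots> = (\<integral>\<^sup>+ x. g (t, x) \<partial>Y)"
    by (rule nn_integral_cong) (auto simp: indicator_def z t)
  finally show "(\<integral>\<^sup>+ x. g (t, x) \<partial>density Y (indicator S)) = (\<integral>\<^sup>+ x. g (t, x) \<partial>Y)" .
qed

lemma tonelli:
  assumes S: "sfin Y S" and g: "g \<in> borel_measurable (X \<Otimes>\<^sub>M Y)"
    and z: "\<And>t x. t \<in> space X \<Longrightarrow> x \<in> space Y \<Longrightarrow> x \<notin> S \<Longrightarrow> g (t, x) = (0::ennreal)"
  shows "(\<lambda>t. \<integral>\<^sup>+ x. g (t, x) \<partial>Y) \<in> borel_measurable X"
    "(\<integral>\<^sup>+ t. (\<integral>\<^sup>+ x. g (t, x) \<partial>Y) \<partial>X) = (\<integral>\<^sup>+ p. g p \<partial>P)"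
    "(\<integral>\<^sup>+ x. (\<integral>\<^sup>+ t. g (t, x) \<partial>X) \<partial>Y) = (\<integral>\<^sup>+ p. g p \<partial>P)"
proof -
  note Sm = sfin_sets[OF S]
  interpret YS: sigma_finite_measure "density Y (indicator S)" by (rule sigma_finite_density_sfin[OF S])
  interpret XY: pair_sigma_finite X "density Y (indicator S)" ..
  have g': "g \<in> borel_measurable (X \<Otimes>\<^sub>M density Y (indicator S))"
    using g by (simp cong: measurable_cong_sets sets_pair_measure_cong)
  note eq = nn_integral_density_prod[OF S g z]
  have "(\<lambda>t. \<integral>\<^sup>+ x. g (t, x) \<partial>density Y (indicator S)) \<in> borel_measurable X"
    using g' by (intro YS.borel_measurable_nn_integral) simp
  then show "(\<lambda>t. \<integral>\<^sup>+ x. g (t, x) \<partial>Y) \<in> borel_measurable X"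
    by (rule measurable_cong[THEN iffD1, rotated]) (rule eq(2))
  have "(\<integral>\<^sup>+ t. (\<integral>\<^sup>+ x. g (t, x) \<partial>Y) \<partial>X) = (\<integral>\<^sup>+ t. (\<integral>\<^sup>+ x. g (t, x) \<partial>density Y (indicator S)) \<partial>X)"
    by (intro nn_integral_cong) (simp add: eq(2))
  also have "\<dots> = (\<integral>\<^sup>+ p. g p \<partial>(X \<Otimes>\<^sub>M density Y (indicator S)))" by (rule YS.nn_integral_fst[OF g'])
  finally show 2: "(\<integral>\<^sup>+ t. (\<integral>\<^sup>+ x. g (t, x) \<partial>Y) \<partial>X) = (\<integral>\<^sup>+ p. g p \<partial>P)" by (simp add: eq(1))
  have gy: "(\<lambda>x. \<integral>\<^sup>+ t. g (t, x) \<partial>X) \<in> borel_measurable Y"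
    using g by (intro X.borel_measurable_nn_integral) (simp add: measurable_pair_swap_iff[of _ Y])
  have "(\<integral>\<^sup>+ x. (\<integral>\<^sup>+ t. g (t, x) \<partial>X) \<partial>Y) = (\<integral>\<^sup>+ x. indicator S x * (\<integral>\<^sup>+ t. g (t, x) \<partial>X) \<partial>Y)"
  proof (rule nn_integral_cong)
    fix x assume x: "x \<in> space Y"
    have "(\<integral>\<^sup>+ t. g (t, x) \<partial>X) = (\<integral>\<^sup>+ t. 0 \<partial>X)" if "x \<notin> S" by (rule nn_integral_cong) (use z x that in auto)
    then show "(\<integral>\<^sup>+ t. g (t, x) \<partial>X) = indicator S x * (\<integral>\<^sup>+ t. g (t, x) \<partial>X)" by (auto simp: indicator_def)
  qed
  also have "\<dots> = (\<integral>\<^sup>+ x. (\<integral>\<^sup>+ t. g (t, x) \<partial>X) \<partial>density Y (indicator S))"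
    by (rule nn_integral_density[symmetric]) (use Sm gy in auto)
  also have "\<dots> = (\<integral>\<^sup>+ t. (\<integral>\<^sup>+ x. g (t, x) \<partial>density Y (indicator S)) \<partial>X)"
    by (rule XY.Fubini') (use g' in simp)
  also have "\<dots> = (\<integral>\<^sup>+ p. g p \<partial>(X \<Otimes>\<^sub>M density Y (indicator S)))" by (rule YS.nn_integral_fst[OF g'])
  finally show "(\<integral>\<^sup>+ x. (\<integral>\<^sup>+ t. g (t, x) \<partial>X) \<partial>Y) = (\<integral>\<^sup>+ p. g p \<partial>P)" by (simp add: eq(1))
qed

text \<open>On a piece \<open>F\<close> of finite measure, take a hull \<open>G\<close>, then a null
  hull \<open>H\<close> of \<open>G - F\<close>; thus \<open>F = G - (G - F)\<close> is product
  measurable up to a null set.\<close>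

lemma completion_sets:
  assumes S: "sfin Y S" and E: "E \<in> sets P" "E \<subseteq> space X \<times> S"
  shows "E \<in> sets (completion (X \<Otimes>\<^sub>M density Y (indicator S)))"
proof -
  let ?K = "X \<Otimes>\<^sub>M density Y (indicator S)"
  obtain C :: "nat \<Rightarrow> 'y set" where C: "\<And>i. C i \<in> sets Y" "\<And>i. emeasure Y (C i) < \<infinity>" "S = (\<Union>i. C i)"
    using sfin_cover[OF S] by metis
  have setsK: "sets ?K = sets (X \<Otimes>\<^sub>M Y)" by (simp cong: sets_pair_measure_cong)
  have "E \<inter> (space X \<times> C i) \<in> sets (completion ?K)" for i
  proof -
    have XC: "space X \<times> C i \<in> sets P" using C(1) by (intro rect_in_caratheodory) auto
    define F where "F = E \<inter> (space X \<times> C i)"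
    have F: "F \<in> sets P" using E(1) XC by (auto simp: F_def)
    have Fo: "rect_outer X Y F = emeasure P F" by (rule emeasure_caratheodory[OF F, symmetric])
    have "emeasure P F \<le> emeasure P (space X \<times> C i)" using XC by (intro emeasure_mono) (auto simp: F_def)
    also have "\<dots> = emeasure X (space X) * emeasure Y (C i)" by (rule emeasure_caratheodory_rect) (use C in auto)
    also have "\<dots> < \<infinity>" using C(2)[of i] X.emeasure_finite[of "space X"]
      unfolding infinity_ennreal_def ennreal_mult_less_top top.not_eq_extremum by blast
    finally have fin: "emeasure P F < \<infinity>" .
    then obtain G where G: "G \<in> sets (X \<Otimes>\<^sub>M Y)" "F \<subseteq> G" "emeasure P G = emeasure P F"
      using caratheodory_hull[of X Y F] Fo by auto
    have GP: "G \<in> sets P" using G pair_sets_subset by auto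
    have "emeasure P (G - F) = 0"
      using emeasure_Diff[of P F G] fin F GP G(2,3) by simp
    then have "rect_outer X Y (G - F) = 0" using emeasure_caratheodory[of "G - F" X Y] F GP by auto
    then obtain H where H: "H \<in> sets (X \<Otimes>\<^sub>M Y)" "G - F \<subseteq> H" "emeasure P H = 0"
      using caratheodory_hull[of X Y "G - F"] by auto
    have HP: "H \<in> sets P" using H pair_sets_subset by auto
    have "emeasure ?K H \<le> emeasure P H"
      unfolding emeasure_density_prod[OF S H(1)] using HP by (intro emeasure_mono) auto
    then have "H \<in> null_sets ?K" using H(1,3) setsK by (auto simp: null_sets_def)
    then have "G - F \<in> null_sets (completion ?K)"
      using H(2) null_sets_completionI null_sets_completion_subset by blast
    then have "G - F \<in> sets (completion ?K)" by auto
    moreover have "G \<in> sets (completion ?K)" using G(1) setsK by auto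
    ultimately have "G - (G - F) \<in> sets (completion ?K)" by (rule sets.Diff[rotated])
    moreover have "G - (G - F) = F" using G(2) by auto
    ultimately show ?thesis by (simp add: F_def)
  qed
  then have "(\<Union>i. E \<inter> (space X \<times> C i)) \<in> sets (completion ?K)" by (intro sets.countable_UN image_subsetI)
  moreover have "(\<Union>i. E \<inter> (space X \<times> C i)) = E" using E(2) C(3) by auto
  ultimately show ?thesis by simp
qed

text \<open>
  The set where \<open>f\<close> differs from \<open>h\<close> is covered by countably many rectangles of finite cost. Those whose
  second side has infinite measure lie over a null set of \<^term>\<open>X\<close>; the others lie over a \<open>\<sigma>\<close>-finite set.
\<close>

lemma normal_form:
  assumes mt: "metric_target N d" and h: "sep_meas Y N d h" and f: "sep_meas P N d f"
    and fin: "(\<integral>\<^sup>+ p. ennreal (d (f p) (h (snd p))) \<partial>P) < \<infinity>"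
  shows "\<exists>f' S. sfin Y S \<and> sep_meas (X \<Otimes>\<^sub>M Y) N d f' \<and>
    (\<forall>t\<in>space X. \<forall>x\<in>space Y. x \<notin> S \<longrightarrow> f' (t, x) = h x) \<and> (AE p in P. f p = f' p)"
proof -
  interpret metric_target N d by (rule mt)
  define H where "H p = h (snd p)" for p :: "'x \<times> 'y"
  have H: "sep_meas (X \<Otimes>\<^sub>M Y) N d H" unfolding H_def[abs_def] by (rule sep_meas_compose[OF h measurable_snd])
  have HP: "sep_meas P N d H"
    unfolding H_def[abs_def] by (rule sep_meas_compose[OF h measurable_pair_caratheodory[OF measurable_snd]])
  note fZ = sep_measD(1)[OF f, unfolded space_caratheodory] and HZ = sep_measD(1)[OF HP, unfolded space_caratheodory]
  have dm: "(\<lambda>p. ennreal (d (f p) (H p))) \<in> borel_measurable P"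
    using sep_meas_dist[OF f HP] by measurable
  have "sfin P {p \<in> space P. ennreal (d (f p) (H p)) \<noteq> 0}"
    by (rule sfin_support[OF dm]) (use fin in \<open>simp add: H_def\<close>)
  moreover have "{p \<in> space P. ennreal (d (f p) (H p)) \<noteq> 0} = {p \<in> space P. f p \<noteq> H p}"
  proof -
    have "d (f p) (H p) \<le> 0 \<longleftrightarrow> f p = H p" if "p \<in> space X \<times> space Y" for p
      using nonneg[of "f p" "H p"] zero[OF fZ[OF that] HZ[OF that]] by linarith
    then show ?thesis unfolding space_caratheodory ennreal_eq_0_iff by (intro Collect_cong conj_cong) auto
  qed
  ultimately have sW: "sfin P {p \<in> space P. f p \<noteq> H p}" by (simp only:)
  obtain W :: "nat \<Rightarrow> ('x \<times> 'y) set" where W: "\<And>n. W n \<in> sets P" "\<And>n. emeasure P (W n) < \<infinity>"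
    "{p \<in> space P. f p \<noteq> H p} = (\<Union>n. W n)"
    using sfin_cover[OF sW] by metis
  have "\<exists>A B. rect_cover X Y (W n) A B \<and> rect_cost X Y A B < \<infinity>" for n
    using W(2)[of n] unfolding emeasure_caratheodory[OF W(1)] by (rule rect_outer_less)
  then obtain A B where AB: "\<And>n. rect_cover X Y (W n) (A n) (B n)" "\<And>n. rect_cost X Y (A n) (B n) < \<infinity>" by metis
  note m = rect_coverD(1,2)[OF AB(1)]
  define B' where "B' n i = (if emeasure Y (B n i) < \<infinity> then B n i else {})" for n i
  define A' where "A' n i = (if emeasure X (A n i) = 0 then A n i else {})" for n i
  define S where "S = (\<Union>n. \<Union>i. B' n i)"
  define A0 where "A0 = (\<Union>n. \<Union>i. A' n i)"
  have S: "sfin Y S"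
    unfolding S_def by (intro sfin_UN sfin_finite) (use m in \<open>auto simp: B'_def\<close>)
  note Sm = sfin_sets[OF S]
  have "A' n i \<in> null_sets X" for n i using m by (auto simp: A'_def null_sets_def)
  then have A0: "A0 \<in> null_sets X" unfolding A0_def by (intro null_sets_UN)
  have "emeasure P (A0 \<times> space Y) = emeasure X A0 * emeasure Y (space Y)"
    by (rule emeasure_caratheodory_rect) (use A0 in auto)
  then have A0P: "A0 \<times> space Y \<in> null_sets P"
    using A0 rect_in_caratheodory[of A0 X "space Y" Y] by (auto simp: null_sets_def)
  have cov: "x \<in> S \<or> t \<in> A0" if "t \<in> space X" "x \<in> space Y" "f (t, x) \<noteq> H (t, x)" for t x
  proof -
    have "(t, x) \<in> (\<Union>n. W n)" unfolding W(3)[symmetric] using that by (simp add: space_caratheodory)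
    then obtain n where "(t, x) \<in> W n" by blast
    then have "(t, x) \<in> (\<Union>i. A n i \<times> B n i)" by (rule subsetD[OF rect_coverD(3)[OF AB(1)]])
    then obtain i where i: "t \<in> A n i" "x \<in> B n i" by auto
    have "emeasure X (A n i) * emeasure Y (B n i) < \<infinity>"
      using AB(2)[of n] unfolding rect_cost_def infinity_ennreal_def by (rule ennreal_suminf_lessD)
    then have "emeasure X (A n i) = 0 \<or> emeasure Y (B n i) < \<infinity>"
      by (auto simp: ennreal_mult_less_top less_top)
    then have "t \<in> A' n i \<or> x \<in> B' n i" using i by (auto simp: A'_def B'_def)
    then show ?thesis unfolding S_def A0_def by blast
  qed
  obtain D1 where D1: "countable D1" "D1 \<subseteq> N" "\<And>p e. p \<in> space P \<Longrightarrow> e > 0 \<Longrightarrow> \<exists>z\<in>D1. d (f p) z < e"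
    using sep_meas_dense[OF f] by metis
  obtain D2 where D2: "countable D2" "D2 \<subseteq> N" "\<And>p e. p \<in> space P \<Longrightarrow> e > 0 \<Longrightarrow> \<exists>z\<in>D2. d (H p) z < e"
    using sep_meas_dense[OF HP] by metis
  let ?K = "X \<Otimes>\<^sub>M density Y (indicator S)"
  have setsK: "sets ?K = sets (X \<Otimes>\<^sub>M Y)" by (simp cong: sets_pair_measure_cong)
  have spK: "space ?K = space X \<times> space Y" by (simp add: space_pair_measure)
  have SP: "space X \<times> S \<in> sets P" by (rule rect_in_caratheodory) (use Sm in auto)
  have SK: "space X \<times> S \<in> sets ?K" using Sm setsK by auto
  \<comment> \<open>\<open>f\<close> is measurable for the sets of \<open>P\<close> only. Over
    \<open>S\<close> these lie in the completion of the product, so each distance function agrees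
    almost everywhere with a product measurable one.\<close>
  have ex: "\<exists>g'\<in>borel_measurable ?K. AE p in ?K. d (f p) z * indicator (space X \<times> S) p = g' p" if z: "z \<in> N" for z
  proof (rule completion_ex_borel_measurable_real)
    have "{p \<in> space X \<times> space Y. d (f p) z * indicator (space X \<times> S) p < r} \<in> sets (completion ?K)" for r
    proof -
      have 1: "{p \<in> space P. d (f p) z < r} \<in> sets P" using sep_measD(2)[OF f z] by measurable
      then have "{p \<in> space P. d (f p) z < r} \<inter> (space X \<times> S) \<in> sets (completion ?K)"
        using SP by (intro completion_sets[OF S]) auto
      moreover have "(if 0 < r then space X \<times> space Y - space X \<times> S else {}) \<in> sets (completion ?K)"
      proof -
        have "space ?K - space X \<times> S \<in> sets ?K" using SK by (rule sets.compl_sets)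
        then show ?thesis by (simp add: spK)
      qed
      ultimately have "{p \<in> space P. d (f p) z < r} \<inter> (space X \<times> S)
          \<union> (if 0 < r then space X \<times> space Y - space X \<times> S else {}) \<in> sets (completion ?K)" by (rule sets.Un)
      moreover have "{p \<in> space X \<times> space Y. d (f p) z * indicator (space X \<times> S) p < r} =
          {p \<in> space P. d (f p) z < r} \<inter> (space X \<times> S)
          \<union> (if 0 < r then space X \<times> space Y - space X \<times> S else {})"
        using sets.sets_into_space[OF Sm] by (auto simp: space_caratheodory indicator_def split: if_splits)
      ultimately show ?thesis by simp
    qed
    then show "(\<lambda>p. d (f p) z * indicator (space X \<times> S) p) \<in> borel_measurable (completion ?K)"
      unfolding borel_measurable_iff_less space_completion spK by blast
  qed
  have DN: "D1 \<union> D2 \<subseteq> N" using D1(2) D2(2) by simp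
  define g' where "g' z = (SOME g'. g' \<in> borel_measurable ?K \<and> (AE p in ?K. d (f p) z * indicator (space X \<times> S) p = g' p))" for z
  have g'_ex: "g' z \<in> borel_measurable ?K \<and> (AE p in ?K. d (f p) z * indicator (space X \<times> S) p = g' z p)"
    if "z \<in> D1 \<union> D2" for z
    unfolding g'_def by (rule someI_ex[OF ex[OF subsetD[OF DN that], unfolded Bex_def]])
  have g': "g' z \<in> borel_measurable ?K" "AE p in ?K. d (f p) z * indicator (space X \<times> S) p = g' z p"
    if "z \<in> D1 \<union> D2" for z
    using g'_ex[OF that] by simp_all
  \<comment> \<open>Distances to the points of a countable dense set decide measurability, so a
    single null set \<open>Q\<close> handles all of them.\<close>
  have "AE p in ?K. \<forall>z\<in>D1 \<union> D2. d (f p) z * indicator (space X \<times> S) p = g' z p"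
    using D1(1) D2(1) g'(2) by (intro AE_ball_countable[THEN iffD2]) auto
  then obtain Q where Q: "Q \<in> null_sets ?K"
    "{p \<in> space ?K. \<not> (\<forall>z\<in>D1 \<union> D2. d (f p) z * indicator (space X \<times> S) p = g' z p)} \<subseteq> Q"
    by (auto elim!: AE_E simp: null_sets_def)
  have QK: "Q \<in> sets (X \<Otimes>\<^sub>M Y)" using Q(1) setsK by (auto simp: null_sets_def)
  have "emeasure P ((space X \<times> S) \<inter> Q) = 0" using emeasure_density_prod[OF S QK] Q(1) by (simp add: null_sets_def)
  then have QP: "(space X \<times> S) \<inter> Q \<in> null_sets P"
    using SP QK pair_sets_subset by (auto simp: null_sets_def)
  \<comment> \<open>The map that follows \<open>f\<close> on \<open>R\<close> and \<open>h\<close>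
    elsewhere differs from \<open>f\<close> only inside the two null sets found above.\<close>
  define R where "R = space X \<times> S - Q"
  have R: "R \<in> sets (X \<Otimes>\<^sub>M Y)" unfolding R_def using Sm QK by auto
  define f' where "f' p = (if p \<in> R then f p else H p)" for p
  have f'Z: "f' p \<in> N" if "p \<in> space X \<times> space Y" for p using fZ HZ that by (simp add: f'_def)
  have "sep_meas (X \<Otimes>\<^sub>M Y) N d f'"
  proof (rule sep_meas_from_dense[of _ _ "D1 \<union> D2"])
    show "f' \<in> space (X \<Otimes>\<^sub>M Y) \<rightarrow> N" using f'Z by (auto simp: space_pair_measure)
    show "countable (D1 \<union> D2)" "D1 \<union> D2 \<subseteq> N" using D1 D2 by auto
    show "\<exists>z\<in>D1 \<union> D2. d (f' p) z < e" if "p \<in> space (X \<Otimes>\<^sub>M Y)" "e > 0" for p e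
      using D1(3)[of p e] D2(3)[of p e] that unfolding f'_def space_pair_measure space_caratheodory by auto
    fix z assume z: "z \<in> D1 \<union> D2"
    then have zN: "z \<in> N" using D1 D2 by auto
    have g1: "g' z \<in> borel_measurable (X \<Otimes>\<^sub>M Y)" using g'(1)[OF z] setsK by (simp cong: measurable_cong_sets)
    have g2: "(\<lambda>p. d (H p) z) \<in> borel_measurable (X \<Otimes>\<^sub>M Y)" by (rule sep_measD(2)[OF H zN])
    have "(\<lambda>p. if p \<in> R then g' z p else d (H p) z) \<in> borel_measurable (X \<Otimes>\<^sub>M Y)"
      by (rule measurable_If_set[OF g1 g2]) (use R in auto)
    moreover have "d (f' p) z = (if p \<in> R then g' z p else d (H p) z)" if "p \<in> space (X \<Otimes>\<^sub>M Y)" for p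
    proof (cases "p \<in> R")
      case True
      then have "p \<in> space ?K" "p \<notin> Q" "p \<in> space X \<times> S" using that by (auto simp: R_def space_pair_measure)
      then have "d (f p) z * indicator (space X \<times> S) p = g' z p" using Q(2) z by blast
      then show ?thesis using True \<open>p \<in> space X \<times> S\<close> by (simp add: f'_def)
    qed (simp add: f'_def)
    ultimately show "(\<lambda>p. d (f' p) z) \<in> borel_measurable (X \<Otimes>\<^sub>M Y)"
      by (simp cong: measurable_cong)
  qed
  moreover have "AE p in P. f p = f' p"
  proof (rule AE_I'[OF null_sets.Un[OF QP A0P]])
    show "{p \<in> space P. f p \<noteq> f' p} \<subseteq> (space X \<times> S) \<inter> Q \<union> A0 \<times> space Y"
      using cov by (auto simp: space_caratheodory f'_def R_def split: if_splits)
  qed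
  moreover have "\<forall>t\<in>space X. \<forall>x\<in>space Y. x \<notin> S \<longrightarrow> f' (t, x) = h x"
    by (simp add: f'_def R_def H_def)
  ultimately show ?thesis using S by blast
qed

end

section \<open>Limits of sequences of maps, pointwise and in the mean\<close>

context metric_target
begin

lemma summable_limit:
  assumes "mcomplete" and u: "\<And>n. u n \<in> Z" and fin: "(\<Sum>n. ennreal (d (u n) (u (Suc n)))) < \<infinity>"
  shows "\<exists>l\<in>Z. (\<lambda>n. d (u n) l) \<longlonglongrightarrow> 0"
proof (rule mcomplete_limit[OF \<open>mcomplete\<close>])
  have s: "summable (\<lambda>n. d (u n) (u (Suc n)))"
    by (rule summable_suminf_not_top) (use fin in auto)
  have dist_sum: "d (u m) (u (m + k)) \<le> (\<Sum>i<k. d (u (m + i)) (u (Suc (m + i))))" for m k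
  proof (induction k)
    case (Suc k)
    have "d (u m) (u (m + Suc k)) \<le> d (u m) (u (m + k)) + d (u (m + k)) (u (m + Suc k))"
      by (rule triangle) (auto intro: u)
    then show ?case using Suc by simp
  qed (use u in simp)
  fix e :: real assume e: "e > 0"
  obtain n0 where n0: "\<And>n. n \<ge> n0 \<Longrightarrow> norm (\<Sum>i. d (u (i + n)) (u (Suc (i + n)))) < e"
    using suminf_exist_split[OF e s] by auto
  have le: "d (u m) (u n) < e" if "n0 \<le> m" "m \<le> n" for m n
  proof -
    have "d (u m) (u (m + (n - m))) \<le> (\<Sum>i<n - m. d (u (m + i)) (u (Suc (m + i))))" by (rule dist_sum)
    also have "\<dots> \<le> (\<Sum>i. d (u (m + i)) (u (Suc (m + i))))"
      using summable_ignore_initial_segment[OF s, of m] by (intro sum_le_suminf) (auto simp: add.commute)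
    also have "\<dots> < e" using n0[OF that(1)] by (simp add: add.commute)
    finally show ?thesis using that by simp
  qed
  show "\<exists>P. eventually P sequentially \<and> (\<forall>m n. P m \<and> P n \<longrightarrow> d (u m) (u n) < e)"
  proof (intro exI[of _ "\<lambda>n. n \<ge> n0"] conjI allI impI)
    show "eventually (\<lambda>n. n \<ge> n0) sequentially" by (rule eventually_ge_at_top)
    show "d (u m) (u n) < e" if "n0 \<le> m \<and> n0 \<le> n" for m n
      using le[of m n] le[of n m] that by (cases "m \<le> n") (auto simp: commute)
  qed
qed (use u in auto)

text \<open>The distance between the two limits is the pointwise limit of d(f n, w), whose integrals
  tend to 0, so Fatou's lemma makes its integral vanish. This identifies a limit built point by
  point with a given class.\<close>

lemma L1_limit_unique:
  assumes w: "sep_meas Y Z d w" and f: "\<And>n::nat. sep_meas Y Z d (f n)" and g: "sep_meas Y Z d g"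
    and pt: "AE y in Y. (\<lambda>n. d (f n y) (g y)) \<longlonglongrightarrow> 0"
    and L: "(\<lambda>n. \<integral>\<^sup>+ y. ennreal (d (f n y) (w y)) \<partial>Y) \<longlonglongrightarrow> 0"
  shows "AE y in Y. g y = w y"
proof -
  have m: "(\<lambda>y. ennreal (d (f n y) (w y))) \<in> borel_measurable Y" for n
    using sep_meas_dist[OF f[of n] w] by measurable
  have "AE y in Y. y \<in> space Y \<and> (\<lambda>n. d (f n y) (g y)) \<longlonglongrightarrow> 0" using pt by (simp add: AE_conj_iff AE_space)
  then have "AE y in Y. ennreal (d (g y) (w y)) = liminf (\<lambda>n. ennreal (d (f n y) (w y)))"
  proof (rule AE_mp, intro AE_I2 impI)
    fix y assume y: "y \<in> space Y \<and> (\<lambda>n. d (f n y) (g y)) \<longlonglongrightarrow> 0"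
    have "(\<lambda>n. d (f n y) (w y)) \<longlonglongrightarrow> d (g y) (w y)"
      by (rule dist_tendsto) (use y sep_measD(1)[OF f] sep_measD(1)[OF g] sep_measD(1)[OF w] in auto)
    then have "(\<lambda>n. ennreal (d (f n y) (w y))) \<longlonglongrightarrow> ennreal (d (g y) (w y))" by (rule tendsto_ennrealI)
    then show "ennreal (d (g y) (w y)) = liminf (\<lambda>n. ennreal (d (f n y) (w y)))"
      by (intro lim_imp_Liminf[symmetric]) auto
  qed
  then have "(\<integral>\<^sup>+ y. ennreal (d (g y) (w y)) \<partial>Y) = (\<integral>\<^sup>+ y. liminf (\<lambda>n. ennreal (d (f n y) (w y))) \<partial>Y)"
    by (rule nn_integral_cong_AE)
  also have "\<dots> \<le> liminf (\<lambda>n. \<integral>\<^sup>+ y. ennreal (d (f n y) (w y)) \<partial>Y)" by (rule nn_integral_liminf[OF m])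
  also have "\<dots> = 0" using L by (intro lim_imp_Liminf) auto
  finally have "(\<integral>\<^sup>+ y. ennreal (d (g y) (w y)) \<partial>Y) = 0" by simp
  then have "AE y in Y. ennreal (d (g y) (w y)) = 0"
    using sep_meas_dist[OF g w] by (subst (asm) nn_integral_0_iff_AE) auto
  then show ?thesis
  proof (rule AE_mp, intro AE_I2 impI)
    fix y assume y: "y \<in> space Y" "ennreal (d (g y) (w y)) = 0"
    then have "d (g y) (w y) = 0" using nonneg[of "g y" "w y"] unfolding ennreal_eq_0_iff by linarith
    then show "g y = w y" using zero[OF sep_measD(1)[OF g y(1)] sep_measD(1)[OF w y(1)]] by blast
  qed
qed

end

section \<open>The isometries between the spaces of integrable curves\<close>

text \<open>
  The sublocales stand for \<open>BV(I, N)\<close> (\<open>A\<close>), \<open>L\<^sup>1\<^sub>h(M, N)\<close> (\<open>Lh\<close>), \<open>BV(I, L\<^sup>1\<^sub>h(M, N))\<close> (\<open>W\<close>), the product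
  \<open>I \<times> M\<close> (\<open>Q\<close>) and \<open>L\<^sup>1(I \<times> M, N)\<close> (\<open>LP\<close>).
\<close>

locale BV_setting = metric_target N d for N :: "'n set" and d :: "'n \<Rightarrow> 'n \<Rightarrow> real" +
  fixes a b :: real and M :: "'m measure" and h0 :: "'m \<Rightarrow> 'n"
  assumes ab': "a < b" and N_ne: "N \<noteq> {}" and h0: "sep_meas M N d h0" and complete: mcomplete
begin

sublocale A: BV_target N d a b by unfold_locales (rule ab', rule N_ne)
sublocale Lh: L1_target N d M h0 by unfold_locales (rule h0, rule N_ne)
sublocale W: BV_target "L1 M N d (ae_class M N h0)" "L1_dist M d" a b
  by unfold_locales (rule ab', use Lh.cls_mem[OF Lh.int1_ref] in blast)
sublocale Q: caratheodory_product "leb_I a b" M by (rule caratheodory_product.intro) (rule finite_measure_leb_I)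
sublocale LP: L1_target N d "caratheodory_prod (leb_I a b) M" "\<lambda>p. h0 (snd p)"
  by unfold_locales (rule sep_meas_compose[OF h0 measurable_pair_caratheodory[OF measurable_snd]], rule N_ne)

abbreviation hcls where "hcls \<equiv> ae_class M N h0"

lemma AE_snd: assumes "AE x in M. R x" shows "AE p in Q.P. R (snd p)"
proof -
  obtain K where K: "K \<in> null_sets M" "{x \<in> space M. \<not> R x} \<subseteq> K" using assms by (auto elim!: AE_E simp: null_sets_def)
  have "emeasure Q.P (space (leb_I a b) \<times> K) = emeasure (leb_I a b) (space (leb_I a b)) * emeasure M K"
    by (rule emeasure_caratheodory_rect) (use K in auto)
  then have "space (leb_I a b) \<times> K \<in> null_sets Q.P"
    using K(1) rect_in_caratheodory[of "space (leb_I a b)" "leb_I a b" K M] by (auto simp: null_sets_def simp del: space_leb_I)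
  then show ?thesis by (rule AE_I') (use K(2) in \<open>auto simp: space_caratheodory\<close>)
qed

lemma L1_IM_eq: "L1_IM a b M N d hcls = LP.L"
proof -
  have "AE p in Q.P. rep hcls (snd p) = h0 (snd p)" by (rule AE_snd[OF rep_AE[OF sep_meas_AE[OF h0] N_ne]])
  then have "h_hat a b M N hcls = LP.cls (\<lambda>p. h0 (snd p))"
    unfolding h_hat_def by (intro ae_class_eq) (simp add: case_prod_beta)
  then show ?thesis by (simp add: L1_IM_def)
qed

text \<open>The form of representative to which Tonelli's theorem applies: two such maps differ only
  over the union of their sets \<open>S\<close>, so their distance vanishes off a sigma-finite
  set.\<close>

definition good :: "(real \<times> 'm \<Rightarrow> 'n) \<Rightarrow> 'm set \<Rightarrow> bool" where
  "good f S \<longleftrightarrow> sfin M S \<and> sep_meas (leb_I a b \<Otimes>\<^sub>M M) N d f \<and> (\<forall>t\<in>{a..b}. \<forall>x\<in>space M. x \<notin> S \<longrightarrow> f (t, x) = h0 x)"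

lemma good_sep: "good f S \<Longrightarrow> sep_meas (leb_I a b \<Otimes>\<^sub>M M) N d f" by (simp add: good_def)

lemma good_sep_P: "good f S \<Longrightarrow> sep_meas Q.P N d f"
  using sep_meas_compose[OF good_sep measurable_pair_caratheodory[OF measurable_ident]] by simp

lemma good_section1: "good f S \<Longrightarrow> t \<in> {a..b} \<Longrightarrow> sep_meas M N d (\<lambda>x. f (t, x))"
  by (rule sep_meas_compose[OF good_sep]) auto

lemma good_section2: "good f S \<Longrightarrow> x \<in> space M \<Longrightarrow> sep_meas (leb_I a b) N d (\<lambda>t. f (t, x))"
  by (rule sep_meas_compose[OF good_sep]) auto

lemma good_h0: "good (\<lambda>p. h0 (snd p)) {}"
  by (simp add: good_def sfin_finite sep_meas_compose[OF h0])

lemma good_tonelli: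
  assumes f: "good f S" and g: "good g S'"
  shows "(\<lambda>t. \<integral>\<^sup>+ x. ennreal (d (f (t, x)) (g (t, x))) \<partial>M) \<in> borel_measurable (leb_I a b)"
    "(\<lambda>x. \<integral>\<^sup>+ t. ennreal (d (f (t, x)) (g (t, x))) \<partial>leb_I a b) \<in> borel_measurable M"
    "(\<integral>\<^sup>+ t. (\<integral>\<^sup>+ x. ennreal (d (f (t, x)) (g (t, x))) \<partial>M) \<partial>leb_I a b) = (\<integral>\<^sup>+ p. ennreal (d (f p) (g p)) \<partial>Q.P)"
    "(\<integral>\<^sup>+ x. (\<integral>\<^sup>+ t. ennreal (d (f (t, x)) (g (t, x))) \<partial>leb_I a b) \<partial>M) = (\<integral>\<^sup>+ p. ennreal (d (f p) (g p)) \<partial>Q.P)"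
proof -
  have S: "sfin M (S \<union> S')" by (rule sfin_Un) (use f g good_def in auto)
  have m: "(\<lambda>p. ennreal (d (f p) (g p))) \<in> borel_measurable (leb_I a b \<Otimes>\<^sub>M M)"
    using sep_meas_dist[OF good_sep[OF f] good_sep[OF g]] by measurable
  have z: "ennreal (d (f (t, x)) (g (t, x))) = 0"
    if "t \<in> space (leb_I a b)" "x \<in> space M" "x \<notin> S \<union> S'" for t x
    using that f g sep_measD(1)[OF h0 that(2)] by (simp add: good_def)
  note T = Q.tonelli[OF S m z]
  show "(\<lambda>t. \<integral>\<^sup>+ x. ennreal (d (f (t, x)) (g (t, x))) \<partial>M) \<in> borel_measurable (leb_I a b)"
    "(\<integral>\<^sup>+ t. (\<integral>\<^sup>+ x. ennreal (d (f (t, x)) (g (t, x))) \<partial>M) \<partial>leb_I a b) = (\<integral>\<^sup>+ p. ennreal (d (f p) (g p)) \<partial>Q.P)"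
    "(\<integral>\<^sup>+ x. (\<integral>\<^sup>+ t. ennreal (d (f (t, x)) (g (t, x))) \<partial>leb_I a b) \<partial>M) = (\<integral>\<^sup>+ p. ennreal (d (f p) (g p)) \<partial>Q.P)"
    using T by auto
  show "(\<lambda>x. \<integral>\<^sup>+ t. ennreal (d (f (t, x)) (g (t, x))) \<partial>leb_I a b) \<in> borel_measurable M"
    using m by (intro Q.X.borel_measurable_nn_integral) (simp add: measurable_pair_swap_iff[of _ M])
qed

lemma LP_normal_form:
  assumes "F \<in> LP.L"
  shows "\<exists>f S. good f S \<and> LP.int1 f \<and> F = LP.cls f"
proof -
  obtain f where f: "LP.int1 f" "F = LP.cls f" using assms by (auto simp: LP.L_iff)
  obtain f' S where f': "sfin M S" "sep_meas (leb_I a b \<Otimes>\<^sub>M M) N d f'"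
    "\<forall>t\<in>space (leb_I a b). \<forall>x\<in>space M. x \<notin> S \<longrightarrow> f' (t, x) = h0 x" "AE p in Q.P. f p = f' p"
    using Q.normal_form[OF metric_target_axioms h0 LP.int1_sep[OF f(1)]] f(1) by (auto simp: LP.int1_def)
  then have g: "good f' S" by (simp add: good_def)
  moreover have "F = LP.cls f'" unfolding f(2) by (rule ae_class_eq[OF f'(4)])
  moreover have "(\<integral>\<^sup>+ p. ennreal (d (f p) (h0 (snd p))) \<partial>Q.P) = (\<integral>\<^sup>+ p. ennreal (d (f' p) (h0 (snd p))) \<partial>Q.P)"
    by (rule nn_integral_cong_AE) (use f'(4) in \<open>auto elim: AE_mp\<close>)
  then have "LP.int1 f'" using f(1) good_sep_P[OF g] by (simp add: LP.int1_def)
  ultimately show ?thesis by blast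
qed

lemma good_int1_sections:
  assumes f: "good f S" and i: "LP.int1 f"
  shows "AE t in leb_I a b. Lh.int1 (\<lambda>x. f (t, x))" "AE x in M. A.I.int1 (\<lambda>t. f (t, x))"
proof -
  note T = good_tonelli[OF f good_h0, simplified]
  have fin: "(\<integral>\<^sup>+ p. ennreal (d (f p) (h0 (snd p))) \<partial>Q.P) < \<infinity>" using i by (simp add: LP.int1_def)
  have "AE t in leb_I a b. (\<integral>\<^sup>+ x. ennreal (d (f (t, x)) (h0 x)) \<partial>M) \<noteq> \<infinity>"
    by (rule nn_integral_noteq_infinite[OF T(1)]) (use fin T(3) in simp)
  then show "AE t in leb_I a b. Lh.int1 (\<lambda>x. f (t, x))"
    by (rule AE_mp) (rule AE_I2, use good_section1[OF f] in \<open>auto simp: Lh.int1_def top.not_eq_extremum\<close>)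
  have "AE x in M. (\<integral>\<^sup>+ t. ennreal (d (f (t, x)) (h0 x)) \<partial>leb_I a b) \<noteq> \<infinity>"
    by (rule nn_integral_noteq_infinite[OF T(2)]) (use fin T(4) in simp)
  then show "AE x in M. A.I.int1 (\<lambda>t. f (t, x))"
  proof (rule AE_mp, intro AE_I2 impI)
    fix x assume x: "x \<in> space M" "(\<integral>\<^sup>+ t. ennreal (d (f (t, x)) (h0 x)) \<partial>leb_I a b) \<noteq> \<infinity>"
    show "A.I.int1 (\<lambda>t. f (t, x))"
      by (rule A.int1_change[OF good_section2[OF f x(1)] sep_measD(1)[OF h0 x(1)]])
        (use x(2) in \<open>simp add: top.not_eq_extremum\<close>)
  qed
qed

lemma sec_I_cls:
  assumes "LP.int1 f"
  shows "sec_I a b M N d hcls (LP.cls f) = W.I.cls (\<lambda>t. Lh.cls (\<lambda>x. f (t, x)))"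
proof -
  have "AE p in Q.P. rep (LP.cls f) p = f p" by (rule rep_AE[OF LP.int1_AE[OF assms] N_ne])
  then have "AE t in leb_I a b. AE x in M. rep (LP.cls f) (t, x) = f (t, x)" by (rule caratheodory_AE_sections)
  then have "AE t in leb_I a b. Lh.cls (\<lambda>x. rep (LP.cls f) (t, x)) = Lh.cls (\<lambda>x. f (t, x))"
    by (rule AE_mp) (rule AE_I2, intro impI ae_class_eq)
  then show ?thesis unfolding sec_I_def by (rule ae_class_eq)
qed

lemma sec_M_cls:
  assumes "LP.int1 f"
  shows "sec_M a b M N d (LP.cls f) = ae_class M (L1_I a b N d) (\<lambda>x. A.I.cls (\<lambda>t. f (t, x)))"
proof -
  have "AE p in Q.P. rep (LP.cls f) p = f p" by (rule rep_AE[OF LP.int1_AE[OF assms] N_ne])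
  then have "AE x in M. AE t in leb_I a b. rep (LP.cls f) (t, x) = f (t, x)" by (rule caratheodory_AE_sections)
  then have "AE x in M. A.I.cls (\<lambda>t. rep (LP.cls f) (t, x)) = A.I.cls (\<lambda>t. f (t, x))"
    by (rule AE_mp) (rule AE_I2, intro impI ae_class_eq)
  then show ?thesis unfolding sec_M_def by (rule ae_class_eq)
qed

lemma LP_eqI:
  assumes f: "good f S" "LP.int1 f" and g: "good g S'" "LP.int1 g"
    and z: "(\<integral>\<^sup>+ t. (\<integral>\<^sup>+ x. ennreal (d (f (t, x)) (g (t, x))) \<partial>M) \<partial>leb_I a b) = 0 \<or>
      (\<integral>\<^sup>+ x. (\<integral>\<^sup>+ t. ennreal (d (f (t, x)) (g (t, x))) \<partial>leb_I a b) \<partial>M) = 0"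
  shows "LP.cls f = LP.cls g"
  unfolding LP.cls_eq_iff[OF f(2) g(2)] using z good_tonelli(3,4)[OF f(1) g(1)] by auto

lemma sec_I_inj: "inj_on (sec_I a b M N d hcls) LP.L"
proof (rule inj_onI)
  fix F G assume "F \<in> LP.L" "G \<in> LP.L" and eq: "sec_I a b M N d hcls F = sec_I a b M N d hcls G"
  then obtain f S g S' where f: "good f S" "LP.int1 f" "F = LP.cls f" and g: "good g S'" "LP.int1 g" "G = LP.cls g"
    using LP_normal_form by metis
  have fL: "AE t in leb_I a b. Lh.cls (\<lambda>x. f (t, x)) \<in> Lh.L"
    using good_int1_sections(1)[OF f(1,2)] by (rule AE_mp) (rule AE_I2, use Lh.cls_mem in blast)
  have "AE t in leb_I a b. Lh.cls (\<lambda>x. f (t, x)) = Lh.cls (\<lambda>x. g (t, x))"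
    using eq unfolding f(3) g(3) sec_I_cls[OF f(2)] sec_I_cls[OF g(2)]
    by (rule ae_class_eqD[OF _ fL W.Z_ne])
  with good_int1_sections(1)[OF f(1,2)] good_int1_sections(1)[OF g(1,2)]
  have "AE t in leb_I a b. (\<integral>\<^sup>+ x. ennreal (d (f (t, x)) (g (t, x))) \<partial>M) = 0"
    by eventually_elim (simp add: Lh.cls_eq_iff)
  then have "(\<integral>\<^sup>+ t. (\<integral>\<^sup>+ x. ennreal (d (f (t, x)) (g (t, x))) \<partial>M) \<partial>leb_I a b) = (\<integral>\<^sup>+ t. 0 \<partial>leb_I a b)"
    by (rule nn_integral_cong_AE)
  then show "F = G" unfolding f(3) g(3) by (intro LP_eqI[OF f(1,2) g(1,2)] disjI1) simp
qed

lemma sec_M_inj: "inj_on (sec_M a b M N d) LP.L"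
proof (rule inj_onI)
  fix F G assume "F \<in> LP.L" "G \<in> LP.L" and eq: "sec_M a b M N d F = sec_M a b M N d G"
  then obtain f S g S' where f: "good f S" "LP.int1 f" "F = LP.cls f" and g: "good g S'" "LP.int1 g" "G = LP.cls g"
    using LP_normal_form by metis
  have fL: "AE x in M. A.I.cls (\<lambda>t. f (t, x)) \<in> L1_I a b N d"
    using good_int1_sections(2)[OF f(1,2)] unfolding A.L1_I_eq by (rule AE_mp) (rule AE_I2, use A.I.cls_mem in blast)
  have ne: "L1_I a b N d \<noteq> {}" unfolding A.L1_I_eq using A.I.cls_mem[OF A.I.int1_ref] by blast
  have "AE x in M. A.I.cls (\<lambda>t. f (t, x)) = A.I.cls (\<lambda>t. g (t, x))"
    using eq unfolding f(3) g(3) sec_M_cls[OF f(2)] sec_M_cls[OF g(2)]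
    by (rule ae_class_eqD[OF _ fL ne])
  with good_int1_sections(2)[OF f(1,2)] good_int1_sections(2)[OF g(1,2)]
  have "AE x in M. (\<integral>\<^sup>+ t. ennreal (d (f (t, x)) (g (t, x))) \<partial>leb_I a b) = 0"
    by eventually_elim (simp add: A.I.cls_eq_iff)
  then have "(\<integral>\<^sup>+ x. (\<integral>\<^sup>+ t. ennreal (d (f (t, x)) (g (t, x))) \<partial>leb_I a b) \<partial>M) = (\<integral>\<^sup>+ x. 0 \<partial>M)"
    by (rule nn_integral_cong_AE)
  then show "F = G" unfolding f(3) g(3) by (intro LP_eqI[OF f(1,2) g(1,2)] disjI2) simp
qed

text \<open>A Bochner integrable curve is the limit of countably valued curves \<open>t \<mapsto> k (i n t)\<close>, which lift to
  the product; the series of their consecutive distances converges almost everywhere there.\<close>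

lemma sec_I_surj:
  assumes "F \<in> L1_I_L1_M a b M N d hcls"
  shows "F \<in> sec_I a b M N d hcls ` LP.L"
proof -
  obtain \<phi> where \<phi>: "W.I.int1 \<phi>" "F = W.I.cls \<phi>"
    using assms unfolding L1_I_L1_M_def W.L1_I_eq by (auto simp: W.I.L_iff)
  note \<phi>s = W.I.int1_sep[OF \<phi>(1)]
  have \<phi>L: "\<phi> t \<in> Lh.L" if "t \<in> {a..b}" for t using sep_measD(1)[OF \<phi>s] that by simp
  obtain D where D: "countable D" "D \<subseteq> \<phi> ` {a..b}" "D \<subseteq> Lh.L"
    "\<And>t e. t \<in> {a..b} \<Longrightarrow> e > 0 \<Longrightarrow> \<exists>z\<in>D. L1_dist M d (\<phi> t) z < e"
    using Lh.Lp.sep_meas_dense[OF \<phi>s] unfolding space_leb_I by metis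
  have Dne: "D \<noteq> {}" using D(4)[of a 1] ab' by auto
  define K where "K = from_nat_into D"
  have KL: "K i \<in> Lh.L" for i unfolding K_def using from_nat_into[OF Dne] D(3) by blast
  then have "\<exists>k. Lh.int1 k \<and> K i = Lh.cls k" for i using Lh.L_iff by blast
  then obtain k where k: "\<And>i. Lh.int1 (k i)" "\<And>i. K i = Lh.cls (k i)" by metis
  \<comment> \<open>Off this sigma-finite set every \<open>k i\<close> equals \<open>h0\<close>,
    hence so do all lifted approximations and their limit.\<close>
  define S where "S = (\<Union>i. {x \<in> space M. ennreal (d (k i x) (h0 x)) \<noteq> 0})"
  have S: "sfin M S"
    unfolding S_def
  proof (rule sfin_UN, rule sfin_support)
    show "(\<lambda>x. ennreal (d (k i x) (h0 x))) \<in> borel_measurable M" for i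
      using sep_meas_dist[OF Lh.int1_sep[OF k(1)[of i]] h0] by measurable
    show "(\<integral>\<^sup>+ x. ennreal (d (k i x) (h0 x)) \<partial>M) < \<infinity>" for i using k(1)[of i] by (simp add: Lh.int1_def)
  qed
  have kN: "k i x \<in> N" if "x \<in> space M" for i x using sep_measD(1)[OF Lh.int1_sep[OF k(1)] that] .
  have off: "k i x = h0 x" if "x \<in> space M" "x \<notin> S" for i x
  proof -
    have "ennreal (d (k i x) (h0 x)) = 0" using that unfolding S_def by blast
    then have "d (k i x) (h0 x) = 0" using nonneg[of "k i x" "h0 x"] unfolding ennreal_eq_0_iff by linarith
    then show ?thesis using zero[OF kN[OF that(1)] sep_measD(1)[OF h0 that(1)]] by blast
  qed
  \<comment> \<open>The first member of the dense sequence within \<open>(1/2)^n\<close> of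
    \<phi>(t). Taking the least index makes the choice measurable, and the powers of 1/2 make
    consecutive distances summable.\<close>
  define i where "i n t = (LEAST j. L1_dist M d (\<phi> t) (K j) < (1/2)^n)" for n :: nat and t
  have i_dist: "L1_dist M d (\<phi> t) (K (i n t)) < (1/2)^n" if t: "t \<in> {a..b}" for n t
  proof -
    obtain z where "z \<in> D" "L1_dist M d (\<phi> t) z < (1/2)^n" using D(4)[OF t, of "(1/2)^n"] by auto
    then have "\<exists>j. L1_dist M d (\<phi> t) (K j) < (1/2)^n"
      unfolding K_def using from_nat_into_surj[OF D(1)] by metis
    then show ?thesis unfolding i_def by (rule LeastI_ex)
  qed
  have i_meas: "i n \<in> measurable (leb_I a b) (count_space UNIV)" for n
  proof -
    have [measurable]: "(\<lambda>t. L1_dist M d (\<phi> t) (K j)) \<in> borel_measurable (leb_I a b)" for j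
      by (rule sep_measD(2)[OF \<phi>s KL])
    show ?thesis unfolding i_def[abs_def] by measurable
  qed
  define f where "f n p = k (i n (fst p)) (snd p)" for n and p :: "real \<times> 'm"
  have f_good: "good (f n) S" for n
    unfolding good_def
  proof (intro conjI ballI impI)
    show "sep_meas (leb_I a b \<Otimes>\<^sub>M M) N d (f n)"
      unfolding f_def[abs_def]
      by (rule sep_meas_countable[where f = "\<lambda>j p. k j (snd p)" and i = "\<lambda>p. i n (fst p)"])
        (rule sep_meas_compose[OF Lh.int1_sep[OF k(1)] measurable_snd], rule measurable_compose[OF measurable_fst i_meas])
  qed (use S off f_def in auto)
  define E where "E p = (\<Sum>n. ennreal (d (f n p) (f (Suc n) p)))" for p
  have dm: "(\<lambda>p. ennreal (d (f n p) (f (Suc n) p))) \<in> borel_measurable (leb_I a b \<Otimes>\<^sub>M M)" for n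
    using sep_meas_dist[OF good_sep[OF f_good] good_sep[OF f_good]] by measurable
  then have Em: "E \<in> borel_measurable (leb_I a b \<Otimes>\<^sub>M M)" unfolding E_def[abs_def] by measurable
  have fN: "f n p \<in> N" if "p \<in> space (leb_I a b \<Otimes>\<^sub>M M)" for n p
    using sep_measD(1)[OF good_sep[OF f_good] that] .
  have "\<exists>l. l \<in> N \<and> (\<lambda>n. d (f n p) l) \<longlonglongrightarrow> 0" if "p \<in> space (leb_I a b \<Otimes>\<^sub>M M)" "E p < \<infinity>" for p
    using summable_limit[OF complete, of "\<lambda>n. f n p"] fN[OF that(1)] that(2) unfolding E_def by blast
  then obtain l where l: "\<And>p. p \<in> space (leb_I a b \<Otimes>\<^sub>M M) \<Longrightarrow> E p < \<infinity> \<Longrightarrow> l p \<in> N"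
    "\<And>p. p \<in> space (leb_I a b \<Otimes>\<^sub>M M) \<Longrightarrow> E p < \<infinity> \<Longrightarrow> (\<lambda>n. d (f n p) (l p)) \<longlonglongrightarrow> 0" by metis
  define g where "g p = (if E p < \<infinity> then l p else h0 (snd p))" for p
  have h0N: "h0 (snd p) \<in> N" if "p \<in> space (leb_I a b \<Otimes>\<^sub>M M)" for p
    using that by (intro sep_measD(1)[OF h0]) (auto simp: space_pair_measure)
  have gN: "g p \<in> N" if "p \<in> space (leb_I a b \<Otimes>\<^sub>M M)" for p
    using l(1)[OF that] h0N[OF that] by (simp add: g_def)
  have g_sep: "sep_meas (leb_I a b \<Otimes>\<^sub>M M) N d g"
  proof (rule sep_meas_lim)
    show "sep_meas (leb_I a b \<Otimes>\<^sub>M M) N d (\<lambda>p. if E p < \<infinity> then f n p else h0 (snd p))" for n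
    proof (rule sep_meas_if[OF good_sep[OF f_good] good_sep[OF good_h0]])
      show "{p \<in> space (leb_I a b \<Otimes>\<^sub>M M). E p < \<infinity>} \<in> sets (leb_I a b \<Otimes>\<^sub>M M)" using Em by measurable
    qed
    show "g \<in> space (leb_I a b \<Otimes>\<^sub>M M) \<rightarrow> N" using gN by auto
    show "(\<lambda>n. d (if E p < \<infinity> then f n p else h0 (snd p)) (g p)) \<longlonglongrightarrow> 0" if "p \<in> space (leb_I a b \<Otimes>\<^sub>M M)" for p
      using l(2)[OF that] h0N[OF that] by (cases "E p < \<infinity>") (simp_all add: g_def)
  qed
  have g_off: "g (t, x) = h0 x" if "t \<in> {a..b}" "x \<in> space M" "x \<notin> S" for t x
  proof -
    have p: "(t, x) \<in> space (leb_I a b \<Otimes>\<^sub>M M)" using that by (simp add: space_pair_measure)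
    have fh: "f n (t, x) = h0 x" for n using off[OF that(2,3)] by (simp add: f_def)
    have hN: "h0 x \<in> N" by (rule sep_measD(1)[OF h0 that(2)])
    have "E (t, x) = 0" unfolding E_def fh using hN by simp
    then have E: "E (t, x) < \<infinity>" by simp
    have "(\<lambda>n. d (f n (t, x)) (l (t, x))) \<longlonglongrightarrow> 0" by (rule l(2)[OF p E])
    then have "d (h0 x) (l (t, x)) = 0" unfolding fh by (simp add: LIMSEQ_const_iff)
    then show ?thesis using zero[OF hN l(1)[OF p E]] E by (simp add: g_def)
  qed
  have g_good: "good g S" unfolding good_def using S g_sep g_off by blast
  have g_cls: "Lh.cls (\<lambda>x. g (t, x)) = \<phi> t" if t: "t \<in> {a..b}" for t
  proof -
    obtain w where w: "Lh.int1 w" "\<phi> t = Lh.cls w" using \<phi>L[OF t] by (auto simp: Lh.L_iff)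
    have fw: "(\<integral>\<^sup>+ x. ennreal (d (f n (t, x)) (w x)) \<partial>M) = ennreal (L1_dist M d (\<phi> t) (K (i n t)))" for n
      unfolding w(2) k(2) Lh.ennreal_dist_cls[OF w(1) k(1)] by (simp add: f_def commute)
    \<comment> \<open>The estimate holds at each \<open>t\<close>, so the series converges at almost
      every \<open>x\<close> for every \<open>t\<close>, not merely for almost every
      \<open>t\<close>.\<close>
    have "(\<integral>\<^sup>+ x. E (t, x) \<partial>M) = (\<Sum>n. \<integral>\<^sup>+ x. ennreal (d (f n (t, x)) (f (Suc n) (t, x))) \<partial>M)"
      unfolding E_def using measurable_Pair2[OF dm, of t] t by (intro nn_integral_suminf) auto
    also have "\<dots> \<le> (\<Sum>n. ennreal (2 * (1/2)^n))"
    proof (intro suminf_le allI)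
      fix n
      have "(\<integral>\<^sup>+ x. ennreal (d (f n (t, x)) (f (Suc n) (t, x))) \<partial>M) = ennreal (L1_dist M d (K (i n t)) (K (i (Suc n) t)))"
        unfolding k(2) Lh.ennreal_dist_cls[OF k(1) k(1)] by (simp add: f_def)
      also have "\<dots> \<le> ennreal (2 * (1/2)^n)"
      proof (rule ennreal_leI)
        have "L1_dist M d (K (i n t)) (K (i (Suc n) t)) \<le> L1_dist M d (K (i n t)) (\<phi> t) + L1_dist M d (\<phi> t) (K (i (Suc n) t))"
          by (rule Lh.Lp.triangle[OF KL \<phi>L[OF t] KL])
        also have "\<dots> \<le> (1/2)^n + (1/2)^Suc n"
          using i_dist[OF t, of n] i_dist[OF t, of "Suc n"] by (simp add: Lh.Lp.commute)
        finally show "L1_dist M d (K (i n t)) (K (i (Suc n) t)) \<le> 2 * (1/2)^n"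
          unfolding power_Suc using zero_le_power[of "1/2::real" n] by linarith
      qed
      finally show "(\<integral>\<^sup>+ x. ennreal (d (f n (t, x)) (f (Suc n) (t, x))) \<partial>M) \<le> ennreal (2 * (1/2)^n)" .
    qed auto
    also have "\<dots> = ennreal (\<Sum>n. 2 * (1/2)^n)" by (rule suminf_ennreal2) auto
    also have "\<dots> < \<infinity>" by simp
    finally have "(\<integral>\<^sup>+ x. E (t, x) \<partial>M) \<noteq> \<infinity>" by simp
    then have E: "AE x in M. E (t, x) \<noteq> \<infinity>"
      by (rule nn_integral_noteq_infinite[OF measurable_Pair2[OF Em, rotated], rotated]) (use t in simp)
    have "AE x in M. g (t, x) = w x"
    proof (rule L1_limit_unique[where f = "\<lambda>n x. f n (t, x)"])
      show "sep_meas M N d w" by (rule Lh.int1_sep[OF w(1)])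
      show "sep_meas M N d (\<lambda>x. f n (t, x))" for n by (rule good_section1[OF f_good t])
      show "sep_meas M N d (\<lambda>x. g (t, x))" by (rule good_section1[OF g_good t])
      from E show "AE x in M. (\<lambda>n. d (f n (t, x)) (g (t, x))) \<longlonglongrightarrow> 0"
      proof (rule AE_mp, intro AE_I2 impI)
        fix x assume "x \<in> space M" "E (t, x) \<noteq> \<infinity>"
        then show "(\<lambda>n. d (f n (t, x)) (g (t, x))) \<longlonglongrightarrow> 0"
          using l(2)[of "(t, x)"] t by (simp add: g_def space_pair_measure top.not_eq_extremum)
      qed
      have "(\<lambda>n. L1_dist M d (\<phi> t) (K (i n t))) \<longlonglongrightarrow> 0"
      proof (rule tendsto_sandwich[OF _ _ tendsto_const])
        show "\<forall>\<^sub>F n in sequentially. 0 \<le> L1_dist M d (\<phi> t) (K (i n t))" by simp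
        show "\<forall>\<^sub>F n in sequentially. L1_dist M d (\<phi> t) (K (i n t)) \<le> (1/2)^n"
          using i_dist[OF t] by (intro always_eventually allI less_imp_le)
        show "(\<lambda>n. (1/2::real)^n) \<longlonglongrightarrow> 0" by (rule LIMSEQ_power_zero) simp
      qed
      then show "(\<lambda>n. \<integral>\<^sup>+ x. ennreal (d (f n (t, x)) (w x)) \<partial>M) \<longlonglongrightarrow> 0"
        unfolding fw using tendsto_ennrealI by fastforce
    qed
    then show ?thesis unfolding w(2) by (rule ae_class_eq)
  qed
  have gi: "Lh.int1 (\<lambda>x. g (t, x))" if t: "t \<in> {a..b}" for t
    by (rule Lh.int1_of_cls[OF good_section1[OF g_good t]]) (simp add: g_cls[OF t] \<phi>L[OF t])
  have "(\<integral>\<^sup>+ p. ennreal (d (g p) (h0 (snd p))) \<partial>Q.P) = (\<integral>\<^sup>+ t. (\<integral>\<^sup>+ x. ennreal (d (g (t, x)) (h0 x)) \<partial>M) \<partial>leb_I a b)"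
    using good_tonelli(3)[OF g_good good_h0] by simp
  also have "\<dots> = (\<integral>\<^sup>+ t. ennreal (L1_dist M d (\<phi> t) hcls) \<partial>leb_I a b)"
  proof (rule nn_integral_cong)
    fix t assume "t \<in> space (leb_I a b)"
    then have t: "t \<in> {a..b}" by simp
    show "(\<integral>\<^sup>+ x. ennreal (d (g (t, x)) (h0 x)) \<partial>M) = ennreal (L1_dist M d (\<phi> t) hcls)"
      using Lh.ennreal_dist_cls[OF gi[OF t] Lh.int1_ref] g_cls[OF t] by simp
  qed
  also have "\<dots> < \<infinity>"
  proof (rule W.I.nn_finite[OF \<phi>(1)])
    have hL: "hcls \<in> Lh.L" by (rule Lh.cls_mem[OF Lh.int1_ref])
    show "W.I.int1 (\<lambda>_. hcls)"
      by (rule W.int1_change[OF Lh.Lp.sep_meas_const[OF hL] hL]) (use hL in simp)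
  qed
  finally have "LP.int1 g" using good_sep_P[OF g_good] by (simp add: LP.int1_def)
  moreover have "W.I.cls (\<lambda>t. Lh.cls (\<lambda>x. g (t, x))) = F"
    unfolding \<phi>(2) by (rule ae_class_eq, rule AE_I2) (simp add: g_cls)
  ultimately show ?thesis using sec_I_cls LP.cls_mem by (metis image_eqI)
qed

end

section \<open>Lifting curves of bounded variation\<close>

text \<open>All members of a class agree almost everywhere, so the compatible one that
  \<open>post_comp\<close> picks can be replaced by \<open>g\<close>.\<close>

lemma post_comp_class:
  assumes g: "\<And>y. y \<in> space Y \<Longrightarrow> g y \<in> D" "\<And>y. y \<in> space Y \<Longrightarrow> g y \<in> Z'"
  shows "\<exists>f. compatible Y D (ae_class Y Z' g) f"
    "post_comp Y D Z \<phi> (ae_class Y Z' g) = ae_class Y Z (\<lambda>y. \<phi> (g y))"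
proof -
  have "restrict g (space Y) \<in> ae_class Y Z' g"
    unfolding ae_class_def using g(2) by (auto intro!: AE_I2)
  then show "\<exists>f. compatible Y D (ae_class Y Z' g) f"
    using g(1) by (intro exI[of _ "restrict g (space Y)"]) (auto simp: compatible_def)
  then have "compatible Y D (ae_class Y Z' g) (SOME f. compatible Y D (ae_class Y Z' g) f)" by (rule someI_ex)
  then have "AE y in Y. (SOME f. compatible Y D (ae_class Y Z' g) f) y = g y"
    unfolding compatible_def by (blast dest: ae_class_memD(2))
  then show "post_comp Y D Z \<phi> (ae_class Y Z' g) = ae_class Y Z (\<lambda>y. \<phi> (g y))"
    unfolding post_comp_def by (intro ae_class_eq) (auto elim: AE_mp)
qed

context metric_target
begin

lemma vsum_measurable:
  assumes "\<And>t. t \<in> set xs \<Longrightarrow> sep_meas Y Z d (k t)"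
  shows "(\<lambda>x. vsum d (\<lambda>t. k t x) xs) \<in> borel_measurable Y"
  using assms
proof (induction xs rule: induct_list012)
  case (3 s t xs)
  have "(\<lambda>x. d (k s x) (k t x)) \<in> borel_measurable Y" by (rule sep_meas_dist) (use 3(3) in auto)
  moreover have "(\<lambda>x. vsum d (\<lambda>t. k t x) (t # xs)) \<in> borel_measurable Y" using 3(2) 3(3) by auto
  ultimately show ?case by simp
qed simp_all

lemma Var_measurable:
  assumes "countable A" "\<And>t. t \<in> A \<Longrightarrow> sep_meas Y Z d (k t)"
  shows "(\<lambda>x. Var d (\<lambda>t. k t x) A) \<in> borel_measurable Y"
  unfolding Var_eq
proof (rule borel_measurable_SUP)
  show "countable (partitions A)"
    by (rule countable_subset[OF _ countable_lists[OF assms(1)]]) (auto simp: partitions_def)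
  fix xs assume "xs \<in> partitions A"
  then have "(\<lambda>x. vsum d (\<lambda>t. k t x) xs) \<in> borel_measurable Y"
    by (intro vsum_measurable assms(2)) (auto simp: partitions_def)
  then show "(\<lambda>x. ennreal (vsum d (\<lambda>t. k t x) xs)) \<in> borel_measurable Y" by measurable
qed

end

section \<open>Integrals of variations\<close>

context L1_target
begin

lemma vsum_integral:
  assumes "\<And>t. t \<in> set xs \<Longrightarrow> int1 (k t)"
  shows "(\<integral>\<^sup>+ x. ennreal (vsum d (\<lambda>t. k t x) xs) \<partial>Y) = ennreal (vsum (L1_dist Y d) (\<lambda>t. cls (k t)) xs)"
  using assms
proof (induction xs rule: induct_list012)
  case (3 s t xs)
  have st: "int1 (k s)" "int1 (k t)" using 3(3) by auto
  have IH: "(\<integral>\<^sup>+ x. ennreal (vsum d (\<lambda>t. k t x) (t # xs)) \<partial>Y) = ennreal (vsum (L1_dist Y d) (\<lambda>t. cls (k t)) (t # xs))"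
    using 3(2) 3(3) by auto
  have m: "(\<lambda>x. d (k s x) (k t x)) \<in> borel_measurable Y" by (rule sep_meas_dist[OF int1_sep int1_sep, OF st])
  have m': "(\<lambda>x. vsum d (\<lambda>t. k t x) (t # xs)) \<in> borel_measurable Y"
    by (rule vsum_measurable[OF int1_sep]) (use 3(3) in auto)
  have "(\<integral>\<^sup>+ x. ennreal (vsum d (\<lambda>t. k t x) (s # t # xs)) \<partial>Y)
      = (\<integral>\<^sup>+ x. ennreal (d (k s x) (k t x)) + ennreal (vsum d (\<lambda>t. k t x) (t # xs)) \<partial>Y)"
    by (simp add: vsum_nonneg)
  also have "\<dots> = (\<integral>\<^sup>+ x. ennreal (d (k s x) (k t x)) \<partial>Y) + (\<integral>\<^sup>+ x. ennreal (vsum d (\<lambda>t. k t x) (t # xs)) \<partial>Y)"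
    using m m' by (intro nn_integral_add) auto
  also have "\<dots> = ennreal (L1_dist Y d (cls (k s)) (cls (k t))) + ennreal (vsum (L1_dist Y d) (\<lambda>t. cls (k t)) (t # xs))"
    by (simp only: ennreal_dist_cls[OF st] IH)
  also have "\<dots> = ennreal (vsum (L1_dist Y d) (\<lambda>t. cls (k t)) (s # t # xs))"
    by (simp add: Lp.vsum_nonneg)
  finally show ?case .
qed simp_all

text \<open>Finite subsets exhaust \<open>A\<close>; on each the variation is a single sum, whose
  integral is the corresponding sum for the classes. Monotone convergence and the same exhaustion on
  the side of the classes give the equality.\<close>

lemma Var_integral:
  assumes A: "countable A" and k: "\<And>t. t \<in> A \<Longrightarrow> int1 (k t)"
  shows "(\<lambda>x. Var d (\<lambda>t. k t x) A) \<in> borel_measurable Y"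
    "(\<integral>\<^sup>+ x. Var d (\<lambda>t. k t x) A \<partial>Y) = Var (L1_dist Y d) (\<lambda>t. cls (k t)) A"
proof -
  define B where "B n = (if A = {} then {} else from_nat_into A ` {..<n})" for n :: nat
  have B: "finite (B n)" "B n \<subseteq> A" for n
    using from_nat_into[of A] by (auto simp: B_def)
  have inc: "incseq B" by (auto simp: B_def incseq_def)
  have UB: "(\<Union>n. B n) = A"
  proof (cases "A = {}")
    case False
    then have "A = from_nat_into A ` UNIV" using range_from_nat_into[OF False A] by simp
    also have "\<dots> = (\<Union>n. B n)" using False by (auto simp: B_def)
    finally show ?thesis by simp
  qed (simp add: B_def)
  define xs where "xs n = sorted_list_of_set (B n)" for n
  have xs: "int1 (k t)" if "t \<in> set (xs n)" for n t
    using that B[of n] k by (auto simp: xs_def)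
  have V: "(\<lambda>x. vsum d (\<lambda>t. k t x) (xs n)) \<in> borel_measurable Y"
    "(\<integral>\<^sup>+ x. ennreal (vsum d (\<lambda>t. k t x) (xs n)) \<partial>Y) = ennreal (vsum (L1_dist Y d) (\<lambda>t. cls (k t)) (xs n))" for n
    by (rule vsum_measurable[OF int1_sep[OF xs]] vsum_integral[OF xs]; assumption)+
  have Vx: "Var d (\<lambda>t. k t x) (B n) = ennreal (vsum d (\<lambda>t. k t x) (xs n))" if "x \<in> space Y" for x n
    unfolding xs_def by (rule Var_finite) (use B sep_measD(1)[OF int1_sep[OF k] that] in auto)
  have Vx': "Var d (\<lambda>t. k t x) A = (SUP n. ennreal (vsum d (\<lambda>t. k t x) (xs n)))" if "x \<in> space Y" for x
    unfolding UB[symmetric] Var_UN_incseq[OF inc] using Vx[OF that] by simp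
  show "(\<lambda>x. Var d (\<lambda>t. k t x) A) \<in> borel_measurable Y"
    by (rule Var_measurable[OF A int1_sep[OF k]])
  \<comment> \<open>Monotonicity rests on \<open>k t x\<close> lying in \<open>Z\<close>, hence on
    \<open>x\<close> lying in the space; the value 0 elsewhere makes the sequence increasing on the
    whole type.\<close>
  have mono: "incseq (\<lambda>n x. if x \<in> space Y then ennreal (vsum d (\<lambda>t. k t x) (xs n)) else 0)"
  proof (intro incseq_SucI le_funI)
    fix n x
    show "(if x \<in> space Y then ennreal (vsum d (\<lambda>t. k t x) (xs n)) else 0)
        \<le> (if x \<in> space Y then ennreal (vsum d (\<lambda>t. k t x) (xs (Suc n))) else 0)"
      using Var_mono[OF incseq_SucD[OF inc, of n], of "\<lambda>t. k t x"]
      by (cases "x \<in> space Y") (simp_all add: Vx)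
  qed
  have "(\<integral>\<^sup>+ x. Var d (\<lambda>t. k t x) A \<partial>Y)
      = (\<integral>\<^sup>+ x. (SUP n. if x \<in> space Y then ennreal (vsum d (\<lambda>t. k t x) (xs n)) else 0) \<partial>Y)"
    by (rule nn_integral_cong) (simp add: Vx')
  also have "\<dots> = (SUP n. \<integral>\<^sup>+ x. (if x \<in> space Y then ennreal (vsum d (\<lambda>t. k t x) (xs n)) else 0) \<partial>Y)"
  proof (rule nn_integral_monotone_convergence_SUP[OF mono])
    fix n
    have "(\<lambda>x. ennreal (vsum d (\<lambda>t. k t x) (xs n))) \<in> borel_measurable Y" using V(1)[of n] by measurable
    then show "(\<lambda>x. if x \<in> space Y then ennreal (vsum d (\<lambda>t. k t x) (xs n)) else 0) \<in> borel_measurable Y"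
      by (rule measurable_cong[THEN iffD1, rotated]) simp
  qed
  also have "\<dots> = (SUP n. ennreal (vsum (L1_dist Y d) (\<lambda>t. cls (k t)) (xs n)))"
  proof (rule SUP_cong[OF refl])
    fix n
    have "(\<integral>\<^sup>+ x. (if x \<in> space Y then ennreal (vsum d (\<lambda>t. k t x) (xs n)) else 0) \<partial>Y)
        = (\<integral>\<^sup>+ x. ennreal (vsum d (\<lambda>t. k t x) (xs n)) \<partial>Y)"
      by (rule nn_integral_cong) simp
    then show "(\<integral>\<^sup>+ x. (if x \<in> space Y then ennreal (vsum d (\<lambda>t. k t x) (xs n)) else 0) \<partial>Y)
        = ennreal (vsum (L1_dist Y d) (\<lambda>t. cls (k t)) (xs n))" unfolding V(2) .
  qed
  also have "\<dots> = (SUP n. Var (L1_dist Y d) (\<lambda>t. cls (k t)) (B n))"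
  proof (rule SUP_cong[OF refl])
    fix n
    show "ennreal (vsum (L1_dist Y d) (\<lambda>t. cls (k t)) (xs n)) = Var (L1_dist Y d) (\<lambda>t. cls (k t)) (B n)"
      unfolding xs_def by (rule Lp.Var_finite[symmetric]) (use B cls_mem[OF k] in auto)
  qed
  also have "\<dots> = Var (L1_dist Y d) (\<lambda>t. cls (k t)) A" unfolding Lp.Var_UN_incseq[OF inc, symmetric] UB ..
  finally show "(\<integral>\<^sup>+ x. Var d (\<lambda>t. k t x) A \<partial>Y) = Var (L1_dist Y d) (\<lambda>t. cls (k t)) A" .
qed

end

section \<open>Lifts of curves of classes and the map \<open>i_tilde\<close>\<close>

context BV_setting
begin

abbreviation BVL where "BVL \<equiv> BV a b (L1 M N d hcls) (L1_dist M d)"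

text \<open>The values of \<gamma> represent \<open>c t\<close> for every \<open>t\<close>, not
  merely for almost every one; \<open>i_tilde c\<close> will be the class of \<gamma>.\<close>

definition lift_of :: "(real \<Rightarrow> ('m \<Rightarrow> 'n) set) \<Rightarrow> ('m \<Rightarrow> real \<Rightarrow> 'n) \<Rightarrow> bool" where
  "lift_of c \<gamma> \<longleftrightarrow> (\<forall>x\<in>space M. \<gamma> x \<in> BV a b N d) \<and>
     (\<forall>t\<in>{a..b}. sep_meas M N d (\<lambda>x. \<gamma> x t) \<and> c t = ae_class M N (\<lambda>x. \<gamma> x t))"

lemma lift_ofD:
  assumes "lift_of c \<gamma>"
  shows "x \<in> space M \<Longrightarrow> \<gamma> x \<in> BV a b N d" "t \<in> {a..b} \<Longrightarrow> sep_meas M N d (\<lambda>x. \<gamma> x t)"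
    "t \<in> {a..b} \<Longrightarrow> c t = Lh.cls (\<lambda>x. \<gamma> x t)"
  using assms by (auto simp: lift_of_def)

abbreviation T where "T \<equiv> \<rat> \<inter> {a<..<b}"

lemma T_countable: "countable T" using countable_rat by blast

lemma lift_int1:
  assumes "c \<in> BVL" "lift_of c \<gamma>" "t \<in> {a..b}"
  shows "Lh.int1 (\<lambda>x. \<gamma> x t)"
  by (rule Lh.int1_of_cls[OF lift_ofD(2)[OF assms(2,3)]])
    (use W.BV_mem[OF assms(1,3)] lift_ofD(3)[OF assms(2,3)] in simp)

lemma lift_exists:
  assumes c: "c \<in> BVL"
  shows "\<exists>\<gamma>. lift_of c \<gamma>"
proof -
  have "\<forall>t\<in>{a..b}. \<exists>k. Lh.int1 k \<and> c t = Lh.cls k" using W.BV_mem[OF c] Lh.L_iff by blast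
  then obtain k where k: "\<And>t. t \<in> {a..b} \<Longrightarrow> Lh.int1 (k t)" "\<And>t. t \<in> {a..b} \<Longrightarrow> c t = Lh.cls (k t)" by metis
  have TI: "t \<in> {a..b}" if "t \<in> T" for t using that by auto
  have kT: "Lh.int1 (k t)" if "t \<in> T" for t using k(1)[OF TI[OF that]] .
  have kN: "k t x \<in> N" if "t \<in> T" "x \<in> space M" for t x using sep_measD(1)[OF Lh.int1_sep[OF kT[OF that(1)]] that(2)] .
  define V where "V x = Var d (\<lambda>t. k t x) T" for x
  note VI = Lh.Var_integral[OF T_countable kT]
  have Vm: "V \<in> borel_measurable M" unfolding V_def[abs_def] by (rule VI(1))
  have "(\<integral>\<^sup>+ x. V x \<partial>M) = Var (L1_dist M d) (\<lambda>t. Lh.cls (k t)) T" unfolding V_def by (rule VI(2))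
  also have "\<dots> = Var (L1_dist M d) c T" by (rule Lh.Lp.Var_cong) (simp add: k(2) TI)
  also have "\<dots> \<le> Var (L1_dist M d) c {a..b}" by (rule Lh.Lp.Var_mono) auto
  also have "\<dots> < \<infinity>" by (rule W.BV_Var[OF c])
  finally have "(\<integral>\<^sup>+ x. V x \<partial>M) \<noteq> \<infinity>" by simp
  then have VAE: "AE x in M. V x \<noteq> \<infinity>" by (rule nn_integral_noteq_infinite[OF Vm])
  have "\<exists>\<gamma>\<in>BV a b N d.
      (\<forall>t\<in>{a..<b}. ((\<lambda>s. d (k s x) (\<gamma> t)) \<longlongrightarrow> 0) (at t within (T \<inter> {t<..}))) \<and>
      ((\<lambda>s. d (k s x) (\<gamma> b)) \<longlongrightarrow> 0) (at b within (T \<inter> {..<b}))" if "x \<in> space M" "V x < \<infinity>" for x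
    by (rule A.BV_extend[OF complete dense_in_rats]) (use kN that in \<open>auto simp: V_def\<close>)
  then obtain \<gamma>0 where \<gamma>0: "\<And>x. x \<in> space M \<Longrightarrow> V x < \<infinity> \<Longrightarrow> \<gamma>0 x \<in> BV a b N d"
    "\<And>x t. x \<in> space M \<Longrightarrow> V x < \<infinity> \<Longrightarrow> t \<in> {a..<b} \<Longrightarrow> ((\<lambda>s. d (k s x) (\<gamma>0 x t)) \<longlongrightarrow> 0) (at t within (T \<inter> {t<..}))"
    "\<And>x. x \<in> space M \<Longrightarrow> V x < \<infinity> \<Longrightarrow> ((\<lambda>s. d (k s x) (\<gamma>0 x b)) \<longlongrightarrow> 0) (at b within (T \<inter> {..<b}))"
    by metis
  \<comment> \<open>On the null set of infinite variation the constant curve at \<open>h0 x\<close>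
    is substituted; it lies in BV and depends measurably on \<open>x\<close>.\<close>
  define \<gamma> where "\<gamma> x = (if V x < \<infinity> then \<gamma>0 x else (\<lambda>t\<in>{a..b}. h0 x))" for x
  have hN: "h0 x \<in> N" if "x \<in> space M" for x by (rule sep_measD(1)[OF h0 that])
  have \<gamma>BV: "\<gamma> x \<in> BV a b N d" if "x \<in> space M" for x
    using \<gamma>0(1)[OF that] A.BV_const[OF hN[OF that]] by (simp add: \<gamma>_def)
  \<comment> \<open>One sequence of rationals serves all \<open>x\<close> at once and also
    \<open>c\<close>, so that pointwise limits can be compared with limits in
    \<open>L\<^sup>1\<close>.\<close>
  have seq: "\<exists>s :: nat \<Rightarrow> real. (\<forall>n. s n \<in> T) \<and> (\<forall>x\<in>space M. V x < \<infinity> \<longrightarrow> (\<lambda>n. d (k (s n) x) (\<gamma> x t)) \<longlonglongrightarrow> 0) \<and>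
      (\<lambda>n. L1_dist M d (c (s n)) (c t)) \<longlonglongrightarrow> 0" if t: "t \<in> {a..b}" for t
  proof (cases "t = b")
    case True
    obtain s :: "nat \<Rightarrow> real" where s: "\<And>j. s j \<in> T" "\<And>j. s j < b" "filterlim s (at_left b) sequentially"
      using dense_in_seq_left[OF dense_in_rats order_refl ab' order_refl] by blast
    then have f: "filterlim s (at b within (T \<inter> {..<b})) sequentially" by (auto simp: filterlim_at)
    show ?thesis
      using filterlim_compose[OF \<gamma>0(3) f] filterlim_compose[OF W.BV_left[OF c] s(3)] s(1) True
      by (intro exI[of _ s]) (auto simp: \<gamma>_def)
  next
    case False
    then have tb: "a \<le> t" "t < b" using t by auto
    obtain s :: "nat \<Rightarrow> real" where s: "\<And>j. s j \<in> T" "\<And>j. t < s j" "filterlim s (at_right t) sequentially"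
      using dense_in_seq_right[OF dense_in_rats tb order_refl] by blast
    then have f: "filterlim s (at t within (T \<inter> {t<..})) sequentially" by (auto simp: filterlim_at)
    show ?thesis
      using filterlim_compose[OF \<gamma>0(2) f] filterlim_compose[OF W.BV_right[OF c tb] s(3)] s(1) tb
      by (intro exI[of _ s]) (auto simp: \<gamma>_def)
  qed
  have "lift_of c \<gamma>"
    unfolding lift_of_def
  proof (intro conjI ballI \<gamma>BV)
    fix t assume t: "t \<in> {a..b}"
    obtain s :: "nat \<Rightarrow> real" where s: "\<And>n. s n \<in> T"
      "\<And>x. x \<in> space M \<Longrightarrow> V x < \<infinity> \<Longrightarrow> (\<lambda>n. d (k (s n) x) (\<gamma> x t)) \<longlonglongrightarrow> 0"
      "(\<lambda>n. L1_dist M d (c (s n)) (c t)) \<longlonglongrightarrow> 0" using seq[OF t] by blast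
    show sm: "sep_meas M N d (\<lambda>x. \<gamma> x t)"
    proof (rule sep_meas_lim)
      show "sep_meas M N d (\<lambda>x. if V x < \<infinity> then k (s n) x else h0 x)" for n
        by (rule sep_meas_if[OF Lh.int1_sep[OF kT[OF s(1)]] h0]) (use Vm in measurable)
      show "(\<lambda>x. \<gamma> x t) \<in> space M \<rightarrow> N" using A.BV_mem[OF \<gamma>BV t] by auto
      show "(\<lambda>n. d (if V x < \<infinity> then k (s n) x else h0 x) (\<gamma> x t)) \<longlonglongrightarrow> 0" if "x \<in> space M" for x
        using s(2)[OF that] hN[OF that] t by (cases "V x < \<infinity>") (simp_all add: \<gamma>_def)
    qed
    have "AE x in M. \<gamma> x t = k t x"
    proof (rule L1_limit_unique[where f = "\<lambda>n. k (s n)"])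
      show "sep_meas M N d (k t)" by (rule Lh.int1_sep[OF k(1)[OF t]])
      show "sep_meas M N d (k (s n))" for n by (rule Lh.int1_sep[OF kT[OF s(1)]])
      show "sep_meas M N d (\<lambda>x. \<gamma> x t)" by (rule sm)
      from VAE show "AE x in M. (\<lambda>n. d (k (s n) x) (\<gamma> x t)) \<longlonglongrightarrow> 0"
        by (rule AE_mp) (rule AE_I2, use s(2) in \<open>simp add: top.not_eq_extremum\<close>)
      have "(\<integral>\<^sup>+ x. ennreal (d (k (s n) x) (k t x)) \<partial>M) = ennreal (L1_dist M d (c (s n)) (c t))" for n
        unfolding k(2)[OF TI[OF s(1)]] k(2)[OF t] by (rule Lh.ennreal_dist_cls[OF kT[OF s(1)] k(1)[OF t], symmetric])
      then show "(\<lambda>n. \<integral>\<^sup>+ x. ennreal (d (k (s n) x) (k t x)) \<partial>M) \<longlonglongrightarrow> 0"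
        using tendsto_ennrealI[OF s(3)] by simp
    qed
    then have "AE x in M. k t x = \<gamma> x t" by (auto elim: AE_mp)
    then show "c t = Lh.cls (\<lambda>x. \<gamma> x t)" unfolding k(2)[OF t] by (rule ae_class_eq)
  qed
  then show ?thesis by blast
qed

lemma const_int1: "W.I.int1 (\<lambda>_. hcls)"
proof (rule W.int1_change[OF Lh.Lp.sep_meas_const])
  show "hcls \<in> Lh.L" "hcls \<in> Lh.L" by (rule Lh.cls_mem[OF Lh.int1_ref])+
  then show "(\<integral>\<^sup>+ t. ennreal (L1_dist M d hcls hcls) \<partial>leb_I a b) < \<infinity>" by simp
qed

definition joint :: "('m \<Rightarrow> real \<Rightarrow> 'n) \<Rightarrow> real \<times> 'm \<Rightarrow> 'n" where
  "joint \<gamma> p = \<gamma> (snd p) (fst p)"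

lemma joint_Pair [simp]: "joint \<gamma> (t, x) = \<gamma> x t" by (simp add: joint_def)

lemma joint_good:
  assumes c: "c \<in> BVL" and l: "lift_of c \<gamma>"
  shows "\<exists>S. good (joint \<gamma>) S" "LP.int1 (joint \<gamma>)"
proof -
  \<comment> \<open>Off the supports at rational times the curve \<gamma>(x) equals
    \<open>h0 x\<close> at all rationals, hence everywhere; countably many times thus yield a
    sigma-finite set that works for all times.\<close>
  define S where "S = (\<Union>t\<in>T. {x \<in> space M. ennreal (d (\<gamma> x t) (h0 x)) \<noteq> 0})"
  have S: "sfin M S"
    unfolding S_def
  proof (rule sfin_countable_UN[OF T_countable], rule sfin_support)
    fix t assume "t \<in> T"
    then have t: "t \<in> {a..b}" by auto
    show "(\<lambda>x. ennreal (d (\<gamma> x t) (h0 x))) \<in> borel_measurable M"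
      using sep_meas_dist[OF lift_ofD(2)[OF l t] h0] by measurable
    show "(\<integral>\<^sup>+ x. ennreal (d (\<gamma> x t) (h0 x)) \<partial>M) < \<infinity>" using lift_int1[OF c l t] by (simp add: Lh.int1_def)
  qed
  have off: "\<gamma> x t = h0 x" if x: "x \<in> space M" "x \<notin> S" and t: "t \<in> {a..b}" for x t
  proof -
    have hN: "h0 x \<in> N" by (rule sep_measD(1)[OF h0 x(1)])
    have "\<gamma> x = (\<lambda>t\<in>{a..b}. h0 x)"
    proof (rule A.BV_eq_dense[OF lift_ofD(1)[OF l x(1)] A.BV_const[OF hN] dense_in_rats])
      fix s assume s: "s \<in> T"
      then have sI: "s \<in> {a..b}" by auto
      have "ennreal (d (\<gamma> x s) (h0 x)) = 0" using x s unfolding S_def by blast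
      then have "d (\<gamma> x s) (h0 x) = 0" using nonneg[of "\<gamma> x s" "h0 x"] unfolding ennreal_eq_0_iff by linarith
      then have "\<gamma> x s = h0 x" using zero[OF A.BV_mem[OF lift_ofD(1)[OF l x(1)] sI] hN] by blast
      then show "\<gamma> x s = (\<lambda>t\<in>{a..b}. h0 x) s" using sI by simp
    qed
    then show ?thesis using t by simp
  qed
  have "sep_meas (leb_I a b \<Otimes>\<^sub>M M) N d (joint \<gamma>)"
    unfolding joint_def[abs_def] by (rule A.sep_meas_joint[OF lift_ofD(1,2)[OF l]])
  then have g: "good (joint \<gamma>) S" unfolding good_def using S off by simp
  then show "\<exists>S. good (joint \<gamma>) S" by blast
  have "(\<integral>\<^sup>+ p. ennreal (d (joint \<gamma> p) (h0 (snd p))) \<partial>Q.P) = (\<integral>\<^sup>+ t. (\<integral>\<^sup>+ x. ennreal (d (\<gamma> x t) (h0 x)) \<partial>M) \<partial>leb_I a b)"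
    using good_tonelli(3)[OF g good_h0] by simp
  also have "\<dots> = (\<integral>\<^sup>+ t. ennreal (L1_dist M d (c t) hcls) \<partial>leb_I a b)"
  proof (rule nn_integral_cong)
    fix t assume "t \<in> space (leb_I a b)"
    then have t: "t \<in> {a..b}" by simp
    show "(\<integral>\<^sup>+ x. ennreal (d (\<gamma> x t) (h0 x)) \<partial>M) = ennreal (L1_dist M d (c t) hcls)"
      using Lh.ennreal_dist_cls[OF lift_int1[OF c l t] Lh.int1_ref] lift_ofD(3)[OF l t] by simp
  qed
  also have "\<dots> < \<infinity>" by (rule W.I.nn_finite[OF W.BV_int1[OF c] const_int1])
  finally show "LP.int1 (joint \<gamma>)" using good_sep_P[OF g] by (simp add: LP.int1_def)
qed

lemma sec_I_joint:
  assumes c: "c \<in> BVL" and l: "lift_of c \<gamma>"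
  shows "sec_I a b M N d hcls (LP.cls (joint \<gamma>)) = W.I.cls c"
  unfolding sec_I_cls[OF joint_good(2)[OF c l]]
  by (rule ae_class_eq, rule AE_I2) (simp add: lift_ofD(3)[OF l])

text \<open>Injectivity of \<open>sec_I\<close> makes the inverse inside \<open>i_bar\<close> return
  the given preimage; on classes of BV curves the values of \<open>i_bar\<close> are found this way
  from the jointly measurable lift.\<close>

lemma i_bar_sec_I: "C \<in> LP.L \<Longrightarrow> i_bar a b M N d hcls (sec_I a b M N d hcls C) = sec_M a b M N d C"
  unfolding i_bar_def L1_IM_eq by (simp add: inv_into_f_f[OF sec_I_inj])

text \<open>Surjectivity of \<open>sec_I\<close> gives both arguments preimages, and injectivity of
  \<open>sec_M\<close> compares them. This is what later makes the inverse of \<open>i_bar\<close>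
  return the original class.\<close>

lemma i_bar_inj: "inj_on (i_bar a b M N d hcls) (L1_I_L1_M a b M N d hcls)"
proof (rule inj_onI)
  fix F G assume F: "F \<in> L1_I_L1_M a b M N d hcls" and G: "G \<in> L1_I_L1_M a b M N d hcls"
    and eq: "i_bar a b M N d hcls F = i_bar a b M N d hcls G"
  obtain C where C: "F = sec_I a b M N d hcls C" "C \<in> LP.L" using sec_I_surj[OF F] by (rule imageE)
  obtain D where D: "G = sec_I a b M N d hcls D" "D \<in> LP.L" using sec_I_surj[OF G] by (rule imageE)
  have "C = D" using eq unfolding C(1) D(1) i_bar_sec_I[OF C(2)] i_bar_sec_I[OF D(2)]
    by (rule inj_onD[OF sec_M_inj _ C(2) D(2)])
  then show "F = G" using C D by simp
qed

lemma i_bar_BV: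
  assumes c: "c \<in> BVL" and l: "lift_of c \<gamma>"
  shows "i_bar a b M N d hcls (W.I.cls c) = ae_class M (L1_I a b N d) (\<lambda>x. A.I.cls (\<gamma> x))"
proof -
  have "i_bar a b M N d hcls (W.I.cls c) = sec_M a b M N d (LP.cls (joint \<gamma>))"
    unfolding sec_I_joint[OF c l, symmetric] by (rule i_bar_sec_I[OF LP.cls_mem[OF joint_good(2)[OF c l]]])
  then show ?thesis unfolding sec_M_cls[OF joint_good(2)[OF c l]] by simp
qed

lemma cls_BV_mem: "\<gamma> \<in> BV a b N d \<Longrightarrow> A.I.cls \<gamma> \<in> L1_I a b N d"
  unfolding A.L1_I_eq by (rule A.I.cls_mem[OF A.BV_int1])

lemma i_tilde_eq:
  assumes c: "c \<in> BVL" and l: "lift_of c \<gamma>"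
  shows "\<exists>f. compatible M (BV_class a b N ` BV a b N d) (i_bar a b M N d hcls (BV_class a b (L1 M N d hcls) c)) f"
    "i_tilde a b M N d hcls c = ae_class M (BV a b N d) \<gamma>"
proof -
  have BVc: "BV_class a b (L1 M N d hcls) c = W.I.cls c" by (simp add: BV_class_def)
  have BVn: "BV_class a b N = A.I.cls" by (simp add: BV_class_def fun_eq_iff)
  have g: "A.I.cls (\<gamma> x) \<in> A.I.cls ` BV a b N d" "A.I.cls (\<gamma> x) \<in> L1_I a b N d" if "x \<in> space M" for x
    using lift_ofD(1)[OF l that] cls_BV_mem by auto
  note P = post_comp_class[of M "\<lambda>x. A.I.cls (\<gamma> x)", OF g]
  show "\<exists>f. compatible M (BV_class a b N ` BV a b N d) (i_bar a b M N d hcls (BV_class a b (L1 M N d hcls) c)) f"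
    unfolding BVc BVn i_bar_BV[OF c l] by (rule P(1))
  have "i_tilde a b M N d hcls c = ae_class M (BV a b N d) (\<lambda>x. inv_into (BV a b N d) A.I.cls (A.I.cls (\<gamma> x)))"
    unfolding i_tilde_def BVc BVn i_bar_BV[OF c l] by (rule P(2))
  also have "\<dots> = ae_class M (BV a b N d) \<gamma>"
    by (rule ae_class_eq, rule AE_I2) (simp add: inv_into_f_f[OF A.BV_cls_inj lift_ofD(1)[OF l]])
  finally show "i_tilde a b M N d hcls c = ae_class M (BV a b N d) \<gamma>" .
qed

lemma i_bar_BV_mem:
  assumes c: "c \<in> BVL" and l: "lift_of c \<gamma>"
  shows "ae_class M (L1_I a b N d) (\<lambda>x. A.I.cls (\<gamma> x)) \<in> L1_M_L1_I a b M N d hcls"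
proof -
  have rh: "AE x in M. rep hcls x = h0 x" by (rule rep_AE[OF sep_meas_AE[OF h0] N_ne])
  have ci: "A.I.int1 (\<lambda>t. z)" if "z \<in> N" for z
    by (rule A.int1_change[OF sep_meas_const[OF that] that]) (use that in simp)
  have hN: "h0 x \<in> N" if "x \<in> space M" for x by (rule sep_measD(1)[OF h0 that])
  have "L1_M_L1_I a b M N d hcls = L1 M A.I.L (L1_dist (leb_I a b) d) (ae_class M A.I.L (\<lambda>x. A.I.cls (\<lambda>t. h0 x)))"
  proof -
    have "ae_class M A.I.L (\<lambda>x. A.I.cls (\<lambda>t. rep hcls x)) = ae_class M A.I.L (\<lambda>x. A.I.cls (\<lambda>t. h0 x))"
      using rh by (intro ae_class_eq) (auto elim: AE_mp)
    then show ?thesis by (simp add: L1_M_L1_I_def A.L1_I_eq)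
  qed
  also have "ae_class M A.I.L (\<lambda>x. A.I.cls (\<gamma> x)) \<in> \<dots>"
  proof (rule A.I.Lp.L1_iff[THEN iffD2])
    show "AE x in M. A.I.cls (\<lambda>t. h0 x) \<in> A.I.L" by (rule AE_I2) (rule A.I.cls_mem[OF ci[OF hN]])
    show "A.I.L \<noteq> {}" using A.I.cls_mem[OF A.I.int1_ref] by blast
    have "(\<integral>\<^sup>+ x. ennreal (L1_dist (leb_I a b) d (A.I.cls (\<gamma> x)) (A.I.cls (\<lambda>t. h0 x))) \<partial>M)
        = (\<integral>\<^sup>+ x. (\<integral>\<^sup>+ t. ennreal (d (\<gamma> x t) (h0 x)) \<partial>leb_I a b) \<partial>M)"
      by (rule nn_integral_cong) (rule A.I.ennreal_dist_cls[OF A.BV_int1[OF lift_ofD(1)[OF l]] ci[OF hN]])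
    also obtain S where S: "good (joint \<gamma>) S" using joint_good(1)[OF c l] by blast
    then have "(\<integral>\<^sup>+ x. (\<integral>\<^sup>+ t. ennreal (d (\<gamma> x t) (h0 x)) \<partial>leb_I a b) \<partial>M) < \<infinity>"
      using good_tonelli(4)[OF S good_h0] joint_good(2)[OF c l] by (simp add: LP.int1_def)
    finally show "\<exists>f. sep_meas M A.I.L (L1_dist (leb_I a b) d) f \<and>
        (\<integral>\<^sup>+ x. ennreal (L1_dist (leb_I a b) d (f x) (A.I.cls (\<lambda>t. h0 x))) \<partial>M) < \<infinity> \<and>
        ae_class M A.I.L (\<lambda>x. A.I.cls (\<gamma> x)) = ae_class M A.I.L f"
      using A.sep_meas_class[OF lift_ofD(1,2)[OF l]] unfolding A.L1_I_eq by blast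
  qed
  finally show ?thesis by (simp add: A.L1_I_eq)
qed

lemma BV_dist_ennreal:
  "\<gamma> \<in> BV a b N d \<Longrightarrow> \<gamma>' \<in> BV a b N d \<Longrightarrow> ennreal (BV_dist a b d \<gamma> \<gamma>') = (\<integral>\<^sup>+ t. ennreal (d (\<gamma> t) (\<gamma>' t)) \<partial>leb_I a b)"
  unfolding A.BV_dist_cls by (rule A.I.ennreal_dist_cls[OF A.BV_int1 A.BV_int1])

lemma L1_M_BV_iff:
  "F \<in> L1_M_BV a b M N d hcls \<longleftrightarrow> (\<exists>f. sep_meas M (BV a b N d) (BV_dist a b d) f \<and>
    (\<integral>\<^sup>+ x. (\<integral>\<^sup>+ t. ennreal (d (f x t) (h0 x)) \<partial>leb_I a b) \<partial>M) < \<infinity> \<and> F = ae_class M (BV a b N d) f)"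
proof -
  have rh: "AE x in M. rep hcls x = h0 x" by (rule rep_AE[OF sep_meas_AE[OF h0] N_ne])
  have hB: "(\<lambda>t\<in>{a..b}. h0 x) \<in> BV a b N d" if "x \<in> space M" for x
    by (rule A.BV_const[OF sep_measD(1)[OF h0 that]])
  have "ae_class M (BV a b N d) (\<lambda>x. \<lambda>t\<in>{a..b}. rep hcls x) = ae_class M (BV a b N d) (\<lambda>x. \<lambda>t\<in>{a..b}. h0 x)"
    using rh by (intro ae_class_eq) (auto elim: AE_mp)
  then have "F \<in> L1_M_BV a b M N d hcls \<longleftrightarrow> (\<exists>f. sep_meas M (BV a b N d) (BV_dist a b d) f \<and>
    (\<integral>\<^sup>+ x. ennreal (BV_dist a b d (f x) (\<lambda>t\<in>{a..b}. h0 x)) \<partial>M) < \<infinity> \<and> F = ae_class M (BV a b N d) f)"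
    unfolding L1_M_BV_def using A.BV_const[OF A.z0] by (subst A.B.L1_iff[symmetric]) (auto intro: AE_I2 hB)
  also have "\<dots> \<longleftrightarrow> (\<exists>f. sep_meas M (BV a b N d) (BV_dist a b d) f \<and>
    (\<integral>\<^sup>+ x. (\<integral>\<^sup>+ t. ennreal (d (f x t) (h0 x)) \<partial>leb_I a b) \<partial>M) < \<infinity> \<and> F = ae_class M (BV a b N d) f)"
  proof (intro ex_cong1 conj_cong refl)
    fix f assume f: "sep_meas M (BV a b N d) (BV_dist a b d) f"
    have "(\<integral>\<^sup>+ x. ennreal (BV_dist a b d (f x) (\<lambda>t\<in>{a..b}. h0 x)) \<partial>M)
        = (\<integral>\<^sup>+ x. (\<integral>\<^sup>+ t. ennreal (d (f x t) (h0 x)) \<partial>leb_I a b) \<partial>M)"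
    proof (rule nn_integral_cong)
      fix x assume x: "x \<in> space M"
      show "ennreal (BV_dist a b d (f x) (\<lambda>t\<in>{a..b}. h0 x)) = (\<integral>\<^sup>+ t. ennreal (d (f x t) (h0 x)) \<partial>leb_I a b)"
        unfolding BV_dist_ennreal[OF sep_measD(1)[OF f x] hB[OF x]] by (rule nn_integral_cong) simp
    qed
    then show "((\<integral>\<^sup>+ x. ennreal (BV_dist a b d (f x) (\<lambda>t\<in>{a..b}. h0 x)) \<partial>M) < \<infinity>)
        = ((\<integral>\<^sup>+ x. (\<integral>\<^sup>+ t. ennreal (d (f x t) (h0 x)) \<partial>leb_I a b) \<partial>M) < \<infinity>)" by simp
  qed
  finally show ?thesis .
qed

lemma i_tilde_mem:
  assumes c: "c \<in> BVL" and l: "lift_of c \<gamma>"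
  shows "ae_class M (BV a b N d) \<gamma> \<in> L1_M_BV a b M N d hcls"
proof -
  obtain S where S: "good (joint \<gamma>) S" using joint_good(1)[OF c l] by blast
  have "(\<integral>\<^sup>+ x. (\<integral>\<^sup>+ t. ennreal (d (\<gamma> x t) (h0 x)) \<partial>leb_I a b) \<partial>M) < \<infinity>"
    using good_tonelli(4)[OF S good_h0] joint_good(2)[OF c l] by (simp add: LP.int1_def)
  then show ?thesis unfolding L1_M_BV_iff using A.sep_meas_BV_valued[OF lift_ofD(1,2)[OF l]] by blast
qed

lemma i_tilde_isometry:
  assumes c: "c \<in> BVL" "lift_of c \<gamma>" and c': "c' \<in> BVL" "lift_of c' \<gamma>'"
  shows "L1_M_BV_dist a b M d (ae_class M (BV a b N d) \<gamma>) (ae_class M (BV a b N d) \<gamma>') = BV_L1_M_dist a b M d c c'"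
proof -
  obtain S S' where S: "good (joint \<gamma>) S" and S': "good (joint \<gamma>') S'"
    using joint_good(1)[OF c] joint_good(1)[OF c'] by blast
  have "L1_M_BV_dist a b M d (ae_class M (BV a b N d) \<gamma>) (ae_class M (BV a b N d) \<gamma>')
      = enn2real (\<integral>\<^sup>+ x. ennreal (BV_dist a b d (\<gamma> x) (\<gamma>' x)) \<partial>M)"
    unfolding L1_M_BV_dist_def
    by (rule A.B.L1_dist_class) (use lift_ofD(1)[OF c(2)] lift_ofD(1)[OF c'(2)] A.BV_const[OF A.z0] in \<open>auto intro: AE_I2\<close>)
  also have "(\<integral>\<^sup>+ x. ennreal (BV_dist a b d (\<gamma> x) (\<gamma>' x)) \<partial>M) = (\<integral>\<^sup>+ x. (\<integral>\<^sup>+ t. ennreal (d (\<gamma> x t) (\<gamma>' x t)) \<partial>leb_I a b) \<partial>M)"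
    by (rule nn_integral_cong) (rule BV_dist_ennreal[OF lift_ofD(1)[OF c(2)] lift_ofD(1)[OF c'(2)]])
  also have "\<dots> = (\<integral>\<^sup>+ t. (\<integral>\<^sup>+ x. ennreal (d (\<gamma> x t) (\<gamma>' x t)) \<partial>M) \<partial>leb_I a b)"
    using good_tonelli(3,4)[OF S S'] by simp
  also have "\<dots> = (\<integral>\<^sup>+ t. ennreal (L1_dist M d (c t) (c' t)) \<partial>leb_I a b)"
  proof (rule nn_integral_cong)
    fix t assume "t \<in> space (leb_I a b)"
    then have t: "t \<in> {a..b}" by simp
    show "(\<integral>\<^sup>+ x. ennreal (d (\<gamma> x t) (\<gamma>' x t)) \<partial>M) = ennreal (L1_dist M d (c t) (c' t))"
      using Lh.ennreal_dist_cls[OF lift_int1[OF c t] lift_int1[OF c' t]]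
      by (simp add: lift_ofD(3)[OF c(2) t] lift_ofD(3)[OF c'(2) t])
  qed
  finally show ?thesis by (simp add: BV_L1_M_dist_def BV_dist_def)
qed

lemma lift_unique:
  assumes "lift_of c \<gamma>" "lift_of c' \<gamma>'" "c \<in> BVL" "c' \<in> BVL"
    and eq: "ae_class M (BV a b N d) \<gamma> = ae_class M (BV a b N d) \<gamma>'"
  shows "c = c'"
proof (rule PiE_ext[OF W.BV_funcset[OF assms(3)] W.BV_funcset[OF assms(4)]])
  fix t assume t: "t \<in> {a..b}"
  have "AE x in M. \<gamma> x = \<gamma>' x"
    by (rule ae_class_eqD[OF eq]) (use lift_ofD(1)[OF assms(1)] A.BV_const[OF A.z0] in \<open>auto intro: AE_I2\<close>)
  then have "AE x in M. \<gamma> x t = \<gamma>' x t" by (auto elim: AE_mp)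
  then show "c t = c' t" unfolding lift_ofD(3)[OF assms(1) t] lift_ofD(3)[OF assms(2) t] by (rule ae_class_eq)
qed

text \<open>The variations on \<open>(a, u)\<close> of the curves in \<open>N\<close> and of
  \<open>c\<close> are those over the rationals inside, where \<open>Var_integral\<close>
  applies.\<close>

lemma lift_Var:
  assumes c: "c \<in> BVL" and l: "lift_of c \<gamma>" and u: "u \<le> b"
  shows "(\<lambda>x. Var d (\<gamma> x) {a<..<u}) \<in> borel_measurable M"
    "(\<integral>\<^sup>+ x. Var d (\<gamma> x) {a<..<u} \<partial>M) = Var (L1_dist M d) c {a<..<u}"
proof -
  have cnt: "countable (T \<inter> {a<..<u})" using T_countable by blast
  have k: "Lh.int1 (\<lambda>x. \<gamma> x t)" if "t \<in> T \<inter> {a<..<u}" for t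
    by (rule lift_int1[OF c l]) (use that in auto)
  have V: "(\<lambda>x. Var d (\<gamma> x) (T \<inter> {a<..<u})) \<in> borel_measurable M"
    "(\<integral>\<^sup>+ x. Var d (\<gamma> x) (T \<inter> {a<..<u}) \<partial>M) = Var (L1_dist M d) (\<lambda>t. Lh.cls (\<lambda>x. \<gamma> x t)) (T \<inter> {a<..<u})"
    using Lh.Var_integral[of "T \<inter> {a<..<u}" "\<lambda>t x. \<gamma> x t", OF cnt k] by simp_all
  have eq: "Var d (\<gamma> x) {a<..<u} = Var d (\<gamma> x) (T \<inter> {a<..<u})" if "x \<in> space M" for x
    by (rule A.Var_open_dense[OF lift_ofD(1)[OF l that] dense_in_rats u])
  show "(\<lambda>x. Var d (\<gamma> x) {a<..<u}) \<in> borel_measurable M"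
    using V(1) by (rule measurable_cong[THEN iffD2, rotated]) (rule eq)
  have "(\<integral>\<^sup>+ x. Var d (\<gamma> x) {a<..<u} \<partial>M) = (\<integral>\<^sup>+ x. Var d (\<gamma> x) (T \<inter> {a<..<u}) \<partial>M)"
    by (rule nn_integral_cong) (rule eq)
  also have "\<dots> = Var (L1_dist M d) (\<lambda>t. Lh.cls (\<lambda>x. \<gamma> x t)) (T \<inter> {a<..<u})" by (rule V(2))
  also have "\<dots> = Var (L1_dist M d) c (T \<inter> {a<..<u})"
    by (rule Lh.Lp.Var_cong) (simp add: lift_ofD(3)[OF l])
  also have "\<dots> = Var (L1_dist M d) c {a<..<u}"
    by (rule W.Var_open_dense[OF c dense_in_rats u, symmetric])
  finally show "(\<integral>\<^sup>+ x. Var d (\<gamma> x) {a<..<u} \<partial>M) = Var (L1_dist M d) c {a<..<u}" .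
qed

end

section \<open>Variation measures\<close>

lemma mixture_emeasure:
  fixes \<kappa> :: "'m \<Rightarrow> real measure" and \<nu> :: "real measure"
  assumes \<kappa>: "\<And>x. x \<in> space M \<Longrightarrow> sets (\<kappa> x) = sets borel" and \<nu>: "sets \<nu> = sets borel"
    and fin: "\<And>x. x \<in> space M \<Longrightarrow> emeasure (\<kappa> x) UNIV < \<infinity>" "emeasure \<nu> UNIV < \<infinity>"
    and top: "(\<lambda>x. emeasure (\<kappa> x) UNIV) \<in> borel_measurable M" "(\<integral>\<^sup>+ x. emeasure (\<kappa> x) UNIV \<partial>M) = emeasure \<nu> UNIV"
    and Ioc: "\<And>s t. s \<le> t \<Longrightarrow> (\<lambda>x. emeasure (\<kappa> x) {s<..t}) \<in> borel_measurable M"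
      "\<And>s t. s \<le> t \<Longrightarrow> (\<integral>\<^sup>+ x. emeasure (\<kappa> x) {s<..t} \<partial>M) = emeasure \<nu> {s<..t}"
    and B: "B \<in> sets borel"
  shows "(\<lambda>x. emeasure (\<kappa> x) B) \<in> borel_measurable M \<and> (\<integral>\<^sup>+ x. emeasure (\<kappa> x) B \<partial>M) = emeasure \<nu> B"
proof -
  let ?G = "range (\<lambda>(s, t). {s<..t::real})"
  have borel: "sets borel = sigma_sets UNIV ?G" by (subst borel_sigma_sets_Ioc) simp
  have sp: "space (\<kappa> x) = UNIV" if "x \<in> space M" for x using sets_eq_imp_space_eq[OF \<kappa>[OF that]] by simp
  have sp\<nu>: "space \<nu> = UNIV" using sets_eq_imp_space_eq[OF \<nu>] by simp
  have "Int_stable ?G"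
  proof (rule Int_stableI)
    fix A B assume "A \<in> ?G" "B \<in> ?G"
    then obtain s t s' t' where "A = {s<..t}" "B = {s'<..t'}" by auto
    then have "A \<inter> B = (\<lambda>(s, t). {s<..t}) (max s s', min t t')" by auto
    then show "A \<inter> B \<in> ?G" by blast
  qed
  \<comment> \<open>Half-open intervals are stable under intersection, so a Dynkin argument applies.
    Finiteness of the total masses handles complements, and measurability in \<open>x\<close> is
    carried along as part of the claim.\<close>
  moreover have "?G \<subseteq> Pow UNIV" by simp
  moreover have "B \<in> sigma_sets UNIV ?G" using B unfolding borel .
  ultimately show ?thesis
  proof (induction rule: sigma_sets_induct_disjoint)
    case (basic A)
    then obtain s t where A: "A = {s<..t}" by auto
    show ?case
    proof (cases "s \<le> t")
      case True
      then show ?thesis unfolding A using Ioc by simp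
    qed (simp add: A)
  next
    case empty
    then show ?case by simp
  next
    case (compl A)
    then have A: "A \<in> sets borel" unfolding borel by simp
    have eq: "emeasure (\<kappa> x) (UNIV - A) = emeasure (\<kappa> x) UNIV - emeasure (\<kappa> x) A" if x: "x \<in> space M" for x
    proof (rule emeasure_Diff)
      have "emeasure (\<kappa> x) A \<le> emeasure (\<kappa> x) UNIV" by (rule emeasure_mono) (use \<kappa>[OF x] in auto)
      then show "emeasure (\<kappa> x) A \<noteq> \<infinity>" using fin(1)[OF x] by auto
    qed (use A \<kappa>[OF x] in auto)
    have le: "emeasure (\<kappa> x) A \<le> emeasure (\<kappa> x) UNIV" if x: "x \<in> space M" for x
      by (rule emeasure_mono) (use \<kappa>[OF x] in auto)
    have m: "(\<lambda>x. emeasure (\<kappa> x) UNIV - emeasure (\<kappa> x) A) \<in> borel_measurable M" using top(1) compl.IH[THEN conjunct1] by measurable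
    have \<nu>le: "emeasure \<nu> A \<le> emeasure \<nu> UNIV" by (rule emeasure_mono) (use \<nu> in auto)
    then have \<nu>A: "emeasure \<nu> A \<noteq> \<infinity>" using fin(2) by auto
    have "(\<integral>\<^sup>+ x. emeasure (\<kappa> x) (UNIV - A) \<partial>M) = (\<integral>\<^sup>+ x. emeasure (\<kappa> x) UNIV - emeasure (\<kappa> x) A \<partial>M)"
      by (rule nn_integral_cong) (rule eq)
    also have "\<dots> = (\<integral>\<^sup>+ x. emeasure (\<kappa> x) UNIV \<partial>M) - (\<integral>\<^sup>+ x. emeasure (\<kappa> x) A \<partial>M)"
      by (rule nn_integral_diff) (use top(1) compl.IH \<nu>A le in \<open>auto intro: AE_I2\<close>)
    also have "\<dots> = emeasure \<nu> UNIV - emeasure \<nu> A" using top(2) compl.IH by simp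
    also have "\<dots> = emeasure \<nu> (UNIV - A)" by (rule emeasure_Diff[symmetric]) (use \<nu>A A \<nu> in auto)
    finally have "(\<integral>\<^sup>+ x. emeasure (\<kappa> x) (UNIV - A) \<partial>M) = emeasure \<nu> (UNIV - A)" .
    moreover have "(\<lambda>x. emeasure (\<kappa> x) (UNIV - A)) \<in> borel_measurable M"
      using m by (rule measurable_cong[THEN iffD2, rotated]) (rule eq)
    ultimately show ?case by simp
  next
    case (union A)
    then have A: "A i \<in> sets borel" for i unfolding borel by blast
    have eq: "emeasure (\<kappa> x) (\<Union>i. A i) = (\<Sum>i. emeasure (\<kappa> x) (A i))" if x: "x \<in> space M" for x
      by (rule suminf_emeasure[symmetric]) (use A \<kappa>[OF x] union.hyps in auto)
    have m: "(\<lambda>x. \<Sum>i. emeasure (\<kappa> x) (A i)) \<in> borel_measurable M"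
      using union.IH by (intro borel_measurable_suminf_order) auto
    have "(\<integral>\<^sup>+ x. emeasure (\<kappa> x) (\<Union>i. A i) \<partial>M) = (\<integral>\<^sup>+ x. (\<Sum>i. emeasure (\<kappa> x) (A i)) \<partial>M)"
      by (rule nn_integral_cong) (rule eq)
    also have "\<dots> = (\<Sum>i. \<integral>\<^sup>+ x. emeasure (\<kappa> x) (A i) \<partial>M)" using union.IH by (intro nn_integral_suminf) auto
    also have "\<dots> = (\<Sum>i. emeasure \<nu> (A i))" using union.IH by simp
    also have "\<dots> = emeasure \<nu> (\<Union>i. A i)" by (rule suminf_emeasure) (use A \<nu> union.hyps in auto)
    finally have "(\<integral>\<^sup>+ x. emeasure (\<kappa> x) (\<Union>i. A i) \<partial>M) = emeasure \<nu> (\<Union>i. A i)" .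
    moreover have "(\<lambda>x. emeasure (\<kappa> x) (\<Union>i. A i)) \<in> borel_measurable M"
      using m by (rule measurable_cong[THEN iffD2, rotated]) (rule eq)
    ultimately show ?case by simp
  qed
qed

section \<open>Stieltjes measures of nondecreasing functions on the interval\<close>

locale stieltjes =
  fixes a b :: real and V :: "real \<Rightarrow> real"
  assumes ab: "a < b" and V_mono: "\<And>s t. a \<le> s \<Longrightarrow> s \<le> t \<Longrightarrow> t \<le> b \<Longrightarrow> V s \<le> V t"
begin

definition W :: "real \<Rightarrow> real" where "W u = V (max a (min b u))"

definition F :: "real \<Rightarrow> real" where "F t = (INF u\<in>{t<..}. W u)"

lemma stieltjes_measure_eq: "stieltjes_measure a b V = restrict_space (interval_measure F) {a..b}"
  by (simp add: stieltjes_measure_def F_def[abs_def] W_def[abs_def])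

lemma W_mono: "s \<le> t \<Longrightarrow> W s \<le> W t"
  unfolding W_def by (rule V_mono) (use ab in \<open>auto simp: min_def max_def\<close>)

lemma W_bounds: "V a \<le> W u" "W u \<le> V b"
  unfolding W_def by (rule V_mono, use ab in \<open>auto simp: min_def max_def\<close>)+

lemma W_bdd: "bdd_below (W ` S)"
  by (rule bdd_belowI2) (rule W_bounds(1))

lemma F_le: "t < u \<Longrightarrow> F t \<le> W u"
  unfolding F_def by (rule cINF_lower[OF W_bdd]) simp

lemma F_mono: "s \<le> t \<Longrightarrow> F s \<le> F t"
  unfolding F_def by (rule cINF_superset_mono) (auto intro: W_bdd)

lemma F_ge: "W t \<le> F t"
  unfolding F_def by (rule cINF_greatest) (auto intro: W_mono)

lemma F_ex: assumes "F t < r" shows "\<exists>u>t. W u < r"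
proof -
  have "\<exists>y\<in>W ` {t<..}. y < r"
    by (rule cInf_lessD) (use assms in \<open>auto simp: F_def\<close>)
  then show ?thesis by auto
qed

lemma F_right_cont: "continuous (at_right t) F"
  unfolding continuous_within
proof (rule order_tendstoI)
  fix r assume "r < F t"
  then show "\<forall>\<^sub>F s in at_right t. r < F s"
    using F_mono by (auto simp: eventually_at_right_field intro!: exI[of _ "t + 1"]) (meson less_le_trans less_imp_le)
next
  fix r assume "F t < r"
  then obtain u where u: "u > t" "W u < r" using F_ex by blast
  then show "\<forall>\<^sub>F s in at_right t. F s < r"
    using F_le unfolding eventually_at_right_field by (intro exI[of _ u]) (auto intro: le_less_trans)
qed

text \<open>A fixed sequence that computes the right limit allows measurability and integrals over a
  parameter to pass from \<open>V\<close> to \<open>F\<close>.\<close>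

lemma F_seq: "(\<lambda>n. W (t + 1 / Suc n)) \<longlonglongrightarrow> F t"
proof (rule order_tendstoI)
  fix r assume "r < F t"
  then show "\<forall>\<^sub>F n in sequentially. r < W (t + 1 / Suc n)"
    using F_le by (intro always_eventually allI) (rule less_le_trans, auto)
next
  fix r assume "F t < r"
  then obtain u where u: "u > t" "W u < r" using F_ex by blast
  obtain n0 where n0: "1 / real (Suc n0) < u - t" using nat_approx_posE[of "u - t"] u by auto
  show "\<forall>\<^sub>F n in sequentially. W (t + 1 / Suc n) < r"
    unfolding eventually_sequentially
  proof (intro exI[of _ n0] allI impI)
    fix n assume "n0 \<le> n"
    then have "1 / real (Suc n) \<le> 1 / real (Suc n0)" by (intro divide_left_mono) auto
    then have "W (t + 1 / Suc n) \<le> W u" using n0 by (intro W_mono) linarith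
    then show "W (t + 1 / Suc n) < r" using u by simp
  qed
qed

lemma F_right: "b \<le> t \<Longrightarrow> F t = V b"
proof -
  assume "b \<le> t"
  then have "W u = V b" if "t \<le> u" for u using that ab by (simp add: W_def)
  then show ?thesis using F_ge[of t] F_le[of t "t + 1"] by simp
qed

lemma F_left: "t < a \<Longrightarrow> F t = V a"
proof -
  assume "t < a"
  then have "F t \<le> V a" using F_le[of t a] ab by (simp add: W_def)
  moreover have "V a \<le> F t" using F_ge[of t] W_bounds(1)[of t] by linarith
  ultimately show ?thesis by simp
qed

lemma F_bounds: "V a \<le> F t" "F t \<le> V b"
proof -
  show "V a \<le> F t" using F_ge[of t] W_bounds(1)[of t] by linarith
  show "F t \<le> V b" using F_le[of t "t + 1"] W_bounds(2)[of "t + 1"] by linarith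
qed

lemma emeasure_Ioc: "s \<le> t \<Longrightarrow> emeasure (interval_measure F) {s<..t} = ennreal (F t - F s)"
  by (rule emeasure_interval_measure_Ioc[OF _ F_mono F_right_cont])

lemma emeasure_UNIV: "emeasure (interval_measure F) UNIV = ennreal (V b - V a)"
proof -
  define C where "C n = {a - 1 - real n<..b + real n}" for n
  have U: "(\<Union>n. C n) = UNIV"
  proof (intro set_eqI iffI UNIV_I)
    fix x :: real
    obtain n :: nat where "\<bar>x\<bar> + \<bar>a\<bar> + \<bar>b\<bar> < real n" using reals_Archimedean2 by blast
    then have "x \<in> C n" by (auto simp: C_def)
    then show "x \<in> (\<Union>n. C n)" by blast
  qed
  have "emeasure (interval_measure F) (C n) = ennreal (V b - V a)" for n
    unfolding C_def using ab by (subst emeasure_Ioc) (auto simp: F_left F_right)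
  moreover have "(SUP n. emeasure (interval_measure F) (C n)) = emeasure (interval_measure F) (\<Union>n. C n)"
    by (rule SUP_emeasure_incseq) (auto simp: C_def incseq_def)
  ultimately show ?thesis unfolding U by simp
qed

lemma emeasure_stieltjes:
  "B \<in> sets borel \<Longrightarrow> B \<subseteq> {a..b} \<Longrightarrow> emeasure (stieltjes_measure a b V) B = emeasure (interval_measure F) B"
  unfolding stieltjes_measure_eq by (rule emeasure_restrict_space) auto

lemma emeasure_stieltjes_Icc: "emeasure (stieltjes_measure a b V) {a..b} = ennreal (V b - V a)"
proof -
  \<comment> \<open>The complement of \<open>[a, b]\<close> as a union of half-open intervals on
    which \<open>F\<close> is constant. Those on the left stop short of \<open>a\<close> because
    \<open>F\<close> may jump there: F(a) is the right limit of \<open>V\<close>.\<close>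
  let ?N = "\<Union>n. {a - 1 - real n<..a - 1 / Suc n} \<union> {b<..b + real n}"
  have "?N \<in> null_sets (interval_measure F)"
  proof (intro null_sets_UN null_sets.Un)
    fix n :: nat
    have "a - 1 - real n \<le> a - 1 / Suc n" by (simp add: field_simps)
    then show "{a - 1 - real n<..a - 1 / Suc n} \<in> null_sets (interval_measure F)"
      by (simp add: null_sets_def emeasure_Ioc F_left)
    show "{b<..b + real n} \<in> null_sets (interval_measure F)"
      by (simp add: null_sets_def emeasure_Ioc F_right)
  qed
  then have "emeasure (interval_measure F) (UNIV - ?N) = emeasure (interval_measure F) UNIV"
    by (rule emeasure_Diff_null_set) simp
  moreover have "UNIV - ?N = {a..b}"
  proof (intro set_eqI iffI)
    fix x assume x: "x \<in> UNIV - ?N"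
    show "x \<in> {a..b}"
    proof (rule ccontr)
      assume "x \<notin> {a..b}"
      then consider "x < a" | "b < x" by force
      then have "x \<in> ?N"
      proof cases
        case 1
        obtain m where m: "1 / real (Suc m) < a - x" using nat_approx_posE[of "a - x"] 1 by auto
        obtain k :: nat where k: "a - x < real k" using reals_Archimedean2 by blast
        define n where "n = max m k"
        have "1 / real (Suc n) \<le> 1 / real (Suc m)" unfolding n_def by (intro divide_left_mono) auto
        moreover have "real k \<le> real n" by (simp add: n_def)
        ultimately have "x \<in> {a - 1 - real n<..a - 1 / Suc n}" using m k by auto
        then show ?thesis by blast
      next
        case 2
        obtain n :: nat where "x - b < real n" using reals_Archimedean2 by blast
        then have "x \<in> {b<..b + real n}" using 2 by auto
        then show ?thesis by blast
      qed
      with x show False by blast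
    qed
  next
    fix x assume x: "x \<in> {a..b}"
    have "a - 1 / real (Suc n) < x" for n
      by (rule less_le_trans[of _ a]) (use x in auto)
    then have "x \<notin> {a - 1 - real n<..a - 1 / Suc n}" for n by (simp add: not_le)
    moreover have "x \<notin> {b<..b + real n}" for n using x by simp
    ultimately show "x \<in> UNIV - ?N" by blast
  qed
  ultimately show ?thesis using emeasure_stieltjes[of "{a..b}"] emeasure_UNIV by simp
qed

end

section \<open>Variation measures of BV curves\<close>

context BV_target
begin

definition V_fun :: "(real \<Rightarrow> 'z) \<Rightarrow> real \<Rightarrow> real" where
  "V_fun c t = enn2real (ess_Var a b Z d c {a<..<t})"

lemma var_measure_eq: "var_measure a b Z d c = stieltjes_measure a b (V_fun c)"
  by (simp add: var_measure_def V_fun_def[abs_def])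

lemma V_fun:
  assumes c: "c \<in> BV a b Z d" and t: "t \<le> b"
  shows "ennreal (V_fun c t) = Var d c {a<..<t}"
proof -
  have "Var d c {a<..<t} \<le> Var d c {a..b}" by (rule Var_mono) (use t in auto)
  then have "Var d c {a<..<t} < \<infinity>" using BV_Var[OF c] by (rule le_less_trans)
  then show ?thesis unfolding V_fun_def ess_Var_BV[OF c t] by simp
qed

lemma V_fun_a: "V_fun c a = 0"
proof -
  have "partitions {} = {[]}" by (auto simp: partitions_def)
  then have "Var d c' {a<..<a} = 0" for c' by (simp add: Var_eq)
  \<comment> \<open>An empty class would make the infimum infinite, and \<open>enn2real\<close>
    sends that to 0 as well.\<close>
  then have "ess_Var a b Z d c {a<..<a} \<in> {0, \<infinity>}"
    by (cases "ae_class (leb_I a b) Z c = {}") (simp_all add: ess_Var_def)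
  then show ?thesis by (auto simp: V_fun_def)
qed

lemma V_fun_nonneg: "0 \<le> V_fun c t" by (simp add: V_fun_def)

lemma stieltjes_BV:
  assumes c: "c \<in> BV a b Z d"
  shows "stieltjes a b (V_fun c)"
proof
  show "a < b" by (rule ab)
  fix s t assume st: "a \<le> s" "s \<le> t" "t \<le> b"
  then have "ennreal (V_fun c s) \<le> ennreal (V_fun c t)"
    using V_fun[OF c, of s] V_fun[OF c, of t] by (auto intro: Var_mono)
  then show "V_fun c s \<le> V_fun c t" by (simp add: V_fun_nonneg)
qed

text \<open>The mass is V(b) - V(a), where V(a) = 0 and V(b) is the variation on
  \<open>(a, b)\<close>. This turns the condition on the range into one on
  \<open>Var\<close>.\<close>

lemma emeasure_var_measure_Icc:
  assumes c: "c \<in> BV a b Z d"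
  shows "emeasure (var_measure a b Z d c) {a..b} = Var d c {a..b}"
  unfolding var_measure_eq stieltjes.emeasure_stieltjes_Icc[OF stieltjes_BV[OF c]] V_fun_a
  using V_fun[OF c order_refl] Var_closed[OF c] by simp

end

section \<open>Integrals of variation measures, and curves from maps with integrable
  variation\<close>

context BV_setting
begin

text \<open>Measurability of evaluation lets any measurable representative take over the role of
  \<gamma>, so results on lifts hold for all of them.\<close>

lemma lift_of_class:
  assumes l: "lift_of c \<gamma>" and f: "sep_meas M (BV a b N d) (BV_dist a b d) f"
    and eq: "ae_class M (BV a b N d) \<gamma> = ae_class M (BV a b N d) f"
  shows "lift_of c f"
  unfolding lift_of_def
proof (intro conjI ballI)
  show "f x \<in> BV a b N d" if "x \<in> space M" for x using sep_measD(1)[OF f that] .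
  fix t assume t: "t \<in> {a..b}"
  show "sep_meas M N d (\<lambda>x. f x t)" by (rule A.sep_meas_eval[OF f t])
  have "AE x in M. \<gamma> x = f x"
    by (rule ae_class_eqD[OF eq]) (use lift_ofD(1)[OF l] A.BV_const[OF A.z0] in \<open>auto intro: AE_I2\<close>)
  then have "AE x in M. \<gamma> x t = f x t" by (auto elim: AE_mp)
  then show "c t = Lh.cls (\<lambda>x. f x t)" unfolding lift_ofD(3)[OF l t] by (rule ae_class_eq)
qed

text \<open>The equality holds for the functions \<open>V\<close> at each time, passes to their
  right limits \<open>F\<close> by dominated convergence, then to half-open intervals by subtraction
  and to Borel sets by \<open>mixture_emeasure\<close>.\<close>

lemma lift_var_measure:
  assumes c: "c \<in> BVL" and l: "lift_of c \<gamma>" and B: "B \<in> sets borel" "B \<subseteq> {a..b}"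
  shows "(\<lambda>x. emeasure (var_measure a b N d (\<gamma> x)) B) \<in> borel_measurable M"
    "(\<integral>\<^sup>+ x. emeasure (var_measure a b N d (\<gamma> x)) B \<partial>M) = emeasure (var_measure a b (L1 M N d hcls) (L1_dist M d) c) B"
proof -
  define Vx where "Vx x = A.V_fun (\<gamma> x)" for x
  define Vc where "Vc = W.V_fun c"
  define Fx where "Fx x = stieltjes.F a b (Vx x)" for x
  define Fc where "Fc = stieltjes.F a b Vc"
  note \<gamma> = lift_ofD(1)[OF l]
  have sx: "stieltjes a b (Vx x)" if "x \<in> space M" for x unfolding Vx_def by (rule A.stieltjes_BV[OF \<gamma>[OF that]])
  have sc: "stieltjes a b Vc" unfolding Vc_def by (rule W.stieltjes_BV[OF c])
  have Vx_nonneg: "0 \<le> Vx x t" for x t by (simp add: Vx_def A.V_fun_nonneg)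
  have Vx_Var: "ennreal (Vx x t) = Var d (\<gamma> x) {a<..<t}" if "x \<in> space M" "t \<le> b" for x t
    unfolding Vx_def by (rule A.V_fun[OF \<gamma>[OF that(1)] that(2)])
  have VI: "(\<integral>\<^sup>+ x. ennreal (Vx x t) \<partial>M) = ennreal (Vc t)" if t: "t \<le> b" for t
  proof -
    have "(\<integral>\<^sup>+ x. ennreal (Vx x t) \<partial>M) = (\<integral>\<^sup>+ x. Var d (\<gamma> x) {a<..<t} \<partial>M)"
      by (rule nn_integral_cong) (rule Vx_Var[OF _ t])
    also have "\<dots> = ennreal (Vc t)" unfolding lift_Var(2)[OF c l t] Vc_def W.V_fun[OF c t] ..
    finally show ?thesis .
  qed
  have Vm: "(\<lambda>x. Vx x t) \<in> borel_measurable M" if t: "t \<le> b" for t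
  proof -
    have "(\<lambda>x. enn2real (Var d (\<gamma> x) {a<..<t})) \<in> borel_measurable M" using lift_Var(1)[OF c l t] by measurable
    then show ?thesis
      by (rule measurable_cong[THEN iffD2, rotated]) (simp add: Vx_nonneg flip: Vx_Var[OF _ t])
  qed
  have clamp: "max a (min b u) \<le> b" for u using ab' by simp
  have F_lim: "(\<lambda>n. Vx x (max a (min b (t + 1 / Suc n)))) \<longlonglongrightarrow> Fx x t" if "x \<in> space M" for x t
    using stieltjes.F_seq[OF sx[OF that]] by (simp add: Fx_def stieltjes.W_def[OF sx[OF that]])
  have Fc_lim: "(\<lambda>n. Vc (max a (min b (t + 1 / Suc n)))) \<longlonglongrightarrow> Fc t" for t
    using stieltjes.F_seq[OF sc] by (simp add: Fc_def stieltjes.W_def[OF sc])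
  have Fm: "(\<lambda>x. Fx x t) \<in> borel_measurable M" for t
  proof (rule borel_measurable_LIMSEQ_real)
    show "(\<lambda>n. Vx x (max a (min b (t + 1 / Suc n)))) \<longlonglongrightarrow> Fx x t" if "x \<in> space M" for x
      by (rule F_lim[OF that])
  qed (rule Vm[OF clamp])
  \<comment> \<open>Clamped times stay in \<open>[a, b]\<close>, so the value of \<open>V\<close> at
    \<open>b\<close>, whose integral is finite, dominates.\<close>
  have FI: "(\<integral>\<^sup>+ x. ennreal (Fx x t) \<partial>M) = ennreal (Fc t)" for t
  proof (rule LIMSEQ_unique)
    show "(\<lambda>n. \<integral>\<^sup>+ x. ennreal (Vx x (max a (min b (t + 1 / Suc n)))) \<partial>M) \<longlonglongrightarrow> (\<integral>\<^sup>+ x. ennreal (Fx x t) \<partial>M)"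
    proof (rule nn_integral_dominated_convergence[where w = "\<lambda>x. ennreal (Vx x b)"])
      show "(\<lambda>x. ennreal (Vx x (max a (min b (t + 1 / Suc n))))) \<in> borel_measurable M" for n
        using Vm[OF clamp] by measurable
      show "AE x in M. ennreal (Vx x (max a (min b (t + 1 / Suc n)))) \<le> ennreal (Vx x b)" for n
        by (rule AE_I2, rule ennreal_leI, rule stieltjes.V_mono[OF sx]) (use ab' in auto)
      show "(\<integral>\<^sup>+ x. ennreal (Vx x b) \<partial>M) < \<infinity>" by (simp add: VI)
      show "AE x in M. (\<lambda>n. ennreal (Vx x (max a (min b (t + 1 / Suc n))))) \<longlonglongrightarrow> ennreal (Fx x t)"
        by (rule AE_I2, rule tendsto_ennrealI, rule F_lim)
    qed (use Fm Vm[of b] in auto)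
    show "(\<lambda>n. \<integral>\<^sup>+ x. ennreal (Vx x (max a (min b (t + 1 / Suc n)))) \<partial>M) \<longlonglongrightarrow> ennreal (Fc t)"
      unfolding VI[OF clamp] by (rule tendsto_ennrealI[OF Fc_lim])
  qed
  have a0: "Vx x a = 0" "Vc a = 0" for x by (simp_all add: Vx_def Vc_def A.V_fun_a W.V_fun_a)
  have F_nonneg: "0 \<le> Fx x t" if "x \<in> space M" for x t
    using stieltjes.F_bounds(1)[OF sx[OF that]] a0 by (simp add: Fx_def)
  have Fc_nonneg: "0 \<le> Fc t" for t using stieltjes.F_bounds(1)[OF sc] a0 by (simp add: Fc_def)
  have mix: "(\<lambda>x. emeasure (interval_measure (Fx x)) B) \<in> borel_measurable M \<and>
      (\<integral>\<^sup>+ x. emeasure (interval_measure (Fx x)) B \<partial>M) = emeasure (interval_measure Fc) B"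
  proof (rule mixture_emeasure)
    have U: "emeasure (interval_measure (Fx x)) UNIV = ennreal (Vx x b)" if "x \<in> space M" for x
      using stieltjes.emeasure_UNIV[OF sx[OF that]] a0 by (simp add: Fx_def)
    have Uc: "emeasure (interval_measure Fc) UNIV = ennreal (Vc b)"
      using stieltjes.emeasure_UNIV[OF sc] a0 by (simp add: Fc_def)
    show "emeasure (interval_measure (Fx x)) UNIV < \<infinity>" if "x \<in> space M" for x using U[OF that] by simp
    show "emeasure (interval_measure Fc) UNIV < \<infinity>" using Uc by simp
    show "(\<lambda>x. emeasure (interval_measure (Fx x)) UNIV) \<in> borel_measurable M"
      by (rule measurable_cong[THEN iffD2, OF U]) (use Vm[of b] in measurable)
    show "(\<integral>\<^sup>+ x. emeasure (interval_measure (Fx x)) UNIV \<partial>M) = emeasure (interval_measure Fc) UNIV"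
      unfolding Uc VI[OF order_refl, symmetric] by (rule nn_integral_cong) (rule U)
    fix s t :: real assume st: "s \<le> t"
    have I: "emeasure (interval_measure (Fx x)) {s<..t} = ennreal (Fx x t) - ennreal (Fx x s)" if "x \<in> space M" for x
      using stieltjes.emeasure_Ioc[OF sx[OF that] st] F_nonneg[OF that] by (simp add: Fx_def ennreal_minus)
    have Ic: "emeasure (interval_measure Fc) {s<..t} = ennreal (Fc t) - ennreal (Fc s)"
      using stieltjes.emeasure_Ioc[OF sc st] Fc_nonneg by (simp add: Fc_def ennreal_minus)
    show "(\<lambda>x. emeasure (interval_measure (Fx x)) {s<..t}) \<in> borel_measurable M"
      by (rule measurable_cong[THEN iffD2, OF I]) (use Fm in measurable)
    have "(\<integral>\<^sup>+ x. emeasure (interval_measure (Fx x)) {s<..t} \<partial>M) = (\<integral>\<^sup>+ x. ennreal (Fx x t) - ennreal (Fx x s) \<partial>M)"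
      by (rule nn_integral_cong) (rule I)
    also have "\<dots> = (\<integral>\<^sup>+ x. ennreal (Fx x t) \<partial>M) - (\<integral>\<^sup>+ x. ennreal (Fx x s) \<partial>M)"
    proof (rule nn_integral_diff)
      show "(\<lambda>x. ennreal (Fx x t)) \<in> borel_measurable M" "(\<lambda>x. ennreal (Fx x s)) \<in> borel_measurable M"
        using Fm by measurable
      show "(\<integral>\<^sup>+ x. ennreal (Fx x s) \<partial>M) \<noteq> \<infinity>" by (simp add: FI)
      show "AE x in M. ennreal (Fx x s) \<le> ennreal (Fx x t)"
        unfolding Fx_def by (rule AE_I2, rule ennreal_leI, rule stieltjes.F_mono[OF sx _]) (use st in auto)
    qed
    also have "\<dots> = emeasure (interval_measure Fc) {s<..t}" unfolding FI Ic ..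
    finally show "(\<integral>\<^sup>+ x. emeasure (interval_measure (Fx x)) {s<..t} \<partial>M) = emeasure (interval_measure Fc) {s<..t}" .
  qed (use B in auto)
  have e: "emeasure (var_measure a b N d (\<gamma> x)) B = emeasure (interval_measure (Fx x)) B" if "x \<in> space M" for x
    using stieltjes.emeasure_stieltjes[OF sx[OF that] B] by (simp add: A.var_measure_eq Fx_def Vx_def)
  have ec: "emeasure (var_measure a b (L1 M N d hcls) (L1_dist M d) c) B = emeasure (interval_measure Fc) B"
    using stieltjes.emeasure_stieltjes[OF sc B] by (simp add: W.var_measure_eq Fc_def Vc_def)
  show "(\<lambda>x. emeasure (var_measure a b N d (\<gamma> x)) B) \<in> borel_measurable M"
    by (rule measurable_cong[THEN iffD2, OF e]) (use mix in auto)
  have "(\<integral>\<^sup>+ x. emeasure (var_measure a b N d (\<gamma> x)) B \<partial>M) = (\<integral>\<^sup>+ x. emeasure (interval_measure (Fx x)) B \<partial>M)"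
    by (rule nn_integral_cong) (rule e)
  then show "(\<integral>\<^sup>+ x. emeasure (var_measure a b N d (\<gamma> x)) B \<partial>M) = emeasure (var_measure a b (L1 M N d hcls) (L1_dist M d) c) B"
    using mix ec by simp
qed

lemma Var_closed_measurable:
  assumes f: "sep_meas M (BV a b N d) (BV_dist a b d) f"
  shows "(\<lambda>x. Var d (f x) {a..b}) \<in> borel_measurable M"
proof -
  note fB = sep_measD(1)[OF f]
  have "(\<lambda>x. Var d (f x) (T \<inter> {a<..<b})) \<in> borel_measurable M"
    using Var_measurable[of "T \<inter> {a<..<b}" M "\<lambda>t x. f x t"] T_countable A.sep_meas_eval[OF f] by auto
  then show ?thesis
    by (rule measurable_cong[THEN iffD2, rotated])
      (simp only: A.Var_closed[OF fB] A.Var_open_dense[OF fB dense_in_rats order_refl])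
qed

text \<open>The bound \<open>d (f x t) (h0 x) \<le> d (f x s) (h0 x) + Var d (f x) {a..b}\<close> is integrated over \<^term>\<open>s\<close>.\<close>

lemma eval_int1:
  assumes f: "sep_meas M (BV a b N d) (BV_dist a b d) f"
    and fin: "(\<integral>\<^sup>+ x. (\<integral>\<^sup>+ t. ennreal (d (f x t) (h0 x)) \<partial>leb_I a b) \<partial>M) < \<infinity>"
    and V: "(\<integral>\<^sup>+ x. Var d (f x) {a..b} \<partial>M) < \<infinity>" and t: "t \<in> {a..b}"
  shows "Lh.int1 (\<lambda>x. f x t)"
proof -
  note fB = sep_measD(1)[OF f]
  note ev = A.sep_meas_eval[OF f]
  have hN: "h0 x \<in> N" if "x \<in> space M" for x by (rule sep_measD(1)[OF h0 that])
  note Vm = Var_closed_measurable[OF f]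
  have j: "sep_meas (leb_I a b \<Otimes>\<^sub>M M) N d (\<lambda>p. f (snd p) (fst p))" by (rule A.sep_meas_joint[OF fB ev])
  have "(\<lambda>p. d (f (snd p) (fst p)) (h0 (snd p))) \<in> borel_measurable (leb_I a b \<Otimes>\<^sub>M M)"
    by (rule sep_meas_dist[OF j good_sep[OF good_h0]])
  then have "(\<lambda>p. ennreal (d (f (snd p) (fst p)) (h0 (snd p)))) \<in> borel_measurable (leb_I a b \<Otimes>\<^sub>M M)" by measurable
  then have Gm: "(\<lambda>x. \<integral>\<^sup>+ s. ennreal (d (f x s) (h0 x)) \<partial>leb_I a b) \<in> borel_measurable M"
    by (intro Q.X.borel_measurable_nn_integral) (simp add: measurable_pair_swap_iff[of _ M])
  have dm: "(\<lambda>x. ennreal (d (f x t) (h0 x))) \<in> borel_measurable M" using sep_meas_dist[OF ev[OF t] h0] by measurable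
  have "ennreal (b - a) * (\<integral>\<^sup>+ x. ennreal (d (f x t) (h0 x)) \<partial>M) = (\<integral>\<^sup>+ x. ennreal (b - a) * ennreal (d (f x t) (h0 x)) \<partial>M)"
    by (rule nn_integral_cmult[OF dm, symmetric])
  also have "\<dots> \<le> (\<integral>\<^sup>+ x. (\<integral>\<^sup>+ s. ennreal (d (f x s) (h0 x)) \<partial>leb_I a b) + ennreal (b - a) * Var d (f x) {a..b} \<partial>M)"
  proof (rule nn_integral_mono)
    fix x assume x: "x \<in> space M"
    have "ennreal (b - a) * ennreal (d (f x t) (h0 x)) = (\<integral>\<^sup>+ s. ennreal (d (f x t) (h0 x)) \<partial>leb_I a b)"
      unfolding A.nn_integral_leb_I_const by (rule mult.commute)
    also have "\<dots> \<le> (\<integral>\<^sup>+ s. ennreal (d (f x s) (h0 x)) + Var d (f x) {a..b} \<partial>leb_I a b)"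
    proof (rule nn_integral_mono)
      fix s assume "s \<in> space (leb_I a b)"
      then have s: "s \<in> {a..b}" by simp
      have "d (f x t) (h0 x) \<le> d (f x s) (h0 x) + d (f x t) (f x s)"
        using triangle[OF A.BV_mem[OF fB[OF x] t] A.BV_mem[OF fB[OF x] s] hN[OF x]] by linarith
      then have "ennreal (d (f x t) (h0 x)) \<le> ennreal (d (f x s) (h0 x) + d (f x t) (f x s))" by (rule ennreal_leI)
      also have "\<dots> = ennreal (d (f x s) (h0 x)) + ennreal (d (f x t) (f x s))" by simp
      also have "\<dots> \<le> ennreal (d (f x s) (h0 x)) + Var d (f x) {a..b}"
        by (rule add_left_mono) (rule A.BV_dist_le(1)[OF fB[OF x] t s])
      finally show "ennreal (d (f x t) (h0 x)) \<le> ennreal (d (f x s) (h0 x)) + Var d (f x) {a..b}" .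
    qed
    also have "\<dots> = (\<integral>\<^sup>+ s. ennreal (d (f x s) (h0 x)) \<partial>leb_I a b) + (\<integral>\<^sup>+ s. Var d (f x) {a..b} \<partial>leb_I a b)"
    proof (rule nn_integral_add)
      show "(\<lambda>s. ennreal (d (f x s) (h0 x))) \<in> borel_measurable (leb_I a b)"
        using sep_measD(2)[OF A.sep_meas_BV(1)[OF fB[OF x]] hN[OF x]] by measurable
    qed simp
    also have "(\<integral>\<^sup>+ s. Var d (f x) {a..b} \<partial>leb_I a b) = ennreal (b - a) * Var d (f x) {a..b}"
      using ab' by (simp add: emeasure_leb_I mult.commute)
    finally show "ennreal (b - a) * ennreal (d (f x t) (h0 x))
        \<le> (\<integral>\<^sup>+ s. ennreal (d (f x s) (h0 x)) \<partial>leb_I a b) + ennreal (b - a) * Var d (f x) {a..b}" .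
  qed
  also have "\<dots> = (\<integral>\<^sup>+ x. (\<integral>\<^sup>+ s. ennreal (d (f x s) (h0 x)) \<partial>leb_I a b) \<partial>M) + (\<integral>\<^sup>+ x. ennreal (b - a) * Var d (f x) {a..b} \<partial>M)"
    by (rule nn_integral_add) (use Gm Vm in auto)
  also have "(\<integral>\<^sup>+ x. ennreal (b - a) * Var d (f x) {a..b} \<partial>M) = ennreal (b - a) * (\<integral>\<^sup>+ x. Var d (f x) {a..b} \<partial>M)"
    by (rule nn_integral_cmult[OF Vm])
  also have "(\<integral>\<^sup>+ x. (\<integral>\<^sup>+ s. ennreal (d (f x s) (h0 x)) \<partial>leb_I a b) \<partial>M) + \<dots> < \<infinity>"
    using fin V by (simp add: ennreal_mult_less_top)
  finally have "(\<integral>\<^sup>+ x. ennreal (d (f x t) (h0 x)) \<partial>M) < \<infinity>"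
    using ab' by (auto simp: ennreal_mult_less_top)
  then show ?thesis using ev[OF t] by (simp add: Lh.int1_def)
qed

text \<open>The total variation of \<open>f x\<close> dominates all distances between values of
  \<open>f x\<close>, and it is integrable in \<open>x\<close>; so one-sided limits at each
  \<open>x\<close> become limits of classes.\<close>

lemma lift_of_finite_variation:
  assumes f: "sep_meas M (BV a b N d) (BV_dist a b d) f"
    and fin: "(\<integral>\<^sup>+ x. (\<integral>\<^sup>+ t. ennreal (d (f x t) (h0 x)) \<partial>leb_I a b) \<partial>M) < \<infinity>"
    and V: "(\<integral>\<^sup>+ x. Var d (f x) {a..b} \<partial>M) < \<infinity>"
  shows "\<exists>c\<in>BVL. lift_of c f"
proof -
  note fB = sep_measD(1)[OF f]
  note ev = A.sep_meas_eval[OF f]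
  note i1 = eval_int1[OF f fin V]
  define c where "c = (\<lambda>t\<in>{a..b}. Lh.cls (\<lambda>x. f x t))"
  have ct: "c t = Lh.cls (\<lambda>x. f x t)" if "t \<in> {a..b}" for t using that by (simp add: c_def)
  \<comment> \<open>A left limit need not be a value of the curve, so the bound by the variation is
    first extended to limits of values.\<close>
  have Var_bound: "ennreal (d l (f x (S n))) \<le> Var d (f x) {a..b}"
    if x: "x \<in> space M" and l: "l \<in> N" and S: "\<And>n::nat. S n \<in> {a..b}" and lim: "(\<lambda>n. d (f x (S n)) l) \<longlonglongrightarrow> 0"
    for x l S n
  proof -
    have "(\<lambda>m. d (f x (S m)) (f x (S n))) \<longlonglongrightarrow> d l (f x (S n))"
      by (rule dist_tendsto[OF lim A.BV_mem[OF fB[OF x] S] l A.BV_mem[OF fB[OF x] S]])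
    then have "(\<lambda>m. ennreal (d (f x (S m)) (f x (S n)))) \<longlonglongrightarrow> ennreal (d l (f x (S n)))" by (rule tendsto_ennrealI)
    moreover have "ennreal (d (f x (S m)) (f x (S n))) \<le> Var d (f x) {a..b}" for m
      by (rule A.BV_dist_le(1)[OF fB[OF x] S S])
    ultimately show ?thesis using LIMSEQ_le_const2 by blast
  qed
  have conv: "(\<lambda>n. L1_dist M d (c (S n)) (Lh.cls l)) \<longlonglongrightarrow> 0"
    if S: "\<And>n::nat. S n \<in> {a..b}" and l: "Lh.int1 l"
      and lim: "\<And>x. x \<in> space M \<Longrightarrow> (\<lambda>n. d (f x (S n)) (l x)) \<longlonglongrightarrow> 0" for S l
  proof -
    have bound: "ennreal (d (f x (S n)) (l x)) \<le> Var d (f x) {a..b}" if x: "x \<in> space M" for x n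
      using Var_bound[OF x sep_measD(1)[OF Lh.int1_sep[OF l] x] S lim[OF x]] by (simp add: commute)
  note Vm = Var_closed_measurable[OF f]
    have "(\<lambda>n. \<integral>\<^sup>+ x. ennreal (d (f x (S n)) (l x)) \<partial>M) \<longlonglongrightarrow> (\<integral>\<^sup>+ x. 0 \<partial>M)"
    proof (rule nn_integral_dominated_convergence[where w = "\<lambda>x. Var d (f x) {a..b}"])
      show "(\<lambda>x. ennreal (d (f x (S n)) (l x))) \<in> borel_measurable M" for n
        using sep_meas_dist[OF ev[OF S] Lh.int1_sep[OF l]] by measurable
      show "AE x in M. ennreal (d (f x (S n)) (l x)) \<le> Var d (f x) {a..b}" for n by (rule AE_I2) (rule bound)
      show "AE x in M. (\<lambda>n. ennreal (d (f x (S n)) (l x))) \<longlonglongrightarrow> 0"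
        by (rule AE_I2) (use tendsto_ennrealI[OF lim] in fastforce)
    qed (use V Vm in auto)
    then have "(\<lambda>n. enn2real (\<integral>\<^sup>+ x. ennreal (d (f x (S n)) (l x)) \<partial>M)) \<longlonglongrightarrow> enn2real 0"
      by (intro tendsto_enn2real) auto
    moreover have "L1_dist M d (c (S n)) (Lh.cls l) = enn2real (\<integral>\<^sup>+ x. ennreal (d (f x (S n)) (l x)) \<partial>M)" for n
      unfolding ct[OF S] by (rule Lh.dist_cls[OF i1[OF S] l])
    ultimately show ?thesis by simp
  qed
  \<comment> \<open>The left limits at the points \<open>x\<close> form one measurable map, being a
    limit along a sequence. It is integrable because its distance to the integrable evaluation at
    \<open>S 0\<close> is at most the variation.\<close>
  have left: "\<exists>l. Lh.int1 l \<and> (\<forall>x\<in>space M. ((\<lambda>s. d (f x s) (l x)) \<longlongrightarrow> 0) (at_left t))" if t: "t \<in> {a<..b}" for t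
  proof -
    have "\<forall>x\<in>space M. \<exists>m\<in>N. ((\<lambda>s. d (f x s) m) \<longlongrightarrow> 0) (at_left t)" using fB t unfolding A.BV_iff by blast
    then obtain l where l: "\<And>x. x \<in> space M \<Longrightarrow> l x \<in> N" "\<And>x. x \<in> space M \<Longrightarrow> ((\<lambda>s. d (f x s) (l x)) \<longlongrightarrow> 0) (at_left t)"
      by metis
    obtain S :: "nat \<Rightarrow> real" where S: "\<And>n. a < S n" "\<And>n. S n < t" "filterlim S (at_left t) sequentially"
      using dense_in_seq_left[OF dense_in_interval order_refl, of a t b] t by auto
    then have SI: "S n \<in> {a..b}" for n using t less_imp_le[OF S(1)[of n]] less_le_trans[OF S(2)[of n], of b] by auto
    have lim: "(\<lambda>n. d (f x (S n)) (l x)) \<longlonglongrightarrow> 0" if "x \<in> space M" for x by (rule filterlim_compose[OF l(2)[OF that] S(3)])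
    have ls: "sep_meas M N d l" by (rule sep_meas_lim[OF ev[OF SI] _ lim]) (use l in auto)
    have bound: "ennreal (d (l x) (f x (S 0))) \<le> Var d (f x) {a..b}" if x: "x \<in> space M" for x
      by (rule Var_bound[OF x l(1)[OF x] SI lim[OF x]])
    have "(\<integral>\<^sup>+ x. ennreal (d (l x) (h0 x)) \<partial>M) \<le>
        (\<integral>\<^sup>+ x. ennreal (d (l x) (f x (S 0))) \<partial>M) + (\<integral>\<^sup>+ x. ennreal (d (f x (S 0)) (h0 x)) \<partial>M)"
      by (rule nn_integral_triangle[OF ls ev[OF SI] h0])
    also have "(\<integral>\<^sup>+ x. ennreal (d (l x) (f x (S 0))) \<partial>M) \<le> (\<integral>\<^sup>+ x. Var d (f x) {a..b} \<partial>M)"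
      by (rule nn_integral_mono) (rule bound)
    also have "(\<integral>\<^sup>+ x. Var d (f x) {a..b} \<partial>M) + (\<integral>\<^sup>+ x. ennreal (d (f x (S 0)) (h0 x)) \<partial>M) < \<infinity>"
      using V i1[OF SI[of 0]] by (simp add: Lh.int1_def)
    finally have "Lh.int1 l" using ls by (simp add: Lh.int1_def add_right_mono)
    with l show ?thesis by blast
  qed
  have left_lim: "((\<lambda>s. L1_dist M d (c s) (Lh.cls l)) \<longlongrightarrow> 0) (at_left t)"
    if t: "t \<in> {a<..b}" and l: "Lh.int1 l" "\<And>x. x \<in> space M \<Longrightarrow> ((\<lambda>s. d (f x s) (l x)) \<longlongrightarrow> 0) (at_left t)" for t l
  \<comment> \<open>Dominated convergence is a statement on sequences, and these decide one-sided
    limits.\<close>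
  proof (rule tendsto_at_left_sequentially)
    show "a < t" using t by simp
    fix S :: "nat \<Rightarrow> real" assume S: "\<And>n. S n < t" "\<And>n. a < S n" "S \<longlonglongrightarrow> t"
    have SI: "S n \<in> {a..b}" for n using t less_imp_le[OF S(2)[of n]] less_le_trans[OF S(1)[of n], of b] by auto
    have f: "filterlim S (at_left t) sequentially"
      unfolding filterlim_at using S by (auto intro!: always_eventually simp: less_imp_neq)
    show "(\<lambda>n. L1_dist M d (c (S n)) (Lh.cls l)) \<longlonglongrightarrow> 0"
      by (rule conv[OF SI l(1)]) (rule filterlim_compose[OF l(2) f])
  qed
  have "c \<in> BVL"
    unfolding W.BV_iff
  proof (intro conjI ballI)
    show "c \<in> {a..b} \<rightarrow>\<^sub>E Lh.L" using Lh.cls_mem[OF i1] by (auto simp: c_def)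
  next
    fix t assume t: "t \<in> {a..<b}"
    then have tI: "t \<in> {a..b}" and tb: "a \<le> t" "t < b" by auto
    show "((\<lambda>s. L1_dist M d (c s) (c t)) \<longlongrightarrow> 0) (at_right t)"
    proof (rule tendsto_at_right_sequentially)
      show "t < b" by (rule tb)
      fix S :: "nat \<Rightarrow> real" assume S: "\<And>n. t < S n" "\<And>n. S n < b" "S \<longlonglongrightarrow> t"
      have SI: "S n \<in> {a..b}" for n using tb less_imp_le[OF S(2)[of n]] le_less_trans[OF tb(1) S(1)[of n]] by auto
      have f: "filterlim S (at_right t) sequentially"
        unfolding filterlim_at using S by (auto intro!: always_eventually simp: less_imp_neq[THEN not_sym])
      show "(\<lambda>n. L1_dist M d (c (S n)) (c t)) \<longlonglongrightarrow> 0"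
        unfolding ct[OF tI] by (rule conv[OF SI i1[OF tI]]) (rule filterlim_compose[OF A.BV_right[OF fB tb] f])
    qed
  next
    fix t assume t: "t \<in> {a<..b}"
    obtain l where l: "Lh.int1 l" "\<forall>x\<in>space M. ((\<lambda>s. d (f x s) (l x)) \<longlongrightarrow> 0) (at_left t)" using left[OF t] by blast
    then show "\<exists>m\<in>Lh.L. ((\<lambda>s. L1_dist M d (c s) m) \<longlongrightarrow> 0) (at_left t)"
      using left_lim[OF t l(1)] Lh.cls_mem[OF l(1)] by blast
  next
    have bI: "b \<in> {a..b}" "b \<in> {a<..b}" using ab' by auto
    show "((\<lambda>s. L1_dist M d (c s) (c b)) \<longlongrightarrow> 0) (at_left b)"
      unfolding ct[OF bI(1)] by (rule left_lim[OF bI(2) i1[OF bI(1)]]) (rule A.BV_left[OF fB])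
  next
    \<comment> \<open>Each single sum for the classes is the integral over \<open>x\<close> of the
      corresponding sums for \<open>f x\<close>.\<close>
    have "Var (L1_dist M d) c {a..b} \<le> (\<integral>\<^sup>+ x. Var d (f x) {a..b} \<partial>M)"
      unfolding Lh.Lp.Var_eq
    proof (rule SUP_least)
      fix xs assume xs: "xs \<in> partitions {a..b}"
      then have sub: "set xs \<subseteq> {a..b}" by (simp add: partitions_def)
      have "vsum (L1_dist M d) c xs = vsum (L1_dist M d) (\<lambda>t. Lh.cls (\<lambda>x. f x t)) xs"
        by (rule vsum_cong) (use sub ct in auto)
      then have "ennreal (vsum (L1_dist M d) c xs) = (\<integral>\<^sup>+ x. ennreal (vsum d (f x) xs) \<partial>M)"
        using Lh.vsum_integral[of xs "\<lambda>t x. f x t", OF i1[OF subsetD[OF sub]]] by simp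
      also have "\<dots> \<le> (\<integral>\<^sup>+ x. Var d (f x) {a..b} \<partial>M)" by (rule nn_integral_mono) (rule Var_upper[OF xs])
      finally show "ennreal (vsum (L1_dist M d) c xs) \<le> (\<integral>\<^sup>+ x. Var d (f x) {a..b} \<partial>M)" .
    qed
    then show "Var (L1_dist M d) c {a..b} < \<infinity>" using V by (rule le_less_trans)
  qed
  moreover have "lift_of c f" unfolding lift_of_def using fB ev ct by simp
  ultimately show ?thesis by blast
qed

end

section \<open>The claims on \<open>i_tilde\<close>, reduced to lifts by fixing a measurable
  representative of \<open>h\<close>\<close>

theorem theorem3p23:
  fixes a b :: real
    and M :: "'m measure"
    and N :: "'n set" and d :: "'n \<Rightarrow> 'n \<Rightarrow> real"
    and h :: "('m \<Rightarrow> 'n) set"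
  assumes "a < b"
    and "space M \<noteq> {}"
    and "Metric_space N d" and "N \<noteq> {}"
    and "h \<in> L0 M N d"
    and "Metric_space.mcomplete N d"
  shows
    "(\<comment> \<open>every step of the composition defining \<open>i_tilde\<close> is defined\<close>
      \<forall>c \<in> BV_L1_M a b M N d h.
        BV_class a b (L1 M N d h) c \<in> L1_I_L1_M a b M N d h \<and>
        i_bar a b M N d h (BV_class a b (L1 M N d h) c) \<in> L1_M_L1_I a b M N d h \<and>
        (\<exists>f. compatible M (BV_class a b N ` BV a b N d)
               (i_bar a b M N d h (BV_class a b (L1 M N d h) c)) f)) \<and>
     isometric_mapping
       (BV_L1_M a b M N d h) (BV_L1_M_dist a b M d)
       (L1_M_BV a b M N d h) (L1_M_BV_dist a b M d)
       (i_tilde a b M N d h) \<and>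
     inj_on (i_tilde a b M N d h) (BV_L1_M a b M N d h) \<and>
     (\<comment> \<open>the inverse on the range; the composition is again defined at every step\<close>
      \<forall>f \<in> i_tilde a b M N d h ` BV_L1_M a b M N d h.
        let g = post_comp M (BV a b N d) (L1_I a b N d) (BV_class a b N) f;
            F = inv_into (L1_I_L1_M a b M N d h) (i_bar a b M N d h) g
        in g \<in> L1_M_L1_I a b M N d h \<and>
           g \<in> i_bar a b M N d h ` L1_I_L1_M a b M N d h \<and>
           F \<in> BV_class a b (L1 M N d h) ` BV_L1_M a b M N d h \<and>
           inv_into (BV_L1_M a b M N d h) (i_tilde a b M N d h) f =
             inv_into (BV_L1_M a b M N d h) (BV_class a b (L1 M N d h)) F) \<and>
     (\<forall>f \<in> i_tilde a b M N d h ` BV_L1_M a b M N d h. \<forall>t \<in> {a..b}.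
        inv_into (BV_L1_M a b M N d h) (i_tilde a b M N d h) f t =
          post_comp M (BV a b N d) N (\<lambda>c. c t) f) \<and>
     (\<comment> \<open>equality of measures; the integrand is measurable for every measurable representative\<close>
      \<forall>c \<in> BV_L1_M a b M N d h. \<forall>B \<in> sets (restrict_space borel {a..b}).
        (\<forall>f \<in> i_tilde a b M N d h c \<inter> L0s M (BV a b N d) (BV_dist a b d).
           (\<lambda>x. emeasure (var_measure a b N d (f x)) B) \<in> borel_measurable M) \<and>
        (\<forall>f \<in> i_tilde a b M N d h c.
           emeasure (var_measure a b (L1 M N d h) (L1_dist M d) c) B =
             (\<integral>\<^sup>+ x. emeasure (var_measure a b N d (f x)) B \<partial>M))) \<and>
     i_tilde a b M N d h ` BV_L1_M a b M N d h =
       {f \<in> L1_M_BV a b M N d h.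
          (\<integral>\<^sup>+ x. emeasure (var_measure a b N d (rep f x)) {a..b} \<partial>M) < \<infinity>}"
proof -
  interpret N: metric_target N d using assms(3) by (simp add: metric_target_def)
  obtain h0 where h0: "sep_meas M N d h0" and h: "h = ae_class M N h0" using assms(5) N.L0_iff by blast
  interpret S: BV_setting N d a b M h0 using assms(1,4,6) h0 by unfold_locales auto
  let ?B = "BV a b N d" and ?L = "L1 M N d h" and ?i = "i_tilde a b M N d h"
  have BVL: "BV_L1_M a b M N d h = S.BVL" by (simp add: BV_L1_M_def h)
  have QL: "BV_class a b ?L = S.W.I.cls" and qN: "BV_class a b N = S.A.I.cls"
    by (simp_all add: BV_class_def fun_eq_iff h)
  have lift: "\<exists>\<gamma>. S.lift_of c \<gamma> \<and> ?i c = ae_class M ?B \<gamma>" if c: "c \<in> S.BVL" for c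
    using S.lift_exists[OF c] S.i_tilde_eq(2)[OF c] unfolding h by blast
  have Q_mem: "S.W.I.cls c \<in> L1_I_L1_M a b M N d h" if c: "c \<in> S.BVL" for c
    unfolding L1_I_L1_M_def h S.W.L1_I_eq by (rule S.W.I.cls_mem[OF S.W.BV_int1[OF c]])
  have inj: "inj_on ?i S.BVL"
  proof (rule inj_onI)
    fix c c' assume c: "c \<in> S.BVL" "c' \<in> S.BVL" and eq: "?i c = ?i c'"
    obtain \<gamma> \<gamma>' where "S.lift_of c \<gamma>" "?i c = ae_class M ?B \<gamma>" "S.lift_of c' \<gamma>'" "?i c' = ae_class M ?B \<gamma>'"
      using lift[OF c(1)] lift[OF c(2)] by blast
    then show "c = c'" using S.lift_unique[of c \<gamma> c' \<gamma>'] c eq by simp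
  qed
  have ne: "?B \<noteq> {}" using S.A.BV_const[OF S.A.z0] by blast

  have 1: "BV_class a b ?L c \<in> L1_I_L1_M a b M N d h \<and>
      i_bar a b M N d h (BV_class a b ?L c) \<in> L1_M_L1_I a b M N d h \<and>
      (\<exists>f. compatible M (BV_class a b N ` ?B) (i_bar a b M N d h (BV_class a b ?L c)) f)"
    if c: "c \<in> S.BVL" for c
  proof -
    obtain \<gamma> where l: "S.lift_of c \<gamma>" using S.lift_exists[OF c] by blast
    have "i_bar a b M N d h (S.W.I.cls c) \<in> L1_M_L1_I a b M N d h"
      unfolding h S.i_bar_BV[OF c l] by (rule S.i_bar_BV_mem[OF c l])
    then show ?thesis using Q_mem[OF c] S.i_tilde_eq(1)[OF c l] unfolding h QL[unfolded h] by blast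
  qed

  have 2: "isometric_mapping S.BVL (BV_L1_M_dist a b M d) (L1_M_BV a b M N d h) (L1_M_BV_dist a b M d) ?i"
    unfolding isometric_mapping_def
  proof (intro conjI ballI subsetI)
    fix F assume "F \<in> ?i ` S.BVL"
    then obtain c where c: "c \<in> S.BVL" "F = ?i c" by (rule imageE)
    then show "F \<in> L1_M_BV a b M N d h" using lift[OF c(1)] S.i_tilde_mem[OF c(1)] unfolding h by auto
  next
    fix c c' assume c: "c \<in> S.BVL" "c' \<in> S.BVL"
    obtain \<gamma> \<gamma>' where l: "S.lift_of c \<gamma>" "?i c = ae_class M ?B \<gamma>" "S.lift_of c' \<gamma>'" "?i c' = ae_class M ?B \<gamma>'"
      using lift[OF c(1)] lift[OF c(2)] by blast
    show "L1_M_BV_dist a b M d (?i c) (?i c') = BV_L1_M_dist a b M d c c'"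
      unfolding l(2,4) by (rule S.i_tilde_isometry[OF c(1) l(1) c(2) l(3)])
  qed

  have inv_c: "inv_into S.BVL ?i (?i c) = c" if "c \<in> S.BVL" for c
    by (rule inv_into_f_f[OF inj that])

  have 3: "let g = post_comp M ?B (L1_I a b N d) (BV_class a b N) f;
            F = inv_into (L1_I_L1_M a b M N d h) (i_bar a b M N d h) g
        in g \<in> L1_M_L1_I a b M N d h \<and>
           g \<in> i_bar a b M N d h ` L1_I_L1_M a b M N d h \<and>
           F \<in> BV_class a b ?L ` S.BVL \<and>
           inv_into S.BVL ?i f = inv_into S.BVL (BV_class a b ?L) F"
    if f: "f \<in> ?i ` S.BVL" for f
  proof -
    obtain c where c: "c \<in> S.BVL" "f = ?i c" using f by (rule imageE)
    obtain \<gamma> where l: "S.lift_of c \<gamma>" "?i c = ae_class M ?B \<gamma>" using lift[OF c(1)] by blast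
    have g: "post_comp M ?B (L1_I a b N d) (BV_class a b N) f = i_bar a b M N d h (S.W.I.cls c)"
      unfolding c(2) l(2) unfolding qN h S.i_bar_BV[OF c(1) l(1)]
      by (rule post_comp_class(2)) (use S.lift_ofD(1)[OF l(1)] in auto)
    \<comment> \<open>\<open>inv_into\<close> searches the whole domain of \<open>i_bar\<close>, so
      it is injectivity there that recovers the class of \<open>c\<close>.\<close>
    have F: "inv_into (L1_I_L1_M a b M N d h) (i_bar a b M N d h) (i_bar a b M N d h (S.W.I.cls c)) = S.W.I.cls c"
      by (rule inv_into_f_f[OF _ Q_mem[OF c(1)]]) (use S.i_bar_inj in \<open>simp add: h\<close>)
    show ?thesis
      unfolding Let_def g F QL
      using 1[OF c(1)] Q_mem[OF c(1)] inv_into_f_f[OF S.W.BV_cls_inj c(1)] inv_c[OF c(1)] c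
      unfolding QL by (auto simp: h)
  qed

  have 4: "inv_into S.BVL ?i f t = post_comp M ?B N (\<lambda>c. c t) f"
    if f: "f \<in> ?i ` S.BVL" and t: "t \<in> {a..b}" for f t
  proof -
    obtain c where c: "c \<in> S.BVL" "f = ?i c" using f by (rule imageE)
    obtain \<gamma> where l: "S.lift_of c \<gamma>" "?i c = ae_class M ?B \<gamma>" using lift[OF c(1)] by blast
    have "post_comp M ?B N (\<lambda>c. c t) f = ae_class M N (\<lambda>x. \<gamma> x t)"
      unfolding c(2) l(2) by (rule post_comp_class(2)) (use S.lift_ofD(1)[OF l(1)] in auto)
    also have "\<dots> = c t" using S.lift_ofD(3)[OF l(1) t] by simp
    finally show ?thesis unfolding c(2) inv_c[OF c(1)] by simp
  qed

  have 5: "(\<forall>f \<in> ?i c \<inter> L0s M ?B (BV_dist a b d).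
           (\<lambda>x. emeasure (var_measure a b N d (f x)) B) \<in> borel_measurable M) \<and>
        (\<forall>f \<in> ?i c. emeasure (var_measure a b ?L (L1_dist M d) c) B =
             (\<integral>\<^sup>+ x. emeasure (var_measure a b N d (f x)) B \<partial>M))"
    if c: "c \<in> S.BVL" and B: "B \<in> sets (restrict_space borel {a..b})" for c B
  proof -
    have B: "B \<in> sets borel" "B \<subseteq> {a..b}" using B by (auto simp: sets_restrict_space)
    obtain \<gamma> where l: "S.lift_of c \<gamma>" "?i c = ae_class M ?B \<gamma>" using lift[OF c] by blast
    show ?thesis
    proof (intro conjI ballI)
      fix f assume "f \<in> ?i c \<inter> L0s M ?B (BV_dist a b d)"
      then have f: "f \<in> ae_class M ?B \<gamma>" "sep_meas M ?B (BV_dist a b d) f" using l(2) S.A.B.L0s_iff by auto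
      show "(\<lambda>x. emeasure (var_measure a b N d (f x)) B) \<in> borel_measurable M"
        by (rule S.lift_var_measure(1)[OF c S.lift_of_class[OF l(1) f(2) ae_class_of_mem[OF f(1)]] B])
    next
      fix f assume "f \<in> ?i c"
      then have "AE x in M. f x = \<gamma> x" unfolding l(2) by (rule ae_class_memD(2))
      then have "(\<integral>\<^sup>+ x. emeasure (var_measure a b N d (f x)) B \<partial>M) = (\<integral>\<^sup>+ x. emeasure (var_measure a b N d (\<gamma> x)) B \<partial>M)"
        by (intro nn_integral_cong_AE) (auto elim: AE_mp)
      also have "\<dots> = emeasure (var_measure a b ?L (L1_dist M d) c) B"
        unfolding h by (rule S.lift_var_measure(2)[OF c l(1) B])
      finally show "emeasure (var_measure a b ?L (L1_dist M d) c) B =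
          (\<integral>\<^sup>+ x. emeasure (var_measure a b N d (f x)) B \<partial>M)" by simp
    qed
  qed

  \<comment> \<open>\<open>rep\<close> may be non-measurable, but it agrees almost everywhere with
    \<open>f\<close>, which leaves the nonnegative integral unchanged.\<close>
  have rep_var: "(\<integral>\<^sup>+ x. emeasure (var_measure a b N d (rep (ae_class M ?B f) x)) {a..b} \<partial>M) = (\<integral>\<^sup>+ x. Var d (f x) {a..b} \<partial>M)"
    if f: "\<And>x. x \<in> space M \<Longrightarrow> f x \<in> ?B" for f
  proof -
    have "AE x in M. rep (ae_class M ?B f) x = f x" by (rule rep_AE[OF AE_I2[OF f] ne])
    then have "(\<integral>\<^sup>+ x. emeasure (var_measure a b N d (rep (ae_class M ?B f) x)) {a..b} \<partial>M)
        = (\<integral>\<^sup>+ x. emeasure (var_measure a b N d (f x)) {a..b} \<partial>M)"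
      by (intro nn_integral_cong_AE) (auto elim: AE_mp)
    also have "\<dots> = (\<integral>\<^sup>+ x. Var d (f x) {a..b} \<partial>M)"
      by (rule nn_integral_cong) (rule S.A.emeasure_var_measure_Icc[OF f])
    finally show ?thesis .
  qed

  have 6: "?i ` S.BVL = {f \<in> L1_M_BV a b M N d h.
      (\<integral>\<^sup>+ x. emeasure (var_measure a b N d (rep f x)) {a..b} \<partial>M) < \<infinity>}"
  proof (intro set_eqI iffI)
    fix F assume "F \<in> ?i ` S.BVL"
    then obtain c where c: "c \<in> S.BVL" "F = ?i c" by (rule imageE)
    obtain \<gamma> where l: "S.lift_of c \<gamma>" "?i c = ae_class M ?B \<gamma>" using lift[OF c(1)] by blast
    note \<gamma> = S.lift_ofD(1)[OF l(1)]
    have "(\<integral>\<^sup>+ x. Var d (\<gamma> x) {a..b} \<partial>M) = (\<integral>\<^sup>+ x. Var d (\<gamma> x) {a<..<b} \<partial>M)"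
      by (rule nn_integral_cong) (rule S.A.Var_closed[OF \<gamma>])
    also have "\<dots> = Var (L1_dist M d) c {a..b}"
      unfolding S.lift_Var(2)[OF c(1) l(1) order_refl] S.W.Var_closed[OF c(1)] ..
    also have "\<dots> < \<infinity>" by (rule S.W.BV_Var[OF c(1)])
    finally show "F \<in> {f \<in> L1_M_BV a b M N d h. (\<integral>\<^sup>+ x. emeasure (var_measure a b N d (rep f x)) {a..b} \<partial>M) < \<infinity>}"
      unfolding c(2) l(2) using S.i_tilde_mem[OF c(1) l(1)] by (simp add: rep_var[OF \<gamma>] h)
  next
    fix F assume F: "F \<in> {f \<in> L1_M_BV a b M N d h. (\<integral>\<^sup>+ x. emeasure (var_measure a b N d (rep f x)) {a..b} \<partial>M) < \<infinity>}"
    then obtain f where f: "sep_meas M ?B (BV_dist a b d) f"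
      "(\<integral>\<^sup>+ x. (\<integral>\<^sup>+ t. ennreal (d (f x t) (h0 x)) \<partial>leb_I a b) \<partial>M) < \<infinity>" "F = ae_class M ?B f"
      using S.L1_M_BV_iff unfolding h by auto
    have "(\<integral>\<^sup>+ x. Var d (f x) {a..b} \<partial>M) < \<infinity>" using F rep_var[of f] sep_measD(1)[OF f(1)] f(3) by simp
    then obtain c where c: "c \<in> S.BVL" "S.lift_of c f" using S.lift_of_finite_variation[OF f(1,2)] by blast
    have "F = ?i c" unfolding f(3) h S.i_tilde_eq(2)[OF c] ..
    then show "F \<in> ?i ` S.BVL" using c(1) by blast
  qed

  show ?thesis
    unfolding BVL
    by (rule conjI, rule ballI, erule 1, rule conjI, rule 2, rule conjI, rule inj, rule conjI, rule ballI, erule 3,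
        rule conjI, rule ballI, rule ballI, erule (1) 4, rule conjI, rule ballI, rule ballI, erule (1) 5, rule 6)
qed

end
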